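(* Let $B$ be a separable Banach space with a Schauder basis $(e_k)_{k\in\mathbb{N}}$, let $\varepsilon=\{(\varepsilon_{i,n})_{1\le i\le n}\}_{n\in\mathbb{N}}$ be a centered error process in $B$ satisfying the moment and dependence condition, the tail entropy condition and the block-length condition (all spelled out in the context), and let $b\in B^*$ with $\|b\|_{B^*}=1$ be such that $(b\otimes b)\sigma^2(u)=\sigma_b^2\in(0,\infty)$ for all $u\in[0,1]$. Let $\theta\in(0,1)$, $\mu,\delta\in B$ and $$X_{i,n}=\mu+\delta\,\mathbf{1}(i>\lfloor\theta n\rfloor)+\varepsilon_{i,n}.$$ Let $\alpha\in(0,1)$, and let $\mathbf{T}_n$ be the statistic and $q_{1-\alpha}$ the quantile defined in the context. Then the decision rule "reject $H_0$ if $\mathbf{T}_n>q_{1-\alpha}$" defines a test that has asymptotically level $\alpha$ under $H_0$ and is consistent against $H_1$, where, with $\mu_i=\mathbb{E}[b(X_{i,n})]$, $$H_0:\ \mu_1=\mu_2=\dots=\mu_n\qquad\text{vs.}\qquad H_1:\ \mu_1=\dots=\mu_{\lfloor\theta n\rfloor}\ne\mu_{\lfloor\theta n\rfloor+1}=\dots=\mu_n .$$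
   Context: Test statistic. Let $T_n(t)=\frac1n\sum_{i=1}^{\lfloor nt\rfloor}b(X_{i,n})$, $D_n(t)=\sqrt n\,(T_n(t)-\frac{\lfloor nt\rfloor}{n}T_n(1))$, $$V_n^2(t)=\sum_{i=1}^{\lfloor nt\rfloor}\Big(T_n(\tfrac in)-\tfrac{i}{\lfloor nt\rfloor}T_n(t)\Big)^2+\sum_{i=\lfloor nt\rfloor+1}^{n}\Big(T_n(1)-T_n(\tfrac in)-\tfrac{n-i}{n-\lfloor nt\rfloor}\big(T_n(1)-T_n(t)\big)\Big)^2,$$ and $\mathbf{T}_n=\max_{k=1}^{n-1}|D_n(k/n)|/V_n(k/n)$. The number $q_{1-\alpha}$ is the $(1-\alpha)$-quantile of $$\sup_{t\in[0,1]}\frac{|W(t)-tW(1)|}{\Big(\int_0^t\big(W(x)-\frac xtW(t)\big)^2\mathrm{d}x+\int_t^1\big(W(1)-W(x)-\frac{1-x}{1-t}[W(1)-W(t)]\big)^2\mathrm{d}x\Big)^{1/2}},$$ with $W$ a standard real Brownian motion. Asymptotic level $\alpha$ means $\limsup_{n\to\infty}\mathbb{P}(\mathbf{T}_n>q_{1-\alpha})\le\alpha$ under $H_0$; consistency means $\lim_{n\to\infty}\mathbb{P}(\mathbf{T}_n>q_{1-\alpha})=1$ under $H_1$. In this model $H_1$ holds if and only if $b(\delta)\neq0$. Tensor products and covariances. $B$ is a real separable Banach space with norm $\|\cdot\|_B$, dual $B^*$ and closed dual unit ball $B_1^*$. Expectations of $B$-valued random variables are Bochner integrals. $B\hat\otimes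 B$ is the completion of the algebraic tensor product $B\otimes B$ under the projective norm $\|u\|_\pi=\inf\{\sum_j\|x_{1j}\|_B\|x_{2j}\|_B: u=\sum_j x_{1j}\otimes x_{2j}\}$. For centered square-integrable $X,Y$ in $B$, $\mathrm{Cov}(X,Y)=\mathbb{E}[X\otimes Y]\in B\hat\otimes B$. For $b_1,b_2\in B^*$, $b_1\otimes b_2$ denotes the continuous linear functional on $B\hat\otimes B$ with $(b_1\otimes b_2)(x\otimes y)=b_1(x)b_2(y)$. Local stationarity. Let $(E,\mathcal{E})$ be a measurable space, $(\eta_i)_{i\in\mathbb{Z}}$ i.i.d. $E$-valued random elements, $(\eta_i^* )_{i\in\mathbb{Z}}$ an independent copy, $\mathcal{F}_i=(\eta_i,\eta_{i-1},\dots)$, and for $i\ge0$ let $\mathcal{F}_i^*=(\eta_i,\dots,\eta_1,\eta_0^*,\eta_{-1},\eta_{-2},\dots)$. For a map $H:[0,1]\times E^{\mathbb{N}_0}\to B$ with $H(t,\mathcal{F}_i)$ measurable for all $t,i$, the physical dependence measure is $\delta_\rho(H,i)=\sup_{t\in[0,1]}\mathbb{E}[\|H(t,\mathcal{F}_i)-H(t,\mathcal{F}_i^* )\|_B^\rho]^{1/\rho}$. A triangular array is locally stationary with map $H$ if its $(i,n)$ entry equals $H(i/n,\mathcal{F}_i)$ for all $1\le i\le n$, $n\in\mathbb{N}$, with $H$ continuous in its first argument. $H$ is Lipschitz continuous with respect to the $L^2$-norm if $\sup_{0\le s<t\le1}\mathbb{E}[\|H(t,\mathcal{F}_i)-H(s,\mathcal{F}_i)\|_B^2]^{1/2}/|t-s|<\infty$.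 Schauder basis. $(e_k)_{k\in\mathbb{N}}$ is a Schauder basis of $B$, with coordinate functionals $(e_k^* )_{k\in\mathbb{N}}\subset B^*$. Put $\Pi_k(x)=\sum_{i=1}^k e_i^*(x)e_i$ and $T_k=I_B-\Pi_k$ (operators on $B$; not to be confused with $T_n(t)$), with $I_B$ the identity. Moment and dependence condition. $\{(\varepsilon_{i,n})_{1\le i\le n}\}_{n\in\mathbb{N}}$ is centered and locally stationary with map $H$, such that for some $\kappa>0$: (1) $H$ is Lipschitz continuous with respect to the $L^2$-norm and $\sup_{t\in[0,1]}\mathbb{E}[\|H(t,\mathcal{F}_0)\|_B^{2+\kappa}]<\infty$; (2) $\sum_{k\in\mathbb{Z}}\Theta_{|k|}<\infty$ where $\Theta_k=\sum_{i=k}^\infty\delta_{2+\kappa}(H,i)$, and $\delta_{2+\kappa}(H,i)$ is non-increasing in $i$. The local long-run variance is $\sigma^2(t)=\sum_{i=-\infty}^\infty\mathrm{Cov}(H(t,\mathcal{F}_i),H(t,\mathcal{F}_0))\in B\hat\otimes B$. Tail entropy condition. Let $\mathcal{G}_k$ be the set of functions $f:B\times[0,1]\to\mathbb{R}$ of the form $f(x,u)=b'(T_kx)\,\mathbf{1}(u\le t)$ with $b'\in B_1^*$, $t\in[0,1]$. For functions $f$ on $B\times[0,1]$ let $\|f\|_{2,n}=(\frac1n\sum_{i=1}^n\mathbb{E}[|f(\varepsilon_{i,n},i/n)|^2])^{1/2}$ and $V_{n,k}(f)=\|f\|_{2,n}+\sum_{i=1}^\infty\min\{\|f\|_{2,n},D\,\delta_2(H,i)\}$,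 where $D>0$ is a constant with $D\ge\sup_{f\in\mathcal{G}_k}\|f\|_{2,n}$ uniformly in $k$ and $n$. $N(\epsilon,\mathcal{G}_k,V_{n,k})$ is the bracketing number: the smallest number of brackets $[\ell,u]=\{f:\ell\le f\le u\}$ with $V_{n,k}(u-\ell)\le\epsilon$ needed to cover $\mathcal{G}_k$. Let $\beta(q)=\sum_{j=q}^\infty\delta_2(H,j)$, $q^*(x)=\min\{q\in\mathbb{N}:\beta(q)\le qx\}$, $r(a)=\max\{r>0:q^*(r)r\le a\}$ and $m(n,a,k)=r(a/D)\,D\sqrt n/\sqrt{\max\{1,\log k\}}$. The condition is: there are $\sigma_k$ with $\sup_{f\in\mathcal{G}_k}V_{n,k}(f)\le\sigma_k$ such that $$I_k=\limsup_{n\to\infty}\int_0^{\sigma_k}\sqrt{1\vee\log N(\epsilon,\mathcal{G}_k,V_{n,k})}\,\mathrm{d}\epsilon<\infty\ \text{ for all }k\in\mathbb{N},\qquad I_k\to0\ (k\to\infty),$$ and, for some sequence $c_k\to0$, uniformly in $n\in\mathbb{N}$, $$\frac1{\sqrt n}\sum_{i=1}^n\mathbb{E}\Big[\|T_k\varepsilon_{i,n}\|_B\,\mathbf{1}\big\{\|T_k\varepsilon_{i,n}\|_B>\tfrac14 m(n,\sigma_k,N(\sigma_k/2,\mathcal{G}_k,V_{n,k}))\big\}\Big]\le c_k.$$ Block-length condition. There are integer sequences $\ell_n\to\infty$, $s_n\to\infty$ with $s_n=o(\ell_n)$, $\sqrt n\,\Theta_{s_n}\to0$, and, with the same $\kappa$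 as in the moment and dependence condition, $\ell_n^{2+2/\kappa}=o(n)$ as $n\to\infty$. *)

theory Defs
  imports "HOL-Probability.Probability" "HOL-Library.Landau_Symbols"
begin

text \<open>
  The algebraic tensor product: finite formal sums of pairs, two of which are identified iff every
  bilinear form takes the same value on them.
\<close>

definition form_value :: "('a \<Rightarrow> 'b \<Rightarrow> real) \<Rightarrow> ('a \<times> 'b) list \<Rightarrow> real" where
  "form_value A ps = (\<Sum>(x, y)\<leftarrow>ps. A x y)"

definition tensor_eq :: "('a::real_vector \<times> 'b::real_vector) list \<Rightarrow> ('a \<times> 'b) list \<Rightarrow> bool" where
  "tensor_eq ps qs \<longleftrightarrow> (\<forall>A. bilinear A \<longrightarrow> form_value A ps = form_value A qs)"

lemma form_value_simps [simp]:
  "form_value A [] = 0"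
  "form_value A ((x, y) # ps) = A x y + form_value A ps"
  "form_value A (ps @ qs) = form_value A ps + form_value A qs"
  by (simp_all add: form_value_def)

lemma form_value_scale:
  assumes "bilinear A"
  shows "form_value A (map (\<lambda>(x, y). (r *\<^sub>R x, y)) ps) = r * form_value A ps"
  by (induction ps) (auto simp: bilinear_lmul[OF assms] algebra_simps)

lemma form_value_neg:
  assumes "bilinear A"
  shows "form_value A (map (\<lambda>(x, y). (- x, y)) ps) = - form_value A ps"
  by (induction ps) (auto simp: bilinear_lneg[OF assms] algebra_simps)

quotient_type (overloaded) ('a, 'b) tensor = "('a::real_vector \<times> 'b::real_vector) list" / tensor_eq
  by (rule equivpI) (auto simp: reflp_def symp_def transp_def tensor_eq_def)

instantiation tensor :: (real_vector, real_vector) real_vector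
begin

lift_definition zero_tensor :: "('a, 'b) tensor" is "[]" .

lift_definition plus_tensor :: "('a, 'b) tensor \<Rightarrow> ('a, 'b) tensor \<Rightarrow> ('a, 'b) tensor" is "(@)"
  by (simp add: tensor_eq_def)

lift_definition uminus_tensor :: "('a, 'b) tensor \<Rightarrow> ('a, 'b) tensor"
  is "map (\<lambda>(x, y). (- x, y))"
  by (simp add: tensor_eq_def form_value_neg)

lift_definition minus_tensor :: "('a, 'b) tensor \<Rightarrow> ('a, 'b) tensor \<Rightarrow> ('a, 'b) tensor"
  is "\<lambda>ps qs. ps @ map (\<lambda>(x, y). (- x, y)) qs"
  by (simp add: tensor_eq_def form_value_neg)

lift_definition scaleR_tensor :: "real \<Rightarrow> ('a, 'b) tensor \<Rightarrow> ('a, 'b) tensor"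
  is "\<lambda>r. map (\<lambda>(x, y). (r *\<^sub>R x, y))"
  by (simp add: tensor_eq_def form_value_scale)

instance
proof
  fix u v w :: "('a, 'b) tensor" and r s :: real
  note [simp] = tensor_eq_def form_value_neg form_value_scale
  note [simp del] = map_map
  show "u + v + w = u + (v + w)" by transfer simp
  show "u + v = v + u" by transfer simp
  show "0 + u = u" by transfer simp
  show "- u + u = 0" by transfer simp
  show "u - v = u + - v" by transfer simp
  show "r *\<^sub>R (u + v) = r *\<^sub>R u + r *\<^sub>R v"
    by transfer (simp del: map_append add: distrib_left)
  show "(r + s) *\<^sub>R u = r *\<^sub>R u + s *\<^sub>R u" by transfer (simp add: distrib_right)
  show "r *\<^sub>R s *\<^sub>R u = (r * s) *\<^sub>R u" by transfer simp
  show "1 *\<^sub>R u = u" by transfer simp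
qed

end

lift_definition tensor :: "'a::real_vector \<Rightarrow> 'b::real_vector \<Rightarrow> ('a, 'b) tensor"
  is "\<lambda>x y. [(x, y)]" .

text \<open>
  The projective norm. It is only shown to be a seminorm here, which suffices for the completion
  below.
\<close>

definition rep_cost :: "('a::real_normed_vector \<times> 'b::real_normed_vector) list \<Rightarrow> real" where
  "rep_cost ps = (\<Sum>(x, y)\<leftarrow>ps. norm x * norm y)"

definition pnorm :: "('a::real_normed_vector, 'b::real_normed_vector) tensor \<Rightarrow> real" where
  "pnorm u = (INF ps\<in>{ps. u = (\<Sum>(x, y)\<leftarrow>ps. tensor x y)}. rep_cost ps)"

lemma sum_tensor_abs: "(\<Sum>(x, y)\<leftarrow>ps. tensor x y) = abs_tensor ps"
proof (induction ps)
  case Nil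
  show ?case by (simp add: zero_tensor_def)
next
  case (Cons p ps)
  obtain x y where p: "p = (x, y)" by force
  have "tensor x y + abs_tensor ps = abs_tensor (p # ps)"
    by (simp add: p tensor.abs_eq plus_tensor.abs_eq)
  then show ?case by (simp add: p Cons)
qed

lemma rep_cost_simps [simp]:
  "rep_cost [] = 0"
  "rep_cost ((x, y) # ps) = norm x * norm y + rep_cost ps"
  "rep_cost (ps @ qs) = rep_cost ps + rep_cost qs"
  by (simp_all add: rep_cost_def)

lemma rep_cost_nonneg [simp]: "0 \<le> rep_cost ps"
  by (induction ps) auto

lemma rep_cost_scale: "rep_cost (map (\<lambda>(x, y). (r *\<^sub>R x, y)) ps) = \<bar>r\<bar> * rep_cost ps"
  by (induction ps) (auto simp: algebra_simps)

lemma bdd_rep_cost [simp]: "bdd_below (rep_cost ` S)"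
  by (rule bdd_belowI[of _ 0]) auto

lemma ex_rep: "\<exists>ps. u = abs_tensor ps"
  by (metis Quotient3_abs_rep Quotient3_tensor)

lemma pnorm_le: "pnorm (abs_tensor ps) \<le> rep_cost ps"
  unfolding pnorm_def by (rule cINF_lower) (auto simp: sum_tensor_abs)

lemma pnorm_nonneg [simp]: "0 \<le> pnorm u"
  unfolding pnorm_def using ex_rep[of u] by (intro cINF_greatest) (auto simp: sum_tensor_abs)

lemma pnorm_approx:
  assumes "e > 0"
  obtains ps where "u = abs_tensor ps" "rep_cost ps < pnorm u + e"
proof -
  have "{ps. u = (\<Sum>(x, y)\<leftarrow>ps. tensor x y)} \<noteq> {}"
    using ex_rep[of u] by (auto simp: sum_tensor_abs)
  moreover have "pnorm u < pnorm u + e" using assms by simp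
  ultimately have "\<exists>ps\<in>{ps. u = (\<Sum>(x, y)\<leftarrow>ps. tensor x y)}. rep_cost ps < pnorm u + e"
    unfolding pnorm_def by (subst (asm) cINF_less_iff) auto
  then show ?thesis using that by (auto simp: sum_tensor_abs)
qed

lemma pnorm_triangle: "pnorm (u + v) \<le> pnorm u + pnorm v"
proof (rule field_le_epsilon)
  fix e :: real assume e: "e > 0"
  obtain ps where ps: "u = abs_tensor ps" "rep_cost ps < pnorm u + e/2"
    by (rule pnorm_approx[of "e/2" u]) (use e in simp)
  obtain qs where qs: "v = abs_tensor qs" "rep_cost qs < pnorm v + e/2"
    by (rule pnorm_approx[of "e/2" v]) (use e in simp)
  have "pnorm (u + v) \<le> rep_cost (ps @ qs)"
    unfolding ps qs plus_tensor.abs_eq by (rule pnorm_le)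
  then show "pnorm (u + v) \<le> pnorm u + pnorm v + e" using ps qs by simp
qed

lemma pnorm_scale_le: "pnorm (r *\<^sub>R u) \<le> \<bar>r\<bar> * pnorm u"
proof (rule field_le_epsilon)
  fix e :: real assume e: "e > 0"
  obtain ps where ps: "u = abs_tensor ps" "rep_cost ps < pnorm u + e/(\<bar>r\<bar>+1)"
    by (rule pnorm_approx[of "e/(\<bar>r\<bar>+1)" u]) (use e in \<open>simp add: divide_pos_pos\<close>)
  have "pnorm (r *\<^sub>R u) \<le> rep_cost (map (\<lambda>(x, y). (r *\<^sub>R x, y)) ps)"
    unfolding ps scaleR_tensor.abs_eq by (rule pnorm_le)
  also have "\<dots> = \<bar>r\<bar> * rep_cost ps" by (rule rep_cost_scale)
  also have "\<dots> \<le> \<bar>r\<bar> * (pnorm u + e/(\<bar>r\<bar>+1))" using ps by (intro mult_left_mono) auto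
  also have "\<dots> = \<bar>r\<bar> * pnorm u + e * (\<bar>r\<bar>/(\<bar>r\<bar>+1))"
    by (simp only: distrib_left times_divide_eq_right mult.commute)
  also have "e * (\<bar>r\<bar>/(\<bar>r\<bar>+1)) \<le> e * 1"
    using e by (intro mult_left_mono divide_le_eq_1_pos[THEN iffD2]) linarith+
  finally show "pnorm (r *\<^sub>R u) \<le> \<bar>r\<bar> * pnorm u + e" by linarith
qed

lemma pnorm_zero [simp]: "pnorm 0 = 0"
  using pnorm_scale_le[of 0 0] by (intro antisym) auto

lemma pnorm_scale: "pnorm (r *\<^sub>R u) = \<bar>r\<bar> * pnorm u"
proof (cases "r = 0")
  case False
  have "pnorm u = pnorm (inverse r *\<^sub>R (r *\<^sub>R u))" using False by simp
  also have "\<dots> \<le> \<bar>inverse r\<bar> * pnorm (r *\<^sub>R u)" by (rule pnorm_scale_le)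
  finally have "\<bar>r\<bar> * pnorm u \<le> \<bar>r\<bar> * (\<bar>inverse r\<bar> * pnorm (r *\<^sub>R u))" by (intro mult_left_mono) auto
  also have "\<dots> = pnorm (r *\<^sub>R u)" using False by (simp add: abs_inverse)
  finally show ?thesis using pnorm_scale_le[of r u] by simp
qed auto

lemma pnorm_minus [simp]: "pnorm (- u) = pnorm u"
  using pnorm_scale[of "-1" u] by simp

lemma pnorm_minus_commute: "pnorm (u - v) = pnorm (v - u)"
  using pnorm_minus[of "u - v"] by simp

lemma pnorm_triangle3: "pnorm (u - w) \<le> pnorm (u - v) + pnorm (v - w)"
  using pnorm_triangle[of "u - v" "v - w"] by simp

lemma pnorm_diff_abs: "\<bar>pnorm u - pnorm v\<bar> \<le> pnorm (u - v)"
  using pnorm_triangle[of "u - v" v] pnorm_triangle[of "v - u" u] pnorm_minus_commute[of u v] by simp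

lemma pnorm_tensor_le: "pnorm (tensor x y) \<le> norm x * norm y"
  using pnorm_le[of "[(x, y)]"] by (simp add: tensor.abs_eq)

text \<open>
  The completed projective tensor product: Cauchy sequences of algebraic tensors modulo sequences
  converging to \<open>0\<close> in the projective norm.
\<close>

definition pcauchy :: "(nat \<Rightarrow> ('a::real_normed_vector, 'b::real_normed_vector) tensor) \<Rightarrow> bool" where
  "pcauchy X \<longleftrightarrow> (\<forall>e>0. \<exists>N. \<forall>m\<ge>N. \<forall>n\<ge>N. pnorm (X m - X n) < e)"

lemma pcauchyE:
  assumes "pcauchy X" "e > 0"
  obtains N where "\<And>m n. m \<ge> N \<Longrightarrow> n \<ge> N \<Longrightarrow> pnorm (X m - X n) < e"
proof -
  obtain N where "\<forall>m\<ge>N. \<forall>n\<ge>N. pnorm (X m - X n) < e"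
    using assms unfolding pcauchy_def by (elim allE[of _ e] impE) auto
  then show ?thesis by (intro that[of N]) simp
qed

definition ptensor_rel ::
    "(nat \<Rightarrow> ('a::real_normed_vector, 'b::real_normed_vector) tensor) \<Rightarrow> (nat \<Rightarrow> ('a, 'b) tensor) \<Rightarrow> bool"
  where
  "ptensor_rel X Y \<longleftrightarrow> pcauchy X \<and> pcauchy Y \<and> (\<lambda>n. pnorm (X n - Y n)) \<longlonglongrightarrow> 0"

lemma pcauchy_const [simp]: "pcauchy (\<lambda>_. u)"
  by (simp add: pcauchy_def)

lemma pcauchy_add:
  assumes "pcauchy X" "pcauchy Y"
  shows "pcauchy (\<lambda>n. X n + Y n)"
  unfolding pcauchy_def
proof (intro allI impI)
  fix e :: real assume "e > 0"
  then have "e/2 > 0" by simp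
  obtain N where N: "\<And>m n. m \<ge> N \<Longrightarrow> n \<ge> N \<Longrightarrow> pnorm (X m - X n) < e/2"
    using pcauchyE[OF assms(1) \<open>e/2 > 0\<close>] by metis
  obtain M where M: "\<And>m n. m \<ge> M \<Longrightarrow> n \<ge> M \<Longrightarrow> pnorm (Y m - Y n) < e/2"
    using pcauchyE[OF assms(2) \<open>e/2 > 0\<close>] by metis
  have "pnorm (X m + Y m - (X n + Y n)) < e" if "m \<ge> max N M" "n \<ge> max N M" for m n
    using pnorm_triangle[of "X m - X n" "Y m - Y n"] N[of m n] M[of m n] that
    by (simp add: add_diff_add)
  then show "\<exists>N. \<forall>m\<ge>N. \<forall>n\<ge>N. pnorm (X m + Y m - (X n + Y n)) < e" by blast
qed

lemma pcauchy_scale: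
  assumes "pcauchy X"
  shows "pcauchy (\<lambda>n. r *\<^sub>R X n)"
  unfolding pcauchy_def
proof (intro allI impI)
  fix e :: real assume e: "e > 0"
  then have "e/(\<bar>r\<bar>+1) > 0" by simp
  then obtain N where N: "\<And>m n. m \<ge> N \<Longrightarrow> n \<ge> N \<Longrightarrow> pnorm (X m - X n) < e/(\<bar>r\<bar>+1)"
    by (metis pcauchyE assms)
  have "pnorm (r *\<^sub>R X m - r *\<^sub>R X n) < e" if "m \<ge> N" "n \<ge> N" for m n
  proof -
    have "pnorm (r *\<^sub>R X m - r *\<^sub>R X n) = \<bar>r\<bar> * pnorm (X m - X n)"
      by (metis pnorm_scale scaleR_diff_right)
    also have "\<dots> \<le> (\<bar>r\<bar>+1) * pnorm (X m - X n)" by (intro mult_right_mono) auto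
    also have "\<dots> < (\<bar>r\<bar>+1) * (e/(\<bar>r\<bar>+1))" by (intro mult_strict_left_mono N that) auto
    finally show ?thesis by simp
  qed
  then show "\<exists>N. \<forall>m\<ge>N. \<forall>n\<ge>N. pnorm (r *\<^sub>R X m - r *\<^sub>R X n) < e" by blast
qed

lemma pcauchy_uminus: "pcauchy X \<Longrightarrow> pcauchy (\<lambda>n. - X n)"
  using pcauchy_scale[of X "-1"] by simp

lemma pcauchy_diff: "pcauchy X \<Longrightarrow> pcauchy Y \<Longrightarrow> pcauchy (\<lambda>n. X n - Y n)"
  using pcauchy_add[of X "\<lambda>n. - Y n"] pcauchy_uminus[of Y] by simp

lemma pcauchy_convergent:
  assumes "pcauchy X"
  shows "convergent (\<lambda>n. pnorm (X n))"
proof -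
  have "Cauchy (\<lambda>n. pnorm (X n))"
  proof (rule metric_CauchyI)
    fix e :: real assume "e > 0"
    then obtain N where N: "\<And>m n. m \<ge> N \<Longrightarrow> n \<ge> N \<Longrightarrow> pnorm (X m - X n) < e"
      by (metis pcauchyE assms)
    have "dist (pnorm (X m)) (pnorm (X n)) < e" if "m \<ge> N" "n \<ge> N" for m n
      using pnorm_diff_abs[of "X m" "X n"] N[OF that] by (simp add: dist_real_def)
    then show "\<exists>N. \<forall>m\<ge>N. \<forall>n\<ge>N. dist (pnorm (X m)) (pnorm (X n)) < e" by blast
  qed
  then show ?thesis by (simp add: Cauchy_convergent_iff)
qed

lemma tendsto0_le:
  fixes f g :: "nat \<Rightarrow> real"
  assumes "g \<longlonglongrightarrow> 0" "\<And>n. 0 \<le> f n" "\<And>n. f n \<le> g n"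
  shows "f \<longlonglongrightarrow> 0"
  by (rule tendsto_sandwich[OF _ _ tendsto_const assms(1)]) (auto simp: assms)

lemma ptensor_rel_add:
  assumes "ptensor_rel X X'" "ptensor_rel Y Y'"
  shows "ptensor_rel (\<lambda>n. X n + Y n) (\<lambda>n. X' n + Y' n)"
  unfolding ptensor_rel_def
proof (intro conjI)
  have "(\<lambda>n. pnorm (X n - X' n) + pnorm (Y n - Y' n)) \<longlonglongrightarrow> 0"
    using assms tendsto_add unfolding ptensor_rel_def by fastforce
  then show "(\<lambda>n. pnorm (X n + Y n - (X' n + Y' n))) \<longlonglongrightarrow> 0"
    by (rule tendsto0_le) (auto simp: add_diff_add intro: pnorm_triangle)
qed (use assms in \<open>auto simp: ptensor_rel_def intro: pcauchy_add\<close>)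

lemma ptensor_rel_scale:
  assumes "ptensor_rel X X'"
  shows "ptensor_rel (\<lambda>n. r *\<^sub>R X n) (\<lambda>n. r *\<^sub>R X' n)"
proof -
  have "(\<lambda>n. \<bar>r\<bar> * pnorm (X n - X' n)) \<longlonglongrightarrow> 0"
    using assms unfolding ptensor_rel_def by (auto intro: tendsto_mult_right_zero)
  then show ?thesis
    using assms by (auto simp: ptensor_rel_def pcauchy_scale pnorm_scale simp flip: scaleR_diff_right)
qed

lemma ptensor_rel_uminus: "ptensor_rel X X' \<Longrightarrow> ptensor_rel (\<lambda>n. - X n) (\<lambda>n. - X' n)"
  using ptensor_rel_scale[of X X' "-1"] by simp

lemma ptensor_rel_diff:
  "ptensor_rel X X' \<Longrightarrow> ptensor_rel Y Y' \<Longrightarrow> ptensor_rel (\<lambda>n. X n - Y n) (\<lambda>n. X' n - Y' n)"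
  using ptensor_rel_add[of X X' "\<lambda>n. - Y n" "\<lambda>n. - Y' n"] ptensor_rel_uminus[of Y Y'] by simp

lemma ptensor_rel_part_equivp:
  "part_equivp (ptensor_rel ::
    (nat \<Rightarrow> ('a::real_normed_vector, 'b::real_normed_vector) tensor) \<Rightarrow> (nat \<Rightarrow> ('a, 'b) tensor) \<Rightarrow> bool)"
  (is "part_equivp ?R")
proof (rule part_equivpI)
  show "\<exists>X. ?R X X" by (rule exI[of _ "\<lambda>_. 0"]) (simp add: ptensor_rel_def)
  show "symp ?R" by (auto simp: symp_def ptensor_rel_def pnorm_minus_commute)
  show "transp ?R"
  proof (rule transpI)
    fix X Y Z :: "nat \<Rightarrow> ('a, 'b) tensor"
    assume 1: "ptensor_rel X Y" and 2: "ptensor_rel Y Z"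
    have "(\<lambda>n. pnorm (X n - Y n) + pnorm (Y n - Z n)) \<longlonglongrightarrow> 0"
      using 1 2 tendsto_add unfolding ptensor_rel_def by fastforce
    then have "(\<lambda>n. pnorm (X n - Z n)) \<longlonglongrightarrow> 0"
      by (rule tendsto0_le) (auto intro: pnorm_triangle3)
    then show "ptensor_rel X Z" using 1 2 by (simp add: ptensor_rel_def)
  qed
qed

quotient_type (overloaded) ('a, 'b) ptensor =
  "nat \<Rightarrow> ('a::real_normed_vector, 'b::real_normed_vector) tensor" / partial: ptensor_rel
  by (rule ptensor_rel_part_equivp)

lemma ptensor_rel_lim:
  assumes "ptensor_rel X Y"
  shows "lim (\<lambda>n. pnorm (X n)) = lim (\<lambda>n. pnorm (Y n))"
proof -
  have X: "(\<lambda>n. pnorm (X n)) \<longlonglongrightarrow> lim (\<lambda>n. pnorm (X n))"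
    using assms pcauchy_convergent unfolding ptensor_rel_def by (metis convergent_LIMSEQ_iff)
  have "(\<lambda>n. \<bar>pnorm (Y n) - pnorm (X n)\<bar>) \<longlonglongrightarrow> 0"
    using assms unfolding ptensor_rel_def
    by (elim conjE, elim tendsto0_le) (auto simp: pnorm_minus_commute[of "X _"] intro: pnorm_diff_abs)
  then have "(\<lambda>n. pnorm (Y n) - pnorm (X n)) \<longlonglongrightarrow> 0"
    by (rule tendsto_rabs_zero_cancel)
  from tendsto_add[OF this X] have "(\<lambda>n. pnorm (Y n)) \<longlonglongrightarrow> lim (\<lambda>n. pnorm (X n))" by simp
  then show ?thesis by (simp add: limI)
qed

instantiation ptensor :: (real_normed_vector, real_normed_vector) real_normed_vector
begin

lift_definition zero_ptensor :: "('a, 'b) ptensor" is "\<lambda>_. 0"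
  by (simp add: ptensor_rel_def)

lift_definition plus_ptensor :: "('a, 'b) ptensor \<Rightarrow> ('a, 'b) ptensor \<Rightarrow> ('a, 'b) ptensor"
  is "\<lambda>X Y n. X n + Y n"
  by (rule ptensor_rel_add)

lift_definition uminus_ptensor :: "('a, 'b) ptensor \<Rightarrow> ('a, 'b) ptensor" is "\<lambda>X n. - X n"
  by (rule ptensor_rel_uminus)

lift_definition minus_ptensor :: "('a, 'b) ptensor \<Rightarrow> ('a, 'b) ptensor \<Rightarrow> ('a, 'b) ptensor"
  is "\<lambda>X Y n. X n - Y n"
  by (rule ptensor_rel_diff)

lift_definition scaleR_ptensor :: "real \<Rightarrow> ('a, 'b) ptensor \<Rightarrow> ('a, 'b) ptensor"
  is "\<lambda>r X n. r *\<^sub>R X n"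
  by (rule ptensor_rel_scale)

lift_definition norm_ptensor :: "('a, 'b) ptensor \<Rightarrow> real" is "\<lambda>X. lim (\<lambda>n. pnorm (X n))"
  by (rule ptensor_rel_lim)

definition dist_ptensor :: "('a, 'b) ptensor \<Rightarrow> ('a, 'b) ptensor \<Rightarrow> real" where
  "dist_ptensor U V = norm (U - V)"

definition uniformity_ptensor :: "(('a, 'b) ptensor \<times> ('a, 'b) ptensor) filter" where
  "uniformity_ptensor = (INF e\<in>{0 <..}. principal {(U, V). dist U V < e})"

definition open_ptensor :: "('a, 'b) ptensor set \<Rightarrow> bool" where
  "open_ptensor S = (\<forall>U\<in>S. \<forall>\<^sub>F (U', V) in uniformity. U' = U \<longrightarrow> V \<in> S)"

definition sgn_ptensor :: "('a, 'b) ptensor \<Rightarrow> ('a, 'b) ptensor" where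
  "sgn_ptensor U = scaleR (inverse (norm U)) U"

lemma ptensor_rel_refl: "ptensor_rel X X \<longleftrightarrow> pcauchy X"
  by (simp add: ptensor_rel_def)

lemma norm_ptensor_lim:
  assumes "pcauchy X"
  shows "(\<lambda>n. pnorm (X n)) \<longlonglongrightarrow> lim (\<lambda>n. pnorm (X n))"
  using pcauchy_convergent[OF assms] by (simp add: convergent_LIMSEQ_iff)

instance
proof
  fix U V W :: "('a, 'b) ptensor" and r s :: real
  show "U + V + W = U + (V + W)"
    by transfer (simp add: ptensor_rel_refl pcauchy_add add.assoc)
  show "U + V = V + U"
    by transfer (simp add: ptensor_rel_refl pcauchy_add add.commute)
  show "0 + U = U"
    by transfer (simp add: ptensor_rel_refl)
  show "- U + U = 0"
    by transfer (simp add: ptensor_rel_refl)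
  show "U - V = U + - V"
    by transfer (simp add: ptensor_rel_refl pcauchy_diff)
  show "r *\<^sub>R (U + V) = r *\<^sub>R U + r *\<^sub>R V"
    by transfer (simp add: ptensor_rel_refl pcauchy_add pcauchy_scale algebra_simps)
  show "(r + s) *\<^sub>R U = r *\<^sub>R U + s *\<^sub>R U"
    by transfer (simp add: ptensor_rel_refl pcauchy_add pcauchy_scale algebra_simps)
  show "r *\<^sub>R s *\<^sub>R U = (r * s) *\<^sub>R U"
    by transfer (simp add: ptensor_rel_refl pcauchy_scale)
  show "1 *\<^sub>R U = U"
    by transfer (simp add: ptensor_rel_refl)
  show "dist U V = norm (U - V)" by (rule dist_ptensor_def)
  show "sgn U = scaleR (inverse (norm U)) U" by (rule sgn_ptensor_def)
  show "uniformity = (INF e\<in>{0 <..}. principal {(U, V :: ('a, 'b) ptensor). dist U V < e})"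
    by (rule uniformity_ptensor_def)
  show "open S = (\<forall>U\<in>S. \<forall>\<^sub>F (U', V) in uniformity. U' = U \<longrightarrow> V \<in> S)"
    for S :: "('a, 'b) ptensor set"
    by (rule open_ptensor_def)
  show "norm U = 0 \<longleftrightarrow> U = 0"
  proof transfer
    fix X :: "nat \<Rightarrow> ('a, 'b) tensor"
    assume "ptensor_rel X X"
    then have X: "pcauchy X" by (simp add: ptensor_rel_refl)
    show "lim (\<lambda>n. pnorm (X n)) = 0 \<longleftrightarrow> ptensor_rel X (\<lambda>_. 0)"
    proof
      assume "lim (\<lambda>n. pnorm (X n)) = 0"
      then show "ptensor_rel X (\<lambda>_. 0)" using norm_ptensor_lim[OF X] X by (simp add: ptensor_rel_def)
    next
      assume "ptensor_rel X (\<lambda>_. 0)"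
      then have "(\<lambda>n. pnorm (X n)) \<longlonglongrightarrow> 0" by (simp add: ptensor_rel_def)
      then show "lim (\<lambda>n. pnorm (X n)) = 0" by (rule limI)
    qed
  qed
  show "norm (U + V) \<le> norm U + norm V"
  proof transfer
    fix X Y :: "nat \<Rightarrow> ('a, 'b) tensor"
    assume "ptensor_rel X X" "ptensor_rel Y Y"
    then have X: "pcauchy X" and Y: "pcauchy Y" by (simp_all add: ptensor_rel_refl)
    show "lim (\<lambda>n. pnorm (X n + Y n)) \<le> lim (\<lambda>n. pnorm (X n)) + lim (\<lambda>n. pnorm (Y n))"
      by (rule LIMSEQ_le[OF norm_ptensor_lim[OF pcauchy_add[OF X Y]]
            tendsto_add[OF norm_ptensor_lim[OF X] norm_ptensor_lim[OF Y]]])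
         (auto intro: pnorm_triangle)
  qed
  show "norm (r *\<^sub>R U) = \<bar>r\<bar> * norm U"
  proof transfer
    fix r :: real and X :: "nat \<Rightarrow> ('a, 'b) tensor"
    assume "ptensor_rel X X"
    then have X: "pcauchy X" by (simp add: ptensor_rel_refl)
    show "lim (\<lambda>n. pnorm (r *\<^sub>R X n)) = \<bar>r\<bar> * lim (\<lambda>n. pnorm (X n))"
      unfolding pnorm_scale by (rule limI, rule tendsto_mult_left, rule norm_ptensor_lim[OF X])
  qed
qed

end

definition of_tensor ::
    "('a::real_normed_vector, 'b::real_normed_vector) tensor \<Rightarrow> ('a, 'b) ptensor" where
  "of_tensor u = abs_ptensor (\<lambda>_. u)"

lemma ex_rep_ptensor: "\<exists>X. pcauchy X \<and> U = abs_ptensor X"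
  using Quotient3_rep_reflp[OF Quotient3_ptensor, of U] Quotient3_abs_rep[OF Quotient3_ptensor, of U]
  by (intro exI[of _ "rep_ptensor U"]) (auto simp: ptensor_rel_def)

lemma linear_of_tensor: "linear of_tensor"
  by (rule linearI)
     (simp_all add: of_tensor_def plus_ptensor.abs_eq scaleR_ptensor.abs_eq ptensor_rel_refl)

lemma norm_of_tensor [simp]: "norm (of_tensor u) = pnorm u"
  by (simp add: of_tensor_def norm_ptensor.abs_eq ptensor_rel_refl)

lemma of_tensor_dense:
  fixes U :: "('a::real_normed_vector, 'b::real_normed_vector) ptensor"
  assumes e: "e > 0"
  shows "\<exists>u. norm (U - of_tensor u) < e"
proof -
  obtain X where X: "pcauchy X" and U: "U = abs_ptensor X" using ex_rep_ptensor by blast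
  have "e/2 > 0" using e by simp
  then obtain N where N: "\<And>m n. m \<ge> N \<Longrightarrow> n \<ge> N \<Longrightarrow> pnorm (X m - X n) < e/2"
    by (metis pcauchyE X)
  have c: "pcauchy (\<lambda>n. X n - X N)" by (intro pcauchy_diff X) simp
  have "norm (U - of_tensor (X N)) = lim (\<lambda>n. pnorm (X n - X N))"
    unfolding U of_tensor_def
    by (subst minus_ptensor.abs_eq, simp add: ptensor_rel_refl X, simp add: ptensor_rel_refl,
        subst norm_ptensor.abs_eq, simp_all add: ptensor_rel_refl c)
  also have "\<dots> \<le> e/2"
    by (rule LIMSEQ_le_const2[OF norm_ptensor_lim[OF c]])
       (use N in \<open>auto intro!: exI[of _ N] less_imp_le\<close>)
  finally show ?thesis using e by (intro exI[of _ "X N"]) auto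
qed

lemma of_tensor_diff: "of_tensor (u - v) = of_tensor u - of_tensor v"
  by (rule linear_diff[OF linear_of_tensor])

lemma of_tensor_complete:
  assumes "pcauchy X"
  shows "\<exists>L. (\<lambda>n. of_tensor (X n)) \<longlonglongrightarrow> L"
proof -
  let ?L = "abs_ptensor X"
  have rel: "ptensor_rel X X" using assms by (simp add: ptensor_rel_refl)
  have "\<exists>N. \<forall>n\<ge>N. norm (of_tensor (X n) - ?L) < e" if e: "e > 0" for e
  proof -
    have "e/2 > 0" using e by simp
    then obtain N where N: "\<And>m n. m \<ge> N \<Longrightarrow> n \<ge> N \<Longrightarrow> pnorm (X m - X n) < e/2"
      by (metis pcauchyE assms)
    have "norm (of_tensor (X n) - ?L) < e" if n: "n \<ge> N" for n
    proof -
      have c: "pcauchy (\<lambda>k. X n - X k)" by (intro pcauchy_diff assms) simp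
      have "norm (of_tensor (X n) - ?L) = lim (\<lambda>k. pnorm (X n - X k))"
        unfolding of_tensor_def
        by (subst minus_ptensor.abs_eq, simp add: ptensor_rel_refl, rule rel,
            subst norm_ptensor.abs_eq, simp_all add: ptensor_rel_refl c)
      also have "\<dots> \<le> e/2"
        by (rule LIMSEQ_le_const2[OF norm_ptensor_lim[OF c]])
           (use N n in \<open>auto intro!: exI[of _ N] less_imp_le\<close>)
      finally show ?thesis using e by simp
    qed
    then show ?thesis by blast
  qed
  then show ?thesis by (auto simp: LIMSEQ_iff)
qed

instance ptensor :: (real_normed_vector, real_normed_vector) banach
proof
  fix U :: "nat \<Rightarrow> ('a, 'b) ptensor"
  assume U: "Cauchy U"
  have "\<forall>n. \<exists>u. norm (U n - of_tensor u) < inverse (real (Suc n))"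
    by (intro allI of_tensor_dense) simp
  then obtain X where X: "\<And>n. norm (U n - of_tensor (X n)) < inverse (real (Suc n))"
    by metis
  have 0: "(\<lambda>n. U n - of_tensor (X n)) \<longlonglongrightarrow> 0"
    by (rule Lim_null_comparison[OF _ LIMSEQ_inverse_real_of_nat]) (intro always_eventually allI less_imp_le X)
  have "Cauchy (\<lambda>n. of_tensor (X n))"
  proof (rule CauchyI)
    fix e :: real assume "e > 0"
    then have e: "e/3 > 0" by simp
    obtain N where N: "\<And>m n. m \<ge> N \<Longrightarrow> n \<ge> N \<Longrightarrow> norm (U m - U n) < e/3"
      using CauchyD[OF U e] by metis
    obtain M where M: "\<And>n. n \<ge> M \<Longrightarrow> norm (U n - of_tensor (X n)) < e/3"
      using LIMSEQ_D[OF 0 e] by auto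
    have "norm (of_tensor (X m) - of_tensor (X n)) < e" if "m \<ge> max N M" "n \<ge> max N M" for m n
    proof -
      have "of_tensor (X m) - of_tensor (X n) =
          (U m - U n) - (U m - of_tensor (X m)) + (U n - of_tensor (X n))" by simp
      also have "norm \<dots> \<le> norm (U m - U n) + norm (U m - of_tensor (X m)) + norm (U n - of_tensor (X n))"
        by (meson add_mono norm_triangle_ineq norm_triangle_ineq4 order_refl order_trans)
      finally show ?thesis using N[of m n] M[of m] M[of n] that by simp
    qed
    then show "\<exists>N. \<forall>m\<ge>N. \<forall>n\<ge>N. norm (of_tensor (X m) - of_tensor (X n)) < e" by blast
  qed
  then have "pcauchy X"
    unfolding pcauchy_def Cauchy_def dist_norm by (simp flip: of_tensor_diff)
  then obtain L where "(\<lambda>n. of_tensor (X n)) \<longlonglongrightarrow> L" using of_tensor_complete by blast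
  from tendsto_add[OF 0 this] have "U \<longlonglongrightarrow> L" by simp
  then show "convergent U" by (auto simp: convergent_def)
qed

definition ptens :: "'a::real_normed_vector \<Rightarrow> 'b::real_normed_vector \<Rightarrow> ('a, 'b) ptensor"
    (infixr \<open>\<otimes>\<^sub>\<pi>\<close> 75) where
  "x \<otimes>\<^sub>\<pi> y = of_tensor (tensor x y)"

lemma tensor_bilinear:
  "tensor (x + x') y = tensor x y + tensor x' y"
  "tensor x (y + y') = tensor x y + tensor x y'"
  "tensor (r *\<^sub>R x) y = r *\<^sub>R tensor x y"
  "tensor x (r *\<^sub>R y) = r *\<^sub>R tensor x y"
  by (transfer; auto simp: tensor_eq_def bilinear_ladd bilinear_radd bilinear_lmul bilinear_rmul)+

lemma bounded_bilinear_ptens: "bounded_bilinear (\<otimes>\<^sub>\<pi>)"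
proof
  show "\<exists>K. \<forall>a b. norm (a \<otimes>\<^sub>\<pi> b) \<le> norm a * norm b * K"
    by (rule exI[of _ 1]) (simp add: ptens_def pnorm_tensor_le)
qed (simp_all add: ptens_def tensor_bilinear linear_add[OF linear_of_tensor] linear_scale[OF linear_of_tensor])

lemma of_tensor_abs: "of_tensor (abs_tensor ps) = (\<Sum>(x, y)\<leftarrow>ps. x \<otimes>\<^sub>\<pi> y)"
  unfolding sum_tensor_abs[symmetric]
  by (induction ps) (auto simp: linear_0[OF linear_of_tensor] linear_add[OF linear_of_tensor] ptens_def)

instance ptensor ::
  ("{real_normed_vector, second_countable_topology}", "{real_normed_vector, second_countable_topology}")
  second_countable_topology
proof
  obtain A :: "'a set" where A: "countable A" "\<And>S. open S \<Longrightarrow> S \<noteq> {} \<Longrightarrow> \<exists>x\<in>A. x \<in> S"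
    by (rule countable_dense_setE) blast
  obtain B :: "'b set" where B: "countable B" "\<And>S. open S \<Longrightarrow> S \<noteq> {} \<Longrightarrow> \<exists>x\<in>B. x \<in> S"
    by (rule countable_dense_setE) blast
  define D where "D = (\<lambda>ps. of_tensor (abs_tensor ps)) ` lists (A \<times> B)"
  have cD: "countable D" unfolding D_def using A(1) B(1) by auto
  interpret bounded_bilinear "(\<otimes>\<^sub>\<pi>) :: 'a \<Rightarrow> 'b \<Rightarrow> _" by (rule bounded_bilinear_ptens)
  have pair: "\<exists>x'\<in>A. \<exists>y'\<in>B. norm (x \<otimes>\<^sub>\<pi> y - x' \<otimes>\<^sub>\<pi> y') < e" if "e > 0" for x :: 'a and y :: 'b and e
  proof -
    have "open ((\<lambda>p. fst p \<otimes>\<^sub>\<pi> snd p) -` ball (x \<otimes>\<^sub>\<pi> y) e)"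
      by (intro continuous_open_vimage open_ball) (auto intro!: continuous_intros continuous)
    moreover have "(x, y) \<in> (\<lambda>p. fst p \<otimes>\<^sub>\<pi> snd p) -` ball (x \<otimes>\<^sub>\<pi> y) e" using that by simp
    ultimately obtain S T where "open S" "open T" "(x, y) \<in> S \<times> T"
      "S \<times> T \<subseteq> (\<lambda>p. fst p \<otimes>\<^sub>\<pi> snd p) -` ball (x \<otimes>\<^sub>\<pi> y) e" by (rule open_prod_elim)
    moreover from this obtain x' y' where "x' \<in> A" "x' \<in> S" "y' \<in> B" "y' \<in> T" using A(2) B(2) by blast
    ultimately show ?thesis by (auto simp: dist_norm subset_iff intro!: bexI[of _ x'] bexI[of _ y'])
  qed
  have fin: "\<exists>qs\<in>lists (A \<times> B). norm ((\<Sum>(x, y)\<leftarrow>ps. x \<otimes>\<^sub>\<pi> y) - (\<Sum>(x, y)\<leftarrow>qs. x \<otimes>\<^sub>\<pi> y)) < e"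
    if "e > 0" for ps :: "('a \<times> 'b) list" and e
    using that
  proof (induction ps arbitrary: e)
    case Nil
    then show ?case by (intro bexI[of _ "[]"]) auto
  next
    case (Cons p ps)
    obtain x y where p: "p = (x, y)" by force
    from Cons have e: "e/2 > 0" by simp
    obtain qs where qs: "qs \<in> lists (A \<times> B)"
      "norm ((\<Sum>(x, y)\<leftarrow>ps. x \<otimes>\<^sub>\<pi> y) - (\<Sum>(x, y)\<leftarrow>qs. x \<otimes>\<^sub>\<pi> y)) < e/2"
      using Cons.IH[OF e] by blast
    obtain x' y' where xy: "x' \<in> A" "y' \<in> B" "norm (x \<otimes>\<^sub>\<pi> y - x' \<otimes>\<^sub>\<pi> y') < e/2" using pair[OF e] by blast
    have "norm ((x \<otimes>\<^sub>\<pi> y - x' \<otimes>\<^sub>\<pi> y') + ((\<Sum>(x, y)\<leftarrow>ps. x \<otimes>\<^sub>\<pi> y) - (\<Sum>(x, y)\<leftarrow>qs. x \<otimes>\<^sub>\<pi> y))) < e"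
      using norm_triangle_lt[of "x \<otimes>\<^sub>\<pi> y - x' \<otimes>\<^sub>\<pi> y'"] xy(3) qs(2) by fastforce
    then show ?case using xy qs by (intro bexI[of _ "(x', y') # qs"]) (auto simp: p add_diff_add)
  qed
  have dense: "\<exists>V\<in>D. dist V U < e" if "e > 0" for U :: "('a, 'b) ptensor" and e
  proof -
    have e: "e/2 > 0" using that by simp
    obtain u where u: "norm (U - of_tensor u) < e/2" using of_tensor_dense[OF e] by blast
    obtain ps where ps: "u = abs_tensor ps" using ex_rep by blast
    obtain qs where qs: "qs \<in> lists (A \<times> B)"
      "norm (of_tensor u - of_tensor (abs_tensor qs)) < e/2"
      using fin[OF e, of ps] by (auto simp: of_tensor_abs ps)
    have "norm (U - of_tensor (abs_tensor qs)) < e"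
      using norm_triangle_lt[of "U - of_tensor u" "of_tensor u - of_tensor (abs_tensor qs)"] u qs by simp
    then show ?thesis using qs by (auto simp: D_def dist_norm norm_minus_commute)
  qed
  let ?B = "(\<lambda>(V, q). ball V (real_of_rat q)) ` (D \<times> (UNIV :: rat set))"
  have "topological_basis ?B"
  proof (rule topological_basisI)
    fix S :: "('a, 'b) ptensor set" and U assume S: "open S" "U \<in> S"
    then obtain e where e: "e > 0" "ball U e \<subseteq> S" by (meson openE)
    obtain q where q: "0 < real_of_rat q" "real_of_rat q < e/2"
      using of_rat_dense[of 0 "e/2"] e by auto
    obtain V where V: "V \<in> D" "dist V U < real_of_rat q" using dense[OF q(1)] by blast
    have "ball V (real_of_rat q) \<subseteq> ball U e"
    proof
      fix W assume "W \<in> ball V (real_of_rat q)"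
      then show "W \<in> ball U e"
        using dist_triangle[of U W V] V q by (simp add: dist_commute)
    qed
    then show "\<exists>B'\<in>?B. U \<in> B' \<and> B' \<subseteq> S"
      using V e by (intro bexI[of _ "ball V (real_of_rat q)"]) auto
  qed auto
  then show "\<exists>B::('a, 'b) ptensor set set. countable B \<and> open = generate_topology B"
    using cD by (intro exI[of _ ?B]) (auto intro!: topological_basis_imp_subbasis)
qed

definition tensor_functional ::
    "('a::real_normed_vector \<Rightarrow>\<^sub>L real) \<Rightarrow> ('b::real_normed_vector \<Rightarrow>\<^sub>L real) \<Rightarrow> ('a, 'b) ptensor \<Rightarrow>\<^sub>L real"
  where
  "tensor_functional f g = (THE h. \<forall>x y. blinfun_apply h (x \<otimes>\<^sub>\<pi> y) = f x * g y)"

lemma tensor_functional_ex1: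
  fixes f :: "'a::real_normed_vector \<Rightarrow>\<^sub>L real" and g :: "'b::real_normed_vector \<Rightarrow>\<^sub>L real"
  shows "\<exists>!h. \<forall>x y. blinfun_apply h (x \<otimes>\<^sub>\<pi> y) = f x * g y"
proof (rule ex_ex1I)
  let ?A = "\<lambda>x y. blinfun_apply f x * blinfun_apply g y"
  have A: "bilinear ?A"
    unfolding bilinear_def by (auto intro!: linearI simp: blinfun.bilinear_simps algebra_simps)
  define v where "v u = form_value ?A (rep_tensor u)" for u
  have v_abs: "v (abs_tensor ps) = form_value ?A ps" for ps
    using Quotient3_rep_abs[OF Quotient3_tensor, of ps] A
    by (simp add: v_def tensor_eq_def)
  have v_add: "v (u + w) = v u + v w" for u w
    using ex_rep[of u] ex_rep[of w] by (auto simp: v_abs plus_tensor.abs_eq)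
  have v_scale: "v (r *\<^sub>R u) = r * v u" for r u
    using ex_rep[of u] by (auto simp: v_abs scaleR_tensor.abs_eq form_value_scale[OF A])
  have v_diff: "v (u - w) = v u - v w" for u w
    using v_add[of u "-1 *\<^sub>R w"] v_scale[of "-1" w] by simp
  define K where "K = norm f * norm g"
  have K0: "K \<ge> 0" by (simp add: K_def)
  have cost: "\<bar>form_value ?A ps\<bar> \<le> K * rep_cost ps" for ps
  proof (induction ps)
    case (Cons p ps)
    obtain x y where p: "p = (x, y)" by force
    have "\<bar>?A x y\<bar> \<le> (norm f * norm x) * (norm g * norm y)"
      unfolding abs_mult using norm_blinfun[of f x] norm_blinfun[of g y] by (intro mult_mono) auto
    then show ?case using Cons by (simp add: p K_def algebra_simps)
  qed simp
  have v_bound: "\<bar>v u\<bar> \<le> K * pnorm u" for u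
  proof (rule field_le_epsilon)
    fix e :: real assume e: "e > 0"
    obtain ps where ps: "u = abs_tensor ps" "rep_cost ps < pnorm u + e/(K+1)"
      by (rule pnorm_approx[of "e/(K+1)" u]) (use e K0 in \<open>simp add: divide_pos_pos\<close>)
    have "\<bar>v u\<bar> \<le> K * rep_cost ps" using cost by (simp add: ps v_abs)
    also have "\<dots> \<le> K * (pnorm u + e/(K+1))" using ps K0 by (intro mult_left_mono) auto
    also have "\<dots> = K * pnorm u + e * (K/(K+1))"
      by (simp only: distrib_left times_divide_eq_right mult.commute)
    also have "e * (K/(K+1)) \<le> e * 1"
      using e K0 by (intro mult_left_mono divide_le_eq_1_pos[THEN iffD2]) linarith+
    finally show "\<bar>v u\<bar> \<le> K * pnorm u + e" by linarith
  qed
  have conv: "(\<lambda>n. v (X n)) \<longlonglongrightarrow> lim (\<lambda>n. v (X n))" if X: "pcauchy X" for X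
  proof -
    have "Cauchy (\<lambda>n. v (X n))"
    proof (rule metric_CauchyI)
      fix e :: real assume e: "e > 0"
      then have "e/(K+1) > 0" using K0 by simp
      then obtain N where N: "\<And>m n. m \<ge> N \<Longrightarrow> n \<ge> N \<Longrightarrow> pnorm (X m - X n) < e/(K+1)"
        by (metis pcauchyE X)
      have "dist (v (X m)) (v (X n)) < e" if "m \<ge> N" "n \<ge> N" for m n
      proof -
        have "dist (v (X m)) (v (X n)) \<le> K * pnorm (X m - X n)"
          using v_bound[of "X m - X n"] by (simp add: dist_real_def v_diff)
        also have "\<dots> \<le> (K+1) * pnorm (X m - X n)" by (intro mult_right_mono) auto
        also have "\<dots> < (K+1) * (e/(K+1))" by (intro mult_strict_left_mono N that) (use K0 in auto)
        finally show ?thesis using K0 by simp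
      qed
      then show "\<exists>N. \<forall>m\<ge>N. \<forall>n\<ge>N. dist (v (X m)) (v (X n)) < e" by blast
    qed
    then show ?thesis by (simp add: Cauchy_convergent_iff convergent_LIMSEQ_iff)
  qed
  define h where "h U = lim (\<lambda>n. v (rep_ptensor U n))" for U :: "('a, 'b) ptensor"
  have rep: "ptensor_rel (rep_ptensor U) (rep_ptensor U)" for U :: "('a, 'b) ptensor"
    by (rule Quotient3_rep_reflp[OF Quotient3_ptensor])
  have absrep: "abs_ptensor (rep_ptensor U) = U" for U :: "('a, 'b) ptensor"
    by (rule Quotient3_abs_rep[OF Quotient3_ptensor])
  have h_abs: "(\<lambda>n. v (X n)) \<longlonglongrightarrow> h (abs_ptensor X)" if X: "pcauchy X" for X
  proof -
    let ?Y = "rep_ptensor (abs_ptensor X)"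
    have rel: "ptensor_rel X ?Y"
      using Quotient3_rep_abs[OF Quotient3_ptensor, of X] X part_equivp_symp[OF ptensor_rel_part_equivp]
      by (auto simp: ptensor_rel_refl)
    have "(\<lambda>n. K * pnorm (X n - ?Y n)) \<longlonglongrightarrow> 0"
      using rel unfolding ptensor_rel_def by (auto intro: tendsto_mult_right_zero)
    then have "(\<lambda>n. v (X n) - v (?Y n)) \<longlonglongrightarrow> 0"
      by (intro Lim_null_comparison[of "\<lambda>n. v (X n) - v (?Y n)" "\<lambda>n. K * pnorm (X n - ?Y n)"])
         (auto simp: v_diff[symmetric] v_bound)
    moreover have "(\<lambda>n. v (?Y n)) \<longlonglongrightarrow> h (abs_ptensor X)"
      unfolding h_def using rel by (intro conv) (simp add: ptensor_rel_def)
    ultimately show ?thesis using tendsto_add[of "\<lambda>n. v (X n) - v (?Y n)" 0] by force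
  qed
  have h_rep: "(\<lambda>n. v (rep_ptensor U n)) \<longlonglongrightarrow> h U" for U
    using h_abs[of "rep_ptensor U"] rep[of U] by (simp add: absrep ptensor_rel_refl)
  have bl: "bounded_linear h"
  proof (rule bounded_linear_intro[where K = K])
    fix U V :: "('a, 'b) ptensor" and r :: real
    let ?X = "rep_ptensor U" and ?Y = "rep_ptensor V"
    have XY: "pcauchy ?X" "pcauchy ?Y" using rep by (auto simp: ptensor_rel_refl)
    have "U + V = abs_ptensor (\<lambda>n. ?X n + ?Y n)"
      using plus_ptensor.abs_eq[OF rep rep, of U V] by (simp add: absrep)
    then have "(\<lambda>n. v (?X n) + v (?Y n)) \<longlonglongrightarrow> h (U + V)"
      using h_abs[OF pcauchy_add[OF XY]] by (simp add: v_add)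
    then show "h (U + V) = h U + h V"
      using tendsto_add[OF h_rep[of U] h_rep[of V]] LIMSEQ_unique by blast
    have "r *\<^sub>R U = abs_ptensor (\<lambda>n. r *\<^sub>R ?X n)"
      using scaleR_ptensor.abs_eq[OF rep, of r U] by (simp add: absrep)
    then have "(\<lambda>n. r * v (?X n)) \<longlonglongrightarrow> h (r *\<^sub>R U)"
      using h_abs[OF pcauchy_scale[OF XY(1)]] by (simp add: v_scale)
    then show "h (r *\<^sub>R U) = r *\<^sub>R h U"
      using tendsto_mult_left[OF h_rep[of U], of r] LIMSEQ_unique by (metis real_scaleR_def)
    have "norm U = lim (\<lambda>n. pnorm (?X n))"
      using norm_ptensor.abs_eq[OF rep, of U] by (simp add: absrep)
    then have "(\<lambda>n. pnorm (?X n) * K) \<longlonglongrightarrow> norm U * K"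
      using norm_ptensor_lim[OF XY(1)] by (auto intro: tendsto_mult_right)
    then show "norm (h U) \<le> norm U * K"
      by (rule LIMSEQ_le[OF tendsto_norm[OF h_rep[of U]]])
         (use v_bound in \<open>auto simp: mult.commute\<close>)
  qed
  have h_ptens: "h (x \<otimes>\<^sub>\<pi> y) = f x * g y" for x y
  proof -
    have "(\<lambda>_. v (tensor x y)) \<longlonglongrightarrow> h (x \<otimes>\<^sub>\<pi> y)"
      using h_abs[of "\<lambda>_. tensor x y"] by (simp add: ptens_def of_tensor_def)
    then have "h (x \<otimes>\<^sub>\<pi> y) = v (tensor x y)" by (simp add: LIMSEQ_const_iff)
    then show ?thesis by (simp add: tensor.abs_eq v_abs)
  qed
  show "\<exists>h. \<forall>x y. blinfun_apply h (x \<otimes>\<^sub>\<pi> y) = f x * g y"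
    by (rule exI[of _ "Blinfun h"]) (simp add: bounded_linear_Blinfun_apply[OF bl] h_ptens)
  fix h1 h2 :: "('a, 'b) ptensor \<Rightarrow>\<^sub>L real"
  assume "\<forall>x y. blinfun_apply h1 (x \<otimes>\<^sub>\<pi> y) = f x * g y" "\<forall>x y. blinfun_apply h2 (x \<otimes>\<^sub>\<pi> y) = f x * g y"
  then have 0: "blinfun_apply (h1 - h2) (x \<otimes>\<^sub>\<pi> y) = 0" for x y by (simp add: blinfun.diff_left)
  have 1: "blinfun_apply (h1 - h2) (of_tensor u) = 0" for u
  proof -
    obtain ps where "u = abs_tensor ps" using ex_rep by blast
    then show ?thesis
      by (simp only: of_tensor_abs, induction ps arbitrary: u) (auto simp: blinfun.add_right 0)
  qed
  have "blinfun_apply (h1 - h2) U = 0" for U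
  proof -
    have le: "\<bar>blinfun_apply (h1 - h2) U\<bar> \<le> 0 + e" if e: "e > 0" for e
    proof -
      let ?M = "norm (h1 - h2) + 1"
      have M: "?M > 0" using norm_ge_zero[of "h1 - h2"] by linarith
      then have "e / ?M > 0" using e by simp
      then obtain u where u: "norm (U - of_tensor u) < e / ?M" using of_tensor_dense by blast
      have "\<bar>blinfun_apply (h1 - h2) U\<bar> = \<bar>blinfun_apply (h1 - h2) (U - of_tensor u)\<bar>"
        using 1[of u] by (simp add: blinfun.diff_right)
      also have "\<dots> \<le> norm (h1 - h2) * norm (U - of_tensor u)"
        using norm_blinfun[of "h1 - h2" "U - of_tensor u"] by simp
      also have "\<dots> \<le> ?M * (e / ?M)" using u M by (intro mult_mono) auto
      also have "\<dots> = 0 + e" using M by simp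
      finally show ?thesis .
    qed
    from field_le_epsilon[OF le] show ?thesis by simp
  qed
  then have "h1 - h2 = 0" by (intro blinfun_eqI) simp
  then show "h1 = h2" by simp
qed

lemma tensor_functional_ptens [simp]:
  "blinfun_apply (tensor_functional f g) (x \<otimes>\<^sub>\<pi> y) = f x * g y"
  using theI'[OF tensor_functional_ex1[of f g]] by (simp add: tensor_functional_def)

definition iid_with_copy ::
    "'w measure \<Rightarrow> 'e measure \<Rightarrow> (int \<Rightarrow> 'w \<Rightarrow> 'e) \<Rightarrow> (int \<Rightarrow> 'w \<Rightarrow> 'e) \<Rightarrow> bool" where
  "iid_with_copy P E \<eta> \<eta>' \<longleftrightarrow>
    prob_space.indep_vars P (\<lambda>_. E) \<eta> UNIV \<and>
    (\<forall>i. distr P E (\<eta> i) = distr P E (\<eta> 0)) \<and>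
    prob_space.indep_var P (PiM UNIV (\<lambda>_. E)) (\<lambda>\<omega> i. \<eta> i \<omega>) (PiM UNIV (\<lambda>_. E)) (\<lambda>\<omega> i. \<eta>' i \<omega>) \<and>
    distr P (PiM UNIV (\<lambda>_. E)) (\<lambda>\<omega> i. \<eta>' i \<omega>) = distr P (PiM UNIV (\<lambda>_. E)) (\<lambda>\<omega> i. \<eta> i \<omega>)"

text \<open>
  The causal shift process \<open>F\<^sub>i = (\<eta>\<^sub>i, \<eta>\<^sub>i\<^sub>-\<^sub>1, \<dots>)\<close> and its coupled version, as elements of
  \<open>E\<^sup>\<nat>\<close>: the coordinate \<open>k\<close> holds the innovation with index \<open>i - k\<close>.
\<close>

definition past :: "(int \<Rightarrow> 'w \<Rightarrow> 'e) \<Rightarrow> int \<Rightarrow> 'w \<Rightarrow> nat \<Rightarrow> 'e" where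
  "past \<eta> i \<omega> k = \<eta> (i - int k) \<omega>"

definition coupled_past ::
    "(int \<Rightarrow> 'w \<Rightarrow> 'e) \<Rightarrow> (int \<Rightarrow> 'w \<Rightarrow> 'e) \<Rightarrow> int \<Rightarrow> 'w \<Rightarrow> nat \<Rightarrow> 'e" where
  "coupled_past \<eta> \<eta>' i \<omega> k = (if i - int k = 0 then \<eta>' 0 \<omega> else \<eta> (i - int k) \<omega>)"

text \<open>
  The maps \<open>H t\<close> are measurable on the product space, which makes every \<open>H t (F\<^sub>i)\<close> and its coupled
  version a random variable whose law is determined by that of the innovations.
\<close>

definition locally_stationary ::
    "'w measure \<Rightarrow> 'e measure \<Rightarrow> (int \<Rightarrow> 'w \<Rightarrow> 'e) \<Rightarrow> (real \<Rightarrow> (nat \<Rightarrow> 'e) \<Rightarrow> 'b::topological_space) \<Rightarrow>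
      (nat \<Rightarrow> nat \<Rightarrow> 'w \<Rightarrow> 'b) \<Rightarrow> bool" where
  "locally_stationary P E \<eta> H X \<longleftrightarrow>
    (\<forall>t\<in>{0..1}. H t \<in> borel_measurable (PiM UNIV (\<lambda>_. E))) \<and>
    (\<forall>x\<in>space (PiM UNIV (\<lambda>_. E)). continuous_on {0..1} (\<lambda>t. H t x)) \<and>
    (\<forall>n. \<forall>i\<in>{1..n}. \<forall>\<omega>\<in>space P. X i n \<omega> = H (real i / real n) (past \<eta> (int i) \<omega>))"

definition centered ::
    "'w measure \<Rightarrow> (nat \<Rightarrow> nat \<Rightarrow> 'w \<Rightarrow> 'b::{banach, second_countable_topology}) \<Rightarrow> bool" where
  "centered P X \<longleftrightarrow> (\<forall>n. \<forall>i\<in>{1..n}. integrable P (X i n) \<and> (\<integral>\<omega>. X i n \<omega> \<partial>P) = 0)"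

text \<open>
  \<open>Lp_norm\<close> and the suprema below are real-valued; they have their usual meaning because all
  variables they are applied to have uniformly bounded moments of the order in question, by the
  (extended real-valued) moment bound in \<open>moment_dependence\<close>.
\<close>

definition Lp_norm :: "'w measure \<Rightarrow> real \<Rightarrow> ('w \<Rightarrow> 'b::real_normed_vector) \<Rightarrow> real" where
  "Lp_norm P p X = (\<integral>\<omega>. norm (X \<omega>) powr p \<partial>P) powr (1 / p)"

definition phys_dep ::
    "'w measure \<Rightarrow> (int \<Rightarrow> 'w \<Rightarrow> 'e) \<Rightarrow> (int \<Rightarrow> 'w \<Rightarrow> 'e) \<Rightarrow>
      (real \<Rightarrow> (nat \<Rightarrow> 'e) \<Rightarrow> 'b::real_normed_vector) \<Rightarrow> real \<Rightarrow> nat \<Rightarrow> real" where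
  "phys_dep P \<eta> \<eta>' H \<rho> i =
    (SUP t\<in>{0..1}. Lp_norm P \<rho> (\<lambda>\<omega>. H t (past \<eta> (int i) \<omega>) - H t (coupled_past \<eta> \<eta>' (int i) \<omega>)))"

definition tail_sum :: "(nat \<Rightarrow> real) \<Rightarrow> nat \<Rightarrow> real" where
  "tail_sum d k = (\<Sum>i. d (i + k))"

definition L2_Lipschitz ::
    "'w measure \<Rightarrow> (int \<Rightarrow> 'w \<Rightarrow> 'e) \<Rightarrow> (real \<Rightarrow> (nat \<Rightarrow> 'e) \<Rightarrow> 'b::real_normed_vector) \<Rightarrow> bool" where
  "L2_Lipschitz P \<eta> H \<longleftrightarrow>
    (\<forall>i. bdd_above {Lp_norm P 2 (\<lambda>\<omega>. H t (past \<eta> i \<omega>) - H s (past \<eta> i \<omega>)) / \<bar>t - s\<bar> | s t.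
      0 \<le> s \<and> s < t \<and> t \<le> 1})"

definition moment_dependence ::
    "'w measure \<Rightarrow> (int \<Rightarrow> 'w \<Rightarrow> 'e) \<Rightarrow> (int \<Rightarrow> 'w \<Rightarrow> 'e) \<Rightarrow>
      (real \<Rightarrow> (nat \<Rightarrow> 'e) \<Rightarrow> 'b::real_normed_vector) \<Rightarrow> real \<Rightarrow> bool" where
  "moment_dependence P \<eta> \<eta>' H \<kappa> \<longleftrightarrow>
    L2_Lipschitz P \<eta> H \<and>
    (SUP t\<in>{0..1}. \<integral>\<^sup>+\<omega>. ennreal (norm (H t (past \<eta> 0 \<omega>)) powr (2 + \<kappa>)) \<partial>P) < \<infinity> \<and>
    summable (phys_dep P \<eta> \<eta>' H (2 + \<kappa>)) \<and>
    (\<lambda>k::int. tail_sum (phys_dep P \<eta> \<eta>' H (2 + \<kappa>)) (nat \<bar>k\<bar>)) summable_on UNIV \<and>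
    decseq (phys_dep P \<eta> \<eta>' H (2 + \<kappa>))"

text \<open>
  \<open>Cov\<close> is meant for centered variables. The two-sided series in \<open>local_lrv\<close> converges absolutely
  under \<open>moment_dependence\<close>, so that it can be written as an unordered sum.
\<close>

definition Cov ::
    "'w measure \<Rightarrow> ('w \<Rightarrow> 'a::{banach, second_countable_topology}) \<Rightarrow>
      ('w \<Rightarrow> 'b::{banach, second_countable_topology}) \<Rightarrow> ('a, 'b) ptensor" where
  "Cov P X Y = (\<integral>\<omega>. X \<omega> \<otimes>\<^sub>\<pi> Y \<omega> \<partial>P)"

definition local_lrv ::
    "'w measure \<Rightarrow> (int \<Rightarrow> 'w \<Rightarrow> 'e) \<Rightarrow>
      (real \<Rightarrow> (nat \<Rightarrow> 'e) \<Rightarrow> 'b::{banach, second_countable_topology}) \<Rightarrow> real \<Rightarrow> ('b, 'b) ptensor" where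
  "local_lrv P \<eta> H t =
    (\<Sum>\<^sub>\<infinity>i\<in>(UNIV::int set). Cov P (\<lambda>\<omega>. H t (past \<eta> i \<omega>)) (\<lambda>\<omega>. H t (past \<eta> 0 \<omega>)))"

text \<open>
  Basis vectors are numbered from \<open>0\<close>, so that the first \<open>k\<close> of them are those with index \<open>< k\<close>.
\<close>

definition schauder_basis ::
    "(nat \<Rightarrow> 'b::real_normed_vector) \<Rightarrow> (nat \<Rightarrow> 'b \<Rightarrow>\<^sub>L real) \<Rightarrow> bool" where
  "schauder_basis e e' \<longleftrightarrow>
    (\<forall>x. \<exists>!a. (\<lambda>i. a i *\<^sub>R e i) sums x) \<and> (\<forall>x. (\<lambda>i. e' i x *\<^sub>R e i) sums x)"

definition basis_proj ::
    "(nat \<Rightarrow> 'b::real_normed_vector) \<Rightarrow> (nat \<Rightarrow> 'b \<Rightarrow>\<^sub>L real) \<Rightarrow> nat \<Rightarrow> 'b \<Rightarrow> 'b" where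
  "basis_proj e e' k x = (\<Sum>i<k. e' i x *\<^sub>R e i)"

definition basis_tail ::
    "(nat \<Rightarrow> 'b::real_normed_vector) \<Rightarrow> (nat \<Rightarrow> 'b \<Rightarrow>\<^sub>L real) \<Rightarrow> nat \<Rightarrow> 'b \<Rightarrow> 'b" where
  "basis_tail e e' k x = x - basis_proj e e' k x"

definition tail_class ::
    "(nat \<Rightarrow> 'b::real_normed_vector) \<Rightarrow> (nat \<Rightarrow> 'b \<Rightarrow>\<^sub>L real) \<Rightarrow> nat \<Rightarrow> ('b \<times> real \<Rightarrow> real) set" where
  "tail_class e e' k =
    {\<lambda>(x, u). blinfun_apply b' (basis_tail e e' k x) * indicator {..t} u | b' t.
      norm b' \<le> 1 \<and> t \<in> {0..1}}"

definition norm2n ::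
    "'w measure \<Rightarrow> (nat \<Rightarrow> nat \<Rightarrow> 'w \<Rightarrow> 'b) \<Rightarrow> nat \<Rightarrow> ('b \<times> real \<Rightarrow> real) \<Rightarrow> real" where
  "norm2n P X n f = sqrt (1 / real n * (\<Sum>i=1..n. \<integral>\<omega>. \<bar>f (X i n \<omega>, real i / real n)\<bar>\<^sup>2 \<partial>P))"

definition dep_norm ::
    "'w measure \<Rightarrow> (nat \<Rightarrow> nat \<Rightarrow> 'w \<Rightarrow> 'b) \<Rightarrow> (nat \<Rightarrow> real) \<Rightarrow> real \<Rightarrow> nat \<Rightarrow> ('b \<times> real \<Rightarrow> real) \<Rightarrow> real"
  where
  "dep_norm P X d D n f = norm2n P X n f + (\<Sum>i. min (norm2n P X n f) (D * d (Suc i)))"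

text \<open>
  Functions on \<open>B \<times> [0,1]\<close> are represented by functions on \<open>B \<times> \<real>\<close> that are only compared on
  \<open>B \<times> [0,1]\<close>. Brackets are required to be measurable with square integrable width: otherwise
  \<open>dep_norm\<close>, in which non-integrable functions have integral \<open>0\<close>, would not measure their size.
\<close>

definition bracket :: "('b \<times> real \<Rightarrow> real) \<Rightarrow> ('b \<times> real \<Rightarrow> real) \<Rightarrow> ('b \<times> real \<Rightarrow> real) set" where
  "bracket l u = {f. \<forall>x. \<forall>t\<in>{0..1}. l (x, t) \<le> f (x, t) \<and> f (x, t) \<le> u (x, t)}"

definition is_bracket ::
    "'w measure \<Rightarrow> (nat \<Rightarrow> nat \<Rightarrow> 'w \<Rightarrow> 'b::topological_space) \<Rightarrow> (nat \<Rightarrow> real) \<Rightarrow> real \<Rightarrow> nat \<Rightarrow> real \<Rightarrow>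
      ('b \<times> real \<Rightarrow> real) \<Rightarrow> ('b \<times> real \<Rightarrow> real) \<Rightarrow> bool" where
  "is_bracket P X d D n \<epsilon> l u \<longleftrightarrow>
    l \<in> borel_measurable borel \<and> u \<in> borel_measurable borel \<and>
    (\<forall>i\<in>{1..n}. integrable P
      (\<lambda>\<omega>. (u (X i n \<omega>, real i / real n) - l (X i n \<omega>, real i / real n))\<^sup>2)) \<and>
    dep_norm P X d D n (\<lambda>z. u z - l z) \<le> \<epsilon>"

definition bracketing_number ::
    "'w measure \<Rightarrow> (nat \<Rightarrow> nat \<Rightarrow> 'w \<Rightarrow> 'b::topological_space) \<Rightarrow> (nat \<Rightarrow> real) \<Rightarrow> real \<Rightarrow> nat \<Rightarrow>
      ('b \<times> real \<Rightarrow> real) set \<Rightarrow> real \<Rightarrow> enat" where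
  "bracketing_number P X d D n F \<epsilon> =
    Inf {enat (card S) | S. finite S \<and> (\<forall>(l, u)\<in>S. is_bracket P X d D n \<epsilon> l u) \<and>
      F \<subseteq> (\<Union>(l, u)\<in>S. bracket l u)}"

text \<open>
  \<open>sqrt (1 \<or> log N)\<close> and the truncation level \<open>m\<close>, with \<open>log \<infinity> = \<infinity>\<close>; \<open>q\<close> ranges over the
  positive integers.
\<close>

definition sqrt_entropy :: "enat \<Rightarrow> ennreal" where
  "sqrt_entropy N = (case N of enat m \<Rightarrow> ennreal (sqrt (max 1 (ln (real m)))) | \<infinity> \<Rightarrow> \<infinity>)"

definition q_star :: "(nat \<Rightarrow> real) \<Rightarrow> real \<Rightarrow> nat" where
  "q_star d x = (LEAST q. 1 \<le> q \<and> tail_sum d q \<le> real q * x)"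

definition r_max :: "(nat \<Rightarrow> real) \<Rightarrow> real \<Rightarrow> real" where
  "r_max d a = (GREATEST r. 0 < r \<and> real (q_star d r) * r \<le> a)"

definition trunc_level :: "(nat \<Rightarrow> real) \<Rightarrow> real \<Rightarrow> nat \<Rightarrow> real \<Rightarrow> enat \<Rightarrow> real" where
  "trunc_level d D n a N =
    (case N of enat m \<Rightarrow> r_max d (a / D) * D * sqrt (real n) / sqrt (max 1 (ln (real m))) | \<infinity> \<Rightarrow> 0)"

definition tail_entropy ::
    "'w measure \<Rightarrow> (nat \<Rightarrow> nat \<Rightarrow> 'w \<Rightarrow> 'b::real_normed_vector) \<Rightarrow> (nat \<Rightarrow> 'b) \<Rightarrow> (nat \<Rightarrow> 'b \<Rightarrow>\<^sub>L real) \<Rightarrow>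
      (nat \<Rightarrow> real) \<Rightarrow> bool" where
  "tail_entropy P X e e' d \<longleftrightarrow>
    (\<exists>D>0. (\<forall>k\<ge>1. \<forall>n\<ge>1. \<forall>f\<in>tail_class e e' k. norm2n P X n f \<le> D) \<and>
      (\<exists>\<sigma> :: nat \<Rightarrow> real.
        (\<forall>k\<ge>1. 0 < \<sigma> k \<and> (\<forall>n\<ge>1. \<forall>f\<in>tail_class e e' k. dep_norm P X d D n f \<le> \<sigma> k)) \<and>
        (let N = (\<lambda>n k. bracketing_number P X d D n (tail_class e e' k));
             I = (\<lambda>k. limsup (\<lambda>n. \<integral>\<^sup>+\<epsilon>\<in>{0<..<\<sigma> k}. sqrt_entropy (N n k \<epsilon>) \<partial>lborel))
         in (\<forall>k\<ge>1. I k < \<infinity>) \<and> I \<longlonglongrightarrow> 0 \<and>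
            (\<exists>c. c \<longlonglongrightarrow> 0 \<and>
              (\<forall>k\<ge>1. \<forall>n\<ge>1. 1 / sqrt (real n) *
                (\<Sum>i=1..n. \<integral>\<omega>. norm (basis_tail e e' k (X i n \<omega>)) *
                  indicator {\<omega>. norm (basis_tail e e' k (X i n \<omega>)) >
                    1/4 * trunc_level d D n (\<sigma> k) (N n k (\<sigma> k / 2))} \<omega> \<partial>P) \<le> c k)))))"

definition block_length :: "(nat \<Rightarrow> real) \<Rightarrow> real \<Rightarrow> bool" where
  "block_length \<Theta> \<kappa> \<longleftrightarrow>
    (\<exists>l s :: nat \<Rightarrow> nat. filterlim l at_top sequentially \<and> filterlim s at_top sequentially \<and>
      (\<lambda>n. real (s n)) \<in> o(\<lambda>n. real (l n)) \<and>
      (\<lambda>n. sqrt (real n) * \<Theta> (s n)) \<longlonglongrightarrow> 0 \<and>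
      (\<lambda>n. real (l n) powr (2 + 2 / \<kappa>)) \<in> o(\<lambda>n. real n))"

text \<open>The statistic, as a function of the realized values \<open>y i\<close> of \<open>b (X i n)\<close>, \<open>1 \<le> i \<le> n\<close>.\<close>

definition T_stat :: "(nat \<Rightarrow> real) \<Rightarrow> nat \<Rightarrow> real \<Rightarrow> real" where
  "T_stat y n t = 1 / real n * (\<Sum>i=1..nat \<lfloor>real n * t\<rfloor>. y i)"

definition D_stat :: "(nat \<Rightarrow> real) \<Rightarrow> nat \<Rightarrow> real \<Rightarrow> real" where
  "D_stat y n t = sqrt (real n) * (T_stat y n t - of_int \<lfloor>real n * t\<rfloor> / real n * T_stat y n 1)"

definition V_stat_sq :: "(nat \<Rightarrow> real) \<Rightarrow> nat \<Rightarrow> real \<Rightarrow> real" where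
  "V_stat_sq y n t = (let k = nat \<lfloor>real n * t\<rfloor> in
    (\<Sum>i=1..k. (T_stat y n (real i / real n) - real i / real k * T_stat y n t)\<^sup>2) +
    (\<Sum>i=k+1..n. (T_stat y n 1 - T_stat y n (real i / real n)
      - (real n - real i) / (real n - real k) * (T_stat y n 1 - T_stat y n t))\<^sup>2))"

text \<open>
  A ratio with \<open>V_stat_sq y n (k / n) = 0\<close> counts as \<open>0\<close> here; the probability that this happens
  for some \<open>k\<close> vanishes asymptotically whenever the long-run variance is positive.
\<close>

definition test_stat :: "(nat \<Rightarrow> real) \<Rightarrow> nat \<Rightarrow> real" where
  "test_stat y n =
    Max ((\<lambda>k. \<bar>D_stat y n (real k / real n)\<bar> / sqrt (V_stat_sq y n (real k / real n))) ` {1..n-1})"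

definition brownian_motion :: "'v measure \<Rightarrow> (real \<Rightarrow> 'v \<Rightarrow> real) \<Rightarrow> bool" where
  "brownian_motion Q W \<longleftrightarrow>
    prob_space Q \<and>
    (\<forall>t\<ge>0. W t \<in> borel_measurable Q) \<and>
    (\<forall>\<omega>\<in>space Q. W 0 \<omega> = 0 \<and> continuous_on {0..} (\<lambda>t. W t \<omega>)) \<and>
    (\<forall>s t. 0 \<le> s \<and> s < t \<longrightarrow>
      distributed Q lborel (\<lambda>\<omega>. W t \<omega> - W s \<omega>) (normal_density 0 (sqrt (t - s)))) \<and>
    (\<forall>(\<tau> :: nat \<Rightarrow> real) m. 0 \<le> \<tau> 0 \<and> strict_mono \<tau> \<longrightarrow>
      prob_space.indep_vars Q (\<lambda>_. borel) (\<lambda>i \<omega>. W (\<tau> (Suc i)) \<omega> - W (\<tau> i) \<omega>) {..<m})"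

definition limit_functional :: "(real \<Rightarrow> real) \<Rightarrow> real" where
  "limit_functional w =
    (SUP t\<in>{0..1}. \<bar>w t - t * w 1\<bar> / sqrt
      (integral {0..t} (\<lambda>x. (w x - x / t * w t)\<^sup>2) +
       integral {t..1} (\<lambda>x. (w 1 - w x - (1 - x) / (1 - t) * (w 1 - w t))\<^sup>2)))"

definition quantile :: "real measure \<Rightarrow> real \<Rightarrow> real" where
  "quantile M p = Inf {x. p \<le> cdf M x}"

definition critical_value :: "'v measure \<Rightarrow> (real \<Rightarrow> 'v \<Rightarrow> real) \<Rightarrow> real \<Rightarrow> real" where
  "critical_value Q W \<alpha> =
    quantile (distr Q borel (\<lambda>\<omega>. limit_functional (\<lambda>t. W t \<omega>))) (1 - \<alpha>)"

text \<open>
  The hypotheses, in terms of the means \<open>m i n\<close> of the \<open>(i, n)\<close> entries, are imposed for every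
  sample size \<open>n\<close>; the alternative only when \<open>\<lfloor>\<theta> n\<rfloor> \<ge> 1\<close>, as otherwise there is nothing before
  the change point.
\<close>

definition H0 :: "(nat \<Rightarrow> nat \<Rightarrow> real) \<Rightarrow> bool" where
  "H0 m \<longleftrightarrow> (\<forall>n. \<forall>i\<in>{1..n}. \<forall>j\<in>{1..n}. m i n = m j n)"

definition H1 :: "real \<Rightarrow> (nat \<Rightarrow> nat \<Rightarrow> real) \<Rightarrow> bool" where
  "H1 \<theta> m \<longleftrightarrow> (\<forall>n. let k = nat \<lfloor>\<theta> * real n\<rfloor> in 1 \<le> k \<longrightarrow>
    (\<forall>i\<in>{1..k}. \<forall>j\<in>{1..k}. m i n = m j n) \<and>
    (\<forall>i\<in>{k+1..n}. \<forall>j\<in>{k+1..n}. m i n = m j n) \<and>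
    m k n \<noteq> m (k + 1) n)"

end

theory Submission
 imports Defs "HOL-Real_Asymp.Real_Asymp"
begin

text \<open>
The statistic only sees the scalars \<open>y\<^sub>i = b (X\<^sub>i)\<close>. With \<open>D\<close> and \<open>V\<close> evaluated on the polygonal path of
the partial sums, \<open>T\<^sub>n > q\<close> says that \<open>D^2 - q^2 V^2\<close> is positive somewhere; unlike the ratio, this
expression is continuous in the path, also where \<open>V = 0\<close>.

Under the null hypothesis, conditional expectations given the last \<open>m\<close> innovations split the errors
into martingale differences whose size is controlled by the physical dependence measure, and Doob's
inequality bounds the maxima of partial sums in \<open>L\<^sup>2\<close> and, for bounded errors, in \<open>L\<^sup>4\<close>. Hence
the errors may be replaced by bounded functions of the last \<open>L\<close> innovations, summed over blocks that
are separated by gaps of length \<open>L\<close>. Block sums are independent, and a Taylor expansion of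
characteristic functions gives normal increments in the limit; the maximal inequalities supply
tightness. The maximum of \<open>D^2 - q^2 V^2\<close> over a Brownian path has no atom at \<open>0\<close>: along the line
\<open>W + x min(\<cdot>, s)\<close> its zeros are essentially separated, and by the Cameron--Martin formula these
shifts preserve null sets.

Under the alternative, \<open>D\<close> at the change point is shifted by a multiple of \<open>\<surd>n\<close>, whereas \<open>V\<close> there does
not feel the change, since it is centred separately on both sides.
\<close>

section \<open>Averaging out old innovations\<close>

text \<open>Only the sign of the maximum of D^2 - q^2 V^2 matters, and this expression is
  homogeneous of degree 2 in the path; so the long-run variance need not be estimated, and the limit
  may be standard Brownian motion. Every approximation is one-sided: small errors turn the event
  {max > 0} into {max >= -small} and in the limit into {max >= 0}, whereas the critical value
  controls {max > 0}. Hence an atom at 0 must be excluded.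

  The martingale structure is found lag by lag: for fixed l, what the innovations l steps back
  contribute is orthogonal when time runs backwards, and summing over l costs the sum of the
  dependence coefficients. With moments of order 2 + \<kappa> only, the errors are clipped at L; the
  clipping error has coefficients bounded both by the summable \<open>\<delta>\<close> and by a
  small \<open>eps L\<close>, so their sum tends to 0. Tightness keeps L fixed, because the fourth
  moment bounds grow with L; the central limit theorem takes L = n^(1/8), which makes block sums
  small against \<open>sqrt n\<close> and the gaps a vanishing share.\<close>

lemmas lint_mono = Bochner_Integration.integral_mono
lemmas lint_cong = Bochner_Integration.integral_cong
lemmas lint_nonneg = Bochner_Integration.integral_nonneg
lemmas integrable_bd = Bochner_Integration.integrable_bound

lemma distr_PiM_UNIV_upd:
 assumes "prob_space \<mu>"
 shows "distr (\<mu> \<Otimes>\<^sub>M PiM UNIV (\<lambda>_. \<mu>)) (PiM UNIV (\<lambda>_. \<mu>)) (\<lambda>(y, z). z(c := y)) = PiM UNIV (\<lambda>_. \<mu>)"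
 using distr_pair_PiM_eq_PiM[of UNIV "\<lambda>_. \<mu>" c] assms by simp

definition lag :: "int => (int => 'e) => nat => 'e" where
 "lag i z k = z (i - int k)"

lemma past_eq_lag: "past d i w = lag i (\<lambda>i. d i w)"
 by (auto simp: past_def lag_def)

lemma lag_upd: "lag i (z(i - int l := y)) = (lag i z)(l := y)"
 by (auto simp: lag_def fun_eq_iff)

text \<open>The canonical model: \<open>\<nu>\<close> is the law of one past, with coordinate k the
  innovation k steps back, and \<open>\<pi>\<close> the law of two-sided noise. A function on
  \<open>\<nu>\<close> read through \<open>lag i\<close> is a stationary process on
  \<open>\<pi>\<close>.\<close>

locale innovations = prob_space \<mu> for \<mu> :: "'e measure"
begin

abbreviation past_law :: "(nat => 'e) measure" ("\<nu>") where "\<nu> \<equiv> PiM UNIV (\<lambda>_. \<mu>)"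
abbreviation noise_law :: "(int => 'e) measure" ("\<pi>") where "\<pi> \<equiv> PiM UNIV (\<lambda>_. \<mu>)"

sublocale nu: sequence_space \<mu>
 by (simp add: sequence_space_def product_prob_space_def product_prob_space_axioms_def
   product_sigma_finite_def prob_space_axioms prob_space_imp_sigma_finite)

sublocale pi: prob_space \<pi>
 by (intro prob_space_PiM prob_space_axioms)

lemma measurable_lag [measurable]: "lag i \<in> measurable \<pi> \<nu>"
 unfolding lag_def by (rule measurable_PiM_single') (auto simp: space_PiM)

lemma distr_lag: "distr \<pi> \<nu> (lag i) = \<nu>"
proof -
 have "inj_on (\<lambda>k::nat. i - int k) UNIV" by (auto simp: inj_on_def)
 from distr_PiM_reindex[of UNIV "\<lambda>_. \<mu>", OF prob_space_axioms this]
 show ?thesis by (simp add: lag_def[abs_def] restrict_UNIV)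
qed

lemma integral_lag:
 fixes f :: "(nat => 'e) => real"
 assumes "f \<in> borel_measurable \<nu>"
 shows "(\<integral>z. f (lag i z) \<partial>\<pi>) = (\<integral>x. f x \<partial>\<nu>)"
 by (subst distr_lag[of i, symmetric], subst integral_distr) (use assms in auto)

lemma integrable_lag:
 fixes f :: "(nat => 'e) => real"
 assumes "f \<in> borel_measurable \<nu>"
 shows "integrable \<pi> (\<lambda>z. f (lag i z)) \<longleftrightarrow> integrable \<nu> f"
 by (subst distr_lag[of i, symmetric], subst integrable_distr_eq) (use assms in auto)

lemma measurable_upd [measurable]:
 "(\<lambda>(y, z). z(c := y)) \<in> measurable (\<mu> \<Otimes>\<^sub>M PiM UNIV (\<lambda>_. \<mu>)) (PiM UNIV (\<lambda>_. \<mu>))"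
proof (rule measurable_PiM_single')
 show "(\<lambda>w. (case w of (y, z) => z(c := y)) i) \<in> \<mu> \<Otimes>\<^sub>M PiM UNIV (\<lambda>_. \<mu>) \<rightarrow>\<^sub>M \<mu>" for i
  by (cases "i = c") (auto simp: split_beta')
qed (auto simp: space_PiM space_pair_measure split: if_splits)

lemma measurable_upd' [measurable (raw)]:
 assumes f: "f \<in> measurable N \<mu>" and g: "g \<in> measurable N (PiM UNIV (\<lambda>_. \<mu>))"
 shows "(\<lambda>x. (g x)(c := f x)) \<in> measurable N (PiM UNIV (\<lambda>_. \<mu>))"
 using measurable_compose[OF measurable_Pair[OF f g] measurable_upd] by simp

text \<open>Overwriting coordinate c by an independent draw preserves the product law, so Fubini
  allows averaging over that coordinate alone.\<close>

lemma integral_resample: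
 fixes F :: "('i => 'e) => real"
 assumes [measurable]: "F \<in> borel_measurable (PiM UNIV (\<lambda>_. \<mu>))" and int: "integrable (PiM UNIV (\<lambda>_. \<mu>)) F"
 shows "(\<integral>z. F z \<partial>PiM UNIV (\<lambda>_. \<mu>)) = (\<integral>z. \<integral>y. F (z(c := y)) \<partial>\<mu> \<partial>PiM UNIV (\<lambda>_. \<mu>))"
proof -
 interpret pair: pair_prob_space \<mu> "PiM (UNIV :: 'i set) (\<lambda>_. \<mu>)"
  by (intro pair_prob_space.intro pair_sigma_finite.intro prob_space_imp_sigma_finite prob_space_PiM prob_space_axioms)
 let ?P = "PiM (UNIV :: 'i set) (\<lambda>_. \<mu>)"
 have "(\<integral>z. F z \<partial>?P) = (\<integral>p. F (case p of (y, z) => z(c := y)) \<partial>(\<mu> \<Otimes>\<^sub>M ?P))"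
  by (subst distr_PiM_UNIV_upd[OF prob_space_axioms, of c, symmetric], subst integral_distr) auto
 moreover have "integrable (\<mu> \<Otimes>\<^sub>M ?P) (\<lambda>p. F (case p of (y, z) => z(c := y)))"
  using int by (subst (asm) distr_PiM_UNIV_upd[OF prob_space_axioms, of c, symmetric],
    subst (asm) integrable_distr_eq) auto
 ultimately show ?thesis
  using pair.integral_snd[of "\<lambda>y z. F (z(c := y))"] by (simp add: split_beta')
qed

text \<open>The orthogonality behind all martingale arguments below: u does not see coordinate c,
  and G averages to 0 over it.\<close>

lemma integral_resample_eq_0:
 fixes G :: "('i => 'e) => real"
 assumes int: "integrable (PiM UNIV (\<lambda>_. \<mu>)) (\<lambda>z. u z * G z)" and u: "!!z y. u (z(c := y)) = u z"
  and G: "!!z. z \<in> space (PiM UNIV (\<lambda>_. \<mu>)) ==> (\<integral>y. G (z(c := y)) \<partial>\<mu>) = 0"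
 shows "(\<integral>z. u z * G z \<partial>PiM UNIV (\<lambda>_. \<mu>)) = 0"
proof -
 have "(\<integral>z. u z * G z \<partial>PiM UNIV (\<lambda>_. \<mu>)) = (\<integral>z. \<integral>y. u (z(c := y)) * G (z(c := y)) \<partial>\<mu> \<partial>PiM UNIV (\<lambda>_. \<mu>))"
  using int by (intro integral_resample) auto
 also have "\<dots> = (\<integral>z. 0 \<partial>PiM UNIV (\<lambda>_::'i. \<mu>))"
  by (intro lint_cong refl) (simp add: u G)
 finally show ?thesis by simp
qed

text \<open>\<open>proj f m\<close> is the conditional expectation of \<open>f\<close> given the \<open>m\<close> most recent innovations.\<close>

definition proj :: "((nat => 'e) => real) => nat => (nat => 'e) => real" where
 "proj f m x = (\<integral>y. f (comb_seq m x y) \<partial>\<nu>)"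

lemma measurable_proj [measurable]:
 assumes [measurable]: "f \<in> borel_measurable \<nu>"
 shows "proj f m \<in> borel_measurable \<nu>"
 unfolding proj_def by measurable

text \<open>A function that is not integrable has integral 0, and K is nonnegative; so the bound
  holds without any measurability.\<close>

lemma integral_abs_bound:
 assumes "prob_space M" "!!x. \<bar>f x\<bar> <= (K::real)"
 shows "\<bar>\<integral>x. f x \<partial>M\<bar> <= K"
proof -
 interpret M: prob_space M by fact
 have "\<bar>\<integral>x. f x \<partial>M\<bar> <= (\<integral>x. \<bar>f x\<bar> \<partial>M)" by (rule integral_abs_bound)
 also have "\<dots> <= K"
  using order_trans[OF abs_ge_zero assms(2)]
  by (cases "integrable M (\<lambda>x. \<bar>f x\<bar>)")
    (auto intro!: M.integral_le_const simp: assms(2) not_integrable_integral_eq simp del: integrable_abs_iff)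
 finally show ?thesis .
qed

lemma proj_bound: "(!!x. \<bar>f x\<bar> <= K) ==> \<bar>proj f m x\<bar> <= K"
 unfolding proj_def by (rule integral_abs_bound) (auto intro!: prob_space_PiM prob_space_axioms)

lemma proj_diff_bound: "(!!x. \<bar>f x\<bar> <= K) ==> \<bar>proj f m x - f x\<bar> <= 2 * K"
proof -
 assume f: "!!x. \<bar>f x\<bar> <= K"
 show ?thesis using proj_bound[of f K m x, OF f] f[of x] by linarith
qed

lemma proj_cong: "(!!k. k < m ==> x k = x' k) ==> proj f m x = proj f m x'"
proof -
 assume "!!k. k < m ==> x k = x' k"
 then have "comb_seq m x = comb_seq m x'" by (auto simp: comb_seq_def fun_eq_iff)
 then show ?thesis by (simp add: proj_def)
qed

lemma proj_0: "proj f 0 x = (\<integral>y. f y \<partial>\<nu>)"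
 by (simp add: proj_def comb_seq_0)

text \<open>\<open>comb_seq l x z\<close> follows x up to l and z from there on; the fresh
  coordinate l may be counted to either part.\<close>

lemma comb_seq_case_nat: "comb_seq (Suc l) (x(l := y)) z = comb_seq l x (case_nat y z)"
proof
 fix k
 consider "k < l" | "k = l" | j where "k = Suc (l + j)"
  by (metis add_Suc less_imp_Suc_add linorder_neqE_nat)
 then show "comb_seq (Suc l) (x(l := y)) z k = comb_seq l x (case_nat y z) k"
  by cases (auto simp: comb_seq_def)
qed

lemma proj_upd: "m <= l ==> proj f m (x(l := y)) = proj f m x"
 by (rule proj_cong) auto

text \<open>One step of the tower property: \<open>PiM_iter\<close> splits the average over the tail
  from l on into coordinate l and the rest.\<close>

lemma proj_average:
 assumes [measurable]: "f \<in> borel_measurable \<nu>" and f: "!!x. \<bar>f x\<bar> <= K" and x: "x \<in> space \<nu>"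
 shows "(\<integral>y. proj f (Suc l) (x(l := y)) \<partial>\<mu>) = proj f l x"
proof -
 interpret pair: pair_prob_space \<mu> \<nu> ..
 note x [measurable]
 have "(\<integral>y. proj f (Suc l) (x(l := y)) \<partial>\<mu>) = (\<integral>y. \<integral>z. f (comb_seq l x (case_nat y z)) \<partial>\<nu> \<partial>\<mu>)"
  by (simp add: proj_def comb_seq_case_nat)
 also have "\<dots> = (\<integral>(y, z). f (comb_seq l x (case_nat y z)) \<partial>(\<mu> \<Otimes>\<^sub>M \<nu>))"
  by (rule pair.integral_fst, rule pair.integrable_const_bound[of _ K])
    (auto simp: f split_beta')
 also have "\<dots> = proj f l x"
  unfolding proj_def by (subst nu.PiM_iter[symmetric], subst integral_distr) (auto simp: split_beta')
 finally show ?thesis .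
qed

definition cinc :: "((nat => 'e) => real) => nat => (nat => 'e) => real" where
 "cinc f l x = proj f (Suc l) x - proj f l x"

text \<open>For a single function, the square of the order 2 physical dependence measure at lag l:
  coordinate l, the innovation l steps back, is replaced by an independent copy.\<close>

definition dep :: "((nat => 'e) => real) => nat => real" where
 "dep f l = (\<integral>(y, x). (f x - f (x(l := y)))^2 \<partial>(\<mu> \<Otimes>\<^sub>M \<nu>))"

lemma measurable_cinc [measurable]:
 assumes [measurable]: "f \<in> borel_measurable \<nu>"
 shows "cinc f l \<in> borel_measurable \<nu>"
 unfolding cinc_def by measurable

lemma cinc_bound: "(!!x. \<bar>f x\<bar> <= K) ==> \<bar>cinc f l x\<bar> <= 2 * K"
 using proj_bound[of f K l x] proj_bound[of f K "Suc l" x] by (simp add: cinc_def)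

lemma cinc_average:
 assumes [measurable]: "f \<in> borel_measurable \<nu>" and f: "!!x. \<bar>f x\<bar> <= K" and x: "x \<in> space \<nu>"
 shows "(\<integral>y. cinc f l (x(l := y)) \<partial>\<mu>) = 0"
proof -
 note x [measurable]
 have "integrable \<mu> (\<lambda>y. proj f (Suc l) (x(l := y)))"
  by (rule integrable_const_bound[of _ K]) (auto simp: proj_bound f)
 then show ?thesis
  using proj_average[of f K x l] by (simp add: cinc_def proj_upd f x prob_space)
qed

lemma cinc_cong: "(!!k. k <= l ==> x k = x' k) ==> cinc f l x = cinc f l x'"
 unfolding cinc_def by (intro arg_cong2[where f = "(-)"] proj_cong) auto

lemma sum_cinc: "(\<Sum>l<R. cinc f l x) = proj f R x - (\<integral>y. f y \<partial>\<nu>)"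
 by (induction R) (auto simp: cinc_def proj_0)

text \<open>\<open>PiM_comb_seq\<close> resamples all coordinates from m on without changing the
  law; u is constant under this, so the average over the fresh tail falls on f alone.\<close>

lemma integral_mult_proj:
 assumes [measurable]: "f \<in> borel_measurable \<nu>" "u \<in> borel_measurable \<nu>" and f: "!!x. \<bar>f x\<bar> <= K" and u: "!!x. \<bar>u x\<bar> <= C"
  and um: "!!x y. u (comb_seq m x y) = u x"
 shows "(\<integral>x. u x * f x \<partial>\<nu>) = (\<integral>x. u x * proj f m x \<partial>\<nu>)"
proof -
 interpret pair2: pair_prob_space \<nu> \<nu> ..
 have b: "\<bar>u x * f y\<bar> <= C * K" for x y
  unfolding abs_mult by (intro mult_mono u f order_trans[OF abs_ge_zero u]) auto
 have "(\<integral>x. u x * f x \<partial>\<nu>) = (\<integral>(x, y). u x * f (comb_seq m x y) \<partial>(\<nu> \<Otimes>\<^sub>M \<nu>))"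
  by (subst nu.PiM_comb_seq[of m, symmetric], subst integral_distr) (auto simp: split_beta' um)
 also have "\<dots> = (\<integral>x. \<integral>y. u x * f (comb_seq m x y) \<partial>\<nu> \<partial>\<nu>)"
  by (rule pair2.integral_fst[symmetric], rule pair2.integrable_const_bound[of _ "C * K"]) (use b in \<open>auto simp: split_beta'\<close>)
 finally show ?thesis by (simp add: proj_def)
qed

lemma integral_proj:
 assumes "f \<in> borel_measurable \<nu>" "!!x. \<bar>f x\<bar> <= K"
 shows "(\<integral>x. proj f m x \<partial>\<nu>) = (\<integral>x. f x \<partial>\<nu>)"
 using integral_mult_proj[of f "\<lambda>_. 1" K 1] assms by simp

text \<open>The increment c is orthogonal to every bounded function that ignores coordinate l, in
  particular to f with that coordinate resampled. So d = f - f(x(l := y)) satisfies E[c d] = E[c f]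
  = E[c^2], and 2 c d <= c^2 + d^2 gives the bound.\<close>

lemma cinc_sq_le_dep:
 assumes [measurable]: "f \<in> borel_measurable \<nu>" and f: "!!x. \<bar>f x\<bar> <= K"
 shows "(\<integral>x. (cinc f l x)^2 \<partial>\<nu>) <= dep f l"
proof -
 interpret pair: pair_prob_space \<mu> \<nu> ..
 let ?c = "cinc f l" and ?d = "\<lambda>y x. f x - f (x(l := y))"
 have c: "\<bar>?c x\<bar> <= 2 * K" for x by (rule cinc_bound[OF f])
 have d: "\<bar>?d y x\<bar> <= 2 * K" for x y using f[of x] f[of "x(l := y)"] by linarith
 have b: "\<bar>a * a'\<bar> <= 2 * K * (2 * K)" if "\<bar>a\<bar> <= 2 * K" "\<bar>a'\<bar> <= 2 * K" for a a'
  unfolding abs_mult using that by (intro mult_mono) auto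
 have int: "integrable \<nu> (\<lambda>x. ?c x * v x)" if [measurable]: "v \<in> borel_measurable \<nu>" and v: "!!x. \<bar>v x\<bar> <= 2 * K" for v
  by (rule nu.integrable_const_bound[of _ "2 * K * (2 * K)"]) (use b[OF c v] in auto)
 have f2: "\<bar>f x\<bar> <= 2 * K" "\<bar>proj f m x\<bar> <= 2 * K" for m x
  using f[of x] proj_bound[of f K m x, OF f] by linarith+
 have zero: "(\<integral>x. ?c x * v x \<partial>\<nu>) = 0"
  if [measurable]: "v \<in> borel_measurable \<nu>" and v: "!!x. \<bar>v x\<bar> <= 2 * K" "!!x y. v (x(l := y)) = v x" for v
  using integral_resample_eq_0[where u = v and G = "?c" and c = l] int[OF _ v(1)] v(2) cinc_average[OF _ f]
  by (simp add: mult.commute)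
 have ic: "(\<integral>x. ?c x * f x \<partial>\<nu>) = (\<integral>x. (?c x)^2 \<partial>\<nu>)"
 proof -
  have "(\<integral>x. ?c x * f x \<partial>\<nu>) = (\<integral>x. ?c x * proj f (Suc l) x \<partial>\<nu>)"
   by (rule integral_mult_proj[OF _ _ f c]) (auto intro!: cinc_cong simp: comb_seq_def)
  also have "\<dots> = (\<integral>x. ?c x * proj f (Suc l) x \<partial>\<nu>) - (\<integral>x. ?c x * proj f l x \<partial>\<nu>)"
   using zero[of "proj f l"] f2 by (simp add: proj_upd)
  also have "\<dots> = (\<integral>x. ?c x * proj f (Suc l) x - ?c x * proj f l x \<partial>\<nu>)"
   by (rule Bochner_Integration.integral_diff[symmetric]) (auto intro!: int f2)
  finally show ?thesis by (simp add: cinc_def power2_eq_square right_diff_distrib)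
 qed
 have fub: "integrable (\<mu> \<Otimes>\<^sub>M \<nu>) (\<lambda>(y, x). g y x)" "(\<integral>(y, x). g y x \<partial>(\<mu> \<Otimes>\<^sub>M \<nu>)) = (\<integral>y. \<integral>x. g y x \<partial>\<nu> \<partial>\<mu>)"
  if [measurable]: "(\<lambda>p. g (fst p) (snd p)) \<in> borel_measurable (\<mu> \<Otimes>\<^sub>M \<nu>)" and g: "!!y x. \<bar>g y x\<bar> <= 2 * K * (2 * K)" for g :: "'e => (nat => 'e) => real"
 proof -
  show i: "integrable (\<mu> \<Otimes>\<^sub>M \<nu>) (\<lambda>(y, x). g y x)"
   by (rule pair.integrable_const_bound[of _ "2 * K * (2 * K)"]) (use g in \<open>auto simp: split_beta'\<close>)
  show "(\<integral>(y, x). g y x \<partial>(\<mu> \<Otimes>\<^sub>M \<nu>)) = (\<integral>y. \<integral>x. g y x \<partial>\<nu> \<partial>\<mu>)" by (rule pair.integral_fst[symmetric, OF i])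
 qed
 have cd: "(\<integral>(y, x). ?c x * ?d y x \<partial>(\<mu> \<Otimes>\<^sub>M \<nu>)) = (\<integral>x. (?c x)^2 \<partial>\<nu>)"
 proof -
  have "(\<integral>x. ?c x * ?d y x \<partial>\<nu>) = (\<integral>x. (?c x)^2 \<partial>\<nu>)" if [measurable]: "y \<in> space \<mu>" for y
  proof -
   have [measurable]: "(\<lambda>x. f (x(l := y))) \<in> borel_measurable \<nu>" by measurable
   have "(\<integral>x. ?c x * ?d y x \<partial>\<nu>) = (\<integral>x. ?c x * f x \<partial>\<nu>) - (\<integral>x. ?c x * f (x(l := y)) \<partial>\<nu>)"
    unfolding right_diff_distrib by (rule Bochner_Integration.integral_diff) (auto intro!: int f2)
   then show ?thesis using zero[of "\<lambda>x. f (x(l := y))"] f2(1) by (simp add: ic)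
  qed
  then show ?thesis
   using fub(2)[of "\<lambda>y x. ?c x * ?d y x"] b[OF c d] by (simp add: prob_space cong: lint_cong)
 qed
 have c2: "(\<integral>(y, x). (?c x)^2 \<partial>(\<mu> \<Otimes>\<^sub>M \<nu>)) = (\<integral>x. (?c x)^2 \<partial>\<nu>)" "integrable (\<mu> \<Otimes>\<^sub>M \<nu>) (\<lambda>(y, x). (?c x)^2)"
  using fub[of "\<lambda>y x. (?c x)^2"] b[OF c c, of x x for x] unfolding power2_eq_square by (simp_all add: prob_space)
 have d2: "integrable (\<mu> \<Otimes>\<^sub>M \<nu>) (\<lambda>(y, x). (?d y x)^2)"
  using fub(1)[of "\<lambda>y x. (?d y x)^2"] b[OF d d, of y x y x for y x] unfolding power2_eq_square by simp
 have "2 * (\<integral>(y, x). ?c x * ?d y x \<partial>(\<mu> \<Otimes>\<^sub>M \<nu>)) = (\<integral>p. 2 * (case p of (y, x) => ?c x * ?d y x) \<partial>(\<mu> \<Otimes>\<^sub>M \<nu>))" by simp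
 also have "\<dots> <= (\<integral>p. (case p of (y, x) => (?c x)\<^sup>2) + (case p of (y, x) => (?d y x)\<^sup>2) \<partial>(\<mu> \<Otimes>\<^sub>M \<nu>))"
 proof (rule lint_mono)
  show "integrable (\<mu> \<Otimes>\<^sub>M \<nu>) (\<lambda>p. 2 * (case p of (y, x) => ?c x * ?d y x))"
   using fub(1)[of "\<lambda>y x. ?c x * ?d y x"] b[OF c d] by simp
  show "2 * (case p of (y, x) => ?c x * ?d y x) <= (case p of (y, x) => (?c x)\<^sup>2) + (case p of (y, x) => (?d y x)\<^sup>2)" for p
   using sum_squares_bound[of "?c (snd p)" "?d (fst p) (snd p)"] by (simp add: split_beta' mult.assoc)
 qed (use c2 d2 in auto)
 also have "\<dots> = (\<integral>x. (?c x)^2 \<partial>\<nu>) + dep f l" using c2 d2 by (simp add: dep_def)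
 finally show ?thesis unfolding cd by simp
qed

section \<open>Convergence of the projections in L1\<close>

definition L1_proj :: "((nat => 'e) => real) => bool" where
 "L1_proj f \<longleftrightarrow> f \<in> borel_measurable \<nu> \<and> (\<exists>K. \<forall>x. \<bar>f x\<bar> <= K) \<and> (\<lambda>m. \<integral>x. \<bar>proj f m x - f x\<bar> \<partial>\<nu>) \<longlonglongrightarrow> 0"

text \<open>Averaging is an L1 contraction: \<open>proj f m\<close> and \<open>proj g m\<close>
  differ by at most \<open>proj\<close> of |f - g|.\<close>

lemma proj_diff_L1:
 assumes [measurable]: "f \<in> borel_measurable \<nu>" "g \<in> borel_measurable \<nu>" and f: "!!x. \<bar>f x\<bar> <= K" and g: "!!x. \<bar>g x\<bar> <= K'"
 shows "(\<integral>x. \<bar>proj f m x - f x\<bar> \<partial>\<nu>) <= (\<integral>x. \<bar>proj g m x - g x\<bar> \<partial>\<nu>) + 2 * (\<integral>x. \<bar>f x - g x\<bar> \<partial>\<nu>)"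
proof -
 let ?h = "\<lambda>x. \<bar>f x - g x\<bar>"
 have h: "\<bar>?h x\<bar> <= K + K'" for x using f[of x] g[of x] by linarith
 note ib = nu.integrable_const_bound[OF AE_I2]
 have int: "integrable \<nu> (\<lambda>x. \<bar>proj f m x - f x\<bar>)" "integrable \<nu> (\<lambda>x. \<bar>proj g m x - g x\<bar>)" "integrable \<nu> ?h" "integrable \<nu> (proj ?h m)"
  using ib[of "\<lambda>x. \<bar>proj f m x - f x\<bar>" "2 * K"] ib[of "\<lambda>x. \<bar>proj g m x - g x\<bar>" "2 * K'"] ib[of ?h "K + K'"] ib[of "proj ?h m" "K + K'"]
   proj_diff_bound[of f, OF f] proj_diff_bound[of g, OF g] h proj_bound[of ?h, OF h] by simp_all
 have "(\<integral>x. \<bar>proj f m x - f x\<bar> \<partial>\<nu>) <= (\<integral>x. \<bar>proj g m x - g x\<bar> + ?h x + proj ?h m x \<partial>\<nu>)"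
 proof (rule lint_mono)
  fix x assume [measurable]: "x \<in> space \<nu>"
  have i: "integrable \<nu> (\<lambda>y. f (comb_seq m x y))" "integrable \<nu> (\<lambda>y. g (comb_seq m x y))"
   by (rule ib[of _ K] ib[of _ K'], use f g in auto)+
  then have "proj f m x - proj g m x = (\<integral>y. f (comb_seq m x y) - g (comb_seq m x y) \<partial>\<nu>)" by (simp add: proj_def)
  then have "\<bar>proj f m x - proj g m x\<bar> <= proj ?h m x" unfolding proj_def by simp
  then show "\<bar>proj f m x - f x\<bar> <= \<bar>proj g m x - g x\<bar> + ?h x + proj ?h m x" by linarith
 qed (use int in auto)
 then show ?thesis using int integral_proj[of ?h "K + K'" m] h by simp
qed

lemma L1_proj_lim:
 assumes f: "f \<in> borel_measurable \<nu>" "!!x. \<bar>f x\<bar> <= K" and g: "!!e. 0 < e ==> \<exists>g. L1_proj g \<and> (\<integral>x. \<bar>f x - g x\<bar> \<partial>\<nu>) <= e"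
 shows "L1_proj f"
 unfolding L1_proj_def
proof (intro conjI f(1) exI[of _ K] allI f(2) LIMSEQ_I)
 fix e :: real assume e: "0 < e"
 then obtain g where g: "L1_proj g" "(\<integral>x. \<bar>f x - g x\<bar> \<partial>\<nu>) <= e / 4" using g[of "e / 4"] by auto
 then obtain K' where K': "g \<in> borel_measurable \<nu>" "!!x. \<bar>g x\<bar> <= K'" unfolding L1_proj_def by blast
 have "(\<lambda>m. \<integral>x. \<bar>proj g m x - g x\<bar> \<partial>\<nu>) \<longlonglongrightarrow> 0" using g(1) by (simp add: L1_proj_def)
 from order_tendstoD(2)[OF this, of "e / 2"] obtain m0 where m0: "!!m. m0 <= m ==> (\<integral>x. \<bar>proj g m x - g x\<bar> \<partial>\<nu>) < e / 2"
  using e by (auto simp: eventually_sequentially)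
 show "\<exists>m0. \<forall>m\<ge>m0. norm ((\<integral>x. \<bar>proj f m x - f x\<bar> \<partial>\<nu>) - 0) < e"
 proof (intro exI[of _ m0] allI impI)
  fix m assume "m0 <= m"
  from m0[OF this] have "(\<integral>x. \<bar>proj f m x - f x\<bar> \<partial>\<nu>) < e"
   using proj_diff_L1[OF f(1) K'(1) f(2) K'(2), of m] g(2) by linarith
  then show "norm ((\<integral>x. \<bar>proj f m x - f x\<bar> \<partial>\<nu>) - 0) < e" by (simp add: lint_nonneg)
 qed
qed

lemma L1_proj_lincomb:
 assumes "L1_proj f" "L1_proj g"
 shows "L1_proj (\<lambda>x. a * f x + b * g x)"
proof -
 have [measurable]: "f \<in> borel_measurable \<nu>" "g \<in> borel_measurable \<nu>" using assms by (auto simp: L1_proj_def)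
 obtain K where K: "!!x. \<bar>f x\<bar> <= K" "!!x. \<bar>g x\<bar> <= K"
  using assms unfolding L1_proj_def by (metis max.coboundedI1 max.coboundedI2)
 have b: "\<bar>a * f x + b * g x\<bar> <= \<bar>a\<bar> * K + \<bar>b\<bar> * K" for x
  by (rule order_trans[OF abs_triangle_ineq]) (auto simp: abs_mult intro!: add_mono mult_left_mono K)
 note ib = nu.integrable_const_bound[OF AE_I2]
 have int: "integrable \<nu> (\<lambda>x. \<bar>proj u m x - u x\<bar>)" if [measurable]: "u \<in> borel_measurable \<nu>" and u: "!!x. \<bar>u x\<bar> <= B" for u m and B :: real
  by (rule ib[of _ "2 * B"]) (use proj_diff_bound[OF u] in auto)
 have le: "(\<integral>x. \<bar>proj (\<lambda>x. a * f x + b * g x) m x - (a * f x + b * g x)\<bar> \<partial>\<nu>) <=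
   \<bar>a\<bar> * (\<integral>x. \<bar>proj f m x - f x\<bar> \<partial>\<nu>) + \<bar>b\<bar> * (\<integral>x. \<bar>proj g m x - g x\<bar> \<partial>\<nu>)" for m
 proof -
  have "(\<integral>x. \<bar>proj (\<lambda>x. a * f x + b * g x) m x - (a * f x + b * g x)\<bar> \<partial>\<nu>) <=
    (\<integral>x. \<bar>a\<bar> * \<bar>proj f m x - f x\<bar> + \<bar>b\<bar> * \<bar>proj g m x - g x\<bar> \<partial>\<nu>)"
  proof (rule lint_mono)
   fix x assume [measurable]: "x \<in> space \<nu>"
   have "integrable \<nu> (\<lambda>y. f (comb_seq m x y))" "integrable \<nu> (\<lambda>y. g (comb_seq m x y))"
    by (rule ib[of _ K], use K in auto)+
   then have "proj (\<lambda>x. a * f x + b * g x) m x = a * proj f m x + b * proj g m x" by (simp add: proj_def)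
   then have "proj (\<lambda>x. a * f x + b * g x) m x - (a * f x + b * g x) = a * (proj f m x - f x) + b * (proj g m x - g x)"
    by (simp add: algebra_simps)
   then show "\<bar>proj (\<lambda>x. a * f x + b * g x) m x - (a * f x + b * g x)\<bar> <= \<bar>a\<bar> * \<bar>proj f m x - f x\<bar> + \<bar>b\<bar> * \<bar>proj g m x - g x\<bar>"
    by (metis abs_mult abs_triangle_ineq)
  qed (use int[of f K] int[of g K] int[OF _ b] K in auto)
  also have "\<dots> = \<bar>a\<bar> * (\<integral>x. \<bar>proj f m x - f x\<bar> \<partial>\<nu>) + \<bar>b\<bar> * (\<integral>x. \<bar>proj g m x - g x\<bar> \<partial>\<nu>)"
   using int[of f K] int[of g K] K by simp
  finally show ?thesis .
 qed
 have lim: "(\<lambda>m. \<bar>a\<bar> * (\<integral>x. \<bar>proj f m x - f x\<bar> \<partial>\<nu>) + \<bar>b\<bar> * (\<integral>x. \<bar>proj g m x - g x\<bar> \<partial>\<nu>)) \<longlonglongrightarrow> \<bar>a\<bar> * 0 + \<bar>b\<bar> * 0"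
  using assms unfolding L1_proj_def by (intro tendsto_intros) auto
 have "(\<lambda>m. \<integral>x. \<bar>proj (\<lambda>x. a * f x + b * g x) m x - (a * f x + b * g x)\<bar> \<partial>\<nu>) \<longlonglongrightarrow> 0"
  by (rule Lim_null_comparison[OF _ lim[unfolded mult_zero_right add_0_right]])
   (use le in \<open>auto simp: lint_nonneg\<close>)
 then show ?thesis using b unfolding L1_proj_def by auto
qed

lemma L1_proj_sum: "finite J ==> (!!j. j \<in> J ==> L1_proj (f j)) ==> L1_proj (\<lambda>x. \<Sum>j\<in>J. c j * f j x)"
proof (induction J rule: finite_induct)
 case empty
 show ?case by (auto simp: L1_proj_def proj_def)
next
 case (insert j J)
 then show ?case using L1_proj_lincomb[of "f j" "\<lambda>x. \<Sum>j\<in>J. c j * f j x" "c j" 1] by simp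
qed

text \<open>Dynkin's argument: cylinders generate the product and are stable under intersection, and
  a cylinder over coordinates below m0 is reproduced exactly by \<open>proj\<close> for m >= m0.
  Complements and disjoint unions follow by linearity and L1 limits.\<close>

lemma L1_proj_indicator:
 assumes "A \<in> sets \<nu>"
 shows "L1_proj (indicator A)"
proof -
 let ?G = "prod_algebra UNIV (\<lambda>_::nat. \<mu>)" and ?O = "\<Pi>\<^sub>E i\<in>UNIV::nat set. space \<mu>"
 have bd: "\<bar>indicat_real A x\<bar> <= 1" for A x by (simp add: indicator_def)
 have sp: "comb_seq m x y \<in> space \<nu>" if "x \<in> space \<nu>" "y \<in> space \<nu>" for m x y
  using that by (auto simp: space_PiM comb_seq_def PiE_iff)
 have A: "A \<in> sigma_sets ?O ?G" using assms by (simp only: sets_PiM)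
 show ?thesis
 proof (rule sigma_sets_induct_disjoint[of ?G ?O A "\<lambda>A. L1_proj (indicator A)"])
  show "Int_stable ?G" "?G \<subseteq> Pow ?O"
   by (rule Int_stable_prod_algebra, rule prod_algebra_sets_into_space)
 next
  fix A assume "A \<in> ?G"
  then obtain J E where A: "A = prod_emb UNIV (\<lambda>_. \<mu>) J (\<Pi>\<^sub>E j\<in>J. E j)" and J: "finite J" "!!j. j \<in> J ==> E j \<in> sets \<mu>"
   by (auto elim!: prod_algebraE)
  obtain m0 where m0: "!!j. j \<in> J ==> j < m0" using J(1) by (metis finite_nat_set_iff_bounded)
  have iff: "x \<in> A \<longleftrightarrow> (\<forall>j\<in>J. x j \<in> E j)" if "x \<in> space \<nu>" for x
   using that by (simp add: A prod_emb_iff space_PiM PiE_iff)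
  have p: "proj (indicator A) m x = indicator A x" if m: "m0 <= m" and x: "x \<in> space \<nu>" for m x
  proof -
   have "indicat_real A (comb_seq m x y) = indicator A x" if "y \<in> space \<nu>" for y
   proof -
    have "\<forall>j\<in>J. comb_seq m x y j = x j" using m m0 by (force simp: comb_seq_def)
    then show ?thesis using iff[OF sp[OF x that, of m]] iff[OF x] by (simp add: indicator_def)
   qed
   then show ?thesis by (simp add: proj_def nu.P.prob_space cong: lint_cong)
  qed
  have "(\<integral>x. \<bar>proj (indicator A) m x - indicator A x\<bar> \<partial>\<nu>) = 0" if "m0 <= m" for m
   using p[OF that] by (simp cong: lint_cong)
  then have "(\<lambda>m. \<integral>x. \<bar>proj (indicator A) m x - indicator A x\<bar> \<partial>\<nu>) \<longlonglongrightarrow> 0"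
   by (intro tendsto_eventually) (auto simp: eventually_sequentially)
  moreover have "A \<in> sets \<nu>" unfolding A using J by (intro sets_PiM_I) auto
  ultimately show "L1_proj (indicator A)" unfolding L1_proj_def using bd[of A] by auto
 next
  show "A \<in> sigma_sets ?O ?G" by (rule A)
  show "L1_proj (indicator {})" using L1_proj_sum[of "{}"] by (simp add: indicator_def[abs_def])
 next
  fix A assume A: "A \<in> sigma_sets ?O ?G" "L1_proj (indicator A)"
  have [measurable]: "A \<in> sets \<nu>" using A by (simp add: sets_PiM)
  have c: "indicat_real (?O - A) x = 1 - indicator A x" if "x \<in> space \<nu>" for x
   using that by (simp add: space_PiM indicator_def)
  have "proj (indicator (?O - A)) m x = 1 - proj (indicator A) m x" if [measurable]: "x \<in> space \<nu>" for m x
  proof -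
   have "proj (indicator (?O - A)) m x = (\<integral>y. 1 - indicator A (comb_seq m x y) \<partial>\<nu>)"
    unfolding proj_def by (intro lint_cong refl c sp that)
   also have "\<dots> = 1 - proj (indicator A) m x"
    unfolding proj_def by (subst Bochner_Integration.integral_diff)
     (auto intro!: nu.integrable_const_bound[of _ 1] simp: nu.P.prob_space bd)
   finally show ?thesis .
  qed
  then have "(\<integral>x. \<bar>proj (indicator (?O - A)) m x - indicator (?O - A) x\<bar> \<partial>\<nu>) = (\<integral>x. \<bar>proj (indicator A) m x - indicator A x\<bar> \<partial>\<nu>)" for m
   by (intro lint_cong refl) (simp add: c abs_minus_commute)
  moreover have "?O - A \<in> sets \<nu>" using sets.compl_sets[of A \<nu>] by (simp add: space_PiM)
  ultimately show "L1_proj (indicator (?O - A))" using A(2) bd unfolding L1_proj_def by auto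
 next
  fix A :: "nat => _" assume disj: "disjoint_family A" and "range A \<subseteq> sigma_sets ?O ?G"
   and IH: "!!i. L1_proj (indicator (A i))"
  then have A [measurable]: "!!i. A i \<in> sets \<nu>" by (auto simp: sets_PiM)
  show "L1_proj (indicator (\<Union>i. A i))"
  proof (rule L1_proj_lim[OF _ bd])
   fix e :: real assume e: "0 < e"
   have "range A \<subseteq> sets \<nu>" using A by blast
   from nu.P.finite_measure_UNION[OF this disj] have "(\<lambda>n. \<Sum>i<n. measure \<nu> (A i)) \<longlonglongrightarrow> measure \<nu> (\<Union>i. A i)"
    by (simp only: sums_def)
   from LIMSEQ_D[OF this e] obtain n where n: "\<bar>(\<Sum>i<n. measure \<nu> (A i)) - measure \<nu> (\<Union>i. A i)\<bar> < e" by auto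
   have s: "(\<Sum>i<n. indicat_real (A i) x) = indicator (\<Union>i<n. A i) x" for x
    by (rule indicator_UN_disjoint[symmetric]) (use disj in \<open>auto simp: disjoint_family_on_def\<close>)
   have int: "integrable \<nu> (indicat_real B)" if "B \<in> sets \<nu>" for B
    using that by (intro nu.integrable_const_bound[of _ 1]) (auto simp: bd)
   have "(\<integral>x. \<bar>indicat_real (\<Union>i. A i) x - (\<Sum>i<n. 1 * indicator (A i) x)\<bar> \<partial>\<nu>)
     = (\<integral>x. indicat_real (\<Union>i. A i) x - (\<Sum>i<n. indicator (A i) x) \<partial>\<nu>)"
    by (intro lint_cong refl) (simp add: s, auto simp: indicator_def)
   also have "\<dots> = measure \<nu> (\<Union>i. A i) - (\<Sum>i<n. measure \<nu> (A i))"
    by (subst Bochner_Integration.integral_diff, simp_all add: int Bochner_Integration.integral_sum)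
   finally show "\<exists>g. L1_proj g \<and> (\<integral>x. \<bar>indicator (\<Union>i. A i) x - g x\<bar> \<partial>\<nu>) <= e"
    using n L1_proj_sum[of "{..<n}" "\<lambda>i. indicator (A i)" "\<lambda>_. 1"] IH
    by (intro exI[of _ "\<lambda>x. \<Sum>i<n. 1 * indicator (A i) x"]) auto
  qed auto
 qed
qed

text \<open>Levy's upward theorem in L1 for bounded functions, obtained by approximation with simple
  functions in place of martingale convergence.\<close>

lemma proj_tendsto_L1:
 assumes [measurable]: "f \<in> borel_measurable \<nu>" and f: "!!x. \<bar>f x\<bar> <= K"
 shows "(\<lambda>m. \<integral>x. \<bar>proj f m x - f x\<bar> \<partial>\<nu>) \<longlonglongrightarrow> 0"
proof -
 have "L1_proj f"
 proof (rule L1_proj_lim[OF _ f])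
  fix e :: real assume e: "0 < e"
  let ?J = "{\<lfloor>- K / e\<rfloor>..\<lfloor>K / e\<rfloor>}"
  \<comment> \<open>f rounded down to a multiple of e. The rounding error is at most e, and
    \<open>?J\<close> is a finite range because f is bounded.\<close>
  let ?g = "\<lambda>x. \<Sum>j\<in>?J. (e * real_of_int j) * indicator {x \<in> space \<nu>. \<lfloor>f x / e\<rfloor> = j} x"
  have "\<bar>f x - ?g x\<bar> <= e" if x: "x \<in> space \<nu>" for x
  proof -
   have "- K <= f x" "f x <= K" using f[of x] by linarith+
   then have "- K / e <= f x / e" "f x / e <= K / e" using e by (intro divide_right_mono; simp)+
   then have "\<lfloor>f x / e\<rfloor> \<in> ?J" by (simp add: floor_mono)
   then have "?g x = (\<Sum>j\<in>?J. if j = \<lfloor>f x / e\<rfloor> then e * real_of_int j else 0)"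
    using x by (intro sum.cong refl) (auto simp: indicator_def)
   also have "\<dots> = e * real_of_int \<lfloor>f x / e\<rfloor>" using \<open>\<lfloor>f x / e\<rfloor> \<in> ?J\<close> by simp
   finally have "f x - ?g x = e * (f x / e - real_of_int \<lfloor>f x / e\<rfloor>)" using e by (simp add: algebra_simps)
   moreover have "0 <= f x / e - real_of_int \<lfloor>f x / e\<rfloor>" "f x / e - real_of_int \<lfloor>f x / e\<rfloor> <= 1" by linarith+
   ultimately show ?thesis using e mult_left_mono[of "f x / e - real_of_int \<lfloor>f x / e\<rfloor>" 1 e] by simp
  qed
  then have "(\<integral>x. \<bar>f x - ?g x\<bar> \<partial>\<nu>) <= e"
   by (intro nu.P.integral_le_const nu.integrable_const_bound[of _ e] AE_I2) auto
  moreover have "L1_proj ?g" by (intro L1_proj_sum L1_proj_indicator) auto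
  ultimately show "\<exists>g. L1_proj g \<and> (\<integral>x. \<bar>f x - g x\<bar> \<partial>\<nu>) <= e" by blast
 qed simp
 then show ?thesis by (simp add: L1_proj_def)
qed

end

section \<open>Maximal inequalities for bounded martingale differences\<close>

primrec rmax :: "(nat => real) => nat => real" where
 "rmax s 0 = s 0"
| "rmax s (Suc n) = max (rmax s n) (s (Suc n))"

lemma le_rmax: "k <= n ==> s k <= rmax s n"
 by (induction n) (auto simp: le_Suc_eq le_max_iff_disj)

lemma rmax_attained: "\<exists>k\<le>n. rmax s n = s k"
proof (induction n)
 case (Suc n)
 then show ?case by (cases "rmax s n <= s (Suc n)") (auto simp: max_def intro: le_SucI)
qed auto

lemma rmax_leI: "(!!k. k <= n ==> s k <= c) ==> rmax s n <= c"
 using rmax_attained[of n s] by auto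

lemma rmax_cong: "(!!k. k <= n ==> s k = t k) ==> rmax s n = rmax t n"
 by (induction n) auto

lemma rmax_nonneg: "(!!k. 0 <= s k) ==> 0 <= rmax s n"
 using rmax_attained[of n s] by auto

lemma measurable_rmax [measurable (raw)]:
 assumes [measurable]: "!!k. k <= n ==> s k \<in> borel_measurable M"
 shows "(\<lambda>w. rmax (\<lambda>k. s k w) n) \<in> borel_measurable M"
 using assms by (induction n) auto

lemma tendsto_rmax:
 assumes "!!k. k <= n ==> ((\<lambda>r. s r k) \<longlongrightarrow> t k) F"
 shows "((\<lambda>r. rmax (s r) n) \<longlongrightarrow> rmax t n) F"
 using assms by (induction n) (auto intro!: tendsto_max)

lemma rmax_sq: "(!!k. 0 <= s k) ==> (rmax s n)^2 = rmax (\<lambda>k. (s k)^2) n"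
proof (induction n)
 case (Suc n)
 have "(max a b)^2 = max (a^2) (b^2)" if "0 <= a" "0 <= b" for a b :: real
  using that power_mono[of a b 2] power_mono[of b a 2] by (cases "a <= b") (auto simp: max_def)
 then show ?case using Suc rmax_nonneg[of s n] by simp
qed simp

text \<open>Induction: where the maximum does not move, both sides gain the same amount; where it
  jumps from m to x, the right side gains an extra (x - m)^2 / 2.\<close>

lemma doob_pathwise_aux:
 assumes "s 0 = 0"
 shows "(\<Sum>k<n. rmax s k * (s (Suc k) - s k)) <= rmax s n * s n - (rmax s n)^2 / 2"
proof (induction n)
 case (Suc n)
 let ?m = "rmax s n" and ?x = "s (Suc n)"
 have "?m * ?x - ?m^2 / 2 <= max ?m ?x * ?x - (max ?m ?x)^2 / 2"
 proof (cases "?x <= ?m")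
  case False
  have "0 <= (?m - ?x)^2" by simp
  then show ?thesis using False by (simp add: max_def power2_eq_square algebra_simps)
 qed (simp add: max_def)
 then show ?case using Suc by (simp add: algebra_simps)
qed (simp add: assms)

text \<open>Doob's L2 inequality with constant 4, path by path: the sum is a discrete stochastic
  integral, which vanishes in mean for a martingale. What is left after
  \<open>doob_pathwise_aux\<close> is the square (m - 2 s)^2.\<close>

lemma doob_pathwise:
 assumes "s 0 = 0"
 shows "(rmax s n)^2 + 4 * (\<Sum>k<n. rmax s k * (s (Suc k) - s k)) <= 4 * (s n)^2"
proof -
 have "0 <= (rmax s n - 2 * s n)^2" by simp
 also have "\<dots> = (rmax s n)^2 - 4 * (rmax s n * s n) + 4 * (s n)^2"
  by (simp add: power2_eq_square algebra_simps)
 finally show ?thesis using doob_pathwise_aux[of s n, OF assms] by simp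
qed

context prob_space
begin

text \<open>Conditional expectations given the past are avoided by testing against bounded functions of
 the earlier differences.\<close>

definition mart_diff :: "(nat => 'a => real) => nat => real => bool" where
 "mart_diff d N B \<longleftrightarrow> (\<forall>k. d k \<in> borel_measurable M \<and> (\<forall>w. \<bar>d k w\<bar> <= B)) \<and>
  (\<forall>k<N. \<forall>u\<in>borel_measurable M. (\<exists>K. \<forall>w. \<bar>u w\<bar> <= K) \<longrightarrow>
   (\<forall>w w'. (\<forall>j<k. d j w = d j w') \<longrightarrow> u w = u w') \<longrightarrow> (\<integral>w. u w * d k w \<partial>M) = 0)"

lemma mart_diffD:
 assumes "mart_diff d N B"
 shows "d k \<in> borel_measurable M" "\<bar>d k w\<bar> <= B"
 using assms unfolding mart_diff_def by auto

lemma mart_diff_orth: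
 assumes "mart_diff d N B" "k < N" "u \<in> borel_measurable M" "!!w. \<bar>u w\<bar> <= K"
  "!!w w'. (!!j. j < k ==> d j w = d j w') ==> u w = u w'"
 shows "(\<integral>w. u w * d k w \<partial>M) = 0"
 using assms(1) unfolding mart_diff_def using assms(2-) by blast

lemma bounded_integrable:
 fixes f :: "'a => real"
 shows "f \<in> borel_measurable M ==> (!!w. \<bar>f w\<bar> <= K) ==> integrable M f"
 by (rule integrable_const_bound[of _ K]) auto

definition psum :: "(nat => 'a => real) => nat => 'a => real" where
 "psum d n w = (\<Sum>j<n. d j w)"

lemma psum_simps [simp]: "psum d 0 w = 0" "psum d (Suc n) w = psum d n w + d n w"
 by (simp_all add: psum_def)

lemma psum_cong: "(!!j. j < n ==> d j w = d j w') ==> k <= n ==> psum d k w = psum d k w'"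
 by (simp add: psum_def)

context
 fixes d N B assumes d: "mart_diff d N B"
begin

lemma mart_diff_B: "0 <= B"
 using mart_diffD(2)[OF d] abs_ge_zero order_trans by blast

lemma measurable_d [measurable]: "d k \<in> borel_measurable M"
 by (rule mart_diffD[OF d])

lemma measurable_psum [measurable]: "psum d n \<in> borel_measurable M"
 unfolding psum_def by measurable

lemma psum_bound: "\<bar>psum d n w\<bar> <= n * B"
proof -
 have "\<bar>psum d n w\<bar> <= (\<Sum>j<n. \<bar>d j w\<bar>)" unfolding psum_def by (rule sum_abs)
 also have "\<dots> <= (\<Sum>j<n. B)" by (intro sum_mono mart_diffD[OF d])
 finally show ?thesis by simp
qed

lemma bounded_pow_mult: "\<bar>psum d n w ^ p * d n w ^ q\<bar> <= (n * B) ^ p * B ^ q"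
 unfolding abs_mult power_abs
 by (intro mult_mono power_mono psum_bound mart_diffD[OF d]) (auto simp: mart_diff_B)

lemma integrable_pow_mult: "integrable M (\<lambda>w. psum d n w ^ p * d n w ^ q)"
 by (rule bounded_integrable[OF _ bounded_pow_mult]) measurable

lemma integrable_psum_pow: "integrable M (\<lambda>w. psum d n w ^ p)"
 using integrable_pow_mult[of n p 0] by simp

lemma integral_psum_pow_d: "n < N ==> (\<integral>w. psum d n w ^ p * d n w \<partial>M) = 0"
proof (rule mart_diff_orth[OF d, of n _ "(n * B) ^ p"])
 show "psum d n w ^ p = psum d n w' ^ p" if "!!j. j < n ==> d j w = d j w'" for w w'
  using psum_cong[of n d w w' n] that by simp
qed (auto simp: power_abs intro!: power_mono psum_bound)

lemma integral_psum_sq: "n <= N ==> (\<integral>w. (psum d n w)^2 \<partial>M) = (\<Sum>k<n. \<integral>w. (d k w)^2 \<partial>M)"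
proof (induction n)
 case (Suc n)
 have "(\<integral>w. (psum d (Suc n) w)^2 \<partial>M) = (\<integral>w. (psum d n w)^2 + 2 * (psum d n w * d n w) + (d n w)^2 \<partial>M)"
  by (simp add: power2_eq_square algebra_simps)
 also have "\<dots> = (\<integral>w. (psum d n w)^2 \<partial>M) + 2 * (\<integral>w. psum d n w * d n w \<partial>M) + (\<integral>w. (d n w)^2 \<partial>M)"
  using integrable_pow_mult[of n 2 0] integrable_pow_mult[of n 1 1] integrable_pow_mult[of n 0 2] by simp
 finally show ?case using Suc integral_psum_pow_d[of n 1] by simp
qed simp

text \<open>In (s + d)^4 the term 4 s^3 d has mean 0, and 6 s^2 d^2 + 4 s d^3 + d^4 is at most 8 B^2
  s^2 + 3 B^4. As E[s^2] <= n B^2, step n adds at most (8 n + 3) B^4, for which the factor 11 = 8 +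
  3 leaves ample room.\<close>

lemma integral_psum_pow4: "n <= N ==> (\<integral>w. psum d n w ^ 4 \<partial>M) <= 11 * (real n)^2 * B ^ 4"
proof (induction n)
 case (Suc n)
 let ?s = "psum d n" and ?d = "d n"
 note int = integrable_pow_mult[of n 4 0, simplified] integrable_pow_mult[of n 3 1, simplified]
  integrable_pow_mult[of n 2 0, simplified]
 have "(\<integral>w. psum d (Suc n) w ^ 4 \<partial>M) <= (\<integral>w. ?s w ^ 4 + 4 * (?s w ^ 3 * ?d w) + 8 * B^2 * (?s w)^2 + 3 * B ^ 4 \<partial>M)"
 proof (rule integral_mono)
  fix w
  have dB: "\<bar>?d w\<bar> <= B" by (rule mart_diffD[OF d])
  have d2: "(?d w)^2 <= B^2" using power_mono[OF dB, of 2] by simp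
  have d4: "?d w ^ 4 <= B ^ 4" using power_mono[OF dB, of 4] by simp
  have "4 * (?s w * ?d w ^ 3) <= 2 * ((?s w)^2 + (?d w)^2) * (?d w)^2"
  proof -
   have "2 * (?s w * ?d w) <= (?s w)^2 + (?d w)^2" using sum_squares_bound[of "?s w" "?d w"] by simp
   then have "2 * (?s w * ?d w) * (2 * (?d w)^2) <= ((?s w)^2 + (?d w)^2) * (2 * (?d w)^2)"
    by (rule mult_right_mono) simp
   then show ?thesis by (simp add: power2_eq_square power3_eq_cube algebra_simps)
  qed
  then have "6 * ((?s w)^2 * (?d w)^2) + 4 * (?s w * ?d w ^ 3) <= 8 * ((?s w)^2 * (?d w)^2) + 2 * ?d w ^ 4"
   by (simp add: power2_eq_square power4_eq_xxxx algebra_simps)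
  also have "\<dots> <= 8 * ((?s w)^2 * B^2) + 2 * B ^ 4"
   by (intro add_mono mult_left_mono d2 d4) auto
  finally show "psum d (Suc n) w ^ 4 <= ?s w ^ 4 + 4 * (?s w ^ 3 * ?d w) + 8 * B^2 * (?s w)^2 + 3 * B ^ 4"
   using d4 by (simp add: power2_eq_square power3_eq_cube power4_eq_xxxx algebra_simps)
 next
  show "integrable M (\<lambda>w. psum d (Suc n) w ^ 4)" by (rule integrable_psum_pow)
 qed (use int in auto)
 also have "\<dots> = (\<integral>w. ?s w ^ 4 \<partial>M) + 4 * (\<integral>w. ?s w ^ 3 * ?d w \<partial>M) + 8 * B^2 * (\<integral>w. (?s w)^2 \<partial>M) + 3 * B ^ 4"
  using int by (simp add: prob_space)
 also have "(\<integral>w. ?s w ^ 3 * ?d w \<partial>M) = 0" using Suc by (intro integral_psum_pow_d) auto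
 also have "(\<integral>w. (?s w)^2 \<partial>M) <= n * B^2"
 proof -
  have "(\<integral>w. (d k w)^2 \<partial>M) <= B^2" for k
  proof (rule integral_le_const)
   show "integrable M (\<lambda>w. (d k w)^2)" using integrable_pow_mult[of k 0 2] by simp
   show "AE w in M. (d k w)^2 <= B^2"
    using power_mono[OF mart_diffD(2)[OF d] abs_ge_zero, of k _ 2] by simp
  qed
  then have "(\<Sum>k<n. \<integral>w. (d k w)^2 \<partial>M) <= (\<Sum>k<n. B^2)" by (intro sum_mono)
  then show ?thesis using Suc by (simp add: integral_psum_sq)
 qed
 finally have "(\<integral>w. psum d (Suc n) w ^ 4 \<partial>M) <= 11 * (real n)^2 * B ^ 4 + 8 * B^2 * (n * B^2) + 3 * B ^ 4"
  using Suc by (simp add: mult_left_mono)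
 also have "\<dots> = (11 * (real n)^2 + 8 * n + 3) * B ^ 4"
  by (simp add: power2_eq_square power4_eq_xxxx algebra_simps)
 also have "\<dots> <= (11 * (real (Suc n))^2) * B ^ 4"
  by (intro mult_right_mono) (auto simp: power2_eq_square algebra_simps mart_diff_B)
 finally show ?case by simp
qed simp

lemma psum_bound':
 fixes k n :: nat
 assumes "k <= n"
 shows "\<bar>psum d k w\<bar> <= n * B"
proof -
 have "real k * B <= real n * B" using assms mart_diff_B by (intro mult_right_mono) auto
 then show ?thesis using psum_bound[of k w] by linarith
qed

text \<open>Doob's maximal inequality for a nonnegative submartingale \<open>X\<close>, whose increments dominate
 those of the martingale transform of \<open>d\<close> by \<open>c\<close>.\<close>

lemma Doob_maximal:
 assumes n: "n <= N" and [measurable]: "!!k. X k \<in> borel_measurable M" "!!k. c k \<in> borel_measurable M"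
  and X0: "!!w. X 0 w = 0" and X: "!!k w. 0 <= X k w" and inc: "!!k w. c k w * d k w <= X (Suc k) w - X k w"
  and XK: "!!k w. k <= n ==> X k w <= K" and cK: "!!k w. k <= n ==> \<bar>c k w\<bar> <= K"
  and loc: "!!k w w'. k <= n ==> (!!j. j < k ==> d j w = d j w') ==> X k w = X k w' \<and> c k w = c k w'"
 shows "(\<integral>w. (rmax (\<lambda>k. X k w) n)^2 \<partial>M) <= 4 * (\<integral>w. (X n w)^2 \<partial>M)"
proof -
 let ?m = "\<lambda>k w. rmax (\<lambda>k. X k w) k"
 have m: "0 <= ?m k w" for k w by (rule rmax_nonneg[OF X])
 have mK: "\<bar>?m k w\<bar> <= K" if "k <= n" for k w
  unfolding abs_of_nonneg[OF m] using that by (intro rmax_leI XK) auto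
 have K: "0 <= K" using mK[OF order_refl] abs_ge_zero order_trans by blast
 have sq: "\<bar>x\<^sup>2\<bar> <= K^2" if "\<bar>x\<bar> <= K" for x using power_mono[OF that abs_ge_zero, of 2] by simp
 have u: "\<bar>?m k w * c k w\<bar> <= K * K" if "k < n" for k w
  unfolding abs_mult using that by (intro mult_mono mK cK K) auto
 have ud: "\<bar>?m k w * c k w * d k w\<bar> <= K * K * B" if "k < n" for k w
  unfolding abs_mult[of "_ * _" "d k w"] using K by (intro mult_mono u that mart_diffD[OF d]) auto
 have int: "integrable M (\<lambda>w. ?m k w * c k w * d k w)" if "k < n" for k
  by (rule bounded_integrable[OF _ ud[OF that]]) measurable
 have isum: "integrable M (\<lambda>w. \<Sum>k<n. ?m k w * c k w * d k w)"
  by (intro Bochner_Integration.integrable_sum int) auto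
 have int2: "integrable M (\<lambda>w. (?m n w)^2)" "integrable M (\<lambda>w. (X n w)^2)"
  using X XK by (auto intro!: bounded_integrable[of _ "K^2"] sq mK simp: abs_of_nonneg)
 have "(\<integral>w. (?m n w)^2 + 4 * (\<Sum>k<n. ?m k w * c k w * d k w) \<partial>M) <= (\<integral>w. 4 * (X n w)^2 \<partial>M)"
 proof (rule integral_mono)
  fix w
  have "(\<Sum>k<n. ?m k w * c k w * d k w) <= (\<Sum>k<n. ?m k w * (X (Suc k) w - X k w))"
   unfolding mult.assoc by (intro sum_mono mult_left_mono inc m)
  then show "(?m n w)^2 + 4 * (\<Sum>k<n. ?m k w * c k w * d k w) <= 4 * (X n w)^2"
   using doob_pathwise[of "\<lambda>k. X k w" n, OF X0] by linarith
 qed (intro Bochner_Integration.integrable_add integrable_mult_right isum int2)+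
 moreover have "(\<integral>w. (?m n w)^2 + 4 * (\<Sum>k<n. ?m k w * c k w * d k w) \<partial>M) =
   (\<integral>w. (?m n w)^2 \<partial>M) + 4 * (\<Sum>k<n. \<integral>w. ?m k w * c k w * d k w \<partial>M)"
 proof -
  have "(\<integral>w. (\<Sum>k<n. ?m k w * c k w * d k w) \<partial>M) = (\<Sum>k<n. \<integral>w. ?m k w * c k w * d k w \<partial>M)"
   by (rule Bochner_Integration.integral_sum) (rule int, simp)
  then show ?thesis by (subst Bochner_Integration.integral_add[OF int2(1) integrable_mult_right[OF isum]]) simp
 qed
 \<comment> \<open>The factor in front of \<open>d k\<close> is a bounded function of the earlier
   differences, hence an admissible test function.\<close>
 moreover have "(\<integral>w. ?m k w * c k w * d k w \<partial>M) = 0" if k: "k < n" for k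
 proof (rule mart_diff_orth[OF d])
  show "?m k w * c k w = ?m k w' * c k w'" if "!!j. j < k ==> d j w = d j w'" for w w'
   using loc[of _ w w'] that k by (intro arg_cong2[where f = "(*)"] rmax_cong) auto
 qed (use k n u[OF k] in auto)
 ultimately show ?thesis using int2 by simp
qed

text \<open>\<open>Doob_maximal\<close> for the submartingale |s|: since |s + d| >= |s| + sgn(s) d,
  the transform is by the sign. The extra 1 in the bound n B + 1 covers the sign itself.\<close>

lemma integral_rmax_psum_sq:
 assumes n: "n <= N"
 shows "(\<integral>w. (rmax (\<lambda>k. \<bar>psum d k w\<bar>) n)^2 \<partial>M) <= 4 * (\<Sum>k<n. \<integral>w. (d k w)^2 \<partial>M)"
proof -
 have "(\<integral>w. (rmax (\<lambda>k. \<bar>psum d k w\<bar>) n)^2 \<partial>M) <= 4 * (\<integral>w. \<bar>psum d n w\<bar>\<^sup>2 \<partial>M)"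
 proof (rule Doob_maximal[OF n, where c = "\<lambda>k w. sgn (psum d k w)"])
  show "sgn (psum d k w) * d k w <= \<bar>psum d (Suc k) w\<bar> - \<bar>psum d k w\<bar>" for k w
   by (auto simp: sgn_if)
  fix k :: nat and w assume "k <= n"
  from psum_bound'[OF this, of w] show "\<bar>psum d k w\<bar> <= n * B + 1" by simp
  show "\<bar>sgn (psum d k w)\<bar> <= n * B + 1" using mart_diff_B by (simp add: sgn_if)
 next
  show "\<bar>psum d k w\<bar> = \<bar>psum d k w'\<bar> \<and> sgn (psum d k w) = sgn (psum d k w')" if "!!j. j < k ==> d j w = d j w'" for k w w'
   using psum_cong[of k d w w' k] that by simp
 qed auto
 then show ?thesis using integral_psum_sq[OF n] by simp
qed

text \<open>\<open>Doob_maximal\<close> for s^2, whose increments dominate 2 s d; 44 is 4 times the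
  11 of \<open>integral_psum_pow4\<close>.\<close>

lemma integral_rmax_psum_pow4:
 assumes n: "n <= N"
 shows "(\<integral>w. (rmax (\<lambda>k. \<bar>psum d k w\<bar>) n) ^ 4 \<partial>M) <= 44 * (real n)^2 * B ^ 4"
proof -
 have p4: "x ^ 4 = (x^2)^2" for x :: real by (simp flip: power_mult)
 have "(\<integral>w. (rmax (\<lambda>k. (psum d k w)^2) n)^2 \<partial>M) <= 4 * (\<integral>w. ((psum d n w)^2)^2 \<partial>M)"
 proof (rule Doob_maximal[OF n, where c = "\<lambda>k w. 2 * psum d k w"])
  show "2 * psum d k w * d k w <= (psum d (Suc k) w)^2 - (psum d k w)^2" for k w
   by (simp add: power2_eq_square algebra_simps)
  fix k :: nat and w assume "k <= n"
  from psum_bound'[OF this, of w] have b: "\<bar>psum d k w\<bar> <= n * B" .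
  show "(psum d k w)^2 <= (n * B)^2 + 2 * (n * B)"
   using power_mono[OF b, of 2] mart_diff_B by (simp add: add_increasing2)
  show "\<bar>2 * psum d k w\<bar> <= (n * B)^2 + 2 * (n * B)" using b zero_le_power2[of "n * B"] by linarith
 next
  show "(psum d k w)^2 = (psum d k w')^2 \<and> 2 * psum d k w = 2 * psum d k w'" if "!!j. j < k ==> d j w = d j w'" for k w w'
   using psum_cong[of k d w w' k] that by simp
 qed auto
 moreover have eq: "(rmax (\<lambda>k. \<bar>psum d k w\<bar>) n) ^ 4 = (rmax (\<lambda>k. (psum d k w)^2) n)^2" for w
  by (simp only: p4 rmax_sq abs_ge_zero power2_abs)
 ultimately show ?thesis using integral_psum_pow4[OF n] unfolding eq p4[of "psum d n _"] by linarith
qed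

end

end

section \<open>Maximal inequalities under physical dependence\<close>

text \<open>Martingale sums run backwards in time, partial sums forwards. A forward sum is a
  difference of two backward ones, so passing to maxima costs a factor 2.\<close>

lemma sum_cinc_reverse:
 fixes g :: "nat => real"
 assumes "k <= n"
 shows "(\<Sum>i=1..k. g i) = (\<Sum>j<n. g (n - j)) - (\<Sum>j<n - k. g (n - j))"
proof -
 have "(\<Sum>j<m. g (n - j)) = (\<Sum>i=n-m+1..n. g i)" if "m <= n" for m
  using that
  by (intro sum.reindex_bij_witness[of _ "\<lambda>i. n - i" "\<lambda>j. n - j"]) auto
 from this[of n] this[of "n - k"] assms
 have "(\<Sum>j<n. g (n - j)) - (\<Sum>j<n - k. g (n - j)) = (\<Sum>i=1..n. g i) - (\<Sum>i=k+1..n. g i)" by simp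
 also have "\<dots> = (\<Sum>i=1..k. g i)"
  using sum.ub_add_nat[of 1 k g "n - k"] assms by simp
 finally show ?thesis by simp
qed

text \<open>With dependence coefficients as weights this takes the place of Minkowski's inequality
  when maxima for different lags are added.\<close>

lemma weighted_Cauchy_Schwarz:
 fixes a w :: "'i => real"
 assumes "!!i. i \<in> I ==> w i > 0"
 shows "(\<Sum>i\<in>I. a i)^2 <= (\<Sum>i\<in>I. w i) * (\<Sum>i\<in>I. (a i)^2 / w i)"
proof -
 have "(\<Sum>i\<in>I. a i)^2 = (\<Sum>i\<in>I. sqrt (w i) * (a i / sqrt (w i)))^2"
 proof (intro arg_cong[where f = "\<lambda>x. x^2"] sum.cong refl)
  show "a i = sqrt (w i) * (a i / sqrt (w i))" if "i \<in> I" for i using assms[OF that] by simp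
 qed
 also have "\<dots> <= (\<Sum>i\<in>I. (sqrt (w i))^2) * (\<Sum>i\<in>I. (a i / sqrt (w i))^2)"
  by (rule Cauchy_Schwarz_ineq_sum)
 also have "\<dots> = (\<Sum>i\<in>I. w i) * (\<Sum>i\<in>I. (a i)^2 / w i)"
  using assms by (intro arg_cong2[where f = "(*)"] sum.cong) (auto simp: power_divide less_imp_le)
 finally show ?thesis .
qed

context innovations
begin

definition lagsum :: "(nat => (nat => 'e) => real) => nat => (int => 'e) => real" where
 "lagsum f k z = (\<Sum>i=1..k. f i (lag (int i) z))"

lemma measurable_lagsum [measurable (raw)]:
 assumes [measurable]: "!!i. f i \<in> borel_measurable \<nu>"
 shows "lagsum f k \<in> borel_measurable \<pi>"
 unfolding lagsum_def by measurable

definition maxsum :: "(nat => (nat => 'e) => real) => nat => (int => 'e) => real" where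
 "maxsum f n z = rmax (\<lambda>k. \<bar>lagsum f k z\<bar>) n"

lemma measurable_maxsum [measurable (raw)]:
 assumes [measurable]: "!!i. f i \<in> borel_measurable \<nu>"
 shows "maxsum f n \<in> borel_measurable \<pi>"
 unfolding maxsum_def by measurable

lemma maxsum_nonneg: "0 <= maxsum f n z"
 unfolding maxsum_def by (rule rmax_nonneg) simp

lemma lagsum_le_maxsum: "k <= n ==> \<bar>lagsum f k z\<bar> <= maxsum f n z"
 unfolding maxsum_def by (rule le_rmax[of k n "\<lambda>k. \<bar>lagsum f k z\<bar>"])

lemma maxsum_leI: "(!!k. k <= n ==> \<bar>lagsum f k z\<bar> <= c) ==> maxsum f n z <= c"
 unfolding maxsum_def by (rule rmax_leI)

lemma maxsum_le_sum: "maxsum f n z <= (\<Sum>i=1..n. \<bar>f i (lag (int i) z)\<bar>)"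
proof (rule maxsum_leI)
 fix k assume "k <= n"
 have "\<bar>lagsum f k z\<bar> <= (\<Sum>i=1..k. \<bar>f i (lag (int i) z)\<bar>)" unfolding lagsum_def by (rule sum_abs)
 also have "\<dots> <= (\<Sum>i=1..n. \<bar>f i (lag (int i) z)\<bar>)" using \<open>k <= n\<close> by (intro sum_mono2) auto
 finally show "\<bar>lagsum f k z\<bar> <= (\<Sum>i=1..n. \<bar>f i (lag (int i) z)\<bar>)" .
qed

text \<open>Averaging out the oldest innovation gives martingale differences in reversed time.\<close>

lemma mart_diff_cinc:
 assumes f [measurable]: "!!i. f i \<in> borel_measurable \<nu>" and fK: "!!i x. \<bar>f i x\<bar> <= K"
 shows "pi.mart_diff (\<lambda>j z. cinc (f (n - j)) l (lag (int (n - j)) z)) n (2 * K)"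
 unfolding pi.mart_diff_def
proof (intro conjI allI impI ballI)
 show "(\<lambda>z. cinc (f (n - k)) l (lag (int (n - k)) z)) \<in> borel_measurable \<pi>" for k by measurable
 show "\<bar>cinc (f (n - k)) l (lag (int (n - k)) z)\<bar> <= 2 * K" for k z by (rule cinc_bound[OF fK])
 fix k and u :: "_ => real" assume k: "k < n" and u [measurable]: "u \<in> borel_measurable \<pi>" and "\<exists>K. \<forall>w. \<bar>u w\<bar> <= K"
  and fac: "\<forall>w w'. (\<forall>j<k. cinc (f (n - j)) l (lag (int (n - j)) w) = cinc (f (n - j)) l (lag (int (n - j)) w')) \<longrightarrow> u w = u w'"
 then obtain K' where K': "!!w. \<bar>u w\<bar> <= K'" by blast
 \<comment> \<open>Coordinate n - k - l is the oldest innovation in term k. Terms with j < k belong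
   to the later times n - j and do not reach back that far.\<close>
 show "(\<integral>z. u z * cinc (f (n - k)) l (lag (int (n - k)) z) \<partial>\<pi>) = 0"
 proof (rule integral_resample_eq_0[where c = "int (n - k) - int l"])
  have "\<bar>u z * cinc (f (n - k)) l (lag (int (n - k)) z)\<bar> <= K' * (2 * K)" for z
   unfolding abs_mult by (intro mult_mono K' cinc_bound fK order_trans[OF abs_ge_zero K']) auto
  then show "integrable \<pi> (\<lambda>z. u z * cinc (f (n - k)) l (lag (int (n - k)) z))"
   by (intro pi.bounded_integrable[of _ "K' * (2 * K)"]) auto
  show "u (z(int (n - k) - int l := y)) = u z" for z y
  proof -
   have "cinc (f (n - j)) l (lag (int (n - j)) (z(int (n - k) - int l := y))) = cinc (f (n - j)) l (lag (int (n - j)) z)"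
    if "j < k" for j
    by (rule cinc_cong) (use that k in \<open>auto simp: lag_def\<close>)
   then show ?thesis using fac by blast
  qed
  show "(\<integral>y. cinc (f (n - k)) l (lag (int (n - k)) (z(int (n - k) - int l := y))) \<partial>\<mu>) = 0" if "z \<in> space \<pi>" for z
   unfolding lag_upd by (rule cinc_average[OF f fK measurable_space[OF measurable_lag that]])
 qed
qed

lemma maxsum_cinc_le:
 fixes f :: "nat => (nat => 'e) => real" and l n
 defines "d \<equiv> (\<lambda>j z. cinc (f (n - j)) l (lag (int (n - j)) z))"
 shows "maxsum (\<lambda>i. cinc (f i) l) n z <= 2 * rmax (\<lambda>k. \<bar>pi.psum d k z\<bar>) n"
proof (rule maxsum_leI)
 fix k assume k: "k <= n"
 have "lagsum (\<lambda>i. cinc (f i) l) k z = pi.psum d n z - pi.psum d (n - k) z"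
  unfolding lagsum_def pi.psum_def d_def by (rule sum_cinc_reverse[OF k])
 also have "\<bar>\<dots>\<bar> <= \<bar>pi.psum d n z\<bar> + \<bar>pi.psum d (n - k) z\<bar>" by (rule abs_triangle_ineq4)
 also have "\<dots> <= rmax (\<lambda>k. \<bar>pi.psum d k z\<bar>) n + rmax (\<lambda>k. \<bar>pi.psum d k z\<bar>) n"
  by (intro add_mono le_rmax[of _ n "\<lambda>k. \<bar>pi.psum d k z\<bar>"]) auto
 finally show "\<bar>lagsum (\<lambda>i. cinc (f i) l) k z\<bar> <= 2 * rmax (\<lambda>k. \<bar>pi.psum d k z\<bar>) n" by simp
qed

lemma cinc_zero: "cinc (\<lambda>_. 0) l x = 0"
 by (simp add: cinc_def proj_def)

lemma maxsum_bound:
 fixes f :: "nat => (nat => 'e) => real" and K :: real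
 assumes "!!i x. \<bar>f i x\<bar> <= K"
 shows "\<bar>maxsum f n z\<bar> <= n * K"
 using order_trans[OF maxsum_le_sum sum_mono[of "{1..n}" _ "\<lambda>_. K"]] assms maxsum_nonneg[of f n z] by simp

lemma maxsum_sq_bound:
 fixes f :: "nat => (nat => 'e) => real" and K :: real
 assumes "!!i x. \<bar>f i x\<bar> <= K"
 shows "\<bar>(maxsum f n z)\<^sup>2\<bar> <= (n * K)^2"
proof -
 have b: "\<bar>maxsum f n z\<bar> <= n * K" by (rule maxsum_bound[OF assms])
 from power_mono[OF b abs_ge_zero, of 2] show ?thesis by simp
qed

text \<open>16 is the square of the 2 from time reversal, times the 4 from Doob. Indices outside I
  contribute no differences, so \<open>card I\<close> stands in place of n; this makes the bound
  small for sparse index sets such as the gaps between blocks.\<close>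

lemma integral_maxsum_cinc_sq:
 fixes D :: real
 assumes f [measurable]: "!!i. f i \<in> borel_measurable \<nu>" and fK: "!!i x. \<bar>f i x\<bar> <= K"
  and I: "I \<subseteq> {1..n}" "!!i. i \<notin> I ==> f i = (\<lambda>_. 0)" and D: "!!i. i \<in> I ==> dep (f i) l <= D"
 shows "(\<integral>z. (maxsum (\<lambda>i. cinc (f i) l) n z)^2 \<partial>\<pi>) <= 16 * card I * D"
proof -
 define d where "d = (\<lambda>j z. cinc (f (n - j)) l (lag (int (n - j)) z))"
 have md: "pi.mart_diff d n (2 * K)" unfolding d_def by (rule mart_diff_cinc[OF f fK])
 note [measurable] = pi.measurable_psum[OF md]
 let ?r = "\<lambda>z. rmax (\<lambda>k. \<bar>pi.psum d k z\<bar>) n"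
 have rb: "\<bar>(?r z)\<^sup>2\<bar> <= (n * (2 * K))^2" for z
 proof -
  have "\<bar>pi.psum d k z\<bar> <= n * (2 * K)" if "k <= n" for k
   by (rule pi.psum_bound'[OF md that])
  then have "?r z <= n * (2 * K)" by (rule rmax_leI)
  then show ?thesis using power_mono[of "?r z" "n * (2 * K)" 2] rmax_nonneg[of "\<lambda>k. \<bar>pi.psum d k z\<bar>" n] by simp
 qed
 have "(\<integral>z. (maxsum (\<lambda>i. cinc (f i) l) n z)^2 \<partial>\<pi>) <= (\<integral>z. 4 * (?r z)^2 \<partial>\<pi>)"
 proof (rule lint_mono)
  show "integrable \<pi> (\<lambda>z. (maxsum (\<lambda>i. cinc (f i) l) n z)^2)"
   by (rule pi.bounded_integrable[OF _ maxsum_sq_bound[OF cinc_bound[OF fK]]]) measurable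
  show "integrable \<pi> (\<lambda>z. 4 * (?r z)^2)"
   by (intro integrable_mult_right pi.bounded_integrable[OF _ rb]) measurable
  show "(maxsum (\<lambda>i. cinc (f i) l) n z)^2 <= 4 * (?r z)^2" for z
   using power_mono[OF maxsum_cinc_le[of f l n z] maxsum_nonneg, of 2] by (simp add: d_def power_mult_distrib)
 qed
 also have "\<dots> <= 4 * (4 * (\<Sum>k<n. \<integral>z. (d k z)^2 \<partial>\<pi>))"
  using pi.integral_rmax_psum_sq[OF md order_refl] by simp
 also have "(\<Sum>k<n. \<integral>z. (d k z)^2 \<partial>\<pi>) = (\<Sum>i=1..n. \<integral>z. (cinc (f i) l (lag (int i) z))^2 \<partial>\<pi>)"
  unfolding d_def by (rule sum.reindex_bij_witness[of _ "\<lambda>i. n - i" "\<lambda>j. n - j"]) auto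
 also have "\<dots> = (\<Sum>i=1..n. \<integral>x. (cinc (f i) l x)^2 \<partial>\<nu>)"
  by (intro sum.cong refl integral_lag) measurable
 also have "\<dots> = (\<Sum>i\<in>I. \<integral>x. (cinc (f i) l x)^2 \<partial>\<nu>)"
  using I by (intro sum.mono_neutral_right) (auto simp: cinc_zero)
 also have "\<dots> <= (\<Sum>i\<in>I. D)"
  by (intro sum_mono order_trans[OF cinc_sq_le_dep[OF f fK] D])
 finally show ?thesis by simp
qed

text \<open>The difference of projections telescopes into lags L <= l < R. Each lag has second
  moment at most 16 \<open>card I\<close> (D l)^2, and \<open>weighted_Cauchy_Schwarz\<close> with
  weights D l recombines them into the square of the sum of the D l.\<close>

lemma integral_maxsum_proj_sq:
 fixes S :: real
 assumes f [measurable]: "!!i. f i \<in> borel_measurable \<nu>" and fK: "!!i x. \<bar>f i x\<bar> <= K"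
  and I: "I \<subseteq> {1..n}" "!!i. i \<notin> I ==> f i = (\<lambda>_. 0)" and D: "!!i l. i \<in> I ==> dep (f i) l <= (D l)^2"
  and D0: "!!l. D l > 0" and LR: "L <= R" and DS: "(\<Sum>l\<in>{L..<R}. D l) <= S"
 shows "(\<integral>z. (maxsum (\<lambda>i x. proj (f i) R x - proj (f i) L x) n z)^2 \<partial>\<pi>) <= 16 * card I * S^2"
proof -
 let ?m = "\<lambda>l z. maxsum (\<lambda>i. cinc (f i) l) n z" and ?p = "\<lambda>i x. proj (f i) R x - proj (f i) L x"
 have le: "maxsum ?p n z <= (\<Sum>l\<in>{L..<R}. ?m l z)" for z
 proof (rule maxsum_leI)
  fix k assume "k <= n"
  have "?p i x = (\<Sum>l\<in>{L..<R}. cinc (f i) l x)" for i x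
   unfolding cinc_def using sum_Suc_diff'[OF LR, of "\<lambda>l. proj (f i) l x"] by simp
  then have "lagsum ?p k z = (\<Sum>l\<in>{L..<R}. lagsum (\<lambda>i. cinc (f i) l) k z)"
   unfolding lagsum_def by (subst sum.swap) simp
  also have "\<bar>\<dots>\<bar> <= (\<Sum>l\<in>{L..<R}. \<bar>lagsum (\<lambda>i. cinc (f i) l) k z\<bar>)" by (rule sum_abs)
  also have "\<dots> <= (\<Sum>l\<in>{L..<R}. ?m l z)" by (intro sum_mono lagsum_le_maxsum \<open>k <= n\<close>)
  finally show "\<bar>lagsum ?p k z\<bar> <= (\<Sum>l\<in>{L..<R}. ?m l z)" .
 qed
 have pK: "\<bar>?p i x\<bar> <= 2 * K" for i x
  using proj_bound[of "f i" K R x] proj_bound[of "f i" K L x] fK by fastforce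
 have int: "integrable \<pi> (\<lambda>z. (?m l z)^2)" for l
  by (rule pi.bounded_integrable[OF _ maxsum_sq_bound[OF cinc_bound[OF fK]]]) measurable
 have "(\<integral>z. (maxsum ?p n z)^2 \<partial>\<pi>) <= (\<integral>z. (\<Sum>l\<in>{L..<R}. D l) * (\<Sum>l\<in>{L..<R}. (?m l z)^2 / D l) \<partial>\<pi>)"
 proof (rule lint_mono)
  show "integrable \<pi> (\<lambda>z. (maxsum ?p n z)^2)"
   by (rule pi.bounded_integrable[OF _ maxsum_sq_bound[OF pK]]) measurable
  show "integrable \<pi> (\<lambda>z. (\<Sum>l\<in>{L..<R}. D l) * (\<Sum>l\<in>{L..<R}. (?m l z)^2 / D l))"
   using int by (intro integrable_mult_right Bochner_Integration.integrable_sum) simp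
  show "(maxsum ?p n z)^2 <= (\<Sum>l\<in>{L..<R}. D l) * (\<Sum>l\<in>{L..<R}. (?m l z)^2 / D l)" for z
   using power_mono[OF le maxsum_nonneg, of z 2] weighted_Cauchy_Schwarz[of "{L..<R}" D "\<lambda>l. ?m l z"] D0
   by (meson order_trans)
 qed
 also have "\<dots> = (\<Sum>l\<in>{L..<R}. D l) * (\<Sum>l\<in>{L..<R}. (\<integral>z. (?m l z)^2 \<partial>\<pi>) / D l)"
  using int by simp
 also have "\<dots> <= (\<Sum>l\<in>{L..<R}. D l) * (\<Sum>l\<in>{L..<R}. (16 * card I * (D l)^2) / D l)"
 proof (intro mult_left_mono sum_mono divide_right_mono)
  show "(\<integral>z. (?m l z)^2 \<partial>\<pi>) <= 16 * card I * (D l)^2" for l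
   by (rule integral_maxsum_cinc_sq[OF f fK I D])
 qed (use D0 in \<open>auto intro!: sum_nonneg simp: less_imp_le\<close>)
 also have "\<dots> = 16 * card I * (\<Sum>l\<in>{L..<R}. D l)^2"
 proof -
  have "(16 * card I * (D l)^2) / D l = 16 * card I * D l" for l
   using D0[of l] by (simp add: power2_eq_square)
  then show ?thesis by (simp add: power2_eq_square flip: sum_distrib_left)
 qed
 also have "\<dots> <= 16 * card I * S^2"
  using D0 by (intro mult_left_mono power_mono DS sum_nonneg) (auto simp: less_imp_le)
 finally show ?thesis .
qed

lemma maxsum_diff: "maxsum f n z <= maxsum g n z + (\<Sum>i=1..n. \<bar>f i (lag (int i) z) - g i (lag (int i) z)\<bar>)"
proof (rule maxsum_leI)
 fix k assume k: "k <= n"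
 have "\<bar>lagsum f k z\<bar> <= \<bar>lagsum g k z\<bar> + \<bar>lagsum f k z - lagsum g k z\<bar>" by simp
 also have "\<bar>lagsum f k z - lagsum g k z\<bar> <= (\<Sum>i=1..k. \<bar>f i (lag (int i) z) - g i (lag (int i) z)\<bar>)"
  unfolding lagsum_def sum_subtractf[symmetric] by (rule sum_abs)
 also have "\<dots> <= (\<Sum>i=1..n. \<bar>f i (lag (int i) z) - g i (lag (int i) z)\<bar>)"
  using k by (intro sum_mono2) auto
 finally show "\<bar>lagsum f k z\<bar> <= maxsum g n z + (\<Sum>i=1..n. \<bar>f i (lag (int i) z) - g i (lag (int i) z)\<bar>)"
  using lagsum_le_maxsum[OF k, of g z] by linarith
qed

text \<open>R tends to infinity in \<open>integral_maxsum_proj_sq\<close> for fixed n. Both maxima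
  are at most 2 n K, so their squares differ by at most 4 n K times a sum of L1 errors of
  projections, which vanishes by \<open>proj_tendsto_L1\<close>.\<close>

lemma integral_maxsum_sq_bounded:
 fixes S :: real
 assumes f [measurable]: "!!i. f i \<in> borel_measurable \<nu>" and fK: "!!i x. \<bar>f i x\<bar> <= K"
  and I: "I \<subseteq> {1..n}" "!!i. i \<notin> I ==> f i = (\<lambda>_. 0)" and D: "!!i l. i \<in> I ==> dep (f i) l <= (D l)^2"
  and D0: "!!l. D l > 0" and DS: "!!R. (\<Sum>l\<in>{L..<R}. D l) <= S"
 shows "integrable \<pi> (\<lambda>z. (maxsum (\<lambda>i x. f i x - proj (f i) L x) n z)^2)"
  "(\<integral>z. (maxsum (\<lambda>i x. f i x - proj (f i) L x) n z)^2 \<partial>\<pi>) <= 16 * card I * S^2"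
proof -
 let ?e = "\<lambda>R. \<Sum>i=1..n. \<integral>x. \<bar>proj (f i) R x - f i x\<bar> \<partial>\<nu>" and ?f = "\<lambda>i x. f i x - proj (f i) L x"
 let ?p = "\<lambda>R i x. proj (f i) R x - proj (f i) L x"
 have b: "\<bar>f i x - proj (f i) R x\<bar> <= 2 * K" "\<bar>?p R i x\<bar> <= 2 * K" for i R x
  using proj_bound[of "f i" K R x] proj_bound[of "f i" K L x] fK[of i x] fK by fastforce+
 show intf: "integrable \<pi> (\<lambda>z. (maxsum ?f n z)^2)"
  by (rule pi.bounded_integrable[OF _ maxsum_sq_bound[OF b(1)]]) measurable
 have "(\<integral>z. (maxsum ?f n z)^2 \<partial>\<pi>) <= 16 * card I * S^2 + 4 * (n * K) * ?e R" if LR: "L <= R" for R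
 proof -
  have int1: "integrable \<pi> (\<lambda>z. (maxsum (?p R) n z)^2)"
   by (rule pi.bounded_integrable[OF _ maxsum_sq_bound[OF b(2)]]) measurable
  have int2: "integrable \<pi> (\<lambda>z. \<bar>f i (lag (int i) z) - proj (f i) R (lag (int i) z)\<bar>)" for i
   by (rule pi.bounded_integrable[of _ "2 * K"], measurable) (use b(1) in simp)
  have "(\<integral>z. (maxsum ?f n z)^2 \<partial>\<pi>) <= (\<integral>z. (maxsum (?p R) n z)^2 +
    4 * (n * K) * (\<Sum>i=1..n. \<bar>f i (lag (int i) z) - proj (f i) R (lag (int i) z)\<bar>) \<partial>\<pi>)"
  proof (rule lint_mono)
   fix z
   let ?a = "maxsum ?f n z" and ?b = "maxsum (?p R) n z"
   let ?s = "\<Sum>i=1..n. \<bar>f i (lag (int i) z) - proj (f i) R (lag (int i) z)\<bar>"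
   have s: "?a - ?b <= ?s" using maxsum_diff[of ?f n z "?p R"] by simp
   have ab: "?a + ?b <= 4 * (n * K)" "0 <= ?a + ?b"
    using maxsum_bound[of ?f, OF b(1), of n z] maxsum_bound[of "?p R", OF b(2), of n z]
     maxsum_nonneg[of ?f n z] maxsum_nonneg[of "?p R" n z] by auto
   have s0: "0 <= ?s" by (intro sum_nonneg) auto
   have "?a^2 - ?b^2 = (?a + ?b) * (?a - ?b)" by (simp add: power2_eq_square algebra_simps)
   also have "\<dots> <= (?a + ?b) * ?s" by (rule mult_left_mono[OF s ab(2)])
   also have "\<dots> <= 4 * (n * K) * ?s" by (rule mult_right_mono[OF ab(1) s0])
   finally show "?a^2 <= ?b^2 + 4 * (n * K) * ?s" by simp
  qed (use intf int1 int2 in auto)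
  also have "\<dots> = (\<integral>z. (maxsum (?p R) n z)^2 \<partial>\<pi>) +
    4 * (n * K) * (\<Sum>i=1..n. \<integral>z. \<bar>f i (lag (int i) z) - proj (f i) R (lag (int i) z)\<bar> \<partial>\<pi>)"
   using int1 int2 by simp
  also have "(\<Sum>i=1..n. \<integral>z. \<bar>f i (lag (int i) z) - proj (f i) R (lag (int i) z)\<bar> \<partial>\<pi>) = ?e R"
   by (intro sum.cong refl, subst integral_lag) (auto simp: abs_minus_commute)
  also have "(\<integral>z. (maxsum (?p R) n z)^2 \<partial>\<pi>) <= 16 * card I * S^2"
   by (rule integral_maxsum_proj_sq[OF f fK I D D0 LR DS])
  finally show ?thesis by simp
 qed
 moreover have "(\<lambda>R. 16 * card I * S^2 + 4 * (n * K) * ?e R) \<longlonglongrightarrow> 16 * card I * S^2 + 4 * (n * K) * (\<Sum>i=1..n. 0)"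
  by (intro tendsto_intros proj_tendsto_L1[OF f fK])
 ultimately have "(\<integral>z. (maxsum ?f n z)^2 \<partial>\<pi>) <= 16 * card I * S^2 + 4 * (n * K) * (\<Sum>i=1..n. 0)"
  by (intro LIMSEQ_le_const) auto
 then show "(\<integral>z. (maxsum ?f n z)^2 \<partial>\<pi>) <= 16 * card I * S^2" by simp
qed

end

section \<open>Truncation and square-integrable functions\<close>

definition clip :: "real => real => real" where
 "clip R v = max (- R) (min R v)"

lemma clip_bound: "0 <= R ==> \<bar>clip R v\<bar> <= R"
 by (auto simp: clip_def)

lemma clip_le: "0 <= R ==> \<bar>clip R v\<bar> <= \<bar>v\<bar>"
 by (auto simp: clip_def)

lemma clip_diff: "\<bar>clip R u - clip R v\<bar> <= \<bar>u - v\<bar>"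
 by (auto simp: clip_def)

lemma clip_id: "\<bar>v\<bar> <= R ==> clip R v = v"
 by (auto simp: clip_def)

lemma measurable_clip [measurable]: "clip R \<in> borel_measurable borel"
 unfolding clip_def by measurable

lemma tendsto_clip: "(\<lambda>R. clip (real R) v) \<longlonglongrightarrow> v"
proof (rule tendsto_eventually)
 show "\<forall>\<^sub>F R in sequentially. clip (real R) v = v"
  using eventually_ge_at_top[of "nat \<lceil>\<bar>v\<bar>\<rceil>"] by eventually_elim (auto intro!: clip_id simp: nat_le_iff ceiling_le_iff)
qed

lemma square_diff_le: "(a - b)^2 <= 2 * a^2 + 2 * (b::real)^2"
 using sum_squares_bound[of a "- b"] by (simp add: power2_eq_square algebra_simps)

context innovations
begin

lemma distr_pair_snd_law:
 "distr (\<mu> \<Otimes>\<^sub>M \<nu>) \<nu> snd = \<nu>"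
proof (rule measure_eqI)
 fix A assume "A \<in> sets (distr (\<mu> \<Otimes>\<^sub>M \<nu>) \<nu> snd)"
 then have A [measurable]: "A \<in> sets \<nu>" by simp
 have "snd -` A \<inter> space (\<mu> \<Otimes>\<^sub>M \<nu>) = space \<mu> \<times> A"
  using sets.sets_into_space[OF A] by (auto simp: space_pair_measure)
 then show "emeasure (distr (\<mu> \<Otimes>\<^sub>M \<nu>) \<nu> snd) A = emeasure \<nu> A"
  by (simp add: emeasure_distr nu.P.emeasure_pair_measure_Times emeasure_space_1)
qed simp

lemma integrable_pair:
 fixes g :: "(nat => 'e) => real"
 assumes "integrable \<nu> g"
 shows "integrable (\<mu> \<Otimes>\<^sub>M \<nu>) (\<lambda>p. g (snd p))" "integrable (\<mu> \<Otimes>\<^sub>M \<nu>) (\<lambda>p. g ((snd p)(l := fst p)))"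
  "(\<integral>p. g (snd p) \<partial>(\<mu> \<Otimes>\<^sub>M \<nu>)) = (\<integral>x. g x \<partial>\<nu>)"
  "(\<integral>p. g ((snd p)(l := fst p)) \<partial>(\<mu> \<Otimes>\<^sub>M \<nu>)) = (\<integral>x. g x \<partial>\<nu>)"
proof -
 have [measurable]: "g \<in> borel_measurable \<nu>" using assms by auto
 have 1: "distr (\<mu> \<Otimes>\<^sub>M \<nu>) \<nu> (\<lambda>p. (snd p)(l := fst p)) = \<nu>"
  using distr_PiM_UNIV_upd[OF prob_space_axioms, of l] by (simp add: split_beta')
 show "integrable (\<mu> \<Otimes>\<^sub>M \<nu>) (\<lambda>p. g (snd p))"
  using assms by (subst (asm) distr_pair_snd_law[symmetric], subst (asm) integrable_distr_eq) auto
 show "integrable (\<mu> \<Otimes>\<^sub>M \<nu>) (\<lambda>p. g ((snd p)(l := fst p)))"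
  using assms by (subst (asm) 1[symmetric], subst (asm) integrable_distr_eq) auto
 show "(\<integral>p. g (snd p) \<partial>(\<mu> \<Otimes>\<^sub>M \<nu>)) = (\<integral>x. g x \<partial>\<nu>)"
  by (subst (2) distr_pair_snd_law[symmetric], subst integral_distr) auto
 show "(\<integral>p. g ((snd p)(l := fst p)) \<partial>(\<mu> \<Otimes>\<^sub>M \<nu>)) = (\<integral>x. g x \<partial>\<nu>)"
 proof -
  have "(\<integral>x. g x \<partial>\<nu>) = (\<integral>x. g x \<partial>distr (\<mu> \<Otimes>\<^sub>M \<nu>) \<nu> (\<lambda>p. (snd p)(l := fst p)))" by (simp only: 1)
  then show ?thesis by (simp add: integral_distr)
 qed
qed

definition sq_int :: "((nat => 'e) => real) => bool" where
 "sq_int f \<longleftrightarrow> f \<in> borel_measurable \<nu> \<and> integrable \<nu> (\<lambda>x. (f x)^2)"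

lemma sq_intD [measurable_dest]: "sq_int f ==> f \<in> borel_measurable \<nu>"
 and sq_int_sq: "sq_int f ==> integrable \<nu> (\<lambda>x. (f x)^2)"
 by (auto simp: sq_int_def)

lemma sq_int_integrable: "sq_int f ==> integrable \<nu> f"
 unfolding sq_int_def by (auto intro: nu.P.square_integrable_imp_integrable)

lemma sq_int_bounded: "f \<in> borel_measurable \<nu> ==> (!!x. \<bar>f x\<bar> <= K) ==> sq_int f"
 unfolding sq_int_def
 by (auto intro!: nu.P.integrable_const_bound[of _ "K^2"] AE_I2 simp: abs_le_square_iff[symmetric] order_trans[OF _ abs_ge_self])

lemma sq_int_diff: "sq_int f ==> sq_int g ==> sq_int (\<lambda>x. f x - g x)"
proof -
 assume fg: "sq_int f" "sq_int g"
 have "integrable \<nu> (\<lambda>x. (f x - g x)^2)"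
 proof (rule integrable_bd)
  show "integrable \<nu> (\<lambda>x. 2 * (f x)^2 + 2 * (g x)^2)" using fg by (simp add: sq_int_def)
 qed (use fg square_diff_le in \<open>auto simp: sq_int_def\<close>)
 then show ?thesis using fg by (auto simp: sq_int_def)
qed

lemma sq_int_const: "sq_int (\<lambda>_. c)"
 by (rule sq_int_bounded[of _ "\<bar>c\<bar>"]) auto

lemma dep_integrable:
 assumes "sq_int f"
 shows "integrable (\<mu> \<Otimes>\<^sub>M \<nu>) (\<lambda>(y, x). (f x - f (x(l := y)))^2)"
proof (rule integrable_bd)
 note [measurable] = sq_intD[OF assms]
 show "integrable (\<mu> \<Otimes>\<^sub>M \<nu>) (\<lambda>p. 2 * (f (snd p))^2 + 2 * (f ((snd p)(l := fst p)))^2)"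
  using integrable_pair(1,2)[OF sq_int_sq[OF assms]] by simp
 show "(\<lambda>(y, x). (f x - f (x(l := y)))^2) \<in> borel_measurable (\<mu> \<Otimes>\<^sub>M \<nu>)" by measurable
qed (use square_diff_le in \<open>auto simp: split_beta'\<close>)

text \<open>Serves for functions that are small in L2, such as the clipping error: every single
  coefficient is then small.\<close>

lemma dep_le_4_norm:
 assumes f: "sq_int f"
 shows "dep f l <= 4 * (\<integral>x. (f x)^2 \<partial>\<nu>)"
proof -
 have "dep f l <= (\<integral>p. 2 * (f (snd p))^2 + 2 * (f ((snd p)(l := fst p)))^2 \<partial>(\<mu> \<Otimes>\<^sub>M \<nu>))"
  unfolding dep_def using dep_integrable[OF f] integrable_pair(1,2)[OF sq_int_sq[OF f]] square_diff_le
  by (intro lint_mono) (auto simp: split_beta')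
 also have "\<dots> = 4 * (\<integral>x. (f x)^2 \<partial>\<nu>)"
  using integrable_pair[OF sq_int_sq[OF f]] by simp
 finally show ?thesis .
qed

text \<open>Made for clipping, which is a contraction and so cannot increase the dependence on any
  coordinate.\<close>

lemma dep_mono:
 assumes g: "sq_int g" and f: "sq_int f" and le: "!!x x'. \<bar>f x - f x'\<bar> <= \<bar>g x - g x'\<bar>"
 shows "dep f l <= dep g l"
 unfolding dep_def using dep_integrable[OF g] dep_integrable[OF f] le
 by (intro lint_mono) (auto simp: split_beta' simp flip: abs_le_square_iff)

lemma dep_diff_le:
 assumes g: "sq_int g" and f: "sq_int f"
 shows "dep (\<lambda>x. f x - g x) l <= 2 * dep f l + 2 * dep g l"
proof -
 have "dep (\<lambda>x. f x - g x) l <= (\<integral>p. 2 * (case p of (y, x) => (f x - f (x(l := y)))\<^sup>2) + 2 * (case p of (y, x) => (g x - g (x(l := y)))\<^sup>2) \<partial>(\<mu> \<Otimes>\<^sub>M \<nu>))"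
  unfolding dep_def
 proof (rule lint_mono)
  fix p :: "'e \<times> (nat => 'e)"
  obtain y x where p: "p = (y, x)" by force
  have "f x - g x - (f (x(l := y)) - g (x(l := y))) = (f x - f (x(l := y))) - (g x - g (x(l := y)))" by simp
  then show "(case p of (y, x) => (f x - g x - (f (x(l := y)) - g (x(l := y))))\<^sup>2) <=
   2 * (case p of (y, x) => (f x - f (x(l := y)))\<^sup>2) + 2 * (case p of (y, x) => (g x - g (x(l := y)))\<^sup>2)"
   unfolding p prod.case by (simp only: square_diff_le)
 qed (use dep_integrable[OF g] dep_integrable[OF f] dep_integrable[OF sq_int_diff[OF f g]] in auto)
 also have "\<dots> = 2 * dep f l + 2 * dep g l"
  unfolding dep_def using dep_integrable[OF g] dep_integrable[OF f] by simp
 finally show ?thesis .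
qed

lemma dep_shift: "dep (\<lambda>x. f x - c) l = dep f l"
 by (simp add: dep_def)

lemma sq_int_clip: "sq_int f ==> 0 <= R ==> sq_int (\<lambda>x. clip R (f x))"
 by (rule sq_int_bounded[of _ R]) (auto intro!: clip_bound dest: sq_intD)

text \<open>The bounded case is applied to f clipped at R and recentred, and R tends to infinity.
  \<open>W\<close> dominates all the squared maxima at once, because a clipped and recentred
  function is at most |f| + E|f|.\<close>

theorem integral_maxsum_sq:
 fixes S :: real
 assumes f: "!!i. sq_int (f i)" and mean: "!!i. (\<integral>x. f i x \<partial>\<nu>) = 0"
  and I: "I \<subseteq> {1..n}" "!!i. i \<notin> I ==> f i = (\<lambda>_. 0)" and D: "!!i l. i \<in> I ==> dep (f i) l <= (D l)^2"
  and D0: "!!l. D l > 0" and DS: "!!R. (\<Sum>l<R. D l) <= S"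
 shows "integrable \<pi> (\<lambda>z. (maxsum f n z)^2)" "(\<integral>z. (maxsum f n z)^2 \<partial>\<pi>) <= 16 * card I * S^2"
proof -
 note [measurable] = sq_intD[OF f]
 define g where "g R i x = clip (real R) (f i x) - (\<integral>x. clip (real R) (f i x) \<partial>\<nu>)" for R :: nat and i x
 define B where "B i x = \<bar>f i x\<bar> + (\<integral>x. \<bar>f i x\<bar> \<partial>\<nu>)" for i x
 have int: "integrable \<nu> (f i)" "integrable \<nu> (\<lambda>x. clip (real R) (f i x))" for R :: nat and i
  using f sq_int_clip[OF f, of "real R" i] by (auto intro: sq_int_integrable)
 have [measurable]: "g R i \<in> borel_measurable \<nu>" for R i unfolding g_def by measurable
 have gB: "\<bar>g R i x\<bar> <= B i x" for R i x
 proof -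
  have "\<bar>\<integral>x. clip (real R) (f i x) \<partial>\<nu>\<bar> <= (\<integral>x. \<bar>f i x\<bar> \<partial>\<nu>)"
   by (rule order_trans[OF Bochner_Integration.integral_abs_bound])
     (intro lint_mono integrable_abs int clip_le, simp)
  moreover have "\<bar>clip (real R) (f i x)\<bar> <= \<bar>f i x\<bar>" by (rule clip_le) simp
  ultimately show ?thesis unfolding g_def B_def by linarith
 qed
 have gD: "dep (\<lambda>x. clip (real R) (f i x)) l <= (D l)^2" if "i \<in> I" for R :: nat and i l
  using dep_mono[OF f sq_int_clip[OF f] clip_diff, of "real R" i l] D[OF that, of l] by simp
 \<comment> \<open>With L = 0 the subtracted projection is the mean, that is, exactly the recentring
   in \<open>g\<close>.\<close>
 have bound: "(\<integral>z. (maxsum (g R) n z)^2 \<partial>\<pi>) <= 16 * card I * S^2" for R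
  using integral_maxsum_sq_bounded(2)[of "\<lambda>i x. clip (real R) (f i x)" R I n D 0 S, OF _ _ I(1) _ gD D0] DS I(2) clip_bound[of "real R"]
  by (simp add: proj_0 g_def[abs_def] atLeast0LessThan clip_def)
 have glim: "(\<lambda>R. g R i x) \<longlonglongrightarrow> f i x" for i x
 proof -
  have "(\<lambda>R. \<integral>x. clip (real R) (f i x) \<partial>\<nu>) \<longlonglongrightarrow> (\<integral>x. f i x \<partial>\<nu>)"
   by (rule integral_dominated_convergence[where w = "\<lambda>x. \<bar>f i x\<bar>"])
     (auto intro!: integrable_abs int tendsto_clip clip_le)
  from tendsto_diff[OF tendsto_clip[of "f i x"] this] show ?thesis by (simp add: g_def mean)
 qed
 define W where "W z = n * (\<Sum>i=1..n. (B i (lag (int i) z))^2)" for z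
 have B: "sq_int (B i)" for i
 proof -
  have "sq_int (\<lambda>x. \<bar>f i x\<bar>)" using f[of i] by (auto simp: sq_int_def)
  from sq_int_diff[OF this sq_int_const[of "- (\<integral>x. \<bar>f i x\<bar> \<partial>\<nu>)"]] show ?thesis by (simp add: B_def[abs_def])
 qed
 note [measurable] = sq_intD[OF B]
 have W: "integrable \<pi> W"
  unfolding W_def
 proof (intro integrable_mult_right Bochner_Integration.integrable_sum)
  show "integrable \<pi> (\<lambda>z. (B i (lag (int i) z))^2)" for i
   using integrable_lag[of "\<lambda>x. (B i x)^2" "int i"] sq_int_sq[OF B[of i]] by simp
 qed
 have mW: "(maxsum u n z)^2 <= W z" if "!!i x. \<bar>u i x\<bar> <= B i x" for u z
 proof -
  have "maxsum u n z <= (\<Sum>i=1..n. B i (lag (int i) z))"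
   by (rule order_trans[OF maxsum_le_sum]) (intro sum_mono that)
  then have "(maxsum u n z)^2 <= (\<Sum>i=1..n. B i (lag (int i) z))^2"
   by (intro power_mono maxsum_nonneg)
  also have "\<dots> <= W z"
   using weighted_Cauchy_Schwarz[of "{1..n}" "\<lambda>_. 1" "\<lambda>i. B i (lag (int i) z)"] by (simp add: W_def)
  finally show ?thesis .
 qed
 have fB: "\<bar>f i x\<bar> <= B i x" for i x
  unfolding B_def by (simp add: lint_nonneg)
 show "integrable \<pi> (\<lambda>z. (maxsum f n z)^2)"
  by (rule integrable_bd[OF W]) (use mW[of f, OF fB] in \<open>auto intro: order_trans[OF _ abs_ge_self]\<close>)
 have "(\<lambda>R. \<integral>z. (maxsum (g R) n z)^2 \<partial>\<pi>) \<longlonglongrightarrow> (\<integral>z. (maxsum f n z)^2 \<partial>\<pi>)"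
 proof (rule integral_dominated_convergence[OF _ _ W])
  show "AE z in \<pi>. (\<lambda>R. (maxsum (g R) n z)^2) \<longlonglongrightarrow> (maxsum f n z)\<^sup>2"
   unfolding maxsum_def lagsum_def
   by (intro AE_I2 tendsto_power tendsto_rmax tendsto_rabs tendsto_sum glim)
  show "AE z in \<pi>. norm ((maxsum (g R) n z)^2) <= W z" for R
   using mW[of "g R", OF gB] by simp
 qed measurable
 then show "(\<integral>z. (maxsum f n z)^2 \<partial>\<pi>) <= 16 * card I * S^2"
  by (rule LIMSEQ_le_const2) (use bound in auto)
qed

text \<open>The maximal inequality for a single time point; its constant is 16 = 4^2.\<close>

lemma proj_tail_sq:
 assumes f [measurable]: "f \<in> borel_measurable \<nu>" and fK: "!!x. \<bar>f x\<bar> <= K"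
  and D: "!!l. dep f l <= (D l)^2" and D0: "!!l. D l > 0" and DS: "!!R. (\<Sum>l\<in>{L..<R}. D l) <= S"
 shows "(\<integral>x. (f x - proj f L x)^2 \<partial>\<nu>) <= (4 * S)^2"
proof -
 let ?f = "\<lambda>i. if i = 1 then f else (\<lambda>_. 0)" and ?g = "\<lambda>x. f x - proj f L x"
 have fm: "?f i \<in> borel_measurable \<nu>" "\<bar>?f i x\<bar> <= K" for i :: nat and x
  using fK[of x] order_trans[OF abs_ge_zero fK] by auto
 note m = integral_maxsum_sq_bounded[of ?f K "{1}" 1 D L S, OF fm _ _ _ D0 DS]
 have gK: "\<bar>?g x\<bar> <= 2 * K" for x using proj_diff_bound[of f K L x, OF fK] by (simp add: abs_minus_commute)
 have "(\<integral>x. (?g x)^2 \<partial>\<nu>) = (\<integral>z. (?g (lag 1 z))^2 \<partial>\<pi>)" by (rule integral_lag[symmetric]) measurable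
 also have "\<dots> <= (\<integral>z. (maxsum (\<lambda>i x. ?f i x - proj (?f i) L x) 1 z)^2 \<partial>\<pi>)"
 proof (rule lint_mono)
  show "integrable \<pi> (\<lambda>z. (?g (lag 1 z))^2)"
   using power_mono[OF gK abs_ge_zero, of _ 2] by (intro pi.bounded_integrable[of _ "(2 * K)^2"]) auto
  show "integrable \<pi> (\<lambda>z. (maxsum (\<lambda>i x. ?f i x - proj (?f i) L x) 1 z)^2)" using m(1) D by auto
  show "(?g (lag 1 z))^2 <= (maxsum (\<lambda>i x. ?f i x - proj (?f i) L x) 1 z)^2" for z
   using power_mono[OF lagsum_le_maxsum[of 1 1 "\<lambda>i x. ?f i x - proj (?f i) L x" z] abs_ge_zero, of 2] by (simp add: lagsum_def)
 qed
 also have "\<dots> <= (4 * S)^2" using m(2) D by (auto simp: power_mult_distrib)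
 finally show ?thesis .
qed

section \<open>Fourth moments of increments\<close>

lemma power4_sum_le: "(\<Sum>l<R. a l) ^ 4 <= real R ^ 3 * (\<Sum>l<R. (a l :: real) ^ 4)"
proof -
 have cs: "(\<Sum>l<R. b l)^2 <= real R * (\<Sum>l<R. (b l)^2)" for b :: "nat => real"
  using weighted_Cauchy_Schwarz[of "{..<R}" "\<lambda>_. 1" b] by simp
 have "(\<Sum>l<R. a l) ^ 4 = ((\<Sum>l<R. a l)^2)^2" by (simp flip: power_mult)
 also have "\<dots> <= (real R * (\<Sum>l<R. (a l)^2))^2" by (intro power_mono cs) simp
 also have "\<dots> = (real R)^2 * (\<Sum>l<R. (a l)^2)^2" by (simp add: power_mult_distrib)
 also have "\<dots> <= (real R)^2 * (real R * (\<Sum>l<R. ((a l)^2)^2))" by (intro mult_left_mono cs) simp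
 finally show ?thesis by (simp add: power2_eq_square power3_eq_cube power4_eq_xxxx mult.assoc)
qed

text \<open>The bound is quadratic in the number N of terms: for M stretches of length n / M it adds
  up to order n^2 / M, which is what tightness needs. The constant 11264 is 16 times 44 times 16,
  from the factor 2 of time reversal, from \<open>integral_rmax_psum_pow4\<close> and from
  differences bounded by 2 K; R^4 comes from adding R lags.\<close>

lemma integral_max_increment_pow4:
 fixes R :: nat
 assumes f [measurable]: "!!i. f i \<in> borel_measurable \<nu>" and fK: "!!i x. \<bar>f i x\<bar> <= K"
 defines "g \<equiv> (\<lambda>i x. proj (f i) R x - proj (f i) 0 x)"
 shows "integrable \<pi> (\<lambda>z. (rmax (\<lambda>k. \<bar>lagsum g (a + k) z - lagsum g a z\<bar>) N) ^ 4)"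
  "(\<integral>z. (rmax (\<lambda>k. \<bar>lagsum g (a + k) z - lagsum g a z\<bar>) N) ^ 4 \<partial>\<pi>)
  <= 11264 * real R ^ 4 * K ^ 4 * (real N)^2"
proof -
 define d where "d l = (\<lambda>j z. cinc (f (a + N - j)) l (lag (int (a + N - j)) z))" for l
 have md: "pi.mart_diff (d l) N (2 * K)" for l
  using mart_diff_cinc[where f = f and K = K and n = "a + N" and l = l, OF f fK] unfolding pi.mart_diff_def d_def by auto
 have [measurable]: "g i \<in> borel_measurable \<nu>" for i unfolding g_def by measurable
 note [measurable] = pi.measurable_psum[OF md]
 let ?r = "\<lambda>l z. rmax (\<lambda>k. \<bar>pi.psum (d l) k z\<bar>) N"
 let ?x = "\<lambda>z. rmax (\<lambda>k. \<bar>lagsum g (a + k) z - lagsum g a z\<bar>) N"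
 have K0: "0 <= K" using fK[of 0 undefined] by linarith
 have rb: "0 <= ?r l z" "?r l z <= N * (2 * K)" for l z
  by (rule rmax_nonneg, simp) (rule rmax_leI, rule pi.psum_bound'[OF md])
 have int: "integrable \<pi> (\<lambda>z. ?r l z ^ 4)" for l
  by (rule pi.bounded_integrable[of _ "(N * (2 * K)) ^ 4"], measurable)
    (auto simp: power_abs abs_of_nonneg[OF rb(1)] intro!: power_mono rb)
 have le: "?x z <= (\<Sum>l<R. 2 * ?r l z)" for z
 proof (rule rmax_leI)
  fix k assume k: "k <= N"
  have inc: "lagsum g (a + k) z - lagsum g a z = (\<Sum>i=1..k. g (a + i) (lag (int (a + i)) z))"
  proof -
   have "lagsum g (a + k) z = lagsum g a z + (\<Sum>i=a+1..a+k. g i (lag (int i) z))"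
    unfolding lagsum_def by (rule sum.ub_add_nat) simp
   also have "(\<Sum>i=a+1..a+k. g i (lag (int i) z)) = (\<Sum>i=1..k. g (a + i) (lag (int (a + i)) z))"
    by (rule sum.reindex_bij_witness[of _ "\<lambda>i. a + i" "\<lambda>i. i - a"]) auto
   finally show ?thesis by simp
  qed
  have "lagsum g (a + k) z - lagsum g a z =
    (\<Sum>l<R. \<Sum>i=1..k. cinc (f (a + i)) l (lag (int (a + i)) z))"
   unfolding inc by (subst sum.swap) (simp add: sum_cinc g_def proj_0)
  also have "\<dots> = (\<Sum>l<R. pi.psum (d l) N z - pi.psum (d l) (N - k) z)"
  proof (rule sum.cong[OF refl])
   fix l
   show "(\<Sum>i=1..k. cinc (f (a + i)) l (lag (int (a + i)) z)) = pi.psum (d l) N z - pi.psum (d l) (N - k) z"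
    using sum_cinc_reverse[OF k, of "\<lambda>i. cinc (f (a + i)) l (lag (int (a + i)) z)"]
    unfolding pi.psum_def d_def by simp
  qed
  also have "\<bar>\<dots>\<bar> <= (\<Sum>l<R. \<bar>pi.psum (d l) N z - pi.psum (d l) (N - k) z\<bar>)" by (rule sum_abs)
  also have "\<dots> <= (\<Sum>l<R. 2 * ?r l z)"
  proof (rule sum_mono)
   fix l
   have "\<bar>pi.psum (d l) N z - pi.psum (d l) (N - k) z\<bar> <= \<bar>pi.psum (d l) N z\<bar> + \<bar>pi.psum (d l) (N - k) z\<bar>"
    by (rule abs_triangle_ineq4)
   also have "\<dots> <= ?r l z + ?r l z" by (intro add_mono le_rmax[of _ N "\<lambda>k. \<bar>pi.psum (d l) k z\<bar>"]) auto
   finally show "\<bar>pi.psum (d l) N z - pi.psum (d l) (N - k) z\<bar> <= 2 * ?r l z" by simp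
  qed
  finally show "\<bar>lagsum g (a + k) z - lagsum g a z\<bar> <= (\<Sum>l<R. 2 * ?r l z)" .
 qed
 have x0: "0 <= ?x z" for z by (rule rmax_nonneg) simp
 have le4: "?x z ^ 4 <= real R ^ 3 * (\<Sum>l<R. 16 * ?r l z ^ 4)" for z
  using order_trans[OF power_mono[OF le x0] power4_sum_le, of z] by (simp add: power_mult_distrib)
 have int2: "integrable \<pi> (\<lambda>z. real R ^ 3 * (\<Sum>l<R. 16 * ?r l z ^ 4))" using int by auto
 show int3: "integrable \<pi> (\<lambda>z. ?x z ^ 4)"
 proof (rule integrable_bd[OF int2])
  show "AE z in \<pi>. norm (?x z ^ 4) <= norm (real R ^ 3 * (\<Sum>l<R. 16 * ?r l z ^ 4))"
   using le4 x0 by (intro AE_I2) (simp only: real_norm_def power_abs abs_of_nonneg[OF x0], meson abs_ge_self order_trans)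
 qed measurable
 have "(\<integral>z. ?x z ^ 4 \<partial>\<pi>) <= (\<integral>z. real R ^ 3 * (\<Sum>l<R. 16 * ?r l z ^ 4) \<partial>\<pi>)"
  by (rule lint_mono[OF int3 int2 le4])
 also have "\<dots> = real R ^ 3 * (\<Sum>l<R. 16 * (\<integral>z. ?r l z ^ 4 \<partial>\<pi>))" using int by simp
 also have "\<dots> <= real R ^ 3 * (\<Sum>l<R. 16 * (44 * (real N)^2 * (2 * K) ^ 4))"
  by (intro mult_left_mono sum_mono pi.integral_rmax_psum_pow4[OF md]) auto
 also have "\<dots> = 11264 * real R ^ 4 * K ^ 4 * (real N)^2"
  by (simp add: power_mult_distrib power3_eq_cube power4_eq_xxxx)
 finally show "(\<integral>z. ?x z ^ 4 \<partial>\<pi>) <= 11264 * real R ^ 4 * K ^ 4 * (real N)^2" .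
qed

end

section \<open>Covariances of lagged values\<close>

lemma integral_Cauchy_Schwarz:
 fixes u v :: "'a => real"
 assumes [measurable]: "u \<in> borel_measurable M" "v \<in> borel_measurable M"
  and u: "integrable M (\<lambda>x. (u x)^2)" and v: "integrable M (\<lambda>x. (v x)^2)"
 shows "integrable M (\<lambda>x. u x * v x)"
  "\<bar>\<integral>x. u x * v x \<partial>M\<bar> <= sqrt (\<integral>x. (u x)^2 \<partial>M) * sqrt (\<integral>x. (v x)^2 \<partial>M)"
proof -
 show uv: "integrable M (\<lambda>x. u x * v x)"
 proof (rule integrable_bd)
  show "integrable M (\<lambda>x. (u x)^2 + (v x)^2)" using u v by simp
  have "\<bar>a * b\<bar> <= a^2 + b^2" for a b :: real
  proof -
   have "2 * \<bar>a\<bar> * \<bar>b\<bar> <= a^2 + b^2" using sum_squares_bound[of "\<bar>a\<bar>" "\<bar>b\<bar>"] by simp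
   moreover have "0 <= \<bar>a\<bar> * \<bar>b\<bar>" by (intro mult_nonneg_nonneg) auto
   ultimately show ?thesis unfolding abs_mult by linarith
  qed
  then show "AE x in M. norm (u x * v x) <= norm ((u x)^2 + (v x)^2)"
   by (simp add: order_trans[OF _ abs_ge_self])
 qed measurable
 let ?A = "\<integral>x. (u x)^2 \<partial>M" and ?B = "\<integral>x. (v x)^2 \<partial>M" and ?C = "\<integral>x. u x * v x \<partial>M"
 have A0: "0 <= ?A" and B0: "0 <= ?B" by (auto intro: lint_nonneg)
 have q: "0 <= ?A - 2 * t * ?C + t^2 * ?B" for t
 proof -
  have "0 <= (\<integral>x. (u x - t * v x)^2 \<partial>M)" by (intro lint_nonneg) auto
  also have "\<dots> = (\<integral>x. (u x)^2 - 2 * t * (u x * v x) + t^2 * (v x)^2 \<partial>M)"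
   by (intro lint_cong) (auto simp: power2_eq_square algebra_simps)
  also have "\<dots> = ?A - 2 * t * ?C + t^2 * ?B" using u v uv by simp
  finally show ?thesis .
 qed
 have "?C^2 <= ?A * ?B"
 proof (cases "?B = 0")
  case True
  have "?C = 0"
  proof (rule ccontr)
   assume "?C \<noteq> 0"
   \<comment> \<open>With \<open>?B = 0\<close> the quadratic is affine in t, and this t makes it
     equal to -1.\<close>
   then show False using q[of "(?A + 1) / (2 * ?C)"] True by simp
  qed
  then show ?thesis using A0 B0 by simp
 next
  case False
  have "0 <= ?B * (?A - 2 * (?C / ?B) * ?C + (?C / ?B)^2 * ?B)" using q B0 by (intro mult_nonneg_nonneg)
  also have "\<dots> = ?A * ?B - ?C^2" using False by (simp add: power2_eq_square field_simps)
  finally show ?thesis by simp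
 qed
 then have "sqrt (?C^2) <= sqrt (?A * ?B)" by (rule real_sqrt_le_mono)
 then show "\<bar>?C\<bar> <= sqrt ?A * sqrt ?B" by (simp add: real_sqrt_mult)
qed

context innovations
begin

lemma distr_shift: "distr \<pi> \<pi> (\<lambda>z c. z (c + m)) = \<pi>"
proof -
 have "inj_on (\<lambda>c::int. c + m) UNIV" by (auto simp: inj_on_def)
 from distr_PiM_reindex[of UNIV "\<lambda>_. \<mu>", OF prob_space_axioms this]
 show ?thesis by (simp add: restrict_UNIV)
qed

lemma measurable_shift [measurable]: "(\<lambda>z c. z (c + m)) \<in> measurable \<pi> \<pi>"
 by (rule measurable_PiM_single') (auto simp: space_PiM)

lemma integral_lag_shift:
 fixes F :: "(nat => 'e) => (nat => 'e) => real"
 assumes [measurable]: "(\<lambda>z. F (lag i z) (lag j z)) \<in> borel_measurable \<pi>"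
 shows "(\<integral>z. F (lag (i + m) z) (lag (j + m) z) \<partial>\<pi>) = (\<integral>z. F (lag i z) (lag j z) \<partial>\<pi>)"
proof -
 have lag: "lag i (\<lambda>c. z (c + m)) = lag (i + m) z" for i and z :: "int => 'e"
  by (auto simp: lag_def algebra_simps)
 have "(\<integral>z. F (lag i z) (lag j z) \<partial>\<pi>) = (\<integral>z. F (lag i z) (lag j z) \<partial>distr \<pi> \<pi> (\<lambda>z c. z (c + m)))"
  by (simp only: distr_shift)
 also have "\<dots> = (\<integral>z. F (lag (i + m) z) (lag (j + m) z) \<partial>\<pi>)"
  by (subst integral_distr) (auto simp: lag)
 finally show ?thesis by simp
qed

lemma sq_int_lag: "sq_int f ==> integrable \<pi> (\<lambda>z. (f (lag i z))^2)"
 using integrable_lag[of "\<lambda>x. (f x)^2" i] by (auto simp: sq_int_def)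

lemma cov_integrable:
 assumes "sq_int g" "sq_int f"
 shows "integrable \<pi> (\<lambda>z. g (lag i z) * f (lag j z))"
  "\<bar>\<integral>z. g (lag i z) * f (lag j z) \<partial>\<pi>\<bar> <= sqrt (\<integral>x. (g x)^2 \<partial>\<nu>) * sqrt (\<integral>x. (f x)^2 \<partial>\<nu>)"
proof -
 note [measurable] = sq_intD[OF assms(1)] sq_intD[OF assms(2)]
 note * = integral_Cauchy_Schwarz[of "\<lambda>z. g (lag i z)" \<pi> "\<lambda>z. f (lag j z)", OF _ _ sq_int_lag[OF assms(1)] sq_int_lag[OF assms(2)]]
 show "integrable \<pi> (\<lambda>z. g (lag i z) * f (lag j z))" by (rule *) auto
 have "(\<integral>z. (g (lag i z))^2 \<partial>\<pi>) = (\<integral>x. (g x)^2 \<partial>\<nu>)" "(\<integral>z. (f (lag j z))^2 \<partial>\<pi>) = (\<integral>x. (f x)^2 \<partial>\<nu>)"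
  by (rule integral_lag, measurable)+
 then show "\<bar>\<integral>z. g (lag i z) * f (lag j z) \<partial>\<pi>\<bar> <= sqrt (\<integral>x. (g x)^2 \<partial>\<nu>) * sqrt (\<integral>x. (f x)^2 \<partial>\<nu>)"
  using *(2) by simp
qed

text \<open>g at time i ignores the innovations after time i, so the increments of f at time i + k
  with lag l < k are orthogonal to it. Only f - \<open>proj f k\<close> is left, for which
  \<open>proj_tail_sq\<close> and Cauchy-Schwarz apply.\<close>

lemma cov_proj_le:
 assumes g: "sq_int g" and f [measurable]: "f \<in> borel_measurable \<nu>" and fK: "!!x. \<bar>f x\<bar> <= K"
  and D: "!!l. dep f l <= (D l)^2" and D0: "!!l. D l > 0" and DS: "!!R. (\<Sum>l\<in>{k..<R}. D l) <= S"
 shows "\<bar>\<integral>z. g (lag i z) * (f (lag (i + int k) z) - (\<integral>x. f x \<partial>\<nu>)) \<partial>\<pi>\<bar> <= sqrt (\<integral>x. (g x)^2 \<partial>\<nu>) * (4 * S)"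
proof -
 note [measurable] = sq_intD[OF g]
 let ?j = "i + int k" and ?m = "\<integral>x. f x \<partial>\<nu>"
 have S0: "0 <= S" using DS[of k] by simp
 have c: "sq_int (cinc f l)" "sq_int (\<lambda>x. f x - proj f k x)" for l
  using cinc_bound[OF fK] proj_diff_bound[OF fK] by (auto intro!: sq_int_bounded[of _ "2 * K"] simp: abs_minus_commute)
 have zero: "(\<integral>z. g (lag i z) * cinc f l (lag ?j z) \<partial>\<pi>) = 0" if "l < k" for l
 proof (rule integral_resample_eq_0[where c = "?j - int l"])
  show "integrable \<pi> (\<lambda>z. g (lag i z) * cinc f l (lag ?j z))" by (rule cov_integrable(1)[OF g c(1)])
  have "lag i (z(?j - int l := y)) = lag i z" for z :: "int => 'e" and y using that by (auto simp: lag_def fun_eq_iff)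
  then show "g (lag i (z(?j - int l := y))) = g (lag i z)" for z y by simp
  show "(\<integral>y. cinc f l (lag ?j (z(?j - int l := y))) \<partial>\<mu>) = 0" if "z \<in> space \<pi>" for z
   unfolding lag_upd by (rule cinc_average[OF f fK measurable_space[OF measurable_lag that]])
 qed
 have eq: "f x - ?m = (\<Sum>l<k. cinc f l x) + (f x - proj f k x)" for x by (simp add: sum_cinc)
 have "(\<integral>z. g (lag i z) * (f (lag ?j z) - ?m) \<partial>\<pi>) =
   (\<integral>z. (\<Sum>l<k. g (lag i z) * cinc f l (lag ?j z)) + g (lag i z) * (f (lag ?j z) - proj f k (lag ?j z)) \<partial>\<pi>)"
  by (simp only: eq distrib_left sum_distrib_left)
 also have "\<dots> = (\<Sum>l<k. \<integral>z. g (lag i z) * cinc f l (lag ?j z) \<partial>\<pi>) + (\<integral>z. g (lag i z) * (f (lag ?j z) - proj f k (lag ?j z)) \<partial>\<pi>)"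
  using cov_integrable(1)[OF g c(1)] cov_integrable(1)[OF g c(2)] by simp
 also have "\<bar>\<dots>\<bar> <= sqrt (\<integral>x. (g x)^2 \<partial>\<nu>) * sqrt (\<integral>x. (f x - proj f k x)^2 \<partial>\<nu>)"
  using cov_integrable(2)[OF g c(2), of i ?j] by (simp add: zero)
 also have "\<dots> <= sqrt (\<integral>x. (g x)^2 \<partial>\<nu>) * (4 * S)"
  using proj_tail_sq[OF f fK D D0 DS] S0
  by (intro mult_left_mono real_le_lsqrt) (auto intro: lint_nonneg)
 finally show ?thesis .
qed

end

lemma (in prob_space) variance_le_square:
 fixes f :: "'a => real"
 assumes "integrable M f" "integrable M (\<lambda>x. (f x)^2)"
 shows "(\<integral>x. (f x - (\<integral>x. f x \<partial>M))^2 \<partial>M) <= (\<integral>x. (f x)^2 \<partial>M)"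
 using variance_eq[OF assms] by simp

section \<open>Truncation and the long-run variance\<close>

text \<open>The scalar error process. \<open>\<delta>\<close> bounds its dependence coefficients and
  is strictly positive because it serves as a weight in \<open>weighted_Cauchy_Schwarz\<close>.
  Centering is available at the sampling points i / n, whereas moments, Lipschitz bound and long-run
  variance are given on all of [0,1].\<close>

locale loc_stat = innovations \<mu> for \<mu> :: "'e measure" +
 fixes h :: "real => (nat => 'e) => real" and \<delta> :: "nat => real" and \<kappa> Cm \<Lambda> \<sigma>2 :: real
 assumes h_meas: "t \<in> {0..1} ==> h t \<in> borel_measurable \<nu>"
  and \<kappa>_pos: "0 < \<kappa>"
  and moment: "t \<in> {0..1} ==> integrable \<nu> (\<lambda>x. \<bar>h t x\<bar> powr (2 + \<kappa>))"
   "t \<in> {0..1} ==> (\<integral>x. \<bar>h t x\<bar> powr (2 + \<kappa>) \<partial>\<nu>) <= Cm"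
  and \<delta>_pos: "0 < \<delta> l"
  and dep_h: "t \<in> {0..1} ==> dep (h t) l <= (\<delta> l)^2"
  and summable_\<delta>: "summable \<delta>"
  and summable_tail: "summable (tail_sum \<delta>)"
  and lip: "s \<in> {0..1} ==> t \<in> {0..1} ==> (\<integral>x. (h t x - h s x)^2 \<partial>\<nu>) <= (\<Lambda> * (t - s))^2"
  and \<Lambda>_nonneg: "0 <= \<Lambda>"
  and mean_h: "1 <= i ==> i <= n ==> (\<integral>x. h (real i / real n) x \<partial>\<nu>) = 0"
  and \<sigma>2_pos: "0 < \<sigma>2"
  and lrv: "t \<in> {0..1} ==> ((\<lambda>k::int. \<integral>\<zeta>. h t (lag k \<zeta>) * h t (lag 0 \<zeta>) \<partial>\<pi>) has_sum \<sigma>2) UNIV"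
begin

lemma sq_int_h: "t \<in> {0..1} ==> sq_int (h t)"
 and h_sq_le: "t \<in> {0..1} ==> (\<integral>x. (h t x)^2 \<partial>\<nu>) <= 1 + Cm"
proof -
 assume t: "t \<in> {0..1}"
 have [measurable]: "h t \<in> borel_measurable \<nu>" by (rule h_meas[OF t])
 have le: "(h t x)^2 <= 1 + \<bar>h t x\<bar> powr (2 + \<kappa>)" for x
 proof (cases "\<bar>h t x\<bar> <= 1")
  case True
  then show ?thesis using power_mono[of "\<bar>h t x\<bar>" 1 2] powr_ge_zero[of "\<bar>h t x\<bar>" "2 + \<kappa>"]
   by (simp add: add_increasing2)
 next
  case False
  then have "(h t x)^2 = \<bar>h t x\<bar> powr 2" by (simp add: powr_numeral)
  also have "\<dots> <= \<bar>h t x\<bar> powr (2 + \<kappa>)" using False \<kappa>_pos by (intro powr_mono) auto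
  finally show ?thesis by simp
 qed
 have int: "integrable \<nu> (\<lambda>x. 1 + \<bar>h t x\<bar> powr (2 + \<kappa>))" using moment(1)[OF t] by simp
 have int2: "integrable \<nu> (\<lambda>x. (h t x)^2)"
 proof (rule integrable_bd[OF int])
  show "AE x in \<nu>. norm ((h t x)^2) <= norm (1 + \<bar>h t x\<bar> powr (2 + \<kappa>))"
   using le by (intro AE_I2) (simp add: abs_of_nonneg add_nonneg_nonneg)
 qed measurable
 show "sq_int (h t)" using int2 by (simp add: sq_int_def)
 have "(\<integral>x. (h t x)^2 \<partial>\<nu>) <= (\<integral>x. 1 + \<bar>h t x\<bar> powr (2 + \<kappa>) \<partial>\<nu>)"
  by (rule lint_mono[OF int2 int le])
 also have "\<dots> <= 1 + Cm" using moment[OF t] by (simp add: nu.P.prob_space)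
 finally show "(\<integral>x. (h t x)^2 \<partial>\<nu>) <= 1 + Cm" .
qed

lemma Cm_nonneg: "0 <= Cm"
 using order_trans[OF lint_nonneg moment(2)[of 0]] by simp

definition \<Theta> :: "nat => real" where "\<Theta> = tail_sum \<delta>"

lemma sum_\<delta>_le: "(\<Sum>l\<in>{k..<R}. \<delta> l) <= \<Theta> k"
proof -
 have "(\<Sum>l\<in>{k..<R}. \<delta> l) = (\<Sum>l<R - k. \<delta> (l + k))"
  by (rule sum.reindex_bij_witness[of _ "\<lambda>l. l + k" "\<lambda>l. l - k"]) auto
 also have "\<dots> <= \<Theta> k"
  unfolding \<Theta>_def tail_sum_def
  using summable_\<delta> \<delta>_pos by (intro sum_le_suminf) (auto simp: summable_iff_shift less_imp_le)
 finally show ?thesis .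
qed

lemma \<Theta>_nonneg: "0 <= \<Theta> k"
 using sum_\<delta>_le[of k k] by simp

lemma \<Theta>_tendsto: "\<Theta> \<longlonglongrightarrow> 0"
 using summable_tail summable_LIMSEQ_zero unfolding \<Theta>_def by blast

lemma \<Theta>_pos: "0 < \<Theta> k"
 using sum_\<delta>_le[of k "Suc k"] \<delta>_pos[of k] by simp

section \<open>Clipped summands with finite memory\<close>

definition cl :: "nat => real => (nat => 'e) => real" where
 "cl L t x = clip (real L) (h t x)"

text \<open>A single parameter L is both the clipping level and the length of the memory;
  subtracting \<open>proj _ 0\<close>, the mean, restores centering after clipping.\<close>

definition tr :: "nat => real => (nat => 'e) => real" where
 "tr L t x = proj (cl L t) L x - proj (cl L t) 0 x"

text \<open>A bound for the L2 size of the clipping error, from the moment of order 2 + \<kappa>.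
  The term with \<open>\<Theta>\<close> keeps it positive, again for use as a weight.\<close>

definition eps :: "nat => real" where
 "eps L = sqrt (2 * Cm * real L powr (- \<kappa>) + 2 * (\<Theta> L)^2)"

text \<open>Sums up the dependence coefficients of the error h - \<open>tr L\<close>: the clipping
  part has coefficient at most 2 min(\<delta> l, eps L) at lag l, the loss of memory contributes the
  tail \<open>\<Theta> L\<close>, and the outer 2 pays for splitting a square.\<close>

definition S :: "nat => real" where
 "S L = 2 * ((\<Sum>l. 2 * min (\<delta> l) (eps L)) + \<Theta> L)"

lemma eps_pos: "0 < eps L"
 unfolding eps_def using \<Theta>_pos[of L] Cm_nonneg by (intro real_sqrt_gt_zero add_nonneg_pos) auto

lemma eps_tendsto: "eps \<longlonglongrightarrow> 0"
proof -
 have "(\<lambda>L. real L powr (- \<kappa>)) \<longlonglongrightarrow> 0"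
  using \<kappa>_pos by (intro tendsto_neg_powr filterlim_real_sequentially) auto
 then have "(\<lambda>L. sqrt (2 * Cm * real L powr (- \<kappa>) + 2 * (\<Theta> L)^2)) \<longlonglongrightarrow> sqrt (2 * Cm * 0 + 2 * 0^2)"
  by (intro tendsto_intros \<Theta>_tendsto)
 then show ?thesis by (simp add: eps_def[abs_def])
qed

lemma summable_S: "summable (\<lambda>l. 2 * min (\<delta> l) (eps L))"
 using eps_pos[of L] \<delta>_pos
 by (intro summable_comparison_test'[OF summable_mult[OF summable_\<delta>, of 2], of 0]) (auto simp: less_imp_le)

lemma sum_le_S: "(\<Sum>l<R. 2 * min (\<delta> l) (eps L)) <= (\<Sum>l. 2 * min (\<delta> l) (eps L))"
 using eps_pos[of L] \<delta>_pos by (intro sum_le_suminf summable_S) (auto simp: less_imp_le)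

text \<open>Each term of the series tends to 0 with \<open>eps L\<close> and is dominated by 2
  \<open>\<delta> l\<close>, which is summable.\<close>

lemma S_tendsto: "S \<longlonglongrightarrow> 0"
proof -
 have "(\<lambda>L. \<Sum>l. 2 * min (\<delta> l) (eps L)) \<longlonglongrightarrow> (\<Sum>l. 2 * min (\<delta> l) 0)"
 proof (rule tannerys_theorem[THEN conjunct2, THEN conjunct2])
  show "(\<lambda>L. 2 * min (\<delta> l) (eps L)) \<longlonglongrightarrow> 2 * min (\<delta> l) 0" for l
   by (intro tendsto_intros tendsto_min eps_tendsto)
  show "summable (\<lambda>l. 2 * \<delta> l)" by (rule summable_mult[OF summable_\<delta>])
  show "\<forall>\<^sub>F (l, L) in sequentially \<times>\<^sub>F sequentially. norm (2 * min (\<delta> l) (eps L)) <= 2 * \<delta> l"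
   using \<delta>_pos eps_pos by (intro always_eventually) (auto simp: less_imp_le)
 qed simp
 moreover have "(\<lambda>l. 2 * min (\<delta> l) 0) = (\<lambda>l. 0)"
  using \<delta>_pos by (auto simp: fun_eq_iff min_def) (metis less_le_not_le)
 ultimately have "(\<lambda>L. \<Sum>l. 2 * min (\<delta> l) (eps L)) \<longlonglongrightarrow> 0" by simp
 from tendsto_mult_left[OF tendsto_add[OF this \<Theta>_tendsto], of 2] show ?thesis by (simp add: S_def[abs_def])
qed

lemma measurable_cl [measurable]: "t \<in> {0..1} ==> cl L t \<in> borel_measurable \<nu>"
 using h_meas[of t] unfolding cl_def[abs_def] by measurable

lemma measurable_tr [measurable]: "t \<in> {0..1} ==> tr L t \<in> borel_measurable \<nu>"
 unfolding tr_def[abs_def] by measurable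

lemma cl_bound: "\<bar>cl L t x\<bar> <= real L"
 unfolding cl_def by (rule clip_bound) simp

lemma tr_bound: "\<bar>tr L t x\<bar> <= 2 * real L"
 unfolding tr_def using proj_bound[of "cl L t" "real L" L x, OF cl_bound] proj_bound[of "cl L t" "real L" 0 x, OF cl_bound] by linarith

lemma tr_cong: "(!!k. k < L ==> x k = x' k) ==> tr L t x = tr L t x'"
 unfolding tr_def by (intro arg_cong2[where f = "(-)"] proj_cong) auto

lemma sq_int_cl: "t \<in> {0..1} ==> sq_int (cl L t)"
 by (rule sq_int_bounded[OF measurable_cl cl_bound])

lemma sq_int_tr: "t \<in> {0..1} ==> sq_int (tr L t)"
 by (rule sq_int_bounded[OF measurable_tr tr_bound])

lemma mean_tr: "t \<in> {0..1} ==> (\<integral>x. tr L t x \<partial>\<nu>) = 0"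
proof -
 assume t: "t \<in> {0..1}"
 have "integrable \<nu> (proj (cl L t) m)" for m
  using t by (intro nu.integrable_const_bound[of _ "real L"] AE_I2) (auto intro!: proj_bound cl_bound)
 then show ?thesis by (simp add: tr_def integral_proj[OF measurable_cl[OF t] cl_bound])
qed

lemma dep_cl: "t \<in> {0..1} ==> dep (cl L t) l <= (\<delta> l)^2"
 unfolding cl_def[abs_def] by (rule order_trans[OF dep_mono[OF sq_int_h sq_int_clip[OF sq_int_h] clip_diff] dep_h]) auto

text \<open>Where clipping acts, |h| > L, hence h^2 <= L^(-\<kappa>) |h|^(2 + \<kappa>).\<close>

lemma clip_error:
 assumes t: "t \<in> {0..1}" and L: "1 <= L"
 shows "(\<integral>x. (h t x - cl L t x)^2 \<partial>\<nu>) <= (eps L)^2"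
proof -
 have le: "(h t x - clip (real L) (h t x))^2 <= real L powr (- \<kappa>) * \<bar>h t x\<bar> powr (2 + \<kappa>)" for x
 proof (cases "\<bar>h t x\<bar> <= real L")
  case True
  then show ?thesis by (simp add: clip_id)
 next
  case False
  then have pos: "0 < \<bar>h t x\<bar>" using L by linarith
  have "\<bar>h t x - clip (real L) (h t x)\<bar> <= \<bar>h t x\<bar>" by (auto simp: clip_def)
  from power_mono[OF this abs_ge_zero, of 2]
  have "(h t x - clip (real L) (h t x))^2 <= \<bar>h t x\<bar> powr 2" using pos by (simp add: powr_numeral)
  also have "\<dots> = \<bar>h t x\<bar> powr (- \<kappa>) * \<bar>h t x\<bar> powr (2 + \<kappa>)" by (simp flip: powr_add)
  also have "\<dots> <= real L powr (- \<kappa>) * \<bar>h t x\<bar> powr (2 + \<kappa>)"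
   using False L \<kappa>_pos by (intro mult_right_mono powr_mono2') auto
  finally show ?thesis .
 qed
 have "(\<integral>x. (h t x - clip (real L) (h t x))^2 \<partial>\<nu>) <= (\<integral>x. real L powr (- \<kappa>) * \<bar>h t x\<bar> powr (2 + \<kappa>) \<partial>\<nu>)"
  using moment(1)[OF t] le
  by (intro lint_mono sq_int_sq sq_int_diff sq_int_clip sq_int_h t) auto
 also have "\<dots> <= real L powr (- \<kappa>) * Cm"
  using moment[OF t] by (simp add: mult_left_mono)
 also have "\<dots> <= 2 * Cm * real L powr (- \<kappa>) + 2 * (\<Theta> L)^2" using Cm_nonneg by simp
 also have "\<dots> = (eps L)^2"
  unfolding eps_def by (rule real_sqrt_pow2[symmetric]) (use Cm_nonneg in auto)
 finally show ?thesis unfolding cl_def .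
qed

lemma grid_in_unit: "i <= n ==> real i / real n \<in> {0..1}"
 by (cases "n = 0") auto

text \<open>Zero functions off I let a sum over part of the sample be treated as a sum over the full
  sample, with I visible to the maximal inequalities.\<close>

abbreviation on :: "nat set => nat => (real => (nat => 'e) => real) => nat => (nat => 'e) => real" where
 "on I n f \<equiv> (\<lambda>i. if i \<in> I then f (real i / real n) else (\<lambda>_. 0))"

lemma maxsum_on:
 fixes T :: real
 assumes I: "I \<subseteq> {1..n}" and f: "!!i. i \<in> I ==> sq_int (f (real i / real n))"
  "!!i. i \<in> I ==> (\<integral>x. f (real i / real n) x \<partial>\<nu>) = 0"
  and D: "!!i l. i \<in> I ==> dep (f (real i / real n)) l <= (D l)^2" "!!l. 0 < D l" "!!R. (\<Sum>l<R. D l) <= T"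
 shows "integrable \<pi> (\<lambda>z. (maxsum (on I n f) n z)^2)"
  "(\<integral>z. (maxsum (on I n f) n z)^2 \<partial>\<pi>) <= 16 * card I * T^2"
proof -
 have 1: "sq_int (on I n f i)" for i using f by (auto simp: sq_int_const)
 have 2: "(\<integral>x. on I n f i x \<partial>\<nu>) = 0" for i using f by auto
 have 3: "on I n f i = (\<lambda>_. 0)" if "i \<notin> I" for i using that by simp
 have 4: "dep (on I n f i) l <= (D l)^2" if "i \<in> I" for i l using that D by simp
 show "integrable \<pi> (\<lambda>z. (maxsum (on I n f) n z)^2)"
  by (rule integral_maxsum_sq(1)[OF 1 2 I 3 4 D(2,3)])
 show "(\<integral>z. (maxsum (on I n f) n z)^2 \<partial>\<pi>) <= 16 * card I * T^2"
  by (rule integral_maxsum_sq(2)[OF 1 2 I 3 4 D(2,3)])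
qed

lemma grid_unit: "I \<subseteq> {1..n} ==> i \<in> I ==> real i / real n \<in> {0..1}"
 by (rule grid_in_unit) auto

lemma grid_mean: "I \<subseteq> {1..n} ==> i \<in> I ==> (\<integral>x. h (real i / real n) x \<partial>\<nu>) = 0"
 by (rule mean_h) auto

lemma maxsum_h:
 assumes "I \<subseteq> {1..n}"
 shows "integrable \<pi> (\<lambda>z. (maxsum (on I n h) n z)^2)"
  "(\<integral>z. (maxsum (on I n h) n z)^2 \<partial>\<pi>) <= 16 * card I * (\<Theta> 0)^2"
 by (rule maxsum_on[where D = \<delta> and f = h, OF assms sq_int_h[OF grid_unit[OF assms]] grid_mean[OF assms] dep_h[OF grid_unit[OF assms]] \<delta>_pos
    sum_\<delta>_le[of 0, unfolded atLeast0LessThan]], assumption+)+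

lemma on_cl:
 assumes "I \<subseteq> {1..n}"
 shows "on I n (cl L) i \<in> borel_measurable \<nu>" "\<bar>on I n (cl L) i x\<bar> <= real L" "i \<notin> I ==> on I n (cl L) i = (\<lambda>_. 0)"
  "i \<in> I ==> dep (on I n (cl L) i) l <= (\<delta> l)^2" "on I n (tr L) i x = proj (on I n (cl L) i) L x - proj (on I n (cl L) i) 0 x"
  "on I n (\<lambda>t x. cl L t x - proj (cl L t) L x) i x = on I n (cl L) i x - proj (on I n (cl L) i) L x"
 using measurable_cl dep_cl grid_unit[OF assms] cl_bound by (auto simp: tr_def proj_def)

lemma maxsum_tr:
 assumes I: "I \<subseteq> {1..n}"
 shows "integrable \<pi> (\<lambda>z. (maxsum (on I n (tr L)) n z)^2)"
  "(\<integral>z. (maxsum (on I n (tr L)) n z)^2 \<partial>\<pi>) <= 16 * card I * (\<Theta> 0)^2"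
proof -
 have b [measurable]: "on I n (tr L) i \<in> borel_measurable \<nu>" and b2: "\<bar>on I n (tr L) i x\<bar> <= 2 * real L" for i x
  using grid_unit[OF I] measurable_tr tr_bound by auto
 show "integrable \<pi> (\<lambda>z. (maxsum (on I n (tr L)) n z)^2)"
  by (rule pi.bounded_integrable[OF _ maxsum_sq_bound[OF b2]]) measurable
 have "on I n (tr L) = (\<lambda>i x. proj (on I n (cl L) i) L x - proj (on I n (cl L) i) 0 x)" using on_cl(5)[OF I] by blast
 then show "(\<integral>z. (maxsum (on I n (tr L)) n z)^2 \<partial>\<pi>) <= 16 * card I * (\<Theta> 0)^2"
  using integral_maxsum_proj_sq[OF on_cl(1,2)[OF I] I on_cl(3,4)[OF I] \<delta>_pos le0 sum_\<delta>_le] by simp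
qed

text \<open>h - \<open>tr L\<close> is the recentred clipping error plus the memory error cl -
  \<open>proj\<close> cl L. A lag of the first is bounded both through \<open>\<delta>\<close> and
  through the total L2 size, whence the minimum; the second involves only lags l >= L.\<close>

lemma maxsum_err:
 assumes I: "I \<subseteq> {1..n}" and L: "1 <= L"
 shows "integrable \<pi> (\<lambda>z. (maxsum (on I n (\<lambda>t x. h t x - tr L t x)) n z)^2)"
  "(\<integral>z. (maxsum (on I n (\<lambda>t x. h t x - tr L t x)) n z)^2 \<partial>\<pi>) <= 16 * card I * (S L)^2"
proof -
 let ?s = "\<Sum>l. 2 * min (\<delta> l) (eps L)"
 \<comment> \<open>The double minus brings the recentring into the form of
   \<open>sq_int_diff\<close> and \<open>dep_shift\<close>.\<close>
 let ?a = "\<lambda>t x. (h t x - cl L t x) - - proj (cl L t) 0 x" and ?b = "\<lambda>t x. cl L t x - proj (cl L t) L x"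
 let ?A = "\<lambda>z. maxsum (on I n ?a) n z" and ?B = "\<lambda>z. maxsum (on I n ?b) n z" and ?E = "\<lambda>z. maxsum (on I n (\<lambda>t x. h t x - tr L t x)) n z"
 have t: "real i / real n \<in> {0..1}" "(\<integral>x. h (real i / real n) x \<partial>\<nu>) = 0" if "i \<in> I" for i
  by (rule grid_unit[OF I that]) (rule grid_mean[OF I that])
 have a: "sq_int (\<lambda>x. h t x - cl L t x)" "sq_int (?a t)" "dep (?a t) l <= (2 * min (\<delta> l) (eps L))^2" if "t \<in> {0..1}" for t l
 proof -
  show 1: "sq_int (\<lambda>x. h t x - cl L t x)" by (intro sq_int_diff sq_int_h sq_int_cl that)
  show "sq_int (?a t)" unfolding proj_0 by (rule sq_int_diff[OF 1 sq_int_const])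
  have "dep (\<lambda>x. h t x - cl L t x) l <= 4 * (\<delta> l)^2"
   using dep_diff_le[OF sq_int_cl sq_int_h, OF that that, of L l] dep_h[OF that, of l] dep_cl[OF that, of L l] by linarith
  moreover have "dep (\<lambda>x. h t x - cl L t x) l <= 4 * (eps L)^2"
   using dep_le_4_norm[OF 1, of l] clip_error[OF that L] by linarith
  ultimately show "dep (?a t) l <= (2 * min (\<delta> l) (eps L))^2"
   unfolding proj_0 dep_shift by (auto simp: min_def power_mult_distrib)
 qed
 have m: "(\<integral>x. ?a (real i / real n) x \<partial>\<nu>) = 0" if "i \<in> I" for i
  using t[OF that] sq_int_integrable[OF sq_int_h[OF t(1)[OF that]]] sq_int_integrable[OF sq_int_cl[OF t(1)[OF that]]]
  by (simp add: proj_0 nu.P.prob_space)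
 have p: "0 < 2 * min (\<delta> l) (eps L)" for l using \<delta>_pos eps_pos by simp
 note A = maxsum_on[where f = ?a and D = "\<lambda>l. 2 * min (\<delta> l) (eps L)", OF I a(2)[OF t(1)] m a(3)[OF t(1)] p sum_le_S]
 have "on I n ?b = (\<lambda>i x. on I n (cl L) i x - proj (on I n (cl L) i) L x)" using on_cl(6)[OF I] by blast
 then have B: "integrable \<pi> (\<lambda>z. (?B z)^2)" "(\<integral>z. (?B z)^2 \<partial>\<pi>) <= 16 * card I * (\<Theta> L)^2"
  using integral_maxsum_sq_bounded[OF on_cl(1,2)[OF I] I on_cl(3,4)[OF I] \<delta>_pos sum_\<delta>_le] by simp_all
 have le: "(?E z)^2 <= 2 * (?A z)^2 + 2 * (?B z)^2" for z
 proof -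
  have "lagsum (on I n (\<lambda>t x. h t x - tr L t x)) k z = lagsum (on I n ?a) k z + lagsum (on I n ?b) k z" for k
   unfolding lagsum_def sum.distrib[symmetric] by (rule sum.cong) (auto simp: tr_def)
  then have le: "?E z <= ?A z + ?B z"
   by (intro maxsum_leI) (auto intro!: order_trans[OF abs_triangle_ineq] add_mono lagsum_le_maxsum)
  then show ?thesis
   using power_mono[OF le maxsum_nonneg, of 2] square_diff_le[of "?A z" "- ?B z"] by simp
 qed
 have [measurable]: "on I n (\<lambda>t x. h t x - tr L t x) i \<in> borel_measurable \<nu>" for i using t(1) h_meas measurable_tr by auto
 show int: "integrable \<pi> (\<lambda>z. (?E z)^2)"
  by (rule integrable_bd[of _ "\<lambda>z. 2 * (?A z)^2 + 2 * (?B z)^2"])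
   (use A(1) B(1) le in \<open>auto intro: order_trans[OF _ abs_ge_self]\<close>)
 have "(\<integral>z. (?E z)^2 \<partial>\<pi>) <= (\<integral>z. 2 * (?A z)^2 + 2 * (?B z)^2 \<partial>\<pi>)"
  by (rule lint_mono) (use int A(1) B(1) le in auto)
 also have "\<dots> = 2 * (\<integral>z. (?A z)^2 \<partial>\<pi>) + 2 * (\<integral>z. (?B z)^2 \<partial>\<pi>)" using A(1) B(1) by simp
 also have "\<dots> <= 16 * card I * (2 * ?s^2 + 2 * (\<Theta> L)^2)" using A(2) B(2) by (simp add: algebra_simps)
 also have "\<dots> <= 16 * card I * (S L)^2"
 proof (rule mult_left_mono)
  have "0 <= ?s" using sum_le_S[where R = 0 and L = L] by simp
  then have "0 <= ?s * \<Theta> L" using \<Theta>_nonneg by (intro mult_nonneg_nonneg)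
  then show "2 * ?s^2 + 2 * (\<Theta> L)^2 <= (S L)^2"
   using zero_le_power2[of ?s] zero_le_power2[of "\<Theta> L"] unfolding S_def power_mult_distrib power2_sum by simp
 qed simp
 finally show "(\<integral>z. (?E z)^2 \<partial>\<pi>) <= 16 * card I * (S L)^2" .
qed

section \<open>Variance of sums over stretches of the sample\<close>

definition cov :: "real => real => nat => real" where
 "cov s t k = (\<integral>z. h s (lag 0 z) * h t (lag (int k) z) \<partial>\<pi>)"

lemma integral_h_h:
 assumes "s \<in> {0..1}" "t \<in> {0..1}"
 shows "(\<integral>z. h s (lag i z) * h t (lag (i + int k) z) \<partial>\<pi>) = cov s t k"
proof -
 note [measurable] = h_meas[OF assms(1)] h_meas[OF assms(2)]
 show ?thesis
  unfolding cov_def using integral_lag_shift[of "\<lambda>x y. h s x * h t y" 0 "int k" i] by (simp add: add.commute)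
qed

definition cbound :: "nat => real" where
 "cbound k = sqrt (1 + Cm) * (4 * \<Theta> k)"

lemma cbound_nonneg: "0 <= cbound k"
 unfolding cbound_def using \<Theta>_nonneg[of k] Cm_nonneg by (intro mult_nonneg_nonneg) auto

lemma summable_cbound: "summable cbound"
 unfolding cbound_def[abs_def] \<Theta>_def by (intro summable_mult summable_tail)

lemma norm_h_le: "t \<in> {0..1} ==> sqrt (\<integral>x. (h t x)^2 \<partial>\<nu>) <= sqrt (1 + Cm)"
 by (rule real_sqrt_le_mono[OF h_sq_le])

text \<open>The later factor is replaced by its clipped and recentred version, to which
  \<open>cov_proj_le\<close> applies; then L tends to infinity. As that factor has mean 0, the
  replacement error is a centred clipping error and so no larger than \<open>eps L\<close>.\<close>

lemma cov_bound:
 assumes s: "s \<in> {0..1}" and t: "t \<in> {0..1}" and mean: "(\<integral>x. h t x \<partial>\<nu>) = 0"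
 shows "\<bar>cov s t k\<bar> <= cbound k"
proof -
 let ?N = "sqrt (\<integral>x. (h s x)^2 \<partial>\<nu>)"
 have "\<bar>cov s t k\<bar> <= sqrt (1 + Cm) * (4 * \<Theta> k + eps L)" if L: "1 <= L" for L
 proof -
  let ?m = "\<integral>x. cl L t x \<partial>\<nu>"
  let ?Z = "\<lambda>x. h t x - cl L t x" and ?F = "\<lambda>x. cl L t x - ?m"
  have Z: "sq_int ?Z" and F: "sq_int ?F" by (intro sq_int_diff sq_int_cl sq_int_h sq_int_const t)+
  have eq: "?Z x - (\<integral>x. ?Z x \<partial>\<nu>) = h t x - ?F x" for x
   using sq_int_integrable[OF sq_int_h[OF t]] sq_int_integrable[OF sq_int_cl[OF t]] by (simp add: mean)
  have R: "sq_int (\<lambda>x. h t x - ?F x)" by (intro sq_int_diff sq_int_h F t)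
  have "(\<integral>x. (h t x - ?F x)^2 \<partial>\<nu>) <= (eps L)^2"
   using nu.P.variance_le_square[OF sq_int_integrable[OF Z] sq_int_sq[OF Z]] clip_error[OF t L] unfolding eq by linarith
  then have e: "sqrt (\<integral>x. (h t x - ?F x)^2 \<partial>\<nu>) <= eps L"
   using eps_pos[of L] by (intro real_le_lsqrt) (auto intro: lint_nonneg)
  have "cov s t k = (\<integral>z. h s (lag 0 z) * ?F (lag (int k) z) + h s (lag 0 z) * (h t (lag (int k) z) - ?F (lag (int k) z)) \<partial>\<pi>)"
   unfolding cov_def by (simp add: algebra_simps)
  also have "\<dots> = (\<integral>z. h s (lag 0 z) * ?F (lag (int k) z) \<partial>\<pi>) + (\<integral>z. h s (lag 0 z) * (h t (lag (int k) z) - ?F (lag (int k) z)) \<partial>\<pi>)"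
   by (intro Bochner_Integration.integral_add cov_integrable(1)[OF sq_int_h[OF s] F] cov_integrable(1)[OF sq_int_h[OF s] R])
  finally have "\<bar>cov s t k\<bar> <= ?N * (4 * \<Theta> k) + ?N * sqrt (\<integral>x. (h t x - ?F x)^2 \<partial>\<nu>)"
   by (simp only:, intro order_trans[OF abs_triangle_ineq] add_mono cov_integrable(2)[OF sq_int_h[OF s] R]
     cov_proj_le[OF sq_int_h[OF s] measurable_cl[OF t] cl_bound dep_cl[OF t] \<delta>_pos sum_\<delta>_le, of 0 L k, unfolded add_0])
  also have "\<dots> <= ?N * (4 * \<Theta> k + eps L)" 
   unfolding distrib_left by (intro add_left_mono mult_left_mono e real_sqrt_ge_zero lint_nonneg zero_le_power2)
  also have "\<dots> <= sqrt (1 + Cm) * (4 * \<Theta> k + eps L)"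
   using \<Theta>_nonneg[of k] eps_pos[of L] by (intro mult_right_mono norm_h_le s) auto
  finally show ?thesis .
 qed
 moreover have "(\<lambda>L. sqrt (1 + Cm) * (4 * \<Theta> k + eps L)) \<longlonglongrightarrow> sqrt (1 + Cm) * (4 * \<Theta> k + 0)"
  by (intro tendsto_intros eps_tendsto)
 ultimately have "\<bar>cov s t k\<bar> <= sqrt (1 + Cm) * (4 * \<Theta> k + 0)" by (intro LIMSEQ_le_const) auto
 then show ?thesis by (simp add: cbound_def)
qed

lemma cov_lip:
 assumes s: "s \<in> {0..1}" and t: "t \<in> {0..1}"
 shows "\<bar>cov s t k - cov s s k\<bar> <= sqrt (1 + Cm) * (\<Lambda> * \<bar>t - s\<bar>)"
proof -
 have "cov s t k - cov s s k = (\<integral>z. h s (lag 0 z) * (h t (lag (int k) z) - h s (lag (int k) z)) \<partial>\<pi>)"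
  unfolding cov_def right_diff_distrib
  by (intro Bochner_Integration.integral_diff[symmetric] cov_integrable sq_int_h s t)
 also have "\<bar>\<dots>\<bar> <= sqrt (\<integral>x. (h s x)^2 \<partial>\<nu>) * sqrt (\<integral>x. (h t x - h s x)^2 \<partial>\<nu>)"
  by (rule cov_integrable(2)[OF sq_int_h[OF s] sq_int_diff[OF sq_int_h[OF t] sq_int_h[OF s]]])
 also have "\<dots> <= sqrt (1 + Cm) * (\<Lambda> * \<bar>t - s\<bar>)"
 proof (intro mult_mono norm_h_le s)
  have "sqrt (\<integral>x. (h t x - h s x)^2 \<partial>\<nu>) <= sqrt ((\<Lambda> * (t - s))^2)" by (rule real_sqrt_le_mono[OF lip[OF s t]])
  then show "sqrt (\<integral>x. (h t x - h s x)^2 \<partial>\<nu>) <= \<Lambda> * \<bar>t - s\<bar>" using \<Lambda>_nonneg by (simp add: abs_mult)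
 qed (use Cm_nonneg in auto)
 finally show ?thesis .
qed

text \<open>Folds a sum over all integer lags onto lags k >= 0, since the covariances at k and -k
  agree.\<close>

abbreviation wt :: "nat => real" where "wt k \<equiv> (if k = 0 then 1 else 2)"

lemma lrv_nat:
 assumes t: "t \<in> {0..1}"
 shows "(\<lambda>k. wt k * cov t t k) sums \<sigma>2"
proof -
 let ?g = "\<lambda>k::int. \<integral>z. h t (lag k z) * h t (lag 0 z) \<partial>\<pi>"
 note [measurable] = h_meas[OF t]
 have g1: "?g (int k) = cov t t k" for k unfolding cov_def by (simp add: mult.commute)
 have g2: "?g (- int k) = cov t t k" for k
  using integral_h_h[OF t t, of "- int k" k] by simp
 have "?g summable_on UNIV" using lrv[OF t] by (auto simp: summable_on_def)
 then have s1: "?g summable_on range int" and s2: "?g summable_on range (\<lambda>k. - int (Suc k))"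
  by (auto intro: summable_on_subset_banach)
 obtain a b where a: "(?g has_sum a) (range int)" and b: "(?g has_sum b) (range (\<lambda>k. - int (Suc k)))"
  using s1 s2 by (auto simp: summable_on_def)
 have U: "range int \<union> range (\<lambda>k. - int (Suc k)) = UNIV"
 proof -
  have "x \<in> range int \<or> x \<in> range (\<lambda>k. - int (Suc k))" for x :: int
  proof (cases "0 <= x")
   case True then show ?thesis by (auto intro: range_eqI[of _ _ "nat x"])
  next
   case False
   then have "x = - int (Suc (nat (- x - 1)))" by simp
   then show ?thesis by blast
  qed
  then show ?thesis by blast
 qed
 have "(?g has_sum (a + b)) (range int \<union> range (\<lambda>k. - int (Suc k)))"
  by (rule has_sum_Un_disjoint[OF a b]) auto
 then have ab: "a + b = \<sigma>2" using lrv[OF t] has_sum_unique unfolding U by blast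
 have inj: "inj (\<lambda>k. - int (Suc k))" by (auto simp: inj_on_def)
 have A: "(\<lambda>k. cov t t k) sums a"
  using a by (subst (asm) has_sum_reindex) (auto simp: o_def g1 intro: has_sum_imp_sums)
 have B: "(\<lambda>k. cov t t (Suc k)) sums b"
  using b by (subst (asm) has_sum_reindex[OF inj]) (auto simp only: o_def g2 intro: has_sum_imp_sums)
 have "(\<lambda>k. (if k = 0 then 0 else cov t t k)) sums b"
  using sums_Suc_imp[of "\<lambda>k. if k = 0 then 0 else cov t t k" b] B by simp
 from sums_add[OF A this] show ?thesis unfolding ab
  by (rule sums_cong[THEN iffD1, rotated]) simp
qed

text \<open>Groups the pairs by their distance; symmetry doubles all but the diagonal.\<close>

lemma sum_square_lag:
 fixes q :: "nat => nat => real"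
 assumes sym: "!!i j. q i j = q j i"
 shows "(\<Sum>i\<in>{a<..b}. \<Sum>j\<in>{a<..b}. q i j) = (\<Sum>i\<in>{a<..b}. \<Sum>k\<le>b - i. wt k * q i (i + k))"
proof -
 have up: "(\<Sum>j\<in>{i..b}. wt (j - i) * q i j) = (\<Sum>k\<le>b - i. wt k * q i (i + k))" if "i <= b" for i
  by (rule sum.reindex_bij_witness[of _ "\<lambda>k. i + k" "\<lambda>j. j - i"]) (use that in auto)
 have "(\<Sum>i\<in>{a<..b}. \<Sum>j\<in>{a<..b}. q i j) =
   (\<Sum>i\<in>{a<..b}. \<Sum>j\<in>{a<..b}. if i <= j then q i j else 0) + (\<Sum>i\<in>{a<..b}. \<Sum>j\<in>{a<..b}. if j < i then q i j else 0)"
  unfolding sum.distrib[symmetric] by (intro sum.cong refl) auto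
 also have "(\<Sum>i\<in>{a<..b}. \<Sum>j\<in>{a<..b}. if j < i then q i j else 0) = (\<Sum>i\<in>{a<..b}. \<Sum>j\<in>{a<..b}. if i < j then q i j else 0)"
  by (subst sum.swap) (intro sum.cong refl, simp add: sym)
 also have "(\<Sum>i\<in>{a<..b}. \<Sum>j\<in>{a<..b}. if i <= j then q i j else 0) + (\<Sum>i\<in>{a<..b}. \<Sum>j\<in>{a<..b}. if i < j then q i j else 0)
   = (\<Sum>i\<in>{a<..b}. \<Sum>j\<in>{a<..b}. if i <= j then wt (j - i) * q i j else 0)"
  unfolding sum.distrib[symmetric] by (intro sum.cong refl) auto
 also have "\<dots> = (\<Sum>i\<in>{a<..b}. \<Sum>k\<le>b - i. wt k * q i (i + k))"
 proof (rule sum.cong[OF refl])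
  fix i assume i: "i \<in> {a<..b}"
  have "(\<Sum>j\<in>{a<..b}. if i <= j then wt (j - i) * q i j else 0) = (\<Sum>j\<in>{i..b}. wt (j - i) * q i j)"
   using i by (intro sum.mono_neutral_cong_right) auto
  then show "(\<Sum>j\<in>{a<..b}. if i <= j then wt (j - i) * q i j else 0) = (\<Sum>k\<le>b - i. wt k * q i (i + k))"
   using up[of i] i by simp
 qed
 finally show ?thesis .
qed

text \<open>Error at lag k when the variance of a sum over a stretch is compared with the long-run
  variance. It is always of order \<open>cbound k\<close>, which is summable; for fixed k it is of
  order 1 / n, because at most k pairs leave the stretch and the others change by a Lipschitz
  constant times k / n. The factor 2 is \<open>wt\<close>.\<close>

definition vbound :: "nat => nat => real" where
 "vbound k n = 2 * min (2 * cbound k) (real k * (cbound k + sqrt (1 + Cm) * \<Lambda>) / real n)"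

lemma vbound_nonneg: "0 <= vbound k n"
 unfolding vbound_def using cbound_nonneg[of k] Cm_nonneg \<Lambda>_nonneg by (auto intro!: divide_nonneg_nonneg mult_nonneg_nonneg add_nonneg_nonneg)

lemma summable_vbound: "summable (\<lambda>k. vbound k n)"
 by (rule summable_comparison_test'[OF summable_mult[OF summable_cbound, of 4], of 0])
   (use vbound_nonneg in \<open>auto simp: vbound_def\<close>)

lemma vbound_tendsto: "(\<lambda>n. \<Sum>k. vbound k n) \<longlonglongrightarrow> 0"
proof -
 have "(\<lambda>n. \<Sum>k. vbound k n) \<longlonglongrightarrow> (\<Sum>k::nat. 0)"
 proof (rule tannerys_theorem[THEN conjunct2, THEN conjunct2])
  show "(\<lambda>n. vbound k n) \<longlonglongrightarrow> 0" for k
  proof -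
   have "(\<lambda>n. 2 * min (2 * cbound k) (real k * (cbound k + sqrt (1 + Cm) * \<Lambda>) / real n)) \<longlonglongrightarrow> 2 * min (2 * cbound k) 0"
    by (intro tendsto_intros tendsto_min lim_const_over_n)
   then show ?thesis using cbound_nonneg[of k] by (simp add: vbound_def)
  qed
  show "summable (\<lambda>l. 4 * cbound l)" by (rule summable_mult[OF summable_cbound])
  show "\<forall>\<^sub>F (k, n) in sequentially \<times>\<^sub>F sequentially. norm (vbound k n) <= 4 * cbound k"
   using vbound_nonneg by (intro always_eventually) (auto simp: vbound_def)
 qed simp
 then show ?thesis by simp
qed

text \<open>At each i of the stretch the covariances of (i, i + k) are compared with those of the
  process frozen at time i / n, whose weighted sum over k is \<open>\<sigma>2\<close> by
  \<open>lrv_nat\<close>. The bound is the same for all stretches and vanishes by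
  \<open>vbound_tendsto\<close>.\<close>

lemma variance_approx:
 assumes n: "1 <= n" and ab: "a <= b" "b <= n"
 shows "\<bar>(\<integral>z. (\<Sum>i\<in>{a<..b}. h (real i / real n) (lag (int i) z))^2 \<partial>\<pi>) / real n - real (b - a) / real n * \<sigma>2\<bar>
  <= (\<Sum>k. vbound k n)"
proof -
 let ?t = "\<lambda>i. real i / real n"
 have t: "?t i \<in> {0..1}" if "i <= n" for i using that by (rule grid_in_unit)
 have mean: "(\<integral>x. h (?t i) x \<partial>\<nu>) = 0" if "i \<in> {a<..b}" for i using that ab by (intro mean_h) auto
 define q where "q i j = (\<integral>z. h (?t i) (lag (int i) z) * h (?t j) (lag (int j) z) \<partial>\<pi>)" for i j
 have q_cov: "q i (i + k) = cov (?t i) (?t (i + k)) k" if "i + k <= n" for i k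
  unfolding q_def using integral_h_h[of "?t i" "?t (i + k)" "int i" k] t[of i] t[of "i + k"] that by simp
 have int: "integrable \<pi> (\<lambda>z. h (?t i) (lag (int i) z) * h (?t j) (lag (int j) z))" if "i \<in> {a<..b}" "j \<in> {a<..b}" for i j
  using that ab by (intro cov_integrable sq_int_h t) auto
 \<comment> \<open>Pairs that leave the stretch count as 0, so \<open>d\<close> also records the
   covariances lost at its right end.\<close>
 define d where "d i k = (if i + k <= b then cov (?t i) (?t (i + k)) k else 0) - cov (?t i) (?t i) k" for i k
 have E: "(\<integral>z. (\<Sum>i\<in>{a<..b}. h (?t i) (lag (int i) z))^2 \<partial>\<pi>) = (\<Sum>i\<in>{a<..b}. \<Sum>k\<le>b - i. wt k * q i (i + k))"
 proof -
  have "(\<integral>z. (\<Sum>i\<in>{a<..b}. h (?t i) (lag (int i) z))^2 \<partial>\<pi>) = (\<Sum>i\<in>{a<..b}. \<Sum>j\<in>{a<..b}. q i j)"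
   unfolding power2_eq_square sum_product q_def
   by (subst Bochner_Integration.integral_sum, intro Bochner_Integration.integrable_sum int, assumption+,
     intro sum.cong refl Bochner_Integration.integral_sum int)
  also have "\<dots> = (\<Sum>i\<in>{a<..b}. \<Sum>k\<le>b - i. wt k * q i (i + k))"
   by (rule sum_square_lag) (simp add: q_def mult.commute)
  finally show ?thesis .
 qed
 have dsum: "(\<lambda>k. wt k * d i k) sums ((\<Sum>k\<le>b - i. wt k * q i (i + k)) - \<sigma>2)" if i: "i \<in> {a<..b}" for i
 proof -
  have "(\<lambda>k. if k \<in> {..b - i} then wt k * q i (i + k) else 0) sums (\<Sum>k\<le>b - i. wt k * q i (i + k))"
   by (rule sums_If_finite_set) simp
  from sums_diff[OF this lrv_nat[OF t[of i]]] i ab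
  have s: "(\<lambda>k. (if k \<in> {..b - i} then wt k * q i (i + k) else 0) - wt k * cov (?t i) (?t i) k) sums
    ((\<Sum>k\<le>b - i. wt k * q i (i + k)) - \<sigma>2)" by simp
  have eq: "(if k \<in> {..b - i} then wt k * q i (i + k) else 0) - wt k * cov (?t i) (?t i) k = wt k * d i k" for k
   using q_cov[of i k] i ab by (auto simp: d_def right_diff_distrib)
  show ?thesis using s unfolding eq .
 qed
 have db: "\<bar>d i k\<bar> <= 2 * cbound k" if i: "i \<in> {a<..b}" for i k
 proof -
  have "\<bar>cov (?t i) (?t i) k\<bar> <= cbound k" using i ab by (intro cov_bound t mean) auto
  moreover have "\<bar>cov (?t i) (?t (i + k)) k\<bar> <= cbound k" if "i + k <= b"
   using i ab that by (intro cov_bound t mean) auto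
  ultimately show ?thesis unfolding d_def using cbound_nonneg[of k] by (auto split: if_splits)
 qed
 have dsum_le: "(\<Sum>i\<in>{a<..b}. \<bar>d i k\<bar>) / n <= vbound k n / 2" for k
 proof -
  have 1: "(\<Sum>i\<in>{a<..b}. \<bar>d i k\<bar>) / n <= 2 * cbound k"
  proof -
   have "(\<Sum>i\<in>{a<..b}. \<bar>d i k\<bar>) <= (\<Sum>i\<in>{a<..b}. 2 * cbound k)" by (intro sum_mono db)
   also have "\<dots> = real (b - a) * (2 * cbound k)" by simp
   also have "\<dots> <= n * (2 * cbound k)" using ab cbound_nonneg[of k] by (intro mult_right_mono) auto
   finally show ?thesis using n by (simp add: divide_le_eq mult.commute)
  qed
  have 2: "(\<Sum>i\<in>{a<..b}. \<bar>d i k\<bar>) / n <= real k * (cbound k + sqrt (1 + Cm) * \<Lambda>) / n"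
  proof -
   have "\<bar>d i k\<bar> <= (if b - k < i then cbound k else 0) + sqrt (1 + Cm) * \<Lambda> * (k / n)" if i: "i \<in> {a<..b}" for i
   proof (cases "i + k <= b")
    case True
    have "\<bar>d i k\<bar> <= sqrt (1 + Cm) * (\<Lambda> * \<bar>?t (i + k) - ?t i\<bar>)"
     unfolding d_def using True i ab by (simp del: of_nat_add, intro cov_lip t) auto
    also have "\<bar>?t (i + k) - ?t i\<bar> = k / n" by (simp flip: diff_divide_distrib)
    finally show ?thesis using cbound_nonneg[of k] by simp
   next
    case False
    have "\<bar>cov (?t i) (?t i) k\<bar> <= cbound k" using i ab by (intro cov_bound t mean) auto
    moreover have "0 <= sqrt (1 + Cm) * \<Lambda> * (k / n)" using Cm_nonneg \<Lambda>_nonneg by (intro mult_nonneg_nonneg) auto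
    ultimately show ?thesis using False i unfolding d_def by auto
   qed
   then have "(\<Sum>i\<in>{a<..b}. \<bar>d i k\<bar>) <= (\<Sum>i\<in>{a<..b}. (if b - k < i then cbound k else 0) + sqrt (1 + Cm) * \<Lambda> * (k / n))"
    by (rule sum_mono)
   also have "\<dots> = (\<Sum>i\<in>{a<..b}. if b - k < i then cbound k else 0) + real (b - a) * (sqrt (1 + Cm) * \<Lambda> * (k / n))"
    by (simp add: sum.distrib)
   also have "\<dots> <= k * cbound k + n * (sqrt (1 + Cm) * \<Lambda> * (k / n))"
   proof (intro add_mono mult_right_mono)
    have "(\<Sum>i\<in>{a<..b}. if b - k < i then cbound k else 0) = (\<Sum>i\<in>{a<..b} \<inter> {b - k<..}. cbound k)"
     by (subst sum.inter_restrict) (auto intro!: sum.cong)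
    also have "\<dots> <= (\<Sum>i\<in>{b - k<..b}. cbound k)" by (intro sum_mono2) (auto simp: cbound_nonneg)
    also have "\<dots> <= k * cbound k" using cbound_nonneg[of k] by (auto intro!: mult_right_mono)
    finally show "(\<Sum>i\<in>{a<..b}. if b - k < i then cbound k else 0) <= k * cbound k" .
   qed (use ab Cm_nonneg \<Lambda>_nonneg in auto)
   also have "\<dots> = real k * (cbound k + sqrt (1 + Cm) * \<Lambda>)" using n by (simp add: field_simps)
   finally show ?thesis by (rule divide_right_mono) simp
  qed
  show ?thesis using 1 2 unfolding vbound_def by simp
 qed
 have s1: "summable (\<lambda>k. wt k * \<bar>d i k\<bar>)" if "i \<in> {a<..b}" for i
 proof (rule summable_comparison_test'[OF summable_mult[OF summable_cbound, of 4], of 0])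
  show "norm (wt k * \<bar>d i k\<bar>) <= 4 * cbound k" for k
   using db[OF that, of k] cbound_nonneg[of k] by auto
 qed
 have "(\<integral>z. (\<Sum>i\<in>{a<..b}. h (?t i) (lag (int i) z))^2 \<partial>\<pi>) / n - real (b - a) / n * \<sigma>2
   = (\<Sum>i\<in>{a<..b}. (\<Sum>k\<le>b - i. wt k * q i (i + k)) - \<sigma>2) / n"
  unfolding E by (simp add: sum_subtractf diff_divide_distrib)
 also have "\<bar>\<dots>\<bar> <= (\<Sum>i\<in>{a<..b}. \<Sum>k. wt k * \<bar>d i k\<bar>) / n"
 proof -
  have "\<bar>(\<Sum>k\<le>b - i. wt k * q i (i + k)) - \<sigma>2\<bar> <= (\<Sum>k. wt k * \<bar>d i k\<bar>)" if "i \<in> {a<..b}" for i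
  proof -
   have eq: "norm (wt k * d i k) = wt k * \<bar>d i k\<bar>" for k by (simp add: abs_mult)
   have "\<bar>\<Sum>k. wt k * d i k\<bar> <= (\<Sum>k. norm (wt k * d i k))"
    using summable_norm[of "\<lambda>k. wt k * d i k"] s1[OF that] unfolding eq by simp
   then show ?thesis using sums_unique[OF dsum[OF that]] unfolding eq by simp
  qed
  then have "\<bar>\<Sum>i\<in>{a<..b}. (\<Sum>k\<le>b - i. wt k * q i (i + k)) - \<sigma>2\<bar> <= (\<Sum>i\<in>{a<..b}. \<Sum>k. wt k * \<bar>d i k\<bar>)"
   by (intro order_trans[OF sum_abs] sum_mono)
  then show ?thesis by (simp add: divide_right_mono)
 qed
 also have "\<dots> = (\<Sum>k. (\<Sum>i\<in>{a<..b}. wt k * \<bar>d i k\<bar>) / n)"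
 proof -
  have "(\<Sum>i\<in>{a<..b}. \<Sum>k. wt k * \<bar>d i k\<bar>) = (\<Sum>k. \<Sum>i\<in>{a<..b}. wt k * \<bar>d i k\<bar>)"
   by (rule suminf_sum[symmetric]) (rule s1)
  then show ?thesis using suminf_divide[OF summable_sum[of "{a<..b}" "\<lambda>i k. wt k * \<bar>d i k\<bar>", OF s1], of n] by simp
 qed
 also have "\<dots> <= (\<Sum>k. vbound k n)"
 proof (rule suminf_le)
  show "(\<Sum>i\<in>{a<..b}. wt k * \<bar>d i k\<bar>) / n <= vbound k n" for k
  proof -
   have "(\<Sum>i\<in>{a<..b}. wt k * \<bar>d i k\<bar>) / n <= (\<Sum>i\<in>{a<..b}. 2 * \<bar>d i k\<bar>) / n"
    by (intro divide_right_mono sum_mono mult_right_mono) auto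
   also have "\<dots> = 2 * ((\<Sum>i\<in>{a<..b}. \<bar>d i k\<bar>) / n)" by (simp add: sum_distrib_left)
   also have "\<dots> <= vbound k n" using dsum_le[of k] by linarith
   finally show ?thesis .
  qed
  show "summable (\<lambda>k. (\<Sum>i\<in>{a<..b}. wt k * \<bar>d i k\<bar>) / n)"
   by (intro summable_divide summable_sum s1)
 qed (rule summable_vbound)
 finally show ?thesis .
qed

end

section \<open>Blocks and characteristic functions\<close>

text \<open>Factors are exchanged one at a time; all the others have norm at most 1.\<close>

lemma norm_prod_diff_le:
 fixes z w :: "'i => complex"
 assumes "finite I" "!!i. i \<in> I ==> norm (z i) <= 1" "!!i. i \<in> I ==> norm (w i) <= 1"
 shows "norm ((\<Prod>i\<in>I. z i) - (\<Prod>i\<in>I. w i)) <= (\<Sum>i\<in>I. norm (z i - w i))"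
 using assms
proof (induction I rule: finite_induct)
 case (insert a I)
 have p: "norm (\<Prod>i\<in>I. w i) <= 1" unfolding prod_norm[symmetric] by (rule prod_le_1) (use insert in auto)
 have "(\<Prod>i\<in>insert a I. z i) - (\<Prod>i\<in>insert a I. w i) =
   z a * ((\<Prod>i\<in>I. z i) - (\<Prod>i\<in>I. w i)) + (z a - w a) * (\<Prod>i\<in>I. w i)"
  using insert by (simp add: algebra_simps)
 also have "norm \<dots> <= norm (z a) * norm ((\<Prod>i\<in>I. z i) - (\<Prod>i\<in>I. w i)) + norm (z a - w a) * norm (\<Prod>i\<in>I. w i)"
  by (rule order_trans[OF norm_triangle_ineq]) (simp add: norm_mult)
 also have "\<dots> <= 1 * norm ((\<Prod>i\<in>I. z i) - (\<Prod>i\<in>I. w i)) + norm (z a - w a) * 1"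
  using insert p by (intro add_mono mult_mono) auto
 also have "\<dots> <= (\<Sum>i\<in>insert a I. norm (z i - w i))" using insert by simp
 finally show ?case .
qed simp

lemma exp_neg_approx: "0 <= x ==> \<bar>exp (- x) - (1 - x)\<bar> <= x^2 / (2::real)"
proof -
 assume x: "0 <= x"
 let ?f = "\<lambda>x::real. 1 - x + x^2 / 2 - exp (- x)"
 have "?f 0 <= ?f x"
 proof (rule DERIV_nonneg_imp_nondecreasing[OF x])
  fix y :: real assume "0 <= y"
  have "(?f has_real_derivative (- 1 + y + exp (- y))) (at y)"
   by (auto intro!: derivative_eq_intros simp: power2_eq_square)
  moreover have "0 <= - 1 + y + exp (- y)" using exp_ge_add_one_self[of "- y"] by simp
  ultimately show "\<exists>z. (?f has_real_derivative z) (at y) \<and> 0 <= z" by blast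
 qed
 then show ?thesis using exp_ge_add_one_self[of "- x"] by simp
qed

text \<open>Lindeberg's argument for bounded summands: each factor is compared with 1 - t^2 v / 2 by
  its Taylor expansion and then with exp(- t^2 v / 2). Both errors are v times a quantity that
  vanishes with the bound B, so they add up to V times that quantity.\<close>

lemma (in prob_space) char_sum_approx:
 fixes X :: "'i => 'a => real"
 assumes A: "finite A" and ind: "indep_vars (\<lambda>_. borel) X A"
  and B: "!!r w. r \<in> A ==> \<bar>X r w\<bar> <= B" and mean: "!!r. r \<in> A ==> expectation (X r) = 0"
 defines "V \<equiv> (\<Sum>r\<in>A. expectation (\<lambda>w. (X r w)^2))"
 shows "cmod (char (distr M borel (\<lambda>w. \<Sum>r\<in>A. X r w)) t - exp (- (t^2 * V / 2)))
  <= V * (\<bar>t\<bar> ^ 3 * B + t ^ 4 * B^2)"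
proof -
 have rv: "random_variable borel (X r)" if "r \<in> A" for r using ind that by (auto simp: indep_vars_def)
 define v where "v r = expectation (\<lambda>w. (X r w)^2)" for r
 have int: "integrable M (\<lambda>w. X r w ^ k)" if "r \<in> A" for r k
 proof (rule bounded_integrable[of _ "B ^ k"])
  show "\<bar>X r w ^ k\<bar> <= B ^ k" for w unfolding power_abs by (intro power_mono B that) simp
 qed (use rv[OF that] in measurable)
 have v0: "0 <= v r" for r unfolding v_def by (intro lint_nonneg) simp
 have trm: "cmod (char (distr M borel (X r)) t - complex_of_real (exp (- (t^2 * v r / 2)))) <= v r * (\<bar>t\<bar> ^ 3 * B + t ^ 4 * B^2)"
  if r: "r \<in> A" for r
 proof -
  have B0: "0 <= B" using B[OF r, of undefined] by linarith
  have vB: "v r <= B^2"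
  proof -
   have "(X r w)^2 <= B^2" for w using power_mono[OF B[OF r] abs_ge_zero, of w 2] by simp
   then show ?thesis unfolding v_def by (intro integral_le_const int r) auto
  qed
  have var: "variance (X r) = v r" by (simp add: v_def mean[OF r])
  have "cmod (char (distr M borel (X r)) t - complex_of_real (1 - t^2 * v r / 2)) <=
    (t^2 / 6) * expectation (\<lambda>x. min (6 * (X r x)^2) (\<bar>t\<bar> * \<bar>X r x\<bar> ^ 3))"
   by (rule char_approx3'[OF rv[OF r] _ int[OF r] mean[OF r] var refl]) (use int[OF r, of 1] in simp)
  also have "\<dots> <= (t^2 / 6) * (\<bar>t\<bar> * B * v r)"
  proof (intro mult_left_mono)
   have i2: "integrable M (\<lambda>x. \<bar>t\<bar> * B * (X r x)^2)" using int[OF r] by simp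
   have mm: "min (6 * (X r x)^2) (\<bar>t\<bar> * \<bar>X r x\<bar> ^ 3) <= \<bar>t\<bar> * B * (X r x)^2" for x
   proof -
    have "\<bar>X r x\<bar> ^ 3 = \<bar>X r x\<bar> * (X r x)^2" by (simp add: power3_eq_cube power2_eq_square mult.assoc)
    also have "\<dots> <= B * (X r x)^2" by (intro mult_right_mono B r) simp
    finally have "\<bar>t\<bar> * \<bar>X r x\<bar> ^ 3 <= \<bar>t\<bar> * (B * (X r x)^2)" by (intro mult_left_mono) auto
    then show ?thesis by (simp add: mult.assoc)
   qed
   have "expectation (\<lambda>x. min (6 * (X r x)^2) (\<bar>t\<bar> * \<bar>X r x\<bar> ^ 3)) <= expectation (\<lambda>x. \<bar>t\<bar> * B * (X r x)^2)"
   proof (rule integral_mono[OF _ i2 mm])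
    show "integrable M (\<lambda>x. min (6 * (X r x)^2) (\<bar>t\<bar> * \<bar>X r x\<bar> ^ 3))"
     by (rule integrable_bd[OF i2])
       (use rv[OF r] mm in \<open>auto intro: order_trans[OF _ abs_ge_self]\<close>)
   qed
   then show "expectation (\<lambda>x. min (6 * (X r x)^2) (\<bar>t\<bar> * \<bar>X r x\<bar> ^ 3)) <= \<bar>t\<bar> * B * v r"
    using int[OF r, of 2] by (simp add: v_def)
  qed simp
  also have "\<dots> = v r * (\<bar>t\<bar> ^ 3 * B) / 6"
  proof -
   define a where "a = \<bar>t\<bar>"
   have t2: "t^2 = a^2" by (simp add: a_def)
   show ?thesis unfolding t2 a_def[symmetric] by (simp add: power3_eq_cube power2_eq_square)
  qed
  also have "\<dots> <= v r * (\<bar>t\<bar> ^ 3 * B)" using v0[of r] B0 by simp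
  finally have 1: "cmod (char (distr M borel (X r)) t - complex_of_real (1 - t^2 * v r / 2)) <= v r * (\<bar>t\<bar> ^ 3 * B)" .
  have "cmod (complex_of_real (1 - t^2 * v r / 2) - complex_of_real (exp (- (t^2 * v r / 2)))) = \<bar>exp (- (t^2 * v r / 2)) - (1 - t^2 * v r / 2)\<bar>"
   unfolding of_real_diff[symmetric] norm_of_real by (rule abs_minus_commute)
  also have "\<dots> <= (t^2 * v r / 2)^2 / 2" by (rule exp_neg_approx) (simp add: v0)
  also have "\<dots> = v r * (t ^ 4 * v r) / 8" by (simp add: power2_eq_square power4_eq_xxxx)
  also have "\<dots> <= v r * (t ^ 4 * v r)" using v0[of r] by simp
  also have "\<dots> <= v r * (t ^ 4 * B^2)" using v0[of r] vB by (intro mult_left_mono) auto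
  finally have 2: "cmod (complex_of_real (1 - t^2 * v r / 2) - complex_of_real (exp (- (t^2 * v r / 2)))) <= v r * (t ^ 4 * B^2)" .
  show ?thesis
   using norm_triangle_ineq[of "char (distr M borel (X r)) t - complex_of_real (1 - t^2 * v r / 2)" "complex_of_real (1 - t^2 * v r / 2) - complex_of_real (exp (- (t^2 * v r / 2)))"] 1 2
   by (simp add: distrib_left)
 qed
 have e: "complex_of_real (exp (- (t^2 * V / 2))) = (\<Prod>r\<in>A. complex_of_real (exp (- (t^2 * v r / 2))))"
  unfolding V_def v_def[symmetric] of_real_prod[symmetric] exp_sum[OF A, symmetric]
  by (simp add: sum_negf sum_distrib_left sum_divide_distrib)
 have "cmod (char (distr M borel (\<lambda>w. \<Sum>r\<in>A. X r w)) t - exp (- (t^2 * V / 2)))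
   <= (\<Sum>r\<in>A. cmod (char (distr M borel (X r)) t - complex_of_real (exp (- (t^2 * v r / 2)))))"
  unfolding char_distr_sum[OF ind] e
 proof (rule norm_prod_diff_le[OF A])
  show "cmod (char (distr M borel (X r)) t) <= 1" if "r \<in> A" for r
   by (rule real_distribution.cmod_char_le_1) (rule real_distribution_distr[OF rv[OF that]])
  show "cmod (complex_of_real (exp (- (t^2 * v r / 2)))) <= 1" for r
   using v0[of r] by simp
 qed
 also have "\<dots> <= (\<Sum>r\<in>A. v r * (\<bar>t\<bar> ^ 3 * B + t ^ 4 * B^2))" by (intro sum_mono trm)
 also have "\<dots> = V * (\<bar>t\<bar> ^ 3 * B + t ^ 4 * B^2)" by (simp add: V_def v_def sum_distrib_right)
 finally show ?thesis .
qed

lemma (in prob_space) indep_vars_sum_square: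
 fixes X :: "'i => 'a => real"
 assumes A: "finite A" and ind: "indep_vars (\<lambda>_. borel) X A"
  and B: "!!r w. r \<in> A ==> \<bar>X r w\<bar> <= B" and mean: "!!r. r \<in> A ==> expectation (X r) = 0"
 shows "expectation (\<lambda>w. (\<Sum>r\<in>A. X r w)^2) = (\<Sum>r\<in>A. expectation (\<lambda>w. (X r w)^2))"
proof -
 have rv: "random_variable borel (X r)" if "r \<in> A" for r using ind that by (auto simp: indep_vars_def)
 have int1: "integrable M (X r)" if "r \<in> A" for r
  by (rule bounded_integrable[OF rv[OF that] B[OF that]])
 have int: "integrable M (\<lambda>w. X r w * X s w)" if "r \<in> A" "s \<in> A" for r s
 proof (rule bounded_integrable[of _ "B * B"])
  have B0: "0 <= B" using B[OF that(1), of undefined] by linarith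
  show "\<bar>X r w * X s w\<bar> <= B * B" for w unfolding abs_mult by (intro mult_mono B that B0) auto
 qed (use rv that in measurable)
 have "expectation (\<lambda>w. (\<Sum>r\<in>A. X r w)^2) = (\<Sum>r\<in>A. \<Sum>s\<in>A. expectation (\<lambda>w. X r w * X s w))"
  unfolding power2_eq_square sum_product
  by (subst Bochner_Integration.integral_sum, intro Bochner_Integration.integrable_sum int, assumption+,
    intro sum.cong refl Bochner_Integration.integral_sum int)
 also have "\<dots> = (\<Sum>r\<in>A. \<Sum>s\<in>A. if s = r then expectation (\<lambda>w. (X r w)^2) else 0)"
 proof (intro sum.cong refl)
  fix r s assume rs: "r \<in> A" "s \<in> A"
  show "expectation (\<lambda>w. X r w * X s w) = (if s = r then expectation (\<lambda>w. (X r w)^2) else 0)"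
  proof (cases "s = r")
   case False
   have "indep_vars (\<lambda>_. borel) X {r, s}" by (rule indep_vars_subset[OF ind]) (use rs in auto)
   from indep_vars_lebesgue_integral[OF _ this] have
    "expectation (\<lambda>w. \<Prod>i\<in>{r, s}. X i w) = (\<Prod>i\<in>{r, s}. expectation (X i))"
    using rs int1 by auto
   then show ?thesis using False rs mean by auto
  qed (simp add: power2_eq_square)
 qed
 also have "\<dots> = (\<Sum>r\<in>A. expectation (\<lambda>w. (X r w)^2))" using A by simp
 finally show ?thesis .
qed

context innovations
begin

lemma indep_vars_coordinates: "pi.indep_vars (\<lambda>_. \<mu>) (\<lambda>c z. z c) UNIV"
proof -
 have "distr \<pi> \<mu> (\<lambda>z. z c) = \<mu>" for c by (rule distr_PiM_component) (auto intro: prob_space_axioms)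
 moreover have "distr \<pi> \<pi> (\<lambda>x. \<lambda>i\<in>UNIV. x i) = \<pi>" by (simp add: restrict_UNIV distr_id)
 ultimately show ?thesis
  by (subst pi.indep_vars_iff_distr_eq_PiM) simp_all
qed

text \<open>\<open>X a\<close> lives on the whole product but depends on the coordinates in
  \<open>K a\<close> only. Filling the others with a fixed point x0 exhibits it as a function of the
  restriction to \<open>K a\<close>, and restrictions to disjoint sets are independent.\<close>

lemma indep_vars_blocks:
 fixes X :: "'i => (int => 'e) => real"
 assumes X: "!!a. a \<in> A ==> X a \<in> borel_measurable \<pi>" and K: "disjoint_family_on K A"
  and XK: "!!a w w'. a \<in> A ==> (!!c. c \<in> K a ==> w c = w' c) ==> X a w = X a w'"
 shows "pi.indep_vars (\<lambda>_. borel) X A"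
proof -
 obtain x0 where x0: "x0 \<in> space \<mu>" using not_empty by blast
 define F where "F a z = X a (\<lambda>c. if c \<in> K a then z c else x0)" for a z
 have 1: "pi.indep_vars (\<lambda>a. PiM (K a) (\<lambda>_. \<mu>)) (\<lambda>a w. restrict (\<lambda>c. w c) (K a)) A"
  by (rule pi.indep_vars_restrict[OF indep_vars_coordinates _ K]) simp
 have extm: "(\<lambda>z c. if c \<in> K a then z c else x0) \<in> measurable (PiM (K a) (\<lambda>_. \<mu>)) \<pi>" for a
 proof (rule measurable_PiM_single')
  show "(\<lambda>z. if c \<in> K a then z c else x0) \<in> measurable (PiM (K a) (\<lambda>_. \<mu>)) \<mu>" for c
   using x0 by (cases "c \<in> K a") auto
 qed (use x0 in \<open>auto simp: space_PiM PiE_iff\<close>)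
 have 2: "pi.indep_vars (\<lambda>_. borel) (\<lambda>a w. F a (restrict (\<lambda>c. w c) (K a))) A"
  by (rule pi.indep_vars_compose2[OF 1]) (unfold F_def, rule measurable_compose[OF extm X])
 have "(\<lambda>w. F a (restrict (\<lambda>c. w c) (K a))) = X a" if "a \<in> A" for a
  unfolding F_def by (rule ext, rule XK[OF that]) simp
 then show ?thesis using 2 by (subst pi.indep_vars_cong[of A A _ "\<lambda>a w. F a (restrict (\<lambda>c. w c) (K a))"]) auto
qed

end

text \<open>The polygonal path through the points \<open>(i / n, (y 1 + \<dots> + y i) / sqrt n)\<close>.\<close>

definition poly_path :: "nat => (nat => real) => real => real" where
 "poly_path n y x = (\<Sum>i=1..n. y i * max 0 (min 1 (real n * x - (real i - 1)))) / sqrt (real n)"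

section \<open>Blocks, gaps and macro-intervals\<close>

text \<open>Blocks have length L^2 and gaps length L, for L of order n^(1/8): block sums are at most
  2 L^3, of order n^(3/8) and thus negligible against \<open>sqrt n\<close>, while the gaps take up
  a share of about 1 / L of the sample.\<close>

definition block_len :: "nat => nat" where
 "block_len n = nat \<lfloor>real n powr (1/8)\<rfloor>"

lemma block_len_le: "real (block_len n) <= real n powr (1/8)"
 unfolding block_len_def by simp

lemma block_len_pos: "1 <= n ==> 1 <= block_len n"
 unfolding block_len_def using ge_one_powr_ge_zero[of "real n" "1/8"] by (simp add: le_nat_iff le_floor_iff)

lemma block_len_at_top: "filterlim block_len at_top sequentially"
 unfolding block_len_def[abs_def] by real_asymp

text \<open>Dropping the first \<open>block_len n\<close> indices of a block makes the sums of different blocks independent,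
 because the truncated summands depend on \<open>block_len n\<close> innovations only.\<close>

definition blk :: "nat => nat => nat set" where
 "blk n r = {r * (block_len n)^2 + block_len n <.. (r + 1) * (block_len n)^2}"

text \<open>The blocks inside the j-th of M macro-intervals (n j / M, n (j + 1) / M], written
  without division. The bound r < n secures finiteness.\<close>

definition blocks_in :: "nat => nat => nat => nat set" where
 "blocks_in n M j = {r. r < n \<and> n * j <= M * (r * (block_len n)^2) \<and> M * ((r + 1) * (block_len n)^2) <= n * (j + 1)}"

definition big_in :: "nat => nat => nat => nat set" where
 "big_in n M j = (\<Union>r\<in>blocks_in n M j. blk n r)"

definition big :: "nat => nat => nat set" where
 "big n M = (\<Union>j<M. big_in n M j)"

context
 fixes n M :: nat
 assumes n: "1 <= n" and M: "1 <= M"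
begin

lemma bl2_pos: "1 <= (block_len n)^2"
 using block_len_pos[OF n] by simp

lemma finite_blocks_in [simp]: "finite (blocks_in n M j)"
 unfolding blocks_in_def by (rule finite_subset[of _ "{..<n}"]) auto

lemma blk_disjoint: "r \<noteq> s ==> blk n r \<inter> blk n s = {}"
proof -
 have aux: "blk n r \<inter> blk n s = {}" if "r < s" for r s
 proof -
  have "(r + 1) * (block_len n)^2 <= s * (block_len n)^2" using that by (intro mult_right_mono) auto
  then show ?thesis by (auto simp: blk_def)
 qed
 assume "r \<noteq> s"
 then show ?thesis using aux[of r s] aux[of s r] by (cases "r < s") auto
qed

lemma blocks_in_disjoint: "j \<noteq> k ==> blocks_in n M j \<inter> blocks_in n M k = {}"
proof -
 have aux: "blocks_in n M j \<inter> blocks_in n M k = {}" if "j < k" for j k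
 proof (rule ccontr)
  assume "blocks_in n M j \<inter> blocks_in n M k \<noteq> {}"
  then obtain r where r: "M * ((r + 1) * (block_len n)^2) <= n * (j + 1)" "n * k <= M * (r * (block_len n)^2)"
   by (auto simp: blocks_in_def)
  have "n * (j + 1) <= n * k" using that by (intro mult_left_mono) auto
  then have "M * ((r + 1) * (block_len n)^2) <= M * (r * (block_len n)^2)" using r by linarith
  then have "(r + 1) * (block_len n)^2 <= r * (block_len n)^2" using M by simp
  then show False using bl2_pos by simp
 qed
 assume "j \<noteq> k"
 then show ?thesis using aux[of j k] aux[of k j] by (cases "j < k") auto
qed

lemma big_in_bounds:
 assumes "i \<in> big_in n M j"
 shows "n * j <= M * (i - 1)" "M * i <= n * (j + 1)" "1 <= i"
proof -
 obtain r where r: "n * j <= M * (r * (block_len n)^2)" "M * ((r + 1) * (block_len n)^2) <= n * (j + 1)" "i \<in> blk n r"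
  using assms by (auto simp: big_in_def blocks_in_def)
 then have i: "r * (block_len n)^2 <= i - 1" "i <= (r + 1) * (block_len n)^2" "1 <= i" by (auto simp: blk_def)
 show "n * j <= M * (i - 1)" using r(1) mult_left_mono[OF i(1), of M] by linarith
 show "M * i <= n * (j + 1)" using r(2) mult_left_mono[OF i(2), of M] by linarith
 show "1 <= i" by (rule i)
qed

lemma big_in_subset: "big_in n M j \<subseteq> {n * j div M <.. n * (j + 1) div M}"
proof
 fix i assume i: "i \<in> big_in n M j"
 note b = big_in_bounds[OF i]
 have "n * j div M <= M * (i - 1) div M" by (rule div_le_mono[OF b(1)])
 then have "n * j div M <= i - 1" using M by simp
 moreover have "i <= n * (j + 1) div M" using b(2) M by (simp add: less_eq_div_iff_mult_less_eq mult.commute)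
 ultimately show "i \<in> {n * j div M <.. n * (j + 1) div M}" using b(3) by auto
qed

lemma macro_le: "j < M ==> n * (j + 1) div M <= n"
proof -
 assume "j < M"
 then have "n * (j + 1) <= n * M" by (intro mult_left_mono) auto
 then have "n * (j + 1) div M <= n * M div M" by (rule div_le_mono)
 then show ?thesis using M by simp
qed

lemma big_subset: "big n M \<subseteq> {1..n}"
proof
 fix i assume "i \<in> big n M"
 then obtain j where j: "j < M" "i \<in> big_in n M j" by (auto simp: big_def)
 then have "i \<in> {n * j div M <.. n * (j + 1) div M}" using big_in_subset by blast
 then show "i \<in> {1..n}" using macro_le[OF j(1)] by auto
qed

lemma big_in_macro:
 assumes j: "j < M"
 shows "{n * j div M <.. n * (j + 1) div M} - big_in n M j = {n * j div M <.. n * (j + 1) div M} - big n M"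
proof -
 have "i \<in> big_in n M j" if i: "i \<in> {n * j div M <.. n * (j + 1) div M}" "i \<in> big n M" for i
 proof -
  obtain k where k: "k < M" "i \<in> big_in n M k" using i by (auto simp: big_def)
  have ik: "i \<in> {n * k div M <.. n * (k + 1) div M}" using k big_in_subset by blast
  have "j = k"
  proof (rule ccontr)
   assume "j \<noteq> k"
   then consider "j + 1 <= k" | "k + 1 <= j" by linarith
   then show False
   proof cases
    case 1
    then have "n * (j + 1) div M <= n * k div M" by (intro div_le_mono mult_left_mono) auto
    then show False using i ik by auto
   next
    case 2
    then have "n * (k + 1) div M <= n * j div M" by (intro div_le_mono mult_left_mono) auto
    then show False using i ik by auto
   qed
  qed
  then show ?thesis using k by simp
 qed
 moreover have "big_in n M j \<subseteq> big n M" using j by (auto simp: big_def)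
 ultimately show ?thesis by blast
qed

text \<open>An index is lost if it lies in the gap at the start of its block or if its block
  straddles the end of a macro-interval. There are at most n / L^2 + 1 gaps of length L, and M ends,
  each of which spoils one block.\<close>

lemma card_not_big: "card ({1..n} - big n M) <= (n div (block_len n)\<^sup>2 + 1) * block_len n + M * (block_len n)^2"
proof -
 let ?p = "(block_len n)^2" and ?L = "block_len n"
 let ?gap = "\<Union>r\<in>{..n div ?p}. {r * ?p <.. r * ?p + ?L}"
 let ?cross = "\<Union>j\<in>{..<M}. {(n * (j + 1) div (M * ?p)) * ?p <.. (n * (j + 1) div (M * ?p) + 1) * ?p}"
 have p: "?p > 0" using bl2_pos by linarith
 have "{1..n} - big n M \<subseteq> ?gap \<union> ?cross"
 proof
  fix i assume i: "i \<in> {1..n} - big n M"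
  define r where "r = (i - 1) div ?p"
  have r1: "r * ?p <= i - 1" unfolding r_def by (rule div_times_less_eq_dividend)
  have r2: "i - 1 < (r + 1) * ?p" using dividend_less_div_times[OF p, of "i - 1"] unfolding r_def by (simp add: add.commute)
  have rn: "r <= n div ?p" unfolding r_def using i by (intro div_le_mono) auto
  have ri: "r * ?p < i" "i <= (r + 1) * ?p" using r1 r2 i by auto
  have "r <= r * ?p" using p by simp
  moreover have "i <= n" using i by simp
  ultimately have rn': "r < n" using ri by linarith
  show "i \<in> ?gap \<union> ?cross"
  proof (cases "i <= r * ?p + ?L")
   case True
   then show ?thesis by (intro UnI1 UN_I[of r]) (use ri rn in simp_all)
  next
   case False
   define j where "j = M * (r * ?p) div n"
   have j1: "n * j <= M * (r * ?p)" unfolding j_def by simp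
   have j2: "M * (r * ?p) < n * (j + 1)" unfolding j_def using n dividend_less_times_div[of n "M * (r * ?p)"] by simp
   have jM: "j < M"
   proof -
    have "M * (r * ?p) < M * n" using ri i M by (intro mult_strict_left_mono) auto
    then have "n * j < n * M" using j1 by (metis le_less_trans mult.commute)
    then show ?thesis by simp
   qed
   have "i \<notin> big_in n M j" using i jM by (auto simp: big_def)
   moreover have "i \<in> blk n r" using False ri by (auto simp: blk_def)
   ultimately have "r \<notin> blocks_in n M j" by (auto simp: big_in_def)
   then have j3: "n * (j + 1) < M * ((r + 1) * ?p)" using rn' j1 by (auto simp: blocks_in_def)
   have e: "M * (x * ?p) = M * ?p * x" for x by (simp only: mult.assoc mult.commute[of x])
   \<comment> \<open>Block r starts in macro-interval j but does not fit into it, so the boundary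
     falls into block r.\<close>
   have "n * (j + 1) div (M * ?p) = r"
    by (rule div_nat_eqI) (use j2 j3 in \<open>simp_all only: e Suc_eq_plus1 less_imp_le\<close>)
   then have "i \<in> {(n * (j + 1) div (M * ?p)) * ?p <.. (n * (j + 1) div (M * ?p) + 1) * ?p}"
    using ri by (simp only: greaterThanAtMost_iff simp_thms)
   then show ?thesis by (intro UnI2 UN_I[of j]) (use jM in simp)
  qed
 qed
 then have "card ({1..n} - big n M) <= card (?gap \<union> ?cross)" by (intro card_mono) auto
 also have "\<dots> <= card ?gap + card ?cross" by (rule card_Un_le)
 also have "card ?gap <= (\<Sum>r\<in>{..n div ?p}. card {r * ?p <.. r * ?p + ?L})" by (rule card_UN_le) simp
 also have "\<dots> = (n div ?p + 1) * ?L" by simp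
 also have "card ?cross <= (\<Sum>j\<in>{..<M}. card {(n * (j + 1) div (M * ?p)) * ?p <.. (n * (j + 1) div (M * ?p) + 1) * ?p})"
  by (rule card_UN_le) simp
 also have "\<dots> = M * ?p" by simp
 finally show ?thesis by simp
qed

end

definition lost :: "nat => nat => real" where
 "lost M n = card ({1..n} - big n M) / real n"

lemma lost_nonneg: "0 <= lost M n"
 by (simp add: lost_def)

text \<open>The three terms of the bound are the shares of the complete gaps, of one more gap at the
  end of the sample, and of the blocks at the ends of macro-intervals.\<close>

lemma lost_tendsto:
 assumes M: "1 <= M"
 shows "lost M \<longlonglongrightarrow> 0"
proof (rule tendsto_sandwich[OF always_eventually[OF allI[OF lost_nonneg]] _ tendsto_const])
 let ?b = "\<lambda>n. 1 / real (block_len n) + real n powr (1/8) / n + M * (real n powr (1/8))^2 / n"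
 show "\<forall>\<^sub>F n in sequentially. lost M n <= ?b n"
  using eventually_ge_at_top[of 1]
 proof eventually_elim
  case (elim n)
  let ?L = "block_len n"
  have L: "1 <= ?L" by (rule block_len_pos[OF elim])
  have "real (card ({1..n} - big n M)) <= real ((n div ?L\<^sup>2 + 1) * ?L + M * ?L^2)"
   using card_not_big[OF elim M] by (simp only: of_nat_le_iff)
  also have "\<dots> = real (n div ?L\<^sup>2) * ?L + ?L + M * (real ?L)^2" by (simp add: algebra_simps)
  also have "\<dots> <= real n / (real ?L)^2 * ?L + real n powr (1/8) + M * (real n powr (1/8))^2"
   using of_nat_div_le_of_nat[of n "?L^2", where 'a = real]
   by (intro add_mono mult_right_mono mult_left_mono power_mono block_len_le) auto
  also have "real n / (real ?L)^2 * ?L = real n / ?L" using L by (simp add: power2_eq_square)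
  finally have "lost M n <= (real n / ?L + real n powr (1/8) + M * (real n powr (1/8))^2) / n"
   unfolding lost_def by (rule divide_right_mono) simp
  also have "\<dots> = ?b n" using elim by (simp add: add_divide_distrib)
  finally show ?case .
 qed
 have 1: "(\<lambda>n. 1 / real (block_len n)) \<longlonglongrightarrow> 0"
  by (intro tendsto_divide_0[OF tendsto_const] filterlim_at_top_imp_at_infinity
    filterlim_compose[OF filterlim_real_sequentially block_len_at_top])
 have 2: "(\<lambda>n. real n powr (1/8) / n) \<longlonglongrightarrow> 0" by real_asymp
 have 3: "(\<lambda>n. M * (real n powr (1/8))^2 / n) \<longlonglongrightarrow> 0" by real_asymp
 show "?b \<longlonglongrightarrow> 0" using tendsto_add[OF tendsto_add[OF 1 2] 3] by simp
qed

section \<open>Replacing the errors by block sums\<close>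

context loc_stat
begin

lemma lagsum_sq:
 assumes int: "integrable \<pi> (\<lambda>z. (maxsum f n z)^2)" and [measurable]: "!!i. f i \<in> borel_measurable \<nu>" and k: "k <= n"
 shows "integrable \<pi> (\<lambda>z. (lagsum f k z)^2)" "(\<integral>z. (lagsum f k z)^2 \<partial>\<pi>) <= (\<integral>z. (maxsum f n z)^2 \<partial>\<pi>)"
proof -
 have le: "(lagsum f k z)^2 <= (maxsum f n z)^2" for z
  using power_mono[OF lagsum_le_maxsum[OF k] abs_ge_zero, of f z 2] by simp
 show i: "integrable \<pi> (\<lambda>z. (lagsum f k z)^2)"
  by (rule integrable_bd[OF int]) (use le in auto)
 show "(\<integral>z. (lagsum f k z)^2 \<partial>\<pi>) <= (\<integral>z. (maxsum f n z)^2 \<partial>\<pi>)"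
  by (rule lint_mono[OF i int le])
qed

lemma measurable_on [measurable]:
 assumes "I \<subseteq> {1..n}" "!!t. t \<in> {0..1} ==> f t \<in> borel_measurable \<nu>"
 shows "on I n f i \<in> borel_measurable \<nu>"
 using assms grid_unit[OF assms(1)] by auto

lemma lagsum_on: "I \<subseteq> {1..n} ==> lagsum (on I n f) n z = (\<Sum>i\<in>I. f (real i / real n) (lag (int i) z))"
 unfolding lagsum_def by (rule sum.mono_neutral_cong_right) auto

definition ysum :: "nat => nat => (int => 'e) => real" where
 "ysum n = lagsum (on {1..n} n h)"

definition yt :: "nat => nat => (int => 'e) => nat => real" where
 "yt M n z i = on (big n M) n (tr (block_len n)) i (lag (int i) z)"

definition blksum :: "nat => nat => (int => 'e) => real" where
 "blksum n r z = (\<Sum>i\<in>blk n r. tr (block_len n) (real i / real n) (lag (int i) z))"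

text \<open>\<open>sqrt M\<close> times the increment of the normalised block path over
  macro-interval j, so that the limiting variance is \<open>\<sigma>2\<close> whatever M.\<close>

definition incs :: "nat => nat => nat => (int => 'e) => real" where
 "incs M n j z = sqrt (real M / real n) * (\<Sum>r\<in>blocks_in n M j. blksum n r z)"

text \<open>32 is twice the 16 of the maximal inequalities. The first term is the error of
  \<open>tr\<close> as an approximation of h, the second the discarded indices.\<close>

definition replacement_bound :: "nat => nat => real" where
 "replacement_bound M n = 32 * ((S (block_len n))^2 + lost M n * (\<Theta> 0)^2)"

lemma replacement_bound_tendsto: "1 <= M ==> replacement_bound M \<longlonglongrightarrow> 0"
proof -
 assume M: "1 <= M"
 have "replacement_bound M \<longlonglongrightarrow> 32 * (0^2 + 0 * (\<Theta> 0)^2)"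
  unfolding replacement_bound_def[abs_def]
  by (intro tendsto_intros filterlim_compose[OF S_tendsto block_len_at_top] lost_tendsto M)
 then show ?thesis by simp
qed

text \<open>The difference is h - \<open>tr\<close> on I plus \<open>tr\<close> on I - J, and both
  have maximal inequalities. General I and J serve the whole sample as well as a single
  macro-interval.\<close>

lemma replacement:
 assumes n: "1 <= n" and M: "1 <= M" and I: "I \<subseteq> {1..n}" and J: "J \<subseteq> I" "I - J \<subseteq> {1..n} - big n M"
 shows "integrable \<pi> (\<lambda>z. (rmax (\<lambda>k. \<bar>lagsum (on I n h) k z - lagsum (on J n (tr (block_len n))) k z\<bar>) n)^2)"
  "(\<integral>z. (rmax (\<lambda>k. \<bar>lagsum (on I n h) k z - lagsum (on J n (tr (block_len n))) k z\<bar>) n)^2 \<partial>\<pi>)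
   <= real n * replacement_bound M n"
proof -
 let ?L = "block_len n"
 let ?e = "\<lambda>t x. h t x - tr ?L t x"
 let ?a = "maxsum (on I n ?e) n" and ?b = "maxsum (on (I - J) n (tr ?L)) n"
 let ?x = "\<lambda>z. rmax (\<lambda>k. \<bar>lagsum (on I n h) k z - lagsum (on J n (tr ?L)) k z\<bar>) n"
 have L: "1 <= ?L" by (rule block_len_pos[OF n])
 have IJ: "I - J \<subseteq> {1..n}" "J \<subseteq> {1..n}" using I J by auto
 note ea = maxsum_err[OF I L] and eb = maxsum_tr[OF IJ(1), of ?L]
 have [measurable]: "on I n h i \<in> borel_measurable \<nu>" "on J n (tr ?L) i \<in> borel_measurable \<nu>" for i
  using measurable_on[OF I, of h i] measurable_on[OF IJ(2), of "tr ?L" i] h_meas measurable_tr by blast+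
 have le: "?x z <= ?a z + ?b z" for z
 proof (rule rmax_leI)
  fix k assume k: "k <= n"
  have eq: "lagsum (on I n h) k z - lagsum (on J n (tr ?L)) k z = lagsum (on I n ?e) k z + lagsum (on (I - J) n (tr ?L)) k z"
   unfolding lagsum_def sum_subtractf[symmetric] sum.distrib[symmetric]
   by (rule sum.cong[OF refl]) (use J in auto)
  show "\<bar>lagsum (on I n h) k z - lagsum (on J n (tr ?L)) k z\<bar> <= ?a z + ?b z"
   unfolding eq by (intro order_trans[OF abs_triangle_ineq] add_mono lagsum_le_maxsum k)
 qed
 have x0: "0 <= ?x z" for z by (rule rmax_nonneg) simp
 have le2: "(?x z)^2 <= 2 * (?a z)^2 + 2 * (?b z)^2" for z
  using power_mono[OF le x0, of z 2] square_diff_le[of "?a z" "- ?b z"] by simp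
 have int: "integrable \<pi> (\<lambda>z. 2 * (?a z)^2 + 2 * (?b z)^2)" using ea(1) eb(1) by simp
 show int2: "integrable \<pi> (\<lambda>z. (?x z)^2)"
  by (rule integrable_bd[OF int]) (use le2 in \<open>auto intro: order_trans[OF _ abs_ge_self]\<close>)
 have "(\<integral>z. (?x z)^2 \<partial>\<pi>) <= (\<integral>z. 2 * (?a z)^2 + 2 * (?b z)^2 \<partial>\<pi>)"
  by (rule lint_mono[OF int2 int le2])
 also have "\<dots> = 2 * (\<integral>z. (?a z)^2 \<partial>\<pi>) + 2 * (\<integral>z. (?b z)^2 \<partial>\<pi>)" using ea(1) eb(1) by simp
 also have "\<dots> <= 2 * (16 * card I * (S ?L)^2) + 2 * (16 * card (I - J) * (\<Theta> 0)^2)"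
  using ea(2) eb(2) by linarith
 also have "\<dots> <= 2 * (16 * n * (S ?L)^2) + 2 * (16 * (n * lost M n) * (\<Theta> 0)^2)"
 proof -
  have "card I <= n" using card_mono[OF _ I] by simp
  moreover have "real (card (I - J)) <= n * lost M n"
   using card_mono[OF _ J(2)] n by (simp add: lost_def)
  ultimately show ?thesis by (intro add_mono mult_left_mono mult_right_mono) auto
 qed
 also have "\<dots> = real n * replacement_bound M n" by (simp add: replacement_bound_def algebra_simps)
 finally show "(\<integral>z. (?x z)^2 \<partial>\<pi>) <= real n * replacement_bound M n" .
qed

lemma ysum_eq: "k <= n ==> ysum n k z = (\<Sum>i=1..k. h (real i / real n) (lag (int i) z))"
 unfolding ysum_def lagsum_def by (rule sum.cong) auto

lemma measurable_ysum [measurable]: "ysum n k \<in> borel_measurable \<pi>"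
proof -
 have "on {1..n} n h i \<in> borel_measurable \<nu>" for i by (rule measurable_on[OF order_refl]) (rule h_meas)
 then show ?thesis unfolding ysum_def lagsum_def[abs_def]
  by (intro borel_measurable_sum measurable_compose[OF measurable_lag])
qed

lemma measurable_yt: "1 <= n ==> 1 <= M ==> (\<lambda>z. yt M n z i) \<in> borel_measurable \<pi>"
 unfolding yt_def by (rule measurable_compose[OF measurable_lag measurable_on[OF big_subset measurable_tr]])

lemma yt_eq_lagsum: "(\<Sum>i=1..k. yt M n z i) = lagsum (on (big n M) n (tr (block_len n))) k z"
 unfolding yt_def lagsum_def ..

theorem replacement_error:
 assumes n: "1 <= n" and M: "1 <= M"
 shows "integrable \<pi> (\<lambda>z. (rmax (\<lambda>k. \<bar>ysum n k z - (\<Sum>i=1..k. yt M n z i)\<bar>) n)^2)"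
  "(\<integral>z. (rmax (\<lambda>k. \<bar>ysum n k z - (\<Sum>i=1..k. yt M n z i)\<bar>) n)^2 \<partial>\<pi>) <= real n * replacement_bound M n"
 using replacement[OF n M order_refl big_subset[OF n M]] unfolding ysum_def yt_eq_lagsum by auto

lemma blk_unit: "1 <= n ==> 1 <= M ==> r \<in> blocks_in n M j ==> j < M ==> i \<in> blk n r ==> real i / real n \<in> {0..1}"
 by (rule grid_unit[OF big_subset[of n M]]) (auto simp: big_def big_in_def)

abbreviation coords :: "nat => nat => int set" where
 "coords n r \<equiv> {int (r * (block_len n)^2) <.. int ((r + 1) * (block_len n)^2)}"

text \<open>The gap pays off: indices in \<open>blk n r\<close> exceed the start of the block by
  more than \<open>block_len n\<close>, so the innovations they use all lie within the
  block.\<close>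

lemma blksum_cong:
 assumes "!!c. c \<in> coords n r ==> z c = z' c"
 shows "blksum n r z = blksum n r z'"
 unfolding blksum_def
proof (rule sum.cong[OF refl], rule tr_cong)
 fix i k assume ik: "i \<in> blk n r" "k < block_len n"
 show "lag (int i) z k = lag (int i) z' k"
  unfolding lag_def
 proof (rule assms)
  have "r * (block_len n)^2 + block_len n < i" "i <= (r + 1) * (block_len n)^2" using ik by (auto simp: blk_def)
  then show "int i - int k \<in> coords n r"
   using ik(2) by (simp only: greaterThanAtMost_iff) linarith
 qed
qed

context
 fixes n M :: nat
 assumes n: "1 <= n" and M: "1 <= M"
begin

lemma measurable_blksum [measurable]: "j < M ==> r \<in> blocks_in n M j ==> blksum n r \<in> borel_measurable \<pi>"
 unfolding blksum_def[abs_def]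
 by (intro borel_measurable_sum measurable_compose[OF measurable_lag measurable_tr] blk_unit[OF n M])

lemma blksum_bound: "\<bar>blksum n r z\<bar> <= 2 * real (block_len n) ^ 3"
proof -
 have "\<bar>blksum n r z\<bar> <= (\<Sum>i\<in>blk n r. 2 * real (block_len n))"
  unfolding blksum_def by (intro order_trans[OF sum_abs] sum_mono tr_bound)
 also have "\<dots> = real (card (blk n r)) * (2 * real (block_len n))" by simp
 also have "\<dots> <= real ((block_len n)^2) * (2 * real (block_len n))"
  by (intro mult_right_mono) (simp_all add: blk_def del: of_nat_power)
 finally show ?thesis by (simp add: power2_eq_square power3_eq_cube)
qed

lemma mean_blksum: "j < M ==> r \<in> blocks_in n M j ==> (\<integral>z. blksum n r z \<partial>\<pi>) = 0"
proof -
 assume j: "j < M" and r: "r \<in> blocks_in n M j"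
 have "(\<integral>z. blksum n r z \<partial>\<pi>) = (\<Sum>i\<in>blk n r. \<integral>z. tr (block_len n) (real i / real n) (lag (int i) z) \<partial>\<pi>)"
  unfolding blksum_def
  by (rule Bochner_Integration.integral_sum)
    (intro integrable_lag[THEN iffD2] measurable_tr sq_int_integrable sq_int_tr blk_unit[OF n M r j])
 also have "\<dots> = (\<Sum>i\<in>blk n r. \<integral>x. tr (block_len n) (real i / real n) x \<partial>\<nu>)"
  by (intro sum.cong refl integral_lag measurable_tr blk_unit[OF n M r j])
 also have "\<dots> = 0" by (intro sum.neutral ballI mean_tr blk_unit[OF n M r j])
 finally show ?thesis .
qed

lemma block_coords_disjoint:
 "r \<noteq> s ==> coords n r \<inter> coords n s = {}"
proof -
 have aux: "coords n r \<inter> coords n s = {}"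
  if "r < s" for r s
 proof -
  have "(r + 1) * (block_len n)^2 <= s * (block_len n)^2" using that by (intro mult_right_mono) auto
  then have "int ((r + 1) * (block_len n)^2) <= int (s * (block_len n)^2)" by (simp only: of_nat_le_iff)
  then show ?thesis by auto
 qed
 assume "r \<noteq> s"
 then show ?thesis using aux[of r s] aux[of s r] by (cases "r < s") auto
qed

lemma indep_blksum: "j < M ==> pi.indep_vars (\<lambda>_. borel) (\<lambda>r z. c * blksum n r z) (blocks_in n M j)"
proof (rule indep_vars_blocks[where K = "coords n"])
 show "(\<lambda>z. c * blksum n r z) \<in> borel_measurable \<pi>" if "j < M" "r \<in> blocks_in n M j" for r
  using measurable_blksum[OF that] by measurable
 show "disjoint_family_on (coords n) (blocks_in n M j)"
  unfolding disjoint_family_on_def using block_coords_disjoint by blast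
 show "c * blksum n r z = c * blksum n r z'"
  if "!!c. c \<in> coords n r ==> z c = z' c" for r z z'
  using blksum_cong[OF that] by simp
qed

lemma measurable_incs [measurable]: "j < M ==> incs M n j \<in> borel_measurable \<pi>"
 unfolding incs_def[abs_def] by (intro borel_measurable_times borel_measurable_const borel_measurable_sum measurable_blksum)

theorem indep_incs: "pi.indep_vars (\<lambda>_. borel) (incs M n) {..<M}"
proof (rule indep_vars_blocks[where K = "\<lambda>j. \<Union>r\<in>blocks_in n M j. coords n r"])
 show "incs M n j \<in> borel_measurable \<pi>" if "j \<in> {..<M}" for j using that by (intro measurable_incs) simp
 show "disjoint_family_on (\<lambda>j. \<Union>r\<in>blocks_in n M j. coords n r) {..<M}"
  unfolding disjoint_family_on_def
 proof (intro ballI impI)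
  fix j k :: nat assume "j \<noteq> k"
  then have "r \<noteq> s" if "r \<in> blocks_in n M j" "s \<in> blocks_in n M k" for r s
   using that blocks_in_disjoint[OF n M] by blast
  then show "(\<Union>r\<in>blocks_in n M j. coords n r) \<inter>
    (\<Union>r\<in>blocks_in n M k. coords n r) = {}"
   using block_coords_disjoint by blast
 qed
 show "incs M n j z = incs M n j z'"
  if "!!c. c \<in> (\<Union>r\<in>blocks_in n M j. coords n r) ==> z c = z' c" for j z z'
  unfolding incs_def using that by (intro arg_cong2[where f = "(*)"] refl sum.cong blksum_cong) blast
qed

lemma sum_big_in: "(\<Sum>r\<in>blocks_in n M j. blksum n r z) = (\<Sum>i\<in>big_in n M j. tr (block_len n) (real i / real n) (lag (int i) z))"
 unfolding blksum_def big_in_def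
proof (rule sum.UNION_disjoint[symmetric])
 show "finite (blocks_in n M j)" by (rule finite_blocks_in[OF n M])
 show "\<forall>r\<in>blocks_in n M j. finite (blk n r)" by (simp add: blk_def)
 show "\<forall>r\<in>blocks_in n M j. \<forall>s\<in>blocks_in n M j. r \<noteq> s \<longrightarrow> blk n r \<inter> blk n s = {}"
  using blk_disjoint[OF n M] by blast
qed

text \<open>X sums h over the macro-interval, Y sums \<open>tr\<close> over its blocks. The errors
  are, in turn, E[Y^2] - E[X^2] by Cauchy-Schwarz, the approximation of E[X^2] by
  \<open>variance_approx\<close>, and the rounding of n / M.\<close>

lemma incs_variance:
 assumes j: "j < M"
 shows "\<bar>(\<integral>z. (incs M n j z)^2 \<partial>\<pi>) - \<sigma>2\<bar> <=
  M * (replacement_bound M n + 2 * \<Theta> 0 * sqrt (16 * replacement_bound M n) + (\<Sum>k. vbound k n)) + M * \<sigma>2 / n"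
proof -
 let ?a = "n * j div M" and ?b = "n * (j + 1) div M" and ?L = "block_len n"
 let ?I = "{?a<..?b}"
 define X where "X z = (\<Sum>i\<in>?I. h (real i / real n) (lag (int i) z))" for z
 define Y where "Y z = (\<Sum>i\<in>big_in n M j. tr ?L (real i / real n) (lag (int i) z))" for z
 have bn: "?b <= n" by (rule macro_le[OF n M j])
 have ab: "?a <= ?b" by (intro div_le_mono) simp
 have I: "?I \<subseteq> {1..n}" using bn by auto
 have J: "big_in n M j \<subseteq> ?I" by (rule big_in_subset[OF n M])
 have Jn: "big_in n M j \<subseteq> {1..n}" using I J by blast
 have IJ: "?I - big_in n M j \<subseteq> {1..n} - big n M" using big_in_macro[OF n M j] I by blast
 have mX [measurable]: "on ?I n h i \<in> borel_measurable \<nu>" and mY [measurable]: "on (big_in n M j) n (tr ?L) i \<in> borel_measurable \<nu>" for i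
  using measurable_on[OF I, of h i] measurable_on[OF Jn, of "tr ?L" i] h_meas measurable_tr by blast+
 have X: "X z = lagsum (on ?I n h) n z" for z unfolding X_def lagsum_on[OF I] ..
 have Y: "Y z = lagsum (on (big_in n M j) n (tr ?L)) n z" for z unfolding Y_def lagsum_on[OF Jn] ..
 have [measurable]: "X \<in> borel_measurable \<pi>" "Y \<in> borel_measurable \<pi>"
  unfolding X[abs_def] Y[abs_def] by measurable
 have iX: "integrable \<pi> (\<lambda>z. (X z)^2)" and eX: "(\<integral>z. (X z)^2 \<partial>\<pi>) <= 16 * n * (\<Theta> 0)^2"
 proof -
  note m = maxsum_h[OF I]
  show "integrable \<pi> (\<lambda>z. (X z)^2)" unfolding X by (rule lagsum_sq(1)[OF m(1) mX order_refl])
  have "(\<integral>z. (X z)^2 \<partial>\<pi>) <= 16 * card ?I * (\<Theta> 0)^2"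
   unfolding X using lagsum_sq(2)[OF m(1) mX order_refl] m(2) by linarith
  also have "\<dots> <= 16 * n * (\<Theta> 0)^2"
   using card_mono[OF _ I] by (intro mult_right_mono) auto
  finally show "(\<integral>z. (X z)^2 \<partial>\<pi>) <= 16 * n * (\<Theta> 0)^2" .
 qed
 have iY: "integrable \<pi> (\<lambda>z. (Y z)^2)"
  unfolding Y by (rule lagsum_sq(1)[OF maxsum_tr(1)[OF Jn] mY order_refl])
 have iD: "integrable \<pi> (\<lambda>z. (X z - Y z)^2)" and eD: "(\<integral>z. (X z - Y z)^2 \<partial>\<pi>) <= n * replacement_bound M n"
 proof -
  note r = replacement[OF n M I J IJ]
  let ?x = "\<lambda>z. rmax (\<lambda>k. \<bar>lagsum (on ?I n h) k z - lagsum (on (big_in n M j) n (tr ?L)) k z\<bar>) n"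
  have le: "(X z - Y z)^2 <= (?x z)^2" for z
   using power_mono[OF le_rmax[OF order_refl, of "\<lambda>k. \<bar>lagsum (on ?I n h) k z - lagsum (on (big_in n M j) n (tr ?L)) k z\<bar>" n] abs_ge_zero, of 2]
   unfolding X Y by simp
  show i: "integrable \<pi> (\<lambda>z. (X z - Y z)^2)"
   by (rule integrable_bd[OF r(1)]) (use le in auto)
  show "(\<integral>z. (X z - Y z)^2 \<partial>\<pi>) <= n * replacement_bound M n"
   using lint_mono[OF i r(1) le] r(2) by linarith
 qed
 have dXY: "\<bar>(\<integral>z. (Y z)^2 \<partial>\<pi>) - (\<integral>z. (X z)^2 \<partial>\<pi>)\<bar> <= n * (replacement_bound M n + 2 * \<Theta> 0 * sqrt (16 * replacement_bound M n))"
 proof -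
  note cs = integral_Cauchy_Schwarz[of X \<pi> "\<lambda>z. X z - Y z", OF _ _ iX iD]
  have i: "integrable \<pi> (\<lambda>z. X z * (X z - Y z))" by (rule cs(1)) measurable
  have "(\<integral>z. (Y z)^2 \<partial>\<pi>) = (\<integral>z. (X z)^2 - 2 * (X z * (X z - Y z)) + (X z - Y z)^2 \<partial>\<pi>)"
   by (intro lint_cong refl) (simp add: power2_eq_square algebra_simps)
  also have "\<dots> = (\<integral>z. (X z)^2 \<partial>\<pi>) - 2 * (\<integral>z. X z * (X z - Y z) \<partial>\<pi>) + (\<integral>z. (X z - Y z)^2 \<partial>\<pi>)"
   using iX iD i by simp
  finally have "\<bar>(\<integral>z. (Y z)^2 \<partial>\<pi>) - (\<integral>z. (X z)^2 \<partial>\<pi>)\<bar> <=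
    (\<integral>z. (X z - Y z)^2 \<partial>\<pi>) + 2 * \<bar>\<integral>z. X z * (X z - Y z) \<partial>\<pi>\<bar>"
   using lint_nonneg[of \<pi> "\<lambda>z. (X z - Y z)^2", OF zero_le_power2] by linarith
  also have "\<bar>\<integral>z. X z * (X z - Y z) \<partial>\<pi>\<bar> <= sqrt (\<integral>z. (X z)^2 \<partial>\<pi>) * sqrt (\<integral>z. (X z - Y z)^2 \<partial>\<pi>)"
   by (rule cs(2)) measurable
  also have "\<dots> <= sqrt (16 * n * (\<Theta> 0)^2) * sqrt (n * replacement_bound M n)"
   by (intro mult_mono real_sqrt_le_mono eX eD) auto
  also have "\<dots> = n * (\<Theta> 0 * sqrt (16 * replacement_bound M n))"
   using \<Theta>_nonneg[of 0] by (simp add: real_sqrt_mult)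
  finally show ?thesis using eD by (simp add: algebra_simps)
 qed
 have vX: "\<bar>(\<integral>z. (X z)^2 \<partial>\<pi>) / n - real (?b - ?a) / n * \<sigma>2\<bar> <= (\<Sum>k. vbound k n)"
  unfolding X_def by (rule variance_approx[OF n ab bn])
 have ba: "\<bar>real (?b - ?a) / n * \<sigma>2 - \<sigma>2 / M\<bar> <= \<sigma>2 / n"
 proof -
  \<comment> \<open>The two end points are rounded down by less than 1 each, so the length differs
    from n / M by at most 1.\<close>
  have fl: "real (m div M) <= real m / M" "real m / M < real (m div M) + 1" for m
  proof -
   have "m < (m div M + 1) * M" using dividend_less_div_times[of M m] M by simp
   then have "real m < real ((m div M + 1) * M)" by (simp only: of_nat_less_iff)
   then have "real m < (real (m div M) + 1) * real M" by (simp add: algebra_simps)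
   then show "real m / M < real (m div M) + 1" using M by (simp add: divide_less_eq)
  qed (rule of_nat_div_le_of_nat)
  have "real (?b - ?a) = real ?b - real ?a" using ab by simp
  moreover have "real (n * (j + 1)) / M - real (n * j) / M = real n / M"
   by (simp add: diff_divide_distrib[symmetric] algebra_simps)
  ultimately have "\<bar>real (?b - ?a) - real n / M\<bar> <= 1" using fl[of "n * (j + 1)"] fl[of "n * j"] by linarith
  then have "\<bar>real (?b - ?a) - real n / M\<bar> * (\<sigma>2 / n) <= 1 * (\<sigma>2 / n)"
   using \<sigma>2_pos by (intro mult_right_mono) auto
  moreover have "real (?b - ?a) / n * \<sigma>2 - \<sigma>2 / M = (real (?b - ?a) - real n / M) * (\<sigma>2 / n)"
   using n M by (simp add: field_simps)
  ultimately show ?thesis using \<sigma>2_pos by (simp add: abs_mult)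
 qed
 have inc: "(incs M n j z)^2 = M / n * (Y z)^2" for z
  unfolding incs_def sum_big_in Y_def by (simp add: power_mult_distrib)
 have eq: "(\<integral>z. (incs M n j z)^2 \<partial>\<pi>) - \<sigma>2 = M * (((\<integral>z. (Y z)^2 \<partial>\<pi>) - (\<integral>z. (X z)^2 \<partial>\<pi>)) / n
   + ((\<integral>z. (X z)^2 \<partial>\<pi>) / n - real (?b - ?a) / n * \<sigma>2) + (real (?b - ?a) / n * \<sigma>2 - \<sigma>2 / M))"
  unfolding inc using n M by (simp add: field_simps)
 have "\<bar>((\<integral>z. (Y z)^2 \<partial>\<pi>) - (\<integral>z. (X z)^2 \<partial>\<pi>)) / n\<bar> <= replacement_bound M n + 2 * \<Theta> 0 * sqrt (16 * replacement_bound M n)"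
  using dXY n by (simp add: abs_divide divide_le_eq mult.commute)
 then have "\<bar>((\<integral>z. (Y z)^2 \<partial>\<pi>) - (\<integral>z. (X z)^2 \<partial>\<pi>)) / n
   + ((\<integral>z. (X z)^2 \<partial>\<pi>) / n - real (?b - ?a) / n * \<sigma>2) + (real (?b - ?a) / n * \<sigma>2 - \<sigma>2 / M)\<bar>
   <= (replacement_bound M n + 2 * \<Theta> 0 * sqrt (16 * replacement_bound M n)) + (\<Sum>k. vbound k n) + \<sigma>2 / n"
  using vX ba by (intro order_trans[OF abs_triangle_ineq] add_mono)
 then have "\<bar>(\<integral>z. (incs M n j z)^2 \<partial>\<pi>) - \<sigma>2\<bar> <=
   M * ((replacement_bound M n + 2 * \<Theta> 0 * sqrt (16 * replacement_bound M n)) + (\<Sum>k. vbound k n) + \<sigma>2 / n)"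
  unfolding eq abs_mult abs_of_nat by (intro mult_left_mono) auto
 then show ?thesis by (simp add: algebra_simps)
qed

lemma char_incs:
 assumes j: "j < M"
 shows "cmod (char (distr \<pi> borel (incs M n j)) t - exp (- (t^2 * (\<integral>z. (incs M n j z)^2 \<partial>\<pi>) / 2)))
  <= (\<integral>z. (incs M n j z)^2 \<partial>\<pi>) * (\<bar>t\<bar> ^ 3 * (sqrt (real M / real n) * (2 * real (block_len n) ^ 3))
    + t ^ 4 * (sqrt (real M / real n) * (2 * real (block_len n) ^ 3))^2)"
proof -
 let ?c = "sqrt (real M / real n)"
 have ind: "pi.indep_vars (\<lambda>_. borel) (\<lambda>r z. ?c * blksum n r z) (blocks_in n M j)" by (rule indep_blksum[OF j])
 have B: "\<bar>?c * blksum n r z\<bar> <= ?c * (2 * real (block_len n) ^ 3)" for r z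
  unfolding abs_mult by (intro mult_mono blksum_bound) auto
 have mean: "(\<integral>z. ?c * blksum n r z \<partial>\<pi>) = 0" if "r \<in> blocks_in n M j" for r
  using mean_blksum[OF j that] by simp
 have eq: "incs M n j z = (\<Sum>r\<in>blocks_in n M j. ?c * blksum n r z)" for z
  unfolding incs_def by (rule sum_distrib_left)
 show ?thesis
  using pi.char_sum_approx[OF finite_blocks_in[OF n M] ind B mean, of t]
   pi.indep_vars_sum_square[OF finite_blocks_in[OF n M] ind B mean]
  unfolding eq[abs_def] by simp
qed

end

section \<open>Central limit theorem for a single increment\<close>

definition limit_normal :: "real measure" where
 "limit_normal = distr std_normal_distribution borel (\<lambda>x. sqrt \<sigma>2 * x)"

lemma real_distribution_limit: "real_distribution limit_normal"
 unfolding limit_normal_def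
 by (intro prob_space.real_distribution_distr prob_space_normal_density) auto

lemma char_limit: "char limit_normal t = exp (- (t^2 * \<sigma>2 / 2))"
proof -
 have "char limit_normal t = char std_normal_distribution (t * sqrt \<sigma>2)"
  unfolding char_def limit_normal_def by (subst integral_distr) (auto simp: mult.assoc)
 then show ?thesis using \<sigma>2_pos by (simp add: char_std_normal_distribution power_mult_distrib)
qed

text \<open>Here the block length matters: the bound \<open>B n\<close> on single normalised block
  sums is of order n^(3/8) / n^(1/2). \<open>Suc n\<close> keeps the sample size positive, as
  \<open>measurable_incs\<close> demands.\<close>

theorem weak_conv_incs:
 assumes M: "1 <= M" and j: "j < M"
 shows "weak_conv_m (\<lambda>n. distr \<pi> borel (incs M (Suc n) j)) limit_normal"
proof (rule levy_continuity)
 show "real_distribution (distr \<pi> borel (incs M (Suc n) j))" for n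
  by (rule pi.real_distribution_distr, rule measurable_incs[OF _ M j]) simp
 show "real_distribution limit_normal" by (rule real_distribution_limit)
 fix t
 define V where "V n = (\<integral>w. (incs M n j w)^2 \<partial>\<pi>)" for n
 have V: "V \<longlonglongrightarrow> \<sigma>2"
 proof (rule LIM_zero_cancel, rule Lim_null_comparison)
  let ?e = "\<lambda>n. M * (replacement_bound M n + 2 * \<Theta> 0 * sqrt (16 * replacement_bound M n) + (\<Sum>k. vbound k n)) + M * \<sigma>2 / n"
  show "\<forall>\<^sub>F n in sequentially. norm (V n - \<sigma>2) <= ?e n"
   using eventually_ge_at_top[of 1]
  proof eventually_elim
   case (elim n)
   then show ?case unfolding V_def real_norm_def by (intro incs_variance M j)
  qed
  have "?e \<longlonglongrightarrow> M * (0 + 2 * \<Theta> 0 * sqrt (16 * 0) + 0) + 0"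
   by (intro tendsto_intros replacement_bound_tendsto M vbound_tendsto lim_const_over_n)
  then show "?e \<longlonglongrightarrow> 0" by simp
 qed
 define B where "B n = sqrt (real M / real n) * (2 * real (block_len n) ^ 3)" for n
 have B: "B \<longlonglongrightarrow> 0"
 proof (rule tendsto_sandwich[OF _ _ tendsto_const])
  show "\<forall>\<^sub>F n in sequentially. 0 <= B n" by (simp add: B_def)
  show "\<forall>\<^sub>F n in sequentially. B n <= sqrt (real M / real n) * (2 * (real n powr (1/8)) ^ 3)"
   unfolding B_def by (intro always_eventually allI mult_left_mono power_mono block_len_le) auto
  show "(\<lambda>n. sqrt (real M / real n) * (2 * (real n powr (1/8)) ^ 3)) \<longlonglongrightarrow> 0"
   using M by real_asymp
 qed
 let ?z = "\<lambda>n. complex_of_real (exp (- (t^2 * V n / 2)))"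
 have d: "(\<lambda>n. char (distr \<pi> borel (incs M n j)) t - ?z n) \<longlonglongrightarrow> 0"
 proof (rule Lim_null_comparison)
  show "\<forall>\<^sub>F n in sequentially. cmod (char (distr \<pi> borel (incs M n j)) t - ?z n) <= V n * (\<bar>t\<bar> ^ 3 * B n + t ^ 4 * (B n)^2)"
   using eventually_ge_at_top[of 1]
  proof eventually_elim
   case (elim n)
   then show ?case unfolding V_def B_def by (rule char_incs[OF _ M j])
  qed
  have "(\<lambda>n. V n * (\<bar>t\<bar> ^ 3 * B n + t ^ 4 * (B n)^2)) \<longlonglongrightarrow> \<sigma>2 * (\<bar>t\<bar> ^ 3 * 0 + t ^ 4 * 0^2)"
   by (intro tendsto_intros V B)
  then show "(\<lambda>n. V n * (\<bar>t\<bar> ^ 3 * B n + t ^ 4 * (B n)^2)) \<longlonglongrightarrow> 0" by simp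
 qed
 have "?z \<longlonglongrightarrow> complex_of_real (exp (- (t^2 * \<sigma>2 / 2)))" by (intro tendsto_intros V) simp
 from tendsto_add[OF d this] have "(\<lambda>n. char (distr \<pi> borel (incs M n j)) t) \<longlonglongrightarrow> char limit_normal t"
  by (simp add: char_limit)
 then show "(\<lambda>n. char (distr \<pi> borel (incs M (Suc n) j)) t) \<longlonglongrightarrow> char limit_normal t"
  by (rule LIMSEQ_Suc)
qed

end

section \<open>The statistic as a functional of the path\<close>

text \<open>The deviation of w from its chord over [a, be], parametrised by the unit interval: the
  domain of integration then does not move with the end points, and an interval of length 0 causes
  no division.\<close>

definition resid :: "(real => real) => real => real => real => real" where
 "resid w a be s = w (a + (be - a) * s) - (1 - s) * w a - s * w be"

definition resid_sq :: "(real => real) => real => real => real" where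
 "resid_sq w a be = (be - a) * integral {0..1} (\<lambda>s. (resid w a be s)^2)"

definition V2 :: "(real => real) => real => real" where
 "V2 w t = resid_sq w 0 t + resid_sq w t 1"

definition bridge :: "(real => real) => real => real" where
 "bridge w t = w t - t * w 1"

text \<open>For \<open>q \<ge> 0\<close> the ratio at \<open>t\<close> in \<^const>\<open>limit_functional\<close> exceeds \<open>q\<close> iff \<open>psi q w t > 0\<close>; unlike the
 ratio, \<open>psi\<close> is continuous in the path.\<close>

definition psi :: "real => (real => real) => real => real" where
 "psi q w t = (bridge w t)^2 - q^2 * V2 w t"

definition unit_path :: "real => (real => real) => bool" where
 "unit_path A w \<longleftrightarrow> continuous_on {0..1} w \<and> w 0 = 0 \<and> (\<forall>x\<in>{0..1}. \<bar>w x\<bar> <= A)"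

lemma unit_pathD:
 assumes "unit_path A w"
 shows "continuous_on {0..1} w" "w 0 = 0" "x \<in> {0..1} ==> \<bar>w x\<bar> <= A" "0 <= A"
 using assms by (auto simp: unit_path_def dest: bspec[of _ _ 0])

lemma segment_unit:
 fixes a be s :: real
 assumes "0 <= a" "a <= be" "be <= 1" "s \<in> {0..1}"
 shows "a + (be - a) * s \<in> {0..1}"
proof -
 have "(be - a) * s <= (be - a) * 1" using assms by (intro mult_left_mono) auto
 moreover have "0 <= (be - a) * s" using assms by simp
 ultimately show ?thesis using assms by simp
qed

lemma continuous_resid:
 assumes "continuous_on {0..1} w" "0 <= a" "a <= be" "be <= 1"
 shows "continuous_on {0..1} (resid w a be)"
 unfolding resid_def[abs_def]
 by (intro continuous_intros continuous_on_compose2[OF assms(1)]) (use segment_unit[OF assms(2-4)] in auto)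

lemma integrable_resid_sq:
 assumes "continuous_on {0..1} w" "0 <= a" "a <= be" "be <= 1"
 shows "(\<lambda>s. (resid w a be s)^2) integrable_on {0..1}"
 using continuous_resid[OF assms] by (intro integrable_continuous_interval continuous_intros)

lemma convex_comb_diff:
 fixes a b a' b' s e :: real
 assumes "\<bar>a - a'\<bar> <= e" "\<bar>b - b'\<bar> <= e" "s \<in> {0..1}"
 shows "\<bar>((1 - s) * a + s * b) - ((1 - s) * a' + s * b')\<bar> <= e"
proof -
 have "((1 - s) * a + s * b) - ((1 - s) * a' + s * b') = (1 - s) * (a - a') + s * (b - b')" by (simp add: algebra_simps)
 also have "\<bar>\<dots>\<bar> <= (1 - s) * \<bar>a - a'\<bar> + s * \<bar>b - b'\<bar>"
  using assms(3) by (intro order_trans[OF abs_triangle_ineq]) (simp add: abs_mult)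
 also have "\<dots> <= (1 - s) * e + s * e" using assms by (intro add_mono mult_left_mono) auto
 finally show ?thesis by (simp add: algebra_simps)
qed

lemma resid_bound:
 assumes "unit_path A w" "0 <= a" "a <= be" "be <= 1" "s \<in> {0..1}"
 shows "\<bar>resid w a be s\<bar> <= 2 * A"
proof -
 note b = unit_pathD(3)[OF assms(1)]
 have "\<bar>((1 - s) * w a + s * w be) - ((1 - s) * 0 + s * 0)\<bar> <= A"
  by (rule convex_comb_diff) (use assms b in auto)
 then show ?thesis using b[OF segment_unit[OF assms(2-5)]] unfolding resid_def by linarith
qed

lemma sq_diff_bound:
 fixes a b A e :: real
 assumes "\<bar>a\<bar> <= A" "\<bar>b\<bar> <= A" "\<bar>a - b\<bar> <= e"
 shows "\<bar>a\<^sup>2 - b^2\<bar> <= 2 * A * e"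
proof -
 have "a^2 - b^2 = (a + b) * (a - b)" by (simp add: power2_eq_square algebra_simps)
 then have "\<bar>a\<^sup>2 - b^2\<bar> = \<bar>a + b\<bar> * \<bar>a - b\<bar>" by (simp add: abs_mult)
 also have "\<dots> <= (2 * A) * e" using assms by (intro mult_mono) auto
 finally show ?thesis .
qed

lemma scaled_diff_bound:
 fixes b b' I I' x y :: real
 assumes "0 <= b" "b <= 1" "\<bar>I - I'\<bar> <= x" "\<bar>I'\<bar> <= y"
 shows "\<bar>b * I - b' * I'\<bar> <= x + y * \<bar>b - b'\<bar>"
proof -
 have "b * I - b' * I' = b * (I - I') + (b - b') * I'" by (simp add: algebra_simps)
 moreover have "\<bar>b * (I - I')\<bar> <= 1 * x" unfolding abs_mult using assms by (intro mult_mono) auto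
 moreover have "\<bar>(b - b') * I'\<bar> <= \<bar>b - b'\<bar> * y" unfolding abs_mult using assms by (intro mult_left_mono) auto
 ultimately show ?thesis by (simp only: mult.commute[of y])
qed

lemma integral_unit_bound:
 fixes f :: "real => real"
 assumes "f integrable_on {0..1}" "!!s. s \<in> {0..1} ==> \<bar>f s\<bar> <= B"
 shows "\<bar>integral {0..1} f\<bar> <= B"
 using integral_norm_bound_integral[OF assms(1) integrable_const_ivl, of B] assms(2) by simp

lemma resid_sq_nonneg: "0 <= a ==> a <= be ==> be <= 1 ==> continuous_on {0..1} w ==> 0 <= resid_sq w a be"
 unfolding resid_sq_def by (intro mult_nonneg_nonneg integral_nonneg integrable_resid_sq) auto

lemma V2_nonneg: "continuous_on {0..1} w ==> t \<in> {0..1} ==> 0 <= V2 w t"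
 unfolding V2_def by (intro add_nonneg_nonneg resid_sq_nonneg) auto

text \<open>Residuals are at most 2 A and differ by at most 2 e, once through w and once through the
  chord; so their squares differ by at most 8 A e. The term with 4 A^2 accounts for the change of
  length.\<close>

lemma resid_sq_diff:
 assumes w: "unit_path A w" "unit_path A w'" and t: "0 <= a" "a <= be" "be <= 1" "0 <= a'" "a' <= be'" "be' <= 1"
  and e: "!!s. s \<in> {0..1} ==> \<bar>w (a + (be - a) * s) - w' (a' + (be' - a') * s)\<bar> <= e"
 shows "\<bar>resid_sq w a be - resid_sq w' a' be'\<bar> <= 8 * A * e + 4 * A^2 * \<bar>(be - a) - (be' - a')\<bar>"
proof -
 let ?f = "\<lambda>s. (resid w a be s)^2" and ?g = "\<lambda>s. (resid w' a' be' s)^2"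
 have i: "?f integrable_on {0..1}" "?g integrable_on {0..1}"
  using integrable_resid_sq unit_pathD(1) w t by blast+
 have d: "\<bar>integral {0..1} (\<lambda>s. ?f s - ?g s)\<bar> <= 8 * A * e"
 proof (rule integral_unit_bound[OF integrable_diff[OF i]])
  fix s :: real assume s: "s \<in> {0..1}"
  have "\<bar>((1 - s) * w a + s * w be) - ((1 - s) * w' a' + s * w' be')\<bar> <= e"
   by (rule convex_comb_diff) (use e[of 0] e[of 1] s in auto)
  then have "\<bar>resid w a be s - resid w' a' be' s\<bar> <= 2 * e"
   using e[OF s] unfolding resid_def by linarith
  then have "\<bar>?f s - ?g s\<bar> <= 2 * (2 * A) * (2 * e)"
   by (intro sq_diff_bound resid_bound w t s)
  then show "\<bar>?f s - ?g s\<bar> <= 8 * A * e" by simp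
 qed
 have "\<bar>integral {0..1} ?g\<bar> <= 4 * A^2"
 proof (rule integral_unit_bound[OF i(2)])
  fix s :: real assume "s \<in> {0..1}"
  then show "\<bar>?g s\<bar> <= 4 * A^2"
   using power_mono[OF resid_bound[OF w(2) t(4-6)] abs_ge_zero, of s 2] by (simp add: power_mult_distrib)
 qed
 with d have "\<bar>resid_sq w a be - resid_sq w' a' be'\<bar> <= 8 * A * e + (4 * A^2) * \<bar>(be - a) - (be' - a')\<bar>"
  unfolding resid_sq_def integral_diff[OF i] using t by (intro scaled_diff_bound) auto
 then show ?thesis by simp
qed

lemma V2_diff:
 assumes w: "unit_path A w" "unit_path A w'" and t: "t \<in> {0..1}" "t' \<in> {0..1}"
  and e: "!!x x'. x \<in> {0..1} ==> x' \<in> {0..1} ==> \<bar>x - x'\<bar> <= \<bar>t - t'\<bar> ==> \<bar>w x - w' x'\<bar> <= e"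
 shows "\<bar>V2 w t - V2 w' t'\<bar> <= 16 * A * e + 8 * A^2 * \<bar>t - t'\<bar>"
proof -
 have "\<bar>resid_sq w 0 t - resid_sq w' 0 t'\<bar> <= 8 * A * e + 4 * A^2 * \<bar>(t - 0) - (t' - 0)\<bar>"
 proof (rule resid_sq_diff[OF w])
  fix s :: real assume s: "s \<in> {0..1}"
  have "\<bar>t * s - t' * s\<bar> = \<bar>t - t'\<bar> * s" using s by (simp add: abs_mult left_diff_distrib[symmetric])
  also have "\<dots> <= \<bar>t - t'\<bar> * 1" using s by (intro mult_left_mono) auto
  finally show "\<bar>w (0 + (t - 0) * s) - w' (0 + (t' - 0) * s)\<bar> <= e"
   using segment_unit[of 0 t s] segment_unit[of 0 t' s] t s by (intro e) auto
 qed (use t in auto)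
 moreover have "\<bar>resid_sq w t 1 - resid_sq w' t' 1\<bar> <= 8 * A * e + 4 * A^2 * \<bar>(1 - t) - (1 - t')\<bar>"
 proof (rule resid_sq_diff[OF w])
  fix s :: real assume s: "s \<in> {0..1}"
  have "(t + (1 - t) * s) - (t' + (1 - t') * s) = (t - t') * (1 - s)" by (simp add: algebra_simps)
  then have "\<bar>(t + (1 - t) * s) - (t' + (1 - t') * s)\<bar> = \<bar>t - t'\<bar> * (1 - s)" using s by (simp add: abs_mult)
  also have "\<dots> <= \<bar>t - t'\<bar> * 1" using s by (intro mult_left_mono) auto
  finally show "\<bar>w (t + (1 - t) * s) - w' (t' + (1 - t') * s)\<bar> <= e"
   using segment_unit[of t 1 s] segment_unit[of t' 1 s] t s by (intro e) auto
 qed (use t in auto)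
 ultimately show ?thesis unfolding V2_def by (simp add: abs_minus_commute)
qed

lemma bridge_bound: "unit_path A w ==> t \<in> {0..1} ==> \<bar>bridge w t\<bar> <= 2 * A"
proof -
 assume w: "unit_path A w" and t: "t \<in> {0..1}"
 have "\<bar>t * w 1\<bar> <= 1 * A" unfolding abs_mult using t unit_pathD(3)[OF w, of 1] by (intro mult_mono) auto
 then show ?thesis using unit_pathD(3)[OF w t] unfolding bridge_def by linarith
qed

text \<open>A Lipschitz constant of \<open>psi\<close> on paths bounded by A. The numbers are
  rounded up so that the same constant serves for perturbed paths, perturbed times and Riemann
  sums.\<close>

definition psi_mod :: "real => real => real" where
 "psi_mod q A = (1 + q^2) * (16 * A + 24 * A^2)"

lemma psi_mod_nonneg: "0 <= A ==> 0 <= psi_mod q A"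
 by (simp add: psi_mod_def)

lemma psi_mod_ge:
 assumes A: "0 <= A" and x: "x <= 16 * A * e + 24 * A^2 * d" "y <= 16 * A * e + 24 * A^2 * d" and e: "0 <= e" "0 <= d"
 shows "x + q^2 * y <= psi_mod q A * (e + d)"
proof -
 let ?z = "16 * A * e + 24 * A^2 * d"
 have "x + q^2 * y <= ?z + q^2 * ?z" using x by (intro add_mono mult_left_mono) auto
 also have "\<dots> = (1 + q^2) * ?z" by (simp add: algebra_simps)
 also have "\<dots> <= (1 + q^2) * ((16 * A + 24 * A^2) * (e + d))"
  using A e by (intro mult_left_mono) (auto simp: algebra_simps)
 finally show ?thesis by (simp add: psi_mod_def mult.assoc)
qed

text \<open>Comparing the paths at times up to |t - t'| apart covers a change of path, a change of
  time and both at once.\<close>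

lemma psi_diff:
 assumes w: "unit_path A w" "unit_path A w'" and t: "t \<in> {0..1}" "t' \<in> {0..1}"
  and e: "!!x x'. x \<in> {0..1} ==> x' \<in> {0..1} ==> \<bar>x - x'\<bar> <= \<bar>t - t'\<bar> ==> \<bar>w x - w' x'\<bar> <= e"
 shows "\<bar>psi q w t - psi q w' t'\<bar> <= psi_mod q A * (e + \<bar>t - t'\<bar>)"
proof -
 have A: "0 <= A" by (rule unit_pathD(4)[OF w(1)])
 have e0: "0 <= e" using e[of 0 0] by simp
 have "\<bar>bridge w t - bridge w' t'\<bar> <= 2 * e + A * \<bar>t - t'\<bar>"
 proof -
  have "bridge w t - bridge w' t' = (w t - w' t') - t * (w 1 - w' 1) - (t - t') * w' 1"
   unfolding bridge_def by (simp add: algebra_simps)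
  moreover have "\<bar>w t - w' t'\<bar> <= e" using t by (intro e) auto
  moreover have "\<bar>t * (w 1 - w' 1)\<bar> <= 1 * e" unfolding abs_mult using t e[of 1 1] by (intro mult_mono) auto
  moreover have "\<bar>(t - t') * w' 1\<bar> <= \<bar>t - t'\<bar> * A" unfolding abs_mult using unit_pathD(3)[OF w(2), of 1] by (intro mult_left_mono) auto
  ultimately show ?thesis by (simp add: mult.commute)
 qed
 then have 1: "\<bar>(bridge w t)\<^sup>2 - (bridge w' t')^2\<bar> <= 2 * (2 * A) * (2 * e + A * \<bar>t - t'\<bar>)"
  by (intro sq_diff_bound bridge_bound w t)
 also have "\<dots> <= 16 * A * e + 24 * A^2 * \<bar>t - t'\<bar>"
  using A e0 by (simp add: algebra_simps power2_eq_square)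
 finally have 1: "\<bar>(bridge w t)\<^sup>2 - (bridge w' t')^2\<bar> <= 16 * A * e + 24 * A^2 * \<bar>t - t'\<bar>" .
 have "8 * A^2 * \<bar>t - t'\<bar> <= 24 * A^2 * \<bar>t - t'\<bar>" by (intro mult_right_mono) auto
 then have 2: "\<bar>V2 w t - V2 w' t'\<bar> <= 16 * A * e + 24 * A^2 * \<bar>t - t'\<bar>"
  using V2_diff[OF w t e] by linarith
 have "psi q w t - psi q w' t' = ((bridge w t)^2 - (bridge w' t')^2) - q^2 * (V2 w t - V2 w' t')"
  unfolding psi_def by (simp add: algebra_simps)
 also have "\<bar>\<dots>\<bar> <= \<bar>(bridge w t)\<^sup>2 - (bridge w' t')^2\<bar> + q^2 * \<bar>V2 w t - V2 w' t'\<bar>"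
  by (intro order_trans[OF abs_triangle_ineq4]) (simp add: abs_mult)
 also have "\<dots> <= psi_mod q A * (e + \<bar>t - t'\<bar>)" by (rule psi_mod_ge[OF A 1 2 e0]) simp
 finally show ?thesis .
qed

lemma riemann_unit:
 fixes f :: "real => real"
 assumes f: "continuous_on {0..1} f" and k: "1 <= k"
  and e: "!!x y. x \<in> {0..1} ==> y \<in> {0..1} ==> \<bar>x - y\<bar> <= 1 / real k ==> \<bar>f x - f y\<bar> <= e"
 shows "\<bar>(\<Sum>i=1..k. f (real i / real k)) / real k - integral {0..1} f\<bar> <= e"
proof -
 have step: "\<bar>(\<Sum>i=1..j. f (real i / real k)) / real k - integral {0..real j / real k} f\<bar> <= e * (real j / real k)" if "j <= k" for j
  using that
 proof (induction j)
  case (Suc j)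
  let ?a = "real j / real k" and ?b = "real (Suc j) / real k"
  have ab: "0 <= ?a" "?a <= ?b" "?b <= 1" "?b - ?a = 1 / real k"
   using Suc.prems k by (auto simp: field_simps)
  have i: "f integrable_on {x..y}" if "0 <= x" "y <= 1" for x y
   using that by (intro integrable_continuous_interval continuous_on_subset[OF f]) auto
  have comb: "integral {0..?a} f + integral {?a..?b} f = integral {0..?b} f"
   using ab by (intro Henstock_Kurzweil_Integration.integral_combine i) auto
  have e': "\<bar>f ?b - f x\<bar> <= e" if x: "x \<in> {?a..?b}" for x
  proof (rule e)
   have x: "?a <= x" "x <= ?b" using x by (simp_all only: atLeastAtMost_iff)
   show "x \<in> {0..1}" "?b \<in> {0..1}" "\<bar>?b - x\<bar> <= 1 / real k"
    unfolding atLeastAtMost_iff using x ab by linarith+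
  qed
  have "\<bar>integral {?a..?b} (\<lambda>x. f ?b - f x)\<bar> <= integral {?a..?b} (\<lambda>x. e)"
   using ab(1,3) e' by (intro integral_norm_bound_integral[where 'a = real, unfolded real_norm_def] integrable_diff i integrable_const_ivl)
  moreover have "integral {?a..?b} (\<lambda>x. f ?b - f x) = f ?b / real k - integral {?a..?b} f"
   using ab by (subst integral_diff) (auto intro: i)
  ultimately have "\<bar>f ?b / real k - integral {?a..?b} f\<bar> <= e / real k"
   using ab by (simp add: mult.commute)
  moreover have "(\<Sum>i=1..Suc j. f (real i / real k)) / real k = (\<Sum>i=1..j. f (real i / real k)) / real k + f ?b / real k"
   by (simp add: add_divide_distrib)
  moreover have "e * ?b = e * ?a + e / real k" using k by (simp add: field_simps)
  ultimately show ?case using Suc.IH Suc.prems comb by linarith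
 qed simp
 show ?thesis using step[of k] k by simp
qed

lemma integral_affine_unit:
 fixes f :: "real => real"
 assumes f: "continuous_on {\<alpha>..\<beta>} f" and "\<alpha> <= \<beta>"
 shows "integral {\<alpha>..\<beta>} f = (\<beta> - \<alpha>) * integral {0..1} (\<lambda>s. f (\<alpha> + (\<beta> - \<alpha>) * s))"
proof (cases "\<alpha> = \<beta>")
 case False
 then have ab: "\<alpha> < \<beta>" using assms by simp
 have "(f has_integral integral {\<alpha>..\<beta>} f) (cbox \<alpha> \<beta>)"
  using integrable_continuous_interval[OF f] by (simp add: has_integral_integral)
 then have "((\<lambda>x. f ((\<beta> - \<alpha>) *\<^sub>R x + \<alpha>)) has_integral (1 / \<bar>\<beta> - \<alpha>\<bar> ^ DIM(real)) *\<^sub>R integral {\<alpha>..\<beta>} f)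
   ((\<lambda>x. (1 / (\<beta> - \<alpha>)) *\<^sub>R x + - ((1 / (\<beta> - \<alpha>)) *\<^sub>R \<alpha>)) ` cbox \<alpha> \<beta>)"
  by (rule has_integral_affinity) (use ab in simp)
 moreover have "(\<lambda>x. (1 / (\<beta> - \<alpha>)) *\<^sub>R x + - ((1 / (\<beta> - \<alpha>)) *\<^sub>R \<alpha>)) ` cbox \<alpha> \<beta> = {0..1}"
 proof -
  have "(\<lambda>x. (1 / (\<beta> - \<alpha>)) *\<^sub>R x + - ((1 / (\<beta> - \<alpha>)) *\<^sub>R \<alpha>)) ` cbox \<alpha> \<beta> =
    cbox ((1 / (\<beta> - \<alpha>)) *\<^sub>R \<alpha> + - ((1 / (\<beta> - \<alpha>)) *\<^sub>R \<alpha>)) ((1 / (\<beta> - \<alpha>)) *\<^sub>R \<beta> + - ((1 / (\<beta> - \<alpha>)) *\<^sub>R \<alpha>))"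
   using ab by (subst image_affinity_cbox) auto
  moreover have "1 / (\<beta> - \<alpha>) * \<beta> - 1 / (\<beta> - \<alpha>) * \<alpha> = 1" using ab by (simp add: diff_divide_distrib[symmetric])
  ultimately show ?thesis by simp
 qed
 ultimately have "((\<lambda>s. f (\<alpha> + (\<beta> - \<alpha>) * s)) has_integral integral {\<alpha>..\<beta>} f / (\<beta> - \<alpha>)) {0..1}"
  using ab by (simp add: add.commute divide_inverse mult.commute)
 then show ?thesis using ab by (simp add: integral_unique)
qed auto

text \<open>Affine substitution, except at t = 0 and t = 1: there one piece is a point, its integral
  is 0, and the division by zero in the integrand does no harm.\<close>

lemma limit_functional_eq:
 assumes w: "continuous_on {0..1} w" "w 0 = 0"
 shows "limit_functional w = (SUP t\<in>{0..1}. \<bar>bridge w t\<bar> / sqrt (V2 w t))"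
 unfolding limit_functional_def
proof (rule SUP_cong[OF refl])
 fix t :: real assume t: "t \<in> {0..1}"
 have "integral {0..t} (\<lambda>x. (w x - x / t * w t)^2) = resid_sq w 0 t"
 proof (cases "t = 0")
  case False
  then have "t > 0" using t by simp
  then have "integral {0..t} (\<lambda>x. (w x - x / t * w t)^2) = (t - 0) * integral {0..1} (\<lambda>s. (w (0 + (t - 0) * s) - (0 + (t - 0) * s) / t * w t)^2)"
   using t by (intro integral_affine_unit continuous_intros continuous_on_subset[OF w(1)]) auto
  then show ?thesis using \<open>t > 0\<close> w(2) by (simp add: resid_sq_def resid_def)
 qed (simp add: resid_sq_def)
 moreover have "integral {t..1} (\<lambda>x. (w 1 - w x - (1 - x) / (1 - t) * (w 1 - w t))^2) = resid_sq w t 1"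
 proof (cases "t = 1")
  case False
  then have t1: "t < 1" using t by simp
  then have "integral {t..1} (\<lambda>x. (w 1 - w x - (1 - x) / (1 - t) * (w 1 - w t))^2) =
    (1 - t) * integral {0..1} (\<lambda>s. (w 1 - w (t + (1 - t) * s) - (1 - (t + (1 - t) * s)) / (1 - t) * (w 1 - w t))^2)"
   using t by (intro integral_affine_unit continuous_intros continuous_on_subset[OF w(1)]) auto
  also have "(\<lambda>s. (w 1 - w (t + (1 - t) * s) - (1 - (t + (1 - t) * s)) / (1 - t) * (w 1 - w t))^2) = (\<lambda>s. (resid w t 1 s)^2)"
  proof
   fix s
   have "1 - (t + (1 - t) * s) = (1 - t) * (1 - s)" by (simp add: algebra_simps)
   then have "(1 - (t + (1 - t) * s)) / (1 - t) = 1 - s" using t1 by simp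
   then have "w 1 - w (t + (1 - t) * s) - (1 - (t + (1 - t) * s)) / (1 - t) * (w 1 - w t) = - resid w t 1 s"
    by (simp only: resid_def) (simp add: algebra_simps)
   then show "(w 1 - w (t + (1 - t) * s) - (1 - (t + (1 - t) * s)) / (1 - t) * (w 1 - w t))^2 = (resid w t 1 s)^2" by simp
  qed
  finally show ?thesis by (simp add: resid_sq_def)
 qed (simp add: resid_sq_def)
 ultimately show "\<bar>w t - t * w 1\<bar> / sqrt (integral {0..t} (\<lambda>x. (w x - x / t * w t)^2) +
    integral {t..1} (\<lambda>x. (w 1 - w x - (1 - x) / (1 - t) * (w 1 - w t))^2)) = \<bar>bridge w t\<bar> / sqrt (V2 w t)"
  by (simp add: bridge_def V2_def)
qed

section \<open>The statistic on the grid\<close>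

definition dbridge :: "nat => (nat => real) => nat => real" where
 "dbridge N p k = p k - real k / real N * p N"

definition dV2 :: "nat => (nat => real) => nat => real" where
 "dV2 N p k = ((\<Sum>i=1..k. (p i - real i / real k * p k)^2) +
  (\<Sum>i=k+1..N. (p N - p i - (real N - real i) / (real N - real k) * (p N - p k))^2)) / real N"

definition dpsi :: "real => nat => (nat => real) => nat => real" where
 "dpsi q N p k = (dbridge N p k)^2 - q^2 * dV2 N p k"

definition dPsi :: "real => nat => (nat => real) => real" where
 "dPsi q N p = Max (dpsi q N p ` {1..N-1})"

definition cPsi :: "real => (real => real) => real" where
 "cPsi q w = (SUP t\<in>{0..1}. psi q w t)"

lemma grid_floor: "1 <= N ==> \<lfloor>real N * (real k / real N)\<rfloor> = int k"
 by simp

lemma T_stat_grid: "1 <= N ==> T_stat y N (real k / real N) = (\<Sum>i=1..k. y i) / sqrt (real N) / sqrt (real N)"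
 unfolding T_stat_def by (simp add: divide_divide_eq_left)

lemma D_stat_grid:
 assumes N: "1 <= N"
 shows "D_stat y N (real k / real N) = dbridge N (\<lambda>k. (\<Sum>i=1..k. y i) / sqrt (real N)) k"
proof -
 have "T_stat y N 1 = (\<Sum>i=1..N. y i) / sqrt (real N) / sqrt (real N)"
  using T_stat_grid[OF N, of y N] N by simp
 moreover have "s * (x / s / s - c * (z / s / s)) = x / s - c * (z / s)" if "s \<noteq> 0" for s x z c :: real
  using that by (simp add: field_simps)
 moreover have "sqrt (real N) \<noteq> 0" using N by simp
 ultimately show ?thesis
  unfolding D_stat_def dbridge_def T_stat_grid[OF N] grid_floor[OF N] by (simp only: of_int_of_nat_eq)
qed

text \<open>\<open>T_stat\<close> is the normalised partial sum divided by another
  \<open>sqrt N\<close>; squared, this is the factor 1 / N of a Riemann sum.\<close>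

lemma V_stat_sq_grid:
 assumes N: "1 <= N"
 shows "V_stat_sq y N (real k / real N) = dV2 N (\<lambda>k. (\<Sum>i=1..k. y i) / sqrt (real N)) k"
proof -
 let ?p = "\<lambda>k. (\<Sum>i=1..k. y i) / sqrt (real N)"
 have T1: "T_stat y N 1 = ?p N / sqrt (real N)"
  using T_stat_grid[OF N, of y N] N by simp
 have k: "nat \<lfloor>real N * (real k / real N)\<rfloor> = k" using N by simp
 have 1: "x / s - c * (z / s) = (x - c * z) / s" and 2: "u / s - x / s - c * (u / s - z / s) = (u - x - c * (u - z)) / s"
  for u x z c s :: real
  by (simp_all add: diff_divide_distrib right_diff_distrib)
 show ?thesis
  unfolding V_stat_sq_def Let_def k T_stat_grid[OF N] T1 1 2 power_divide real_sqrt_pow2[OF of_nat_0_le_iff]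
   sum_divide_distrib[symmetric] dV2_def
  by (simp only: add_divide_distrib)
qed

definition osc :: "real => real => (real => real) => bool" where
 "osc d e w \<longleftrightarrow> (\<forall>x\<in>{0..1}. \<forall>y\<in>{0..1}. \<bar>x - y\<bar> <= d \<longrightarrow> \<bar>w x - w y\<bar> <= e)"

lemma oscD: "osc d e w ==> x \<in> {0..1} ==> y \<in> {0..1} ==> \<bar>x - y\<bar> <= d ==> \<bar>w x - w y\<bar> <= e"
 by (simp add: osc_def)

lemma osc_nonneg: "osc d e w ==> 0 <= d ==> 0 <= e"
 using oscD[of d e w 0 0] by simp

lemma osc_mono: "osc d e w ==> d' <= d ==> e <= e' ==> osc d' e' w"
 unfolding osc_def by (meson order_trans)

lemma uniform_osc:
 assumes "continuous_on {0..1} w" "0 < e"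
 shows "\<exists>d>0. osc d e w"
proof -
 have "uniformly_continuous_on {0..1} w" using assms(1) by (rule compact_uniformly_continuous) simp
 then obtain d where d: "d > 0" "!!x y. x \<in> {0..1} ==> y \<in> {0..1} ==> dist y x < d ==> dist (w y) (w x) < e"
  unfolding uniformly_continuous_on_def using assms(2) by metis
 have "osc (d / 2) e w"
  unfolding osc_def
 proof (intro ballI impI)
  fix x y :: real assume xy: "x \<in> {0..1}" "y \<in> {0..1}" "\<bar>x - y\<bar> <= d / 2"
  then have "dist x y < d" using d(1) by (simp add: dist_real_def)
  then show "\<bar>w x - w y\<bar> <= e" using d(2)[OF xy(2,1)] by (simp add: dist_real_def)
 qed
 then show ?thesis using d(1) by (intro exI[of _ "d / 2"]) simp
qed

text \<open>A mesh 1 / m of the parameter corresponds to 1 / N in time. The chord moves by at most 2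
  A / m per step, which the length m / N of the interval turns into a term of order 1 / N.\<close>

lemma riemann_resid:
 assumes w: "unit_path A w" and t: "0 <= a" "a <= be" "be <= 1" and m: "1 <= m" "1 <= N" "be - a = real m / real N"
  and o: "osc (1 / real N) e w"
 shows "\<bar>(\<Sum>i=1..m. (resid w a be (real i / real m))^2) / real N - resid_sq w a be\<bar> <= 4 * A * e + 8 * A^2 / real N"
proof -
 have A: "0 <= A" by (rule unit_pathD(4)[OF w])
 have e: "0 <= e" using osc_nonneg[OF o] by simp
 let ?f = "\<lambda>s. (resid w a be s)^2" and ?d = "2 * (2 * A) * (e + 2 * A / real m)"
 have "\<bar>(\<Sum>i=1..m. ?f (real i / real m)) / real m - integral {0..1} ?f\<bar> <= ?d"
 proof (rule riemann_unit[OF _ m(1)])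
  show "continuous_on {0..1} ?f"
   by (intro continuous_on_power continuous_resid unit_pathD(1)[OF w] t)
  fix x y :: real assume xy: "x \<in> {0..1}" "y \<in> {0..1}" "\<bar>x - y\<bar> <= 1 / real m"
  have "\<bar>(a + (be - a) * x) - (a + (be - a) * y)\<bar> = (be - a) * \<bar>x - y\<bar>"
   using t by (simp add: abs_mult flip: right_diff_distrib)
  also have "\<dots> <= (be - a) * (1 / real m)" using t xy by (intro mult_left_mono) auto
  also have "\<dots> = 1 / real N" unfolding m(3) using m(1) by simp
  finally have 1: "\<bar>w (a + (be - a) * x) - w (a + (be - a) * y)\<bar> <= e"
   by (intro oscD[OF o] segment_unit t xy)
  have 2: "\<bar>(x - y) * (w a - w be)\<bar> <= 1 / real m * (2 * A)"
  proof -
   have "\<bar>w a\<bar> <= A" "\<bar>w be\<bar> <= A" using t by (auto intro!: unit_pathD(3)[OF w])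
   then show ?thesis unfolding abs_mult by (intro mult_mono xy) auto
  qed
  have "resid w a be x - resid w a be y = (w (a + (be - a) * x) - w (a + (be - a) * y)) + (x - y) * (w a - w be)"
   unfolding resid_def by (simp add: algebra_simps)
  then have "\<bar>resid w a be x - resid w a be y\<bar> <= e + 2 * A / real m" using 1 2 by (simp del: abs_mult)
  then show "\<bar>?f x - ?f y\<bar> <= ?d" by (intro sq_diff_bound resid_bound w t xy)
 qed
 then have "(be - a) * \<bar>(\<Sum>i=1..m. ?f (real i / real m)) / real m - integral {0..1} ?f\<bar> <= (be - a) * ?d"
  using t by (intro mult_left_mono) auto
 moreover have "(\<Sum>i=1..m. ?f (real i / real m)) / real N - resid_sq w a be =
   (be - a) * ((\<Sum>i=1..m. ?f (real i / real m)) / real m - integral {0..1} ?f)"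
  unfolding resid_sq_def right_diff_distrib using m by simp
 ultimately have "\<bar>(\<Sum>i=1..m. ?f (real i / real m)) / real N - resid_sq w a be\<bar> <= (be - a) * ?d"
  using t by (simp only: abs_mult abs_of_nonneg diff_ge_0_iff_ge)
 also have "(be - a) * ?d = (be - a) * (4 * A * e) + 8 * A^2 / real N"
  using m by (simp add: m(3) field_simps power2_eq_square)
 also have "(be - a) * (4 * A * e) <= 1 * (4 * A * e)" using t A e by (intro mult_right_mono) auto
 finally show ?thesis by simp
qed

text \<open>Both sums in \<open>dV2\<close> are Riemann sums of squared residuals; in the second,
  deviations are measured from the right end and equal minus the residual.\<close>

lemma dV2_resid:
 assumes k: "1 <= k" "k < N" and w0: "w 0 = 0"
 shows "dV2 N (\<lambda>i. w (real i / real N)) k =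
  (\<Sum>i=1..k. (resid w 0 (real k / real N) (real i / real k))^2) / real N +
  (\<Sum>i=1..N-k. (resid w (real k / real N) 1 (real i / real (N - k)))^2) / real N"
proof -
 have 1: "w (real i / real N) - real i / real k * w (real k / real N) = resid w 0 (real k / real N) (real i / real k)" for i
  using k w0 by (simp add: resid_def)
 have "(\<Sum>i=k+1..N. (w (real N / real N) - w (real i / real N)
    - (real N - real i) / (real N - real k) * (w (real N / real N) - w (real k / real N)))^2) =
   (\<Sum>i=1..N-k. (resid w (real k / real N) 1 (real i / real (N - k)))^2)"
 proof (rule sum.reindex_bij_witness[of _ "\<lambda>i. i + k" "\<lambda>i. i - k"])
  fix i assume i: "i \<in> {k+1..N}"
  have nk: "real (N - k) = real N - real k" "real (i - k) = real i - real k" using k i by auto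
  have nz: "real N - real k \<noteq> 0" "real N \<noteq> 0" using k by auto
  have "(1 - real k / real N) * ((real i - real k) / (real N - real k)) = (real i - real k) / real N"
   using nz by (simp add: divide_simps)
  then have a: "real k / real N + (1 - real k / real N) * ((real i - real k) / (real N - real k)) = real i / real N"
   by (simp add: diff_divide_distrib)
  have b: "(real N - real i) / (real N - real k) = 1 - (real i - real k) / (real N - real k)"
   using nz by (simp add: divide_simps)
  have "resid w (real k / real N) 1 (real (i - k) / real (N - k)) =
    - (w (real N / real N) - w (real i / real N) - (real N - real i) / (real N - real k) * (w (real N / real N) - w (real k / real N)))"
   unfolding resid_def nk a b divide_self[OF nz(2)] by (simp add: left_diff_distrib right_diff_distrib)
  then show "(resid w (real k / real N) 1 (real (i - k) / real (N - k)))^2 =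
    (w (real N / real N) - w (real i / real N) - (real N - real i) / (real N - real k) * (w (real N / real N) - w (real k / real N)))^2"
   by (simp only: power2_minus)
 qed (use k in auto)
 then show ?thesis unfolding dV2_def 1 by (simp add: add_divide_distrib)
qed

text \<open>The bridge is exact at grid points; the error stems from discretising the two
  integrals.\<close>

lemma dpsi_approx:
 assumes w: "unit_path A w" and k: "1 <= k" "k < N" and o: "osc (1 / real N) e w"
 shows "\<bar>dpsi q N (\<lambda>i. w (real i / real N)) k - psi q w (real k / real N)\<bar> <= psi_mod q A * (e + 1 / real N)"
proof -
 have A: "0 <= A" by (rule unit_pathD(4)[OF w])
 have e: "0 <= e" using osc_nonneg[OF o] by simp
 let ?p = "\<lambda>i. w (real i / real N)" and ?t = "real k / real N"
 have t: "0 <= ?t" "?t <= 1" using k by auto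
 have "\<bar>(\<Sum>i=1..k. (resid w 0 ?t (real i / real k))^2) / real N - resid_sq w 0 ?t\<bar> <= 4 * A * e + 8 * A^2 / real N"
  using k t by (intro riemann_resid w o) auto
 moreover have "\<bar>(\<Sum>i=1..N-k. (resid w ?t 1 (real i / real (N - k)))^2) / real N - resid_sq w ?t 1\<bar> <= 4 * A * e + 8 * A^2 / real N"
  using k t by (intro riemann_resid w o) (auto simp: of_nat_diff diff_divide_distrib)
 ultimately have "\<bar>dV2 N ?p k - V2 w ?t\<bar> <= 8 * A * e + 16 * A^2 / real N"
  unfolding dV2_resid[where w = w, OF k unit_pathD(2)[OF w]] V2_def by linarith
 also have "\<dots> <= 16 * A * e + 24 * A^2 * (1 / real N)"
  using A e by (intro add_mono) (auto intro!: divide_right_mono mult_right_mono)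
 finally have v: "\<bar>dV2 N ?p k - V2 w ?t\<bar> <= 16 * A * e + 24 * A^2 * (1 / real N)" .
 have "dbridge N ?p k = bridge w ?t" unfolding dbridge_def bridge_def using k by simp
 then have "\<bar>dpsi q N ?p k - psi q w ?t\<bar> = 0 + q^2 * \<bar>dV2 N ?p k - V2 w ?t\<bar>"
  unfolding dpsi_def psi_def by (simp add: abs_mult abs_minus_commute flip: right_diff_distrib)
 also have "\<dots> <= psi_mod q A * (e + 1 / real N)"
  using A e by (intro psi_mod_ge v) auto
 finally show ?thesis .
qed

lemma unit_path_bound: "continuous_on {0..1} w ==> w 0 = 0 ==> \<exists>A. unit_path A w"
proof -
 assume w: "continuous_on {0..1} w" "w 0 = 0"
 have "bounded (w ` {0..1})" by (intro compact_imp_bounded compact_continuous_image w) simp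
 then obtain A where "\<forall>x\<in>{0..1}. \<bar>w x\<bar> <= A" unfolding bounded_iff by auto
 then show ?thesis using w by (auto simp: unit_path_def)
qed

lemma psi_continuous:
 assumes w: "continuous_on {0..1} w" "w 0 = 0"
 shows "continuous_on {0..1} (psi q w)"
 unfolding continuous_on_iff
proof (intro ballI allI impI)
 fix t e :: real assume t: "t \<in> {0..1}" and e: "0 < e"
 obtain A where A: "unit_path A w" using unit_path_bound[OF w] by blast
 define C where "C = psi_mod q A + 1"
 have C: "psi_mod q A < C" "0 < C" using psi_mod_nonneg[OF unit_pathD(4)[OF A], of q] by (auto simp: C_def)
 have eC: "0 < e / (2 * C)" using e C by simp
 obtain d where d: "0 < d" "osc d (e / (2 * C)) w" using uniform_osc[OF w(1) eC] by blast
 show "\<exists>d>0. \<forall>x'\<in>{0..1}. dist x' t < d \<longrightarrow> dist (psi q w x') (psi q w t) < e"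
 proof (intro exI[of _ "min d (e / (2 * C))"] conjI ballI impI)
  show "0 < min d (e / (2 * C))" using d eC by simp
  fix x' :: real assume x': "x' \<in> {0..1}" "dist x' t < min d (e / (2 * C))"
  have dx: "\<bar>x' - t\<bar> < d" "\<bar>x' - t\<bar> < e / (2 * C)" using x'(2) by (auto simp: dist_real_def)
  have "\<bar>psi q w x' - psi q w t\<bar> <= psi_mod q A * (e / (2 * C) + \<bar>x' - t\<bar>)"
   using dx by (intro psi_diff A x' t oscD[OF d(2)]) auto
  also have "\<dots> <= C * (e / (2 * C) + \<bar>x' - t\<bar>)"
   using C eC by (intro mult_right_mono) auto
  also have "\<dots> < C * (e / (2 * C) + e / (2 * C))" using C dx by (intro mult_strict_left_mono) auto
  also have "\<dots> = e" using C by (simp add: field_simps)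
  finally show "dist (psi q w x') (psi q w t) < e" by (simp add: dist_real_def)
 qed
qed

lemma cPsi_attained:
 assumes w: "continuous_on {0..1} w" "w 0 = 0"
 shows "\<exists>t\<in>{0..1}. cPsi q w = psi q w t" "t \<in> {0..1} ==> psi q w t <= cPsi q w"
proof -
 obtain t0 where t0: "t0 \<in> {0..1}" "!!t. t \<in> {0..1} ==> psi q w t <= psi q w t0"
  using continuous_attains_sup[OF _ _ psi_continuous[OF w, of q]] by auto
 have eq: "cPsi q w = psi q w t0"
  unfolding cPsi_def by (rule cSup_eq_maximum) (use t0 in auto)
 show "\<exists>t\<in>{0..1}. cPsi q w = psi q w t" using eq t0 by blast
 show "t \<in> {0..1} ==> psi q w t <= cPsi q w" using eq t0 by simp
qed

lemma unit_path_continuous: "unit_path A w ==> continuous_on {0..1} w \<and> w 0 = 0"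
 by (simp add: unit_path_def)

lemma cPsi_diff:
 assumes w: "unit_path A w" "unit_path A w'" and e: "!!x. x \<in> {0..1} ==> \<bar>w x - w' x\<bar> <= e"
 shows "\<bar>cPsi q w - cPsi q w'\<bar> <= psi_mod q A * e"
proof -
 have le: "\<bar>psi q w t - psi q w' t\<bar> <= psi_mod q A * e" if "t \<in> {0..1}" for t
  using psi_diff[OF w that that, of e q] e by simp
 note c = unit_pathD(1,2)[OF w(1)] and c' = unit_pathD(1,2)[OF w(2)]
 obtain t where t: "t \<in> {0..1}" "cPsi q w = psi q w t" using cPsi_attained(1)[OF c] by blast
 obtain t' where t': "t' \<in> {0..1}" "cPsi q w' = psi q w' t'" using cPsi_attained(1)[OF c'] by blast
 show ?thesis
  using le[OF t(1)] le[OF t'(1)] cPsi_attained(2)[OF c' t(1), of q] cPsi_attained(2)[OF c t'(1), of q] t(2) t'(2) by linarith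
qed

text \<open>The factor 2 counts the Riemann sums and the shift of a maximiser of \<open>psi\<close>
  to a grid point.\<close>

lemma dPsi_approx:
 assumes w: "unit_path A w" and N: "2 <= N" and o: "osc (1 / real N) e w"
 shows "\<bar>dPsi q N (\<lambda>i. w (real i / real N)) - cPsi q w\<bar> <= 2 * psi_mod q A * (e + 1 / real N)"
proof -
 let ?p = "\<lambda>i. w (real i / real N)" and ?C = "psi_mod q A * (e + 1 / real N)"
 have C: "0 <= ?C" using psi_mod_nonneg[OF unit_pathD(4)[OF w], of q] osc_nonneg[OF o] by simp
 note c = unit_pathD(1,2)[OF w]
 have fin: "finite (dpsi q N ?p ` {1..N-1})" "dpsi q N ?p ` {1..N-1} \<noteq> {}" using N by auto
 obtain k where k: "k \<in> {1..N-1}" "dPsi q N ?p = dpsi q N ?p k"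
  using Max_in[OF fin] unfolding dPsi_def by auto
 have "dPsi q N ?p <= cPsi q w + ?C"
  using dpsi_approx[OF w _ _ o, of k q] k N cPsi_attained(2)[OF c, of "real k / real N" q] by fastforce
 moreover have "cPsi q w <= dPsi q N ?p + 2 * ?C"
 proof -
  obtain t where t: "t \<in> {0..1}" "cPsi q w = psi q w t" using cPsi_attained(1)[OF c] by blast
  have "\<exists>k\<in>{1..N-1}. \<bar>t - real k / real N\<bar> <= 1 / real N"
  proof -
   define j where "j = nat \<lfloor>real N * t\<rfloor>"
   have j: "real j <= real N * t" "real N * t < real j + 1"
    using t by (auto simp: j_def)
   have "real N * t <= real N * 1" using t by (intro mult_left_mono) auto
   then have "real j <= real N" using j by linarith
   then have jN: "j <= N" by simp
   \<comment> \<open>0 and N are not candidates for the maximum, so j is moved into {1..N-1}; the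
     distance to t stays within one grid step.\<close>
   define k where "k = max 1 (min (N - 1) j)"
   have k: "k \<in> {1..N-1}" using N by (auto simp: k_def)
   have "\<bar>real N * t - real k\<bar> <= 1"
   proof -
    consider "j = 0" | "j = N" | "1 <= j" "j <= N - 1" using jN by linarith
    then show ?thesis
    proof cases
     case 1
     then have "real k = 1" using N by (simp add: k_def)
     then show ?thesis using 1 j by simp
    next
     case 2
     then have "real k = real N - 1" using N by (simp add: k_def)
     then show ?thesis using 2 j \<open>real N * t <= real N * 1\<close> by simp
    next
     case 3
     then have "k = j" by (simp add: k_def)
     then show ?thesis using j by simp
    qed
   qed
   moreover have "real N * t - real k = real N * (t - real k / real N)" using N by (simp add: right_diff_distrib)
   ultimately have "real N * \<bar>t - real k / real N\<bar> <= 1" by (simp add: abs_mult)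
   then have "\<bar>t - real k / real N\<bar> <= 1 / real N" using N by (simp add: le_divide_eq mult.commute)
   then show ?thesis using k by blast
  qed
  then obtain k where k: "k \<in> {1..N-1}" "\<bar>t - real k / real N\<bar> <= 1 / real N" by blast
  have kN: "1 <= k" "k < N" "real k / real N \<in> {0..1}" using k(1) N by auto
  have "\<bar>psi q w t - psi q w (real k / real N)\<bar> <= psi_mod q A * (e + \<bar>t - real k / real N\<bar>)"
   using k(2) by (intro psi_diff w t kN oscD[OF o]) auto
  also have "\<dots> <= ?C" using k(2) psi_mod_nonneg[OF unit_pathD(4)[OF w], of q] by (intro mult_left_mono) auto
  finally have "psi q w t <= dpsi q N ?p k + 2 * ?C"
   using dpsi_approx[OF w kN(1,2) o, of q] by linarith
  also have "dpsi q N ?p k <= dPsi q N ?p" unfolding dPsi_def using fin k(1) by (intro Max_ge) auto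
  finally show ?thesis using t(2) by simp
 qed
 ultimately show ?thesis using C by (simp add: abs_le_iff mult.assoc)
qed

lemma dPsi_tendsto:
 assumes w: "continuous_on {0..1} w" "w 0 = 0"
 shows "(\<lambda>N. dPsi q N (\<lambda>i. w (real i / real N))) \<longlonglongrightarrow> cPsi q w"
proof (rule LIMSEQ_I)
 fix r :: real assume r: "0 < r"
 obtain A where A: "unit_path A w" using unit_path_bound[OF w] by blast
 define C where "C = psi_mod q A + 1"
 have C: "psi_mod q A < C" "0 < C" using psi_mod_nonneg[OF unit_pathD(4)[OF A], of q] by (auto simp: C_def)
 \<comment> \<open>Chosen so that the bound 2 C (r / (6 C) + r / (6 C)) = 2 r / 3 stays below
   r.\<close>
 have e: "0 < r / (6 * C)" using r C by simp
 obtain d where d: "0 < d" "osc d (r / (6 * C)) w" using uniform_osc[OF w(1) e] by blast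
 obtain N0 :: nat where N0: "1 / min d (r / (6 * C)) < N0" using reals_Archimedean2 by blast
 show "\<exists>no. \<forall>n\<ge>no. norm (dPsi q n (\<lambda>i. w (real i / real n)) - cPsi q w) < r"
 proof (intro exI[of _ "max 2 N0"] allI impI)
  fix N assume N: "max 2 N0 <= N"
  have m: "0 < min d (r / (6 * C))" using d e by simp
  have "1 / min d (r / (6 * C)) < real N" using N0 N by linarith
  then have "1 / real N < min d (r / (6 * C))"
   using m N by (simp add: divide_less_eq mult.commute del: min_less_iff_conj)
  then have i: "1 / real N < d" "1 / real N < r / (6 * C)" by simp_all
  have "osc (1 / real N) (r / (6 * C)) w" using i by (intro osc_mono[OF d(2)]) auto
  then have "\<bar>dPsi q N (\<lambda>i. w (real i / real N)) - cPsi q w\<bar> <= 2 * psi_mod q A * (r / (6 * C) + 1 / real N)"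
   using N by (intro dPsi_approx A) auto
  also have "\<dots> <= 2 * C * (r / (6 * C) + r / (6 * C))"
   using C i e psi_mod_nonneg[OF unit_pathD(4)[OF A], of q] by (intro mult_mono) auto
  also have "\<dots> < r" using C r by (simp add: field_simps)
  finally show "norm (dPsi q N (\<lambda>i. w (real i / real N)) - cPsi q w) < r" by simp
 qed
qed

section \<open>Polygonal paths\<close>

lemma poly_path_cases:
 assumes n: "1 <= n" and x: "x \<in> {0..1}"
 obtains k l where "k < n" "l \<in> {0..1}" "real k <= real n * x" "real n * x <= real k + 1"
  "!!y. poly_path n y x = (1 - l) * ((\<Sum>i=1..k. y i) / sqrt (real n)) + l * ((\<Sum>i=1..k+1. y i) / sqrt (real n))"
proof -
 \<comment> \<open>The minimum takes care of x = 1, which belongs to the last segment.\<close>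
 define k where "k = min (n - 1) (nat \<lfloor>real n * x\<rfloor>)"
 define l where "l = real n * x - real k"
 have x1: "real n * x <= real n * 1" using x by (intro mult_left_mono) auto
 have x0: "0 <= real n * x" using x by simp
 have f: "real (nat \<lfloor>real n * x\<rfloor>) <= real n * x" "real n * x < real (nat \<lfloor>real n * x\<rfloor>) + 1"
  using x0 by auto
 have kn: "k < n" using n by (simp add: k_def)
 have kx: "real k <= real n * x" "real n * x <= real k + 1"
 proof -
  have "real k <= real (nat \<lfloor>real n * x\<rfloor>)" by (simp add: k_def)
  then show "real k <= real n * x" using f by linarith
  have "k = n - 1 \<or> k = nat \<lfloor>real n * x\<rfloor>" by (auto simp: k_def)
  then show "real n * x <= real k + 1"
  proof
   assume "k = n - 1"
   then have "real k + 1 = real n" using n by simp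
   then show ?thesis using x1 by simp
  next
   assume "k = nat \<lfloor>real n * x\<rfloor>"
   then show ?thesis using f by simp
  qed
 qed
 have eq: "poly_path n y x = (1 - l) * ((\<Sum>i=1..k. y i) / sqrt (real n)) + l * ((\<Sum>i=1..k+1. y i) / sqrt (real n))" for y
 proof -
  have "(\<Sum>i=1..n. y i * max 0 (min 1 (real n * x - (real i - 1)))) =
    (\<Sum>i=1..k+1. y i * max 0 (min 1 (real n * x - (real i - 1))))"
  proof (rule sum.mono_neutral_right)
   show "\<forall>i\<in>{1..n} - {1..k+1}. y i * max 0 (min 1 (real n * x - (real i - 1))) = 0"
   proof
    fix i assume "i \<in> {1..n} - {1..k+1}"
    then have "real k + 2 <= real i" by auto
    then have "real n * x - (real i - 1) <= 0" using kx by linarith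
    then show "y i * max 0 (min 1 (real n * x - (real i - 1))) = 0" by (simp add: max_def min_def)
   qed
  qed (use kn in auto)
  also have "\<dots> = (\<Sum>i=1..k. y i) + y (k + 1) * l"
  proof -
   have "(\<Sum>i=1..k. y i * max 0 (min 1 (real n * x - (real i - 1)))) = (\<Sum>i=1..k. y i)"
   proof (rule sum.cong[OF refl])
    fix i assume "i \<in> {1..k}"
    then have "real i <= real k" by simp
    then have "1 <= real n * x - (real i - 1)" using kx by linarith
    then show "y i * max 0 (min 1 (real n * x - (real i - 1))) = y i" by (simp add: max_def min_def)
   qed
   moreover have "max 0 (min 1 (real n * x - (real (k + 1) - 1))) = l"
    using kx by (auto simp: l_def max_def min_def)
   ultimately show ?thesis by simp
  qed
  finally show ?thesis unfolding poly_path_def by (simp add: algebra_simps add_divide_distrib diff_divide_distrib)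
 qed
 show thesis by (rule that[OF kn _ kx eq]) (use kx in \<open>auto simp: l_def\<close>)
qed

lemma poly_path_grid:
 assumes n: "1 <= n" and k: "k <= n"
 shows "poly_path n y (real k / real n) = (\<Sum>i=1..k. y i) / sqrt (real n)"
proof -
 have "(\<Sum>i=1..n. y i * max 0 (min 1 (real n * (real k / real n) - (real i - 1)))) = (\<Sum>i=1..k. y i)"
 proof (rule sum.mono_neutral_cong_right)
  show "\<forall>i\<in>{1..n} - {1..k}. y i * max 0 (min 1 (real n * (real k / real n) - (real i - 1))) = 0"
   using n by (auto simp: max_def min_def)
  show "y i * max 0 (min 1 (real n * (real k / real n) - (real i - 1))) = y i" if "i \<in> {1..k}" for i
   using n that by (auto simp: max_def min_def)
 qed (use k in auto)
 then show ?thesis by (simp add: poly_path_def)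
qed

lemma poly_path_continuous: "continuous_on A (poly_path n y)"
 unfolding poly_path_def[abs_def] divide_inverse by (intro continuous_intros)

lemma poly_path_0 [simp]: "poly_path n y 0 = 0"
proof -
 have "y i * max 0 (min 1 (real n * 0 - (real i - 1))) = 0" if "i \<in> {1..n}" for i
  using that by (simp add: max_def min_def)
 then show ?thesis unfolding poly_path_def by simp
qed

lemma poly_path_diff:
 assumes n: "1 <= n" and x: "x \<in> {0..1}"
  and e: "!!k. k <= n ==> \<bar>(\<Sum>i=1..k. y i) / sqrt (real n) - (\<Sum>i=1..k. y' i) / sqrt (real n)\<bar> <= e"
 shows "\<bar>poly_path n y x - poly_path n y' x\<bar> <= e"
proof -
 obtain k l where kl: "k < n" "l \<in> {0..1}"
  "!!y. poly_path n y x = (1 - l) * ((\<Sum>i=1..k. y i) / sqrt (real n)) + l * ((\<Sum>i=1..k+1. y i) / sqrt (real n))"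
  by (rule poly_path_cases[OF n x]) blast
 show ?thesis unfolding kl(3) by (rule convex_comb_diff[OF e e kl(2)]) (use kl(1) in auto)
qed

lemma unit_path_poly:
 assumes n: "1 <= n" and A: "!!k. k <= n ==> \<bar>(\<Sum>i=1..k. y i) / sqrt (real n)\<bar> <= A"
 shows "unit_path A (poly_path n y)"
proof -
 have "\<bar>poly_path n y x\<bar> <= A" if "x \<in> {0..1}" for x
  using poly_path_diff[OF n that, of y "\<lambda>_. 0" A] A by (simp add: poly_path_def[of n "\<lambda>_. 0"])
 then show ?thesis unfolding unit_path_def using poly_path_continuous poly_path_0 by blast
qed

text \<open>On each segment the path lies between its end values. Points at distance d lie in
  segments whose end points are at most n d + 2 indices apart, the 2 stemming from rounding.\<close>

lemma osc_poly:
 assumes n: "1 <= n" and K: "real n * d + 2 <= real K"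
  and e: "!!k l. k <= n ==> l <= n ==> k <= l ==> l <= k + K ==>
   \<bar>(\<Sum>i=1..k. y i) / sqrt (real n) - (\<Sum>i=1..l. y i) / sqrt (real n)\<bar> <= e"
 shows "osc d e (poly_path n y)"
 unfolding osc_def
proof (intro ballI impI)
 fix x x' :: real assume x: "x \<in> {0..1}" "x' \<in> {0..1}" and d: "\<bar>x - x'\<bar> <= d"
 let ?S = "\<lambda>k. (\<Sum>i=1..k. y i) / sqrt (real n)"
 obtain k l where kl: "k < n" "l \<in> {0..1}" "real k <= real n * x" "real n * x <= real k + 1"
  "poly_path n y x = (1 - l) * ?S k + l * ?S (k + 1)"
  by (rule poly_path_cases[OF n x(1)]) blast
 obtain k' l' where kl': "k' < n" "l' \<in> {0..1}" "real k' <= real n * x'" "real n * x' <= real k' + 1"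
  "poly_path n y x' = (1 - l') * ?S k' + l' * ?S (k' + 1)"
  by (rule poly_path_cases[OF n x(2)]) blast
 have "\<bar>real n * x - real n * x'\<bar> = real n * \<bar>x - x'\<bar>" by (simp add: abs_mult flip: right_diff_distrib)
 also have "\<dots> <= real n * d" using d by (intro mult_left_mono) auto
 finally have "\<bar>real n * x - real n * x'\<bar> + 2 <= real K" using K by linarith
 then have kk: "k + 1 <= k' + K" "k' + 1 <= k + K" using kl(3,4) kl'(3,4) by linarith+
 have S: "\<bar>?S i - ?S j\<bar> <= e" if "i \<in> {k, k + 1}" "j \<in> {k', k' + 1}" for i j
 proof -
  have ij: "i <= n" "j <= n" "i <= j + K" "j <= i + K" using that kk kl(1) kl'(1) by auto
  show ?thesis
  proof (cases "i <= j")
   case True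
   then show ?thesis using ij by (intro e)
  next
   case False
   then have "\<bar>?S j - ?S i\<bar> <= e" using ij by (intro e) auto
   then show ?thesis by (simp add: abs_minus_commute)
  qed
 qed
 have same: "(1 - a) * z + a * z = z" for a z :: real by (simp add: algebra_simps)
 have 1: "\<bar>?S i - poly_path n y x'\<bar> <= e" if "i \<in> {k, k + 1}" for i
 proof -
  have "\<bar>((1 - l') * ?S i + l' * ?S i) - ((1 - l') * ?S k' + l' * ?S (k' + 1))\<bar> <= e"
   by (rule convex_comb_diff[OF S[OF that] S[OF that] kl'(2)]) auto
  then show ?thesis unfolding kl'(5) same .
 qed
 have "\<bar>((1 - l) * ?S k + l * ?S (k + 1)) - ((1 - l) * poly_path n y x' + l * poly_path n y x')\<bar> <= e"
  by (rule convex_comb_diff[OF 1 1 kl(2)]) auto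
 then show "\<bar>poly_path n y x - poly_path n y x'\<bar> <= e" unfolding kl(5) same .
qed

text \<open>k and l lie in the same or in adjacent blocks of length K, so the way from k to l
  through the starts of the blocks has three legs.\<close>

lemma block_increment:
 fixes s :: "nat => real"
 assumes K: "1 <= K" and b: "!!r j. r * K <= n ==> j <= K ==> \<bar>s (r * K + j) - s (r * K)\<bar> <= e"
  and kl: "k <= l" "l <= k + K" "l <= n"
 shows "\<bar>s k - s l\<bar> <= 3 * e"
proof -
 have e: "0 <= e" using b[of 0 0] by simp
 have dec: "\<bar>s k - s (k div K * K)\<bar> <= e" if "k <= n" for k
 proof -
  have "k div K * K <= n" using that div_times_less_eq_dividend[of k K] by linarith
  moreover have "k mod K <= K" using K mod_less_divisor[of K k] by linarith
  ultimately have "\<bar>s (k div K * K + k mod K) - s (k div K * K)\<bar> <= e" by (rule b)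
  then show ?thesis by simp
 qed
 have "k div K = l div K \<or> l div K = k div K + 1"
 proof -
  have "l div K <= (k + K) div K" by (rule div_le_mono[OF kl(2)])
  then have "l div K <= k div K + 1" using K by simp
  moreover have "k div K <= l div K" by (rule div_le_mono[OF kl(1)])
  ultimately show ?thesis by linarith
 qed
 moreover have "\<bar>s (k div K * K + K) - s (k div K * K)\<bar> <= e"
  using kl div_times_less_eq_dividend[of k K] by (intro b) linarith+
 ultimately have "\<bar>s (l div K * K) - s (k div K * K)\<bar> <= e"
  using e by (auto simp: add.commute)
 then show ?thesis using dec[of k] dec[of l] kl by linarith
qed

section \<open>Invariance under drift and the rejection event\<close>

text \<open>Adding a constant to the observations adds a linear function to the partial sums, and
  bridge and chord deviations vanish on linear functions. This removes the common mean.\<close>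

lemma dpsi_add_linear:
 assumes k: "1 <= k" "k < n"
 shows "dbridge n (\<lambda>i. p i + c * real i) k = dbridge n p k" "dV2 n (\<lambda>i. p i + c * real i) k = dV2 n p k"
  "dpsi q n (\<lambda>i. p i + c * real i) k = dpsi q n p k"
proof -
 show 1: "dbridge n (\<lambda>i. p i + c * real i) k = dbridge n p k"
  using k by (simp add: dbridge_def field_simps)
 have a: "p i + c * real i - real i / real k * (p k + c * real k) = p i - real i / real k * p k" for i
  using k by (simp add: field_simps)
 have b: "p n + c * real n - (p i + c * real i) - r * (p n + c * real n - (p k + c * real k)) =
   p n - p i - r * (p n - p k) + c * ((real n - real i) - r * (real n - real k))" for r i
  by (simp add: algebra_simps)
 have c: "(real n - real i) - (real n - real i) / (real n - real k) * (real n - real k) = 0" for i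
  using k by simp
 show 2: "dV2 n (\<lambda>i. p i + c * real i) k = dV2 n p k"
  unfolding dV2_def a b c by simp
 show "dpsi q n (\<lambda>i. p i + c * real i) k = dpsi q n p k" unfolding dpsi_def 1 2 ..
qed

lemma dpsi_cong:
 assumes "k <= n" "!!i. i <= n ==> p i = p' i"
 shows "dbridge n p k = dbridge n p' k" "dV2 n p k = dV2 n p' k" "dpsi q n p k = dpsi q n p' k"
proof -
 show 1: "dbridge n p k = dbridge n p' k" using assms by (simp add: dbridge_def)
 have "(\<Sum>i=1..k. (p i - real i / real k * p k)^2) = (\<Sum>i=1..k. (p' i - real i / real k * p' k)^2)"
  by (rule sum.cong) (use assms in auto)
 moreover have "(\<Sum>i=k+1..n. (p n - p i - (real n - real i) / (real n - real k) * (p n - p k))^2) =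
   (\<Sum>i=k+1..n. (p' n - p' i - (real n - real i) / (real n - real k) * (p' n - p' k))^2)"
  by (rule sum.cong) (use assms in auto)
 ultimately show 2: "dV2 n p k = dV2 n p' k" by (simp add: dV2_def)
 show "dpsi q n p k = dpsi q n p' k" unfolding dpsi_def 1 2 ..
qed

lemma dPsi_cong:
 assumes "!!i. i <= n ==> p i = p' i"
 shows "dPsi q n p = dPsi q n p'"
 unfolding dPsi_def
 by (intro arg_cong[where f = Max] image_cong refl dpsi_cong(3)) (use assms in auto)

lemma dV2_nonneg: "0 <= dV2 n p k"
 unfolding dV2_def by (intro divide_nonneg_nonneg add_nonneg_nonneg sum_nonneg) auto

text \<open>V = 0 is a separate case, since the quotient is then 0 and cannot exceed q >= 0.\<close>

lemma ratio_gt_iff: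
 fixes D V q :: real
 assumes "0 <= q" "0 <= V"
 shows "q < \<bar>D\<bar> / sqrt V \<longleftrightarrow> V \<noteq> 0 \<and> q^2 * V < D^2"
proof (cases "V = 0")
 case False
 then have V: "0 < sqrt V" using assms by simp
 have "q < \<bar>D\<bar> / sqrt V \<longleftrightarrow> q * sqrt V < \<bar>D\<bar>" using V by (simp add: less_divide_eq)
 also have "\<dots> \<longleftrightarrow> (q * sqrt V)\<^sup>2 < \<bar>D\<bar>\<^sup>2"
 proof
  assume "q * sqrt V < \<bar>D\<bar>"
  then show "(q * sqrt V)^2 < \<bar>D\<bar>\<^sup>2" using assms by (intro power_strict_mono) auto
 next
  assume "(q * sqrt V)^2 < \<bar>D\<bar>\<^sup>2"
  then show "q * sqrt V < \<bar>D\<bar>" by (rule power_less_imp_less_base) simp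
 qed
 also have "(q * sqrt V)^2 = q^2 * V" using assms by (simp add: power_mult_distrib)
 finally show ?thesis using False by simp
qed (use assms in simp)

lemma test_stat_gt:
 assumes q: "0 <= q" and n: "2 <= n"
 shows "q < test_stat y n \<longleftrightarrow> (\<exists>k\<in>{1..n-1}.
  dV2 n (\<lambda>k. (\<Sum>i=1..k. y i) / sqrt (real n)) k \<noteq> 0 \<and> 0 < dpsi q n (\<lambda>k. (\<Sum>i=1..k. y i) / sqrt (real n)) k)"
proof -
 have n1: "1 <= n" using n by simp
 show ?thesis
  unfolding test_stat_def D_stat_grid[OF n1] V_stat_sq_grid[OF n1] dpsi_def
  by (subst Max_gr_iff) (use n in \<open>auto simp: ratio_gt_iff[OF q dV2_nonneg]\<close>)
qed

lemma sum_add_const: "(\<Sum>i=1..k. y i + c) / sqrt (real n) = (\<Sum>i=1..k. y i) / sqrt (real n) + c / sqrt (real n) * real k"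
 by (simp add: sum.distrib add_divide_distrib)

lemma test_stat_add_const:
 assumes n: "2 <= n"
 shows "test_stat (\<lambda>i. y i + c) n = test_stat y n"
proof -
 have n1: "1 <= n" using n by simp
 show ?thesis
  unfolding test_stat_def D_stat_grid[OF n1] V_stat_sq_grid[OF n1] sum_add_const
 proof (intro arg_cong[where f = Max] image_cong refl)
  fix k assume "k \<in> {1..n-1}"
  then have k: "1 <= k" "k < n" using n by auto
  show "\<bar>dbridge n (\<lambda>k. (\<Sum>i=1..k. y i) / sqrt (real n) + c / sqrt (real n) * real k) k\<bar> /
    sqrt (dV2 n (\<lambda>k. (\<Sum>i=1..k. y i) / sqrt (real n) + c / sqrt (real n) * real k) k) =
    \<bar>dbridge n (\<lambda>k. (\<Sum>i=1..k. y i) / sqrt (real n)) k\<bar> / sqrt (dV2 n (\<lambda>k. (\<Sum>i=1..k. y i) / sqrt (real n)) k)"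
   by (simp only: dpsi_add_linear[OF k])
 qed
qed

text \<open>The way leads from the grid of size n to the path of y, on to the path of y', and to the
  coarse grid of size M. The path of y' oscillates by at most 3 e, and 9 = 2 + 1 + 6 adds up the
  multiples of e.\<close>

lemma dPsi_transfer:
 assumes nM: "M <= n" "2 <= M"
  and A: "!!k. k <= n ==> \<bar>(\<Sum>i=1..k. y i) / sqrt (real n)\<bar> <= A" "!!k. k <= n ==> \<bar>(\<Sum>i=1..k. y' i) / sqrt (real n)\<bar> <= A"
  and e: "!!k. k <= n ==> \<bar>(\<Sum>i=1..k. y i) / sqrt (real n) - (\<Sum>i=1..k. y' i) / sqrt (real n)\<bar> <= e"
  and o: "osc (1 / real M) e (poly_path n y)"
 shows "dPsi q n (\<lambda>k. (\<Sum>i=1..k. y i) / sqrt (real n)) <=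
  dPsi q M (\<lambda>i. poly_path n y' (real i / real M)) + 9 * psi_mod q A * (e + 1 / real M)"
proof -
 let ?w = "poly_path n y" and ?w' = "poly_path n y'" and ?C = "psi_mod q A"
 have n: "1 <= n" "2 <= n" using nM by auto
 have w: "unit_path A ?w" "unit_path A ?w'" by (rule unit_path_poly[OF n(1)], erule A)+
 have C: "0 <= ?C" by (rule psi_mod_nonneg[OF unit_pathD(4)[OF w(1)]])
 have d: "\<bar>?w x - ?w' x\<bar> <= e" if "x \<in> {0..1}" for x by (rule poly_path_diff[OF n(1) that e])
 have inv: "1 / real n <= 1 / real M" using nM by (simp add: frac_le)
 have "dPsi q n (\<lambda>k. (\<Sum>i=1..k. y i) / sqrt (real n)) = dPsi q n (\<lambda>k. ?w (real k / real n))"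
  by (rule dPsi_cong) (simp add: poly_path_grid[OF n(1)])
 also have "\<dots> <= cPsi q ?w + 2 * ?C * (e + 1 / real n)"
  using dPsi_approx[OF w(1) n(2) osc_mono[OF o inv order_refl], of q] by linarith
 also have "\<dots> <= cPsi q ?w + 2 * ?C * (e + 1 / real M)"
  using C inv by (intro add_left_mono mult_left_mono) auto
 also have "cPsi q ?w <= cPsi q ?w' + ?C * e" using cPsi_diff[OF w d, of q] by linarith
 also have "cPsi q ?w' <= dPsi q M (\<lambda>i. ?w' (real i / real M)) + 2 * ?C * (3 * e + 1 / real M)"
 proof -
  have "osc (1 / real M) (3 * e) ?w'"
   unfolding osc_def
  proof (intro ballI impI)
   fix x x' :: real assume "x \<in> {0..1}" "x' \<in> {0..1}" "\<bar>x - x'\<bar> <= 1 / real M"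
   then show "\<bar>?w' x - ?w' x'\<bar> <= 3 * e" using oscD[OF o, of x x'] d[of x] d[of x'] by linarith
  qed
  then show ?thesis using dPsi_approx[OF w(2) nM(2), of "3 * e" q] by linarith
 qed
 finally have "dPsi q n (\<lambda>k. (\<Sum>i=1..k. y i) / sqrt (real n)) <= dPsi q M (\<lambda>i. ?w' (real i / real M)) +
   (2 * ?C * (3 * e + 1 / real M) + ?C * e + 2 * ?C * (e + 1 / real M))" by simp
 also have "2 * ?C * (3 * e + 1 / real M) + ?C * e + 2 * ?C * (e + 1 / real M) = ?C * (9 * e + 4 / real M)"
  by (simp add: algebra_simps)
 also have "\<dots> <= ?C * (9 * (e + 1 / real M))" using C by (intro mult_left_mono) (auto intro: divide_right_mono)
 finally show ?thesis by (simp add: mult_ac)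
qed

section \<open>The limit functional of Brownian motion\<close>

lemma riemann_tendsto:
 fixes f :: "real => real"
 assumes f: "continuous_on {0..1} f"
 shows "(\<lambda>k. (\<Sum>i=1..k. f (real i / real k)) / real k) \<longlonglongrightarrow> integral {0..1} f"
proof (rule LIMSEQ_I)
 fix r :: real assume r: "0 < r"
 obtain d where d: "0 < d" "osc d (r / 2) f" using uniform_osc[OF f, of "r / 2"] r by auto
 obtain N :: nat where N: "1 / d < N" using reals_Archimedean2 by blast
 show "\<exists>no. \<forall>k\<ge>no. norm ((\<Sum>i=1..k. f (real i / real k)) / real k - integral {0..1} f) < r"
 proof (intro exI[of _ "max 1 N"] allI impI)
  fix k assume k: "max 1 N <= k"
  have "1 / d < real k" using N k by linarith
  then have "1 / real k <= d" using d k by (simp add: field_simps)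
  then have "\<bar>(\<Sum>i=1..k. f (real i / real k)) / real k - integral {0..1} f\<bar> <= r / 2"
   using k by (intro riemann_unit f oscD[OF d(2)]) auto
  then show "norm ((\<Sum>i=1..k. f (real i / real k)) / real k - integral {0..1} f) < r" using r by simp
 qed
qed

lemma V2_continuous:
 assumes "continuous_on {0..1} w" "w 0 = 0"
 shows "continuous_on {0..1} (V2 w)"
proof -
 have "V2 w = (\<lambda>t. psi 0 w t - psi 1 w t)" by (simp add: psi_def fun_eq_iff)
 then show ?thesis by (simp add: continuous_intros psi_continuous[OF assms])
qed

lemma bridge_continuous: "continuous_on {0..1} w ==> continuous_on {0..1} (bridge w)"
 unfolding bridge_def[abs_def] by (intro continuous_intros)

lemma resid_sq_eq_0:
 assumes w: "continuous_on {0..1} w" and t: "0 <= a" "a < be" "be <= 1" and z: "resid_sq w a be = 0" and s: "s \<in> {0..1}"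
 shows "w (a + (be - a) * s) = (1 - s) * w a + s * w be"
proof -
 have "integral {0..1} (\<lambda>s. (resid w a be s)^2) = 0" using z t by (simp add: resid_sq_def)
 moreover have "continuous_on {0..1} (\<lambda>s. (resid w a be s)^2)"
  using t by (intro continuous_on_power continuous_resid w) auto
 ultimately have "(resid w a be s)^2 = 0"
  using integral_eq_0_iff[of 0 1 "\<lambda>s. (resid w a be s)^2"] s by simp
 then show ?thesis by (simp add: resid_def)
qed

text \<open>If V2 vanished at t, then w would be affine on [0,t] and on [t,1]. One of the two
  contains a half of [0,1], and there two adjacent increments of length 1/4 would coincide.\<close>

lemma V2_pos:
 assumes w: "continuous_on {0..1} w" "w 0 = 0" and t: "t \<in> {0..1}"
  and g1: "w (1/4) - w 0 \<noteq> w (2/4) - w (1/4)" and g2: "w (3/4) - w (2/4) \<noteq> w 1 - w (3/4)"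
 shows "0 < V2 w t"
proof (rule ccontr)
 assume "\<not> 0 < V2 w t"
 moreover have "0 <= resid_sq w 0 t" "0 <= resid_sq w t 1" using t w by (auto intro!: resid_sq_nonneg)
 ultimately have z: "resid_sq w 0 t = 0" "resid_sq w t 1 = 0" unfolding V2_def by linarith+
 show False
 proof (cases "1/2 <= t")
  case True
  have "w (0 + (t - 0) * (1 / (4 * t))) = (1 - 1 / (4 * t)) * w 0 + 1 / (4 * t) * w t"
   using True t by (intro resid_sq_eq_0 w z) auto
  moreover have "w (0 + (t - 0) * (1 / (2 * t))) = (1 - 1 / (2 * t)) * w 0 + 1 / (2 * t) * w t"
   using True t by (intro resid_sq_eq_0 w z) auto
  ultimately have "w (1/4) = w t / (4 * t)" "w (1/2) = w t / (2 * t)" using True w by auto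
  then have "w (1/2) = 2 * w (1/4)" by simp
  then show False using g1 w(2) by simp
 next
  case False
  define s where "s = (1/2 - t) / (1 - t)"
  have s: "0 <= s" "s <= 1" "t + (1 - t) * s = 1/2" "t + (1 - t) * ((s + 1) / 2) = 3/4"
   using False t by (auto simp: s_def field_simps)
  have "w (t + (1 - t) * s) = (1 - s) * w t + s * w 1"
   using False t s(1,2) by (intro resid_sq_eq_0 w z) auto
  moreover have "w (t + (1 - t) * ((s + 1) / 2)) = (1 - (s + 1) / 2) * w t + (s + 1) / 2 * w 1"
   using False t s(1,2) by (intro resid_sq_eq_0 w z) auto
  ultimately have "2 * w (3/4) = w (1/2) + w 1" unfolding s by (simp add: field_simps)
  then show False using g2 by simp
 qed
qed

text \<open>Only the sets of upper bounds are compared, so that the identity covers unbounded ratios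
  too. Where V2 is positive, rational times approximate t by continuity; where it is 0, so is the
  ratio, and t = 0 provides a nonnegative competitor.\<close>

lemma limit_functional_Rats:
 assumes w: "continuous_on {0..1} w" "w 0 = 0"
 shows "limit_functional w = Sup ((\<lambda>t. \<bar>bridge w t\<bar> / sqrt (V2 w t)) ` ({0..1} \<inter> \<rat>))"
proof -
 let ?R = "\<lambda>t. \<bar>bridge w t\<bar> / sqrt (V2 w t)"
 have "(\<forall>x\<in>?R ` {0..1}. x <= z) \<longleftrightarrow> (\<forall>x\<in>?R ` ({0..1} \<inter> \<rat>). x <= z)" for z
 proof
  assume z: "\<forall>x\<in>?R ` ({0..1} \<inter> \<rat>). x <= z"
  have "?R t <= z" if t: "t \<in> {0..1}" for t
  proof (cases "V2 w t = 0")
   case True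
   have "?R 0 <= z" by (rule bspec[OF z imageI]) simp
   moreover have "0 <= ?R 0" using V2_nonneg[OF w(1), of 0] by simp
   ultimately show ?thesis using True by simp
  next
   case False
   define a where "a n = real (nat \<lfloor>real n * t\<rfloor>) / real n" for n
   have a: "a n \<in> {0..1} \<inter> \<rat>" for n
   proof -
    define m where "m = nat \<lfloor>real n * t\<rfloor>"
    have "real n * t <= real n * 1" using t by (intro mult_left_mono) auto
    moreover have "real m <= real n * t" using t by (auto simp: m_def)
    ultimately have "real m <= real n" by linarith
    then have "real m / real n <= 1" by (cases "n = 0") (auto simp: divide_le_eq)
    then show ?thesis unfolding a_def m_def[symmetric] by simp
   qed
   have lim: "a \<longlonglongrightarrow> t"
   proof (rule LIM_zero_cancel, rule Lim_null_comparison)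
    show "\<forall>\<^sub>F n in sequentially. norm (a n - t) <= 1 / real n"
     using eventually_gt_at_top[of 0]
    proof eventually_elim
     case (elim n)
     have "real (nat \<lfloor>real n * t\<rfloor>) <= real n * t" "real n * t < real (nat \<lfloor>real n * t\<rfloor>) + 1" using t by auto
     then have "\<bar>real (nat \<lfloor>real n * t\<rfloor>) - real n * t\<bar> <= 1" by linarith
     then have "\<bar>(real (nat \<lfloor>real n * t\<rfloor>) - real n * t) / real n\<bar> <= 1 / real n"
      using elim by (simp add: abs_divide divide_right_mono)
     moreover have "a n - t = (real (nat \<lfloor>real n * t\<rfloor>) - real n * t) / real n"
      using elim by (simp add: a_def diff_divide_distrib)
     ultimately show ?case by simp
    qed
   qed (rule lim_const_over_n)
   have c: "(\<lambda>n. f (a n)) \<longlonglongrightarrow> f t" if "continuous_on {0..1} f" for f :: "real => real"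
    using a by (intro continuous_on_tendsto_compose[OF that lim t] always_eventually) auto
   have "(\<lambda>n. ?R (a n)) \<longlonglongrightarrow> ?R t"
    using False V2_nonneg[OF w(1) t]
    by (intro tendsto_intros c[OF bridge_continuous[OF w(1)]] c[OF V2_continuous[OF w]]) auto
   then show ?thesis
    by (rule LIMSEQ_le_const2) (use z a in blast)
  qed
  then show "\<forall>x\<in>?R ` {0..1}. x <= z" by blast
 qed blast
 then show ?thesis unfolding limit_functional_eq[OF w] Sup_real_def by simp
qed

lemma measurable_dPsi:
 assumes [measurable]: "!!i. p i \<in> borel_measurable M"
 shows "(\<lambda>w. dPsi q N (\<lambda>i. p i w)) \<in> borel_measurable M"
proof -
 have "(\<lambda>w. dpsi q N (\<lambda>i. p i w) k) \<in> borel_measurable M" for k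
  unfolding dpsi_def dbridge_def dV2_def by measurable
 then show ?thesis unfolding dPsi_def by (intro borel_measurable_Max) auto
qed

section \<open>Brownian paths and the critical value\<close>

locale brownian = prob_space Q for Q :: "'v measure" +
 fixes W :: "real => 'v => real"
 assumes bm: "brownian_motion Q W"
begin

lemma measurable_W [measurable]: "0 <= t ==> W t \<in> borel_measurable Q"
 using bm by (simp add: brownian_motion_def)

lemma path_W: "w \<in> space Q ==> continuous_on {0..1} (\<lambda>t. W t w)" "w \<in> space Q ==> W 0 w = 0"
proof -
 assume "w \<in> space Q"
 then have "continuous_on {0..} (\<lambda>t. W t w)" "W 0 w = 0" using bm by (simp_all add: brownian_motion_def)
 then show "continuous_on {0..1} (\<lambda>t. W t w)" "W 0 w = 0" by (auto intro: continuous_on_subset)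
qed

definition binc :: "nat => nat => 'v => real" where
 "binc N j w = W (real (Suc j) / real N) w - W (real j / real N) w"

lemma measurable_binc [measurable]: "binc N j \<in> borel_measurable Q"
 unfolding binc_def[abs_def] by measurable

lemma binc_normal: "1 <= N ==> distributed Q lborel (binc N j) (normal_density 0 (sqrt (1 / real N)))"
proof -
 assume N: "1 <= N"
 have "\<forall>s t. 0 <= s \<and> s < t \<longrightarrow> distributed Q lborel (\<lambda>w. W t w - W s w) (normal_density 0 (sqrt (t - s)))"
  using bm by (simp add: brownian_motion_def)
 then have "distributed Q lborel (\<lambda>w. W (real (Suc j) / real N) w - W (real j / real N) w)
   (normal_density 0 (sqrt (real (Suc j) / real N - real j / real N)))"
  by (elim allE[of _ "real j / real N"] allE[of _ "real (Suc j) / real N"] impE) (use N in \<open>simp add: divide_less_cancel\<close>)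
 moreover have "real (Suc j) / real N - real j / real N = 1 / real N" by (simp add: diff_divide_distrib[symmetric])
 ultimately show ?thesis unfolding binc_def[abs_def] by simp
qed

lemma binc_indep: "1 <= N ==> indep_vars (\<lambda>_. borel) (binc N) {..<m}"
proof -
 assume N: "1 <= N"
 have "\<forall>(t :: nat => real) m. 0 <= t 0 \<and> strict_mono t \<longrightarrow>
   indep_vars (\<lambda>_. borel) (\<lambda>i w. W (t (Suc i)) w - W (t i) w) {..<m}"
  using bm by (simp add: brownian_motion_def)
 then have "indep_vars (\<lambda>_. borel) (\<lambda>i w. W (real (Suc i) / real N) w - W (real i / real N) w) {..<m}"
  by (elim allE[of _ "\<lambda>i. real i / real N"] allE[of _ m] impE) (use N in \<open>auto simp: strict_mono_def divide_strict_right_mono\<close>)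
 then show ?thesis unfolding binc_def[abs_def] .
qed

text \<open>The difference of two independent normal increments is normal and so has a
  density.\<close>

lemma binc_adjacent:
 assumes N: "1 <= N"
 shows "AE w in Q. binc N j w \<noteq> binc N (Suc j) w"
proof -
 have "indep_vars (\<lambda>_. borel) (binc N) (insert j {Suc j})"
  by (rule indep_vars_subset[OF binc_indep[OF N, of "Suc (Suc j)"]]) auto
 then have "indep_var borel (binc N j) borel (\<lambda>w. \<Sum>i\<in>{Suc j}. binc N i w)"
  by (intro indep_vars_sum) auto
 then have iv: "indep_var borel (binc N j) borel (binc N (Suc j))" by simp
 have N0: "0 < sqrt (1 / real N)" using N by simp
 have "distributed Q lborel (\<lambda>w. binc N j w - binc N (Suc j) w)
   (normal_density (0 - 0) (sqrt ((sqrt (1 / real N))^2 + (sqrt (1 / real N))^2)))"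
  by (rule diff_indep_normal[OF iv N0 N0 binc_normal[OF N] binc_normal[OF N]])
 from distributed_AE2[OF this, of "\<lambda>x. x \<noteq> 0"] have "(AE w in Q. binc N j w - binc N (Suc j) w \<noteq> 0) \<longleftrightarrow>
   (AE x in lborel. 0 < ennreal (normal_density (0 - 0) (sqrt ((sqrt (1 / real N))^2 + (sqrt (1 / real N))^2)) x) \<longrightarrow> x \<noteq> 0)"
  by simp
 moreover have "AE x in lborel. x \<noteq> (0::real)" by (rule AE_lborel_singleton)
 ultimately show ?thesis by auto
qed

text \<open>The quarter increments give V2 > 0 at every time by \<open>V2_pos\<close>; the half
  increments give a bridge that is not 0 at 1/2.\<close>

definition good :: "'v => bool" where
 "good w \<longleftrightarrow> w \<in> space Q \<and> binc 4 0 w \<noteq> binc 4 1 w \<and> binc 4 2 w \<noteq> binc 4 3 w \<and> binc 2 0 w \<noteq> binc 2 1 w"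

lemma AE_good: "AE w in Q. good w"
proof -
 have "AE w in Q. binc 4 0 w \<noteq> binc 4 1 w" "AE w in Q. binc 4 2 w \<noteq> binc 4 3 w" "AE w in Q. binc 2 0 w \<noteq> binc 2 1 w"
  using binc_adjacent[of 4 0] binc_adjacent[of 4 2] binc_adjacent[of 2 0] by (simp_all add: numeral_eq_Suc)
 then show ?thesis using AE_space by eventually_elim (simp add: good_def)
qed

lemma good_V2: "good w ==> t \<in> {0..1} ==> 0 < V2 (\<lambda>t. W t w) t"
 by (rule V2_pos) (auto simp: good_def binc_def path_W)

lemma good_bridge: "good w ==> bridge (\<lambda>t. W t w) (1/2) \<noteq> 0"
 by (auto simp: good_def binc_def path_W bridge_def)

lemma measurable_bridge [measurable]: "0 <= t ==> (\<lambda>w. bridge (\<lambda>t. W t w) t) \<in> borel_measurable Q"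
 unfolding bridge_def by measurable

lemma measurable_resid_sq:
 assumes t: "0 <= a" "a <= be" "be <= 1"
 shows "(\<lambda>w. resid_sq (\<lambda>t. W t w) a be) \<in> borel_measurable Q"
proof (rule borel_measurable_LIMSEQ_real)
 fix k :: nat
 have u: "0 <= a + (be - a) * (real i / real k)" for i using t by simp
 have b: "0 <= be" using t by simp
 note [measurable] = measurable_W[OF u] measurable_W[OF t(1)] measurable_W[OF b]
 show "(\<lambda>w. (be - a) * ((\<Sum>i=1..k. (resid (\<lambda>t. W t w) a be (real i / real k))^2) / real k)) \<in> borel_measurable Q"
  unfolding resid_def by measurable
next
 fix w assume "w \<in> space Q"
 then show "(\<lambda>k. (be - a) * ((\<Sum>i=1..k. (resid (\<lambda>t. W t w) a be (real i / real k))^2) / real k))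
   \<longlonglongrightarrow> resid_sq (\<lambda>t. W t w) a be"
  unfolding resid_sq_def
  by (intro tendsto_mult_left riemann_tendsto continuous_on_power continuous_resid path_W t)
qed

lemma measurable_V2 [measurable]: "t \<in> {0..1} ==> (\<lambda>w. V2 (\<lambda>t. W t w) t) \<in> borel_measurable Q"
 unfolding V2_def using measurable_resid_sq[of 0 t] measurable_resid_sq[of t 1] by measurable

lemma measurable_limit_functional [measurable]: "(\<lambda>w. limit_functional (\<lambda>t. W t w)) \<in> borel_measurable Q"
proof -
 define R where "R t w = \<bar>bridge (\<lambda>t. W t w) t\<bar> / sqrt (V2 (\<lambda>t. W t w) t)" for t w
 let ?D = "{0..1} \<inter> \<rat> :: real set"
 define F where "F w = (SUP t\<in>?D. ereal (R t w))" for w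
 have "R t \<in> borel_measurable Q" if "t \<in> ?D" for t
 proof -
  have "0 <= t" "t \<in> {0..1}" using that by auto
  note [measurable] = measurable_bridge[OF this(1)] measurable_V2[OF this(2)]
  show ?thesis unfolding R_def[abs_def] by measurable
 qed
 moreover have "countable ?D" using countable_rat by auto
 ultimately have [measurable]: "F \<in> borel_measurable Q"
  unfolding F_def[abs_def] by (intro borel_measurable_SUP) auto
 \<comment> \<open>\<open>LEAST z. False\<close> is what \<open>Sup\<close> on the reals yields for
   a set without upper bounds; the supremum in \<open>ereal\<close> tells the two cases apart
   measurably.\<close>
 have "limit_functional (\<lambda>t. W t w) = (if F w = \<infinity> then LEAST z. False else real_of_ereal (F w))"
  if w: "w \<in> space Q" for w
 proof (cases "F w = \<infinity>")
  case True
  have no: "(\<forall>x\<in>(\<lambda>t. R t w) ` ?D. x <= z) = False" for z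
  proof (rule ccontr)
   assume "(\<forall>x\<in>(\<lambda>t. R t w) ` ?D. x <= z) \<noteq> False"
   then have "F w <= ereal z" unfolding F_def by (intro SUP_least) auto
   then show False using True by simp
  qed
  show ?thesis
   by (simp only: True if_True limit_functional_Rats[OF path_W[OF w]] R_def[symmetric] Sup_real_def no simp_thms)
 next
  case False
  have "ereal (R 0 w) <= F w" unfolding F_def by (rule SUP_upper) simp
  then have "\<bar>F w\<bar> \<noteq> \<infinity>" using False by auto
  then have "ereal (SUP t\<in>?D. R t w) = F w" unfolding F_def by (rule ereal_SUP)
  then have "(SUP t\<in>?D. R t w) = real_of_ereal (F w)" by (metis real_of_ereal.simps(1))
  then show ?thesis using False unfolding limit_functional_Rats[OF path_W[OF w]] R_def by simp
 qed
 then show ?thesis by (subst measurable_cong) auto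
qed

lemma good_ratio_le:
 assumes g: "good w" and t: "t \<in> {0..1}"
 shows "\<bar>bridge (\<lambda>t. W t w) t\<bar> / sqrt (V2 (\<lambda>t. W t w) t) <= limit_functional (\<lambda>t. W t w)"
proof -
 have w: "w \<in> space Q" using g by (simp add: good_def)
 note p = path_W[OF w]
 have "continuous_on {0..1} (\<lambda>t. \<bar>bridge (\<lambda>t. W t w) t\<bar> / sqrt (V2 (\<lambda>t. W t w) t))"
  using good_V2[OF g] by (intro continuous_intros bridge_continuous V2_continuous p) fastforce
 then have "bounded ((\<lambda>t. \<bar>bridge (\<lambda>t. W t w) t\<bar> / sqrt (V2 (\<lambda>t. W t w) t)) ` {0..1})"
  by (intro compact_imp_bounded compact_continuous_image) auto
 then have "bdd_above ((\<lambda>t. \<bar>bridge (\<lambda>t. W t w) t\<bar> / sqrt (V2 (\<lambda>t. W t w) t)) ` {0..1})"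
  by (rule bounded_imp_bdd_above)
 then show ?thesis unfolding limit_functional_eq[OF p] by (rule cSUP_upper[OF t])
qed

abbreviation L_dist :: "real measure" where
 "L_dist \<equiv> distr Q borel (\<lambda>w. limit_functional (\<lambda>t. W t w))"

lemma real_distribution_L: "real_distribution L_dist"
 by (rule real_distribution_distr) measurable

lemma cdf_L: "cdf L_dist x = prob {w \<in> space Q. limit_functional (\<lambda>t. W t w) <= x}"
 unfolding cdf_def by (subst measure_distr) (auto simp: vimage_def Int_def intro!: arg_cong[where f = prob])

lemma cdf_L_nonpos: "x <= 0 ==> cdf L_dist x = 0"
proof -
 assume x: "x <= 0"
 have "AE w in Q. \<not> limit_functional (\<lambda>t. W t w) <= x"
  using AE_good
 proof eventually_elim
  case (elim w)
  have "0 < \<bar>bridge (\<lambda>t. W t w) (1/2)\<bar> / sqrt (V2 (\<lambda>t. W t w) (1/2))"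
   using good_V2[OF elim, of "1/2"] good_bridge[OF elim] by simp
  then show ?case using good_ratio_le[OF elim, of "1/2"] x by simp
 qed
 then show ?thesis unfolding cdf_L by (subst prob_eq_0) auto
qed

text \<open>The infimum in the quantile is attained because a distribution function is right
  continuous. It is positive because the limit functional is at least the ratio at t = 1/2, which is
  almost surely positive.\<close>

lemma critical_value:
 assumes a: "0 < a" "a < 1"
 shows "0 < critical_value Q W a" "prob {w \<in> space Q. critical_value Q W a < limit_functional (\<lambda>t. W t w)} <= a"
proof -
 interpret L: real_distribution L_dist by (rule real_distribution_L)
 define q where "q = critical_value Q W a"
 define A where "A = {x. 1 - a <= cdf L_dist x}"
 have q: "q = Inf A" by (simp add: q_def critical_value_def quantile_def A_def)
 have pos: "0 < x" if "x \<in> A" for x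
  using that cdf_L_nonpos[of x] a by (cases "x <= 0") (auto simp: A_def)
 have "\<forall>\<^sub>F x in at_top. 1 - a < cdf L_dist x"
  by (rule order_tendstoD(1)[OF L.cdf_lim_at_top_prob]) (use a in simp)
 then obtain x0 where "1 - a < cdf L_dist x0" by (meson eventually_happens trivial_limit_at_top_linorder)
 then have "x0 \<in> A" by (simp add: A_def)
 then have ne: "A \<noteq> {}" by blast
 have bdd: "bdd_below A" using pos by (intro bdd_belowI[of _ 0]) (auto simp: less_imp_le)
 have up: "1 - a <= cdf L_dist x" if qx: "q < x" for x
 proof -
  have "Inf A < x" using qx by (simp only: q)
  then have "\<exists>s\<in>A. s < x" using cInf_less_iff[OF ne bdd] by blast
  then obtain s where s: "s \<in> A" "s < x" by blast
  then show ?thesis using L.cdf_nondecreasing[of s x] by (auto simp: A_def)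
 qed
 have qA: "1 - a <= cdf L_dist q"
 proof (rule tendsto_lowerbound)
  show "(cdf L_dist \<longlongrightarrow> cdf L_dist q) (at_right q)"
   using L.cdf_is_right_cont[of q] by (simp add: continuous_within)
  show "\<forall>\<^sub>F x in at_right q. 1 - a <= cdf L_dist x"
   using up by (intro eventually_at_rightI[of q "q + 1"]) auto
 qed simp
 then show "0 < critical_value Q W a" using pos[of q] by (simp add: A_def q_def)
 have "{w \<in> space Q. q < limit_functional (\<lambda>t. W t w)} = space Q - {w \<in> space Q. limit_functional (\<lambda>t. W t w) <= q}" by auto
 then have "prob {w \<in> space Q. q < limit_functional (\<lambda>t. W t w)} = 1 - cdf L_dist q"
  unfolding cdf_L by (simp add: prob_compl)
 then show "prob {w \<in> space Q. critical_value Q W a < limit_functional (\<lambda>t. W t w)} <= a"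
  using qA by (simp add: q_def)
qed

lemma dPsi_W_tendsto: "w \<in> space Q ==> (\<lambda>N. dPsi q N (\<lambda>i. W (real i / real N) w)) \<longlonglongrightarrow> cPsi q (\<lambda>t. W t w)"
 by (rule dPsi_tendsto) (auto simp: path_W)

lemma measurable_cPsi [measurable]: "(\<lambda>w. cPsi q (\<lambda>t. W t w)) \<in> borel_measurable Q"
 by (rule borel_measurable_LIMSEQ_real[OF dPsi_W_tendsto]) (auto intro!: measurable_dPsi)

text \<open>The maximum of \<open>psi\<close> is attained, and on good paths V2 is positive there,
  so a positive maximum yields a ratio above q.\<close>

lemma prob_cPsi_pos:
 assumes a: "0 < a" "a < 1" and q: "q = critical_value Q W a"
 shows "prob {w \<in> space Q. 0 < cPsi q (\<lambda>t. W t w)} <= a"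
proof -
 have q0: "0 <= q" using critical_value(1)[OF a] q by simp
 have "prob {w \<in> space Q. 0 < cPsi q (\<lambda>t. W t w)} <= prob {w \<in> space Q. q < limit_functional (\<lambda>t. W t w)}"
 proof (rule finite_measure_mono_AE)
  show "AE w in Q. w \<in> {w \<in> space Q. 0 < cPsi q (\<lambda>t. W t w)} \<longrightarrow> w \<in> {w \<in> space Q. q < limit_functional (\<lambda>t. W t w)}"
   using AE_good
  proof eventually_elim
   case (elim w)
   have w: "w \<in> space Q" using elim by (simp add: good_def)
   obtain t where t: "t \<in> {0..1}" "cPsi q (\<lambda>t. W t w) = psi q (\<lambda>t. W t w) t"
    using cPsi_attained(1)[OF path_W(1)[OF w] path_W(2)[OF w]] by blast
   have V: "0 < V2 (\<lambda>t. W t w) t" by (rule good_V2[OF elim t(1)])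
   show ?case
   proof (intro impI)
    assume "w \<in> {w \<in> space Q. 0 < cPsi q (\<lambda>t. W t w)}"
    then have "q^2 * V2 (\<lambda>t. W t w) t < (bridge (\<lambda>t. W t w) t)^2" using t(2) by (simp add: psi_def)
    then have "q < \<bar>bridge (\<lambda>t. W t w) t\<bar> / sqrt (V2 (\<lambda>t. W t w) t)"
     using V q0 by (subst ratio_gt_iff) auto
    then show "w \<in> {w \<in> space Q. q < limit_functional (\<lambda>t. W t w)}"
     using good_ratio_le[OF elim t(1)] w by simp
   qed
  qed
 qed measurable
 then show ?thesis using critical_value(2)[OF a] q by simp
qed

end

text \<open>Laws of paths are compared through the values at the dyadic points \<open>dy p\<close>.\<close>

definition dy :: "nat \<times> nat => real" where
 "dy p = min 1 (real (snd p) / 2 ^ fst p)"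

lemma dy_unit: "dy p \<in> {0..1}"
 by (simp add: dy_def)

text \<open>A Cameron-Martin direction with derivative the indicator of [0,s], so that the density
  of the shifted law involves W at time s only. At t = s it moves the bridge by s (1 - s) and leaves
  V2 unchanged, being affine on both pieces.\<close>

definition shift_dir :: "real => real => real" where
 "shift_dir s t = min t s"

section \<open>Cameron-Martin shifts\<close>

context brownian
begin

text \<open>Completing the square in the normal density of variance h.\<close>

lemma normal_shift:
 assumes X: "distributed Q lborel X (normal_density 0 (sqrt h))" and h: "0 < h" and [measurable]: "A \<in> sets borel"
 shows "(\<integral>\<^sup>+w. indicator A (X w + x * h) \<partial>Q) = (\<integral>\<^sup>+w. indicator A (X w) * ennreal (exp (x * X w - x^2 * h / 2)) \<partial>Q)"
proof -
 let ?f = "normal_density 0 (sqrt h)"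
 have e: "?f (u - x * h) = ?f u * exp (x * u - x^2 * h / 2)" for u
 proof -
  have "- (u - x * h - 0)\<^sup>2 / (2 * (sqrt h)^2) = - (u - 0)\<^sup>2 / (2 * (sqrt h)^2) + (x * u - x^2 * h / 2)"
   using h by (simp add: field_simps power2_eq_square)
  then show ?thesis unfolding normal_density_def by (simp only: exp_add mult.assoc)
 qed
 have "(\<integral>\<^sup>+w. indicator A (X w + x * h) \<partial>Q) = (\<integral>\<^sup>+u. ennreal (?f u) * indicator A (u + x * h) \<partial>lborel)"
  by (subst distributed_nn_integral[OF X]) auto
 also have "\<dots> = (\<integral>\<^sup>+u. ennreal (?f (x * h + 1 * u - x * h)) * indicator A (x * h + 1 * u) \<partial>lborel)"
  by (simp add: add.commute)
 also have "\<dots> = (\<integral>\<^sup>+u. ennreal (?f (u - x * h)) * indicator A u \<partial>lborel)"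
  by (subst nn_integral_real_affine[where t = "x * h" and c = 1]) auto
 also have "\<dots> = (\<integral>\<^sup>+u. ennreal (?f u) * (indicator A u * ennreal (exp (x * u - x^2 * h / 2))) \<partial>lborel)"
  by (intro nn_integral_cong) (simp only: e ennreal_mult''[OF exp_ge_zero], simp only: mult_ac)
 also have "\<dots> = (\<integral>\<^sup>+w. indicator A (X w) * ennreal (exp (x * X w - x^2 * h / 2)) \<partial>Q)"
  by (subst distributed_nn_integral[OF X]) auto
 finally show ?thesis .
qed

lemma W_eq_sum: "w \<in> space Q ==> W (real k / real K) w = (\<Sum>i<k. binc K i w)"
 unfolding binc_def by (subst sum_lessThan_telescope[of "\<lambda>i. W (real i / real K) w"]) (simp add: path_W)

text \<open>The first m of K independent normal increments are shifted by x / K each. By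
  \<open>normal_shift\<close> every shift has an exponential density, and the exponents add up to an
  expression in W at time m / K.\<close>

lemma shift_finite:
 assumes K: "1 <= K" and m: "m <= K" and B: "B \<in> sets (PiM {..<K} (\<lambda>_. borel))"
 shows "(\<integral>\<^sup>+w. indicator B (\<lambda>i\<in>{..<K}. binc K i w + (if i < m then x / real K else 0)) \<partial>Q) =
  (\<integral>\<^sup>+w. indicator B (\<lambda>i\<in>{..<K}. binc K i w) *
   ennreal (exp (x * W (real m / real K) w - x^2 * (real m / real K) / 2)) \<partial>Q)"
proof -
 let ?P = "PiM {..<K} (\<lambda>_. borel) :: (nat => real) measure"
 let ?c = "\<lambda>i. if i < m then x / real K else 0"
 let ?ro = "\<lambda>w. ennreal (exp (x * W (real m / real K) w - x^2 * (real m / real K) / 2))"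
 let ?r = "\<lambda>i b. if i < m then ennreal (exp (x * b - x^2 * (1 / real K) / 2)) else 1"
 have [measurable]: "W (real m / real K) \<in> borel_measurable Q" by (rule measurable_W) simp
 have ro: "?ro w = (\<Prod>i<K. ?r i (binc K i w))" if "w \<in> space Q" for w
 proof -
  have "x * W (real m / real K) w - x^2 * (real m / real K) / 2 = (\<Sum>i<m. x * binc K i w - x^2 * (1 / real K) / 2)"
   unfolding W_eq_sum[OF that] by (simp add: sum_subtractf sum_distrib_left)
  then have "?ro w = (\<Prod>i<m. ennreal (exp (x * binc K i w - x^2 * (1 / real K) / 2)))"
   by (simp add: exp_sum prod_ennreal)
  also have "\<dots> = (\<Prod>i<K. ?r i (binc K i w))"
   by (rule prod.mono_neutral_cong_left) (use m in auto)
  finally show ?thesis .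
 qed
 define M1 where "M1 = distr Q ?P (\<lambda>w. \<lambda>i\<in>{..<K}. binc K i w + ?c i)"
 define M2 where "M2 = distr (density Q ?ro) ?P (\<lambda>w. \<lambda>i\<in>{..<K}. binc K i w)"
 have m1: "emeasure M1 A = (\<integral>\<^sup>+w. indicator A (\<lambda>i\<in>{..<K}. binc K i w + ?c i) \<partial>Q)" if [measurable]: "A \<in> sets ?P" for A
  unfolding M1_def by (subst nn_integral_indicator[symmetric], simp, subst nn_integral_distr) auto
 have m2: "emeasure M2 A = (\<integral>\<^sup>+w. indicator A (\<lambda>i\<in>{..<K}. binc K i w) * ?ro w \<partial>Q)" if [measurable]: "A \<in> sets ?P" for A
  unfolding M2_def
  by (subst nn_integral_indicator[symmetric], simp, subst nn_integral_distr, simp, simp, subst nn_integral_density) (auto simp: mult.commute)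
 have "M1 = M2"
 proof (rule measure_eqI_PiM_finite)
  fix A :: "nat => real set" assume A: "!!i. i \<in> {..<K} ==> A i \<in> sets borel"
  have PA: "Pi\<^sub>E {..<K} A \<in> sets ?P" by (rule sets_PiM_I_finite) (use A in auto)
  have ind: "indicator (Pi\<^sub>E {..<K} A) (\<lambda>i\<in>{..<K}. f i) = (\<Prod>i<K. indicator (A i) (f i) :: ennreal)" for f :: "nat => real"
   by (auto simp: indicator_def PiE_iff prod_zero)
  have iv: "indep_vars (\<lambda>_. borel) (\<lambda>i w. g i (binc K i w)) {..<K}"
   if "!!i. i \<in> {..<K} ==> g i \<in> borel_measurable borel" for g :: "nat => real => ennreal"
   by (rule indep_vars_compose2[OF binc_indep[OF K]]) (rule that)
  have "emeasure M1 (Pi\<^sub>E {..<K} A) = (\<integral>\<^sup>+w. (\<Prod>i<K. indicator (A i) (binc K i w + ?c i)) \<partial>Q)"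
   unfolding m1[OF PA] ind ..
  also have "\<dots> = (\<Prod>i<K. \<integral>\<^sup>+w. indicator (A i) (binc K i w + ?c i) \<partial>Q)"
  proof (rule indep_vars_nn_integral[OF _ iv])
   fix i assume "i \<in> {..<K}"
   then have [measurable]: "A i \<in> sets borel" by (rule A)
   show "(\<lambda>b. indicator (A i) (b + ?c i)) \<in> borel_measurable borel" by measurable
  qed auto
  also have "\<dots> = (\<Prod>i<K. \<integral>\<^sup>+w. indicator (A i) (binc K i w) * ?r i (binc K i w) \<partial>Q)"
  proof (rule prod.cong[OF refl])
   fix i assume "i \<in> {..<K}"
   then have Ai: "A i \<in> sets borel" by (rule A)
   show "(\<integral>\<^sup>+w. indicator (A i) (binc K i w + ?c i) \<partial>Q) = (\<integral>\<^sup>+w. indicator (A i) (binc K i w) * ?r i (binc K i w) \<partial>Q)"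
    using normal_shift[OF binc_normal[OF K] _ Ai, of i x] K by simp
  qed
  also have "\<dots> = (\<integral>\<^sup>+w. (\<Prod>i<K. indicator (A i) (binc K i w) * ?r i (binc K i w)) \<partial>Q)"
  proof (rule indep_vars_nn_integral[OF _ iv, symmetric])
   fix i assume "i \<in> {..<K}"
   then have [measurable]: "A i \<in> sets borel" by (rule A)
   show "(\<lambda>b. indicator (A i) b * ?r i b) \<in> borel_measurable borel" by measurable
  qed auto
  also have "\<dots> = emeasure M2 (Pi\<^sub>E {..<K} A)"
   unfolding m2[OF PA] ind by (intro nn_integral_cong) (simp only: ro prod.distrib)
  finally show "emeasure M1 (Pi\<^sub>E {..<K} A) = emeasure M2 (Pi\<^sub>E {..<K} A)" .
 next
  show "range (\<lambda>_::nat. space ?P) \<subseteq> prod_algebra {..<K} (\<lambda>_. borel)"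
   using prod_algebraI_finite[of "{..<K}" "\<lambda>_. UNIV" "\<lambda>_. borel"] by (auto simp: space_PiM)
  have "prob_space M1" unfolding M1_def by (rule prob_space_distr) measurable
  then show "emeasure M1 (space ?P) \<noteq> \<infinity>" for i :: nat
   using prob_space.emeasure_space_1[of M1] by (simp add: M1_def)
 qed (auto simp: M1_def M2_def)
 then show ?thesis using m1[OF B] m2[OF B] by simp
qed

definition Zc :: "(real => real) => nat \<times> nat => real" where
 "Zc w p = w (dy p)"

abbreviation PZ :: "(nat \<times> nat => real) measure" where
 "PZ \<equiv> PiM UNIV (\<lambda>_. borel)"

lemma measurable_Zc [measurable]: "(\<lambda>w. Zc (\<lambda>t. W t w)) \<in> measurable Q PZ"
 unfolding Zc_def by (rule measurable_PiM_single') (use dy_unit in \<open>auto intro!: measurable_W\<close>)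

lemma measurable_shift [measurable]: "(\<lambda>z p. z p + x * g p) \<in> measurable PZ PZ"
 by (rule measurable_PiM_single') auto

text \<open>Finitely many dyadic points together with s lie on a common grid of mesh 2^(-N). There
  the shift adds x / K to the increments before s, which is \<open>shift_finite\<close>; cylinder
  sets determine the law.\<close>

lemma Cameron_Martin:
 assumes s: "s = real s0 / 2 ^ m" "s0 <= 2 ^ m" and B: "B \<in> sets PZ"
 shows "(\<integral>\<^sup>+w. indicator B (\<lambda>p. Zc (\<lambda>t. W t w) p + x * Zc (shift_dir s) p) \<partial>Q) =
  (\<integral>\<^sup>+w. indicator B (Zc (\<lambda>t. W t w)) * ennreal (exp (x * W s w - x^2 * s / 2)) \<partial>Q)"
proof -
 let ?r = "\<lambda>w. ennreal (exp (x * W s w - x^2 * s / 2))"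
 let ?Z = "\<lambda>w. Zc (\<lambda>t. W t w)" and ?g = "Zc (shift_dir s)"
 have s0: "0 <= s" using s by simp
 then have [measurable]: "W s \<in> borel_measurable Q" by (rule measurable_W)
 have [measurable]: "(\<lambda>w p. ?Z w p + x * ?g p) \<in> measurable Q PZ"
  by (rule measurable_compose[OF measurable_Zc measurable_shift])
 define M1 where "M1 = distr Q PZ (\<lambda>w p. ?Z w p + x * ?g p)"
 define M2 where "M2 = distr (density Q ?r) PZ ?Z"
 have m1: "emeasure M1 A = (\<integral>\<^sup>+w. indicator A (\<lambda>p. ?Z w p + x * ?g p) \<partial>Q)" if [measurable]: "A \<in> sets PZ" for A
  unfolding M1_def by (subst nn_integral_indicator[symmetric], simp, subst nn_integral_distr) auto
 have m2: "emeasure M2 A = (\<integral>\<^sup>+w. indicator A (?Z w) * ?r w \<partial>Q)" if [measurable]: "A \<in> sets PZ" for A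
  unfolding M2_def
  by (subst nn_integral_indicator[symmetric], simp, subst nn_integral_distr, simp, simp, subst nn_integral_density) (auto simp: mult.commute)
 have "M1 = M2"
 proof (rule measure_eqI_PiM_infinite)
  fix A :: "nat \<times> nat => real set" and J :: "(nat \<times> nat) set"
  assume J: "finite J" and A: "!!i. i \<in> J ==> A i \<in> sets borel"
  let ?E = "prod_emb UNIV (\<lambda>_. borel) J (Pi\<^sub>E J A)"
  have E: "?E \<in> sets PZ" by (rule sets_PiM_I) (use J A in auto)
  define N where "N = Max (insert m (fst ` J))"
  have mN: "m <= N" and JN: "!!p. p \<in> J ==> fst p <= N" using J by (auto simp: N_def)
  define K :: nat where "K = 2 ^ N"
  have K: "1 <= K" by (simp add: K_def)
  define k where "k p = min K (snd p * 2 ^ (N - fst p))" for p :: "nat \<times> nat"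
  have kK: "k p <= K" for p by (simp add: k_def)
  have k: "dy p = real (k p) / real K" if "p \<in> J" for p
  proof -
   have pw: "(2::real) ^ N = 2 ^ (N - fst p) * 2 ^ fst p" using JN[OF that] by (simp flip: power_add)
   have "real (k p) / real K = min 1 (real (snd p) * 2 ^ (N - fst p) / 2 ^ N)"
    unfolding k_def K_def by (simp add: of_nat_min min_divide_distrib_right)
   then show ?thesis unfolding dy_def pw by simp
  qed
  define m' where "m' = s0 * 2 ^ (N - m)"
  have pw: "(2::nat) ^ N = 2 ^ m * 2 ^ (N - m)" using mN by (simp flip: power_add)
  have m': "m' <= K" using s(2) unfolding m'_def K_def pw by (intro mult_right_mono) auto
  have sK: "s = real m' / real K" unfolding s m'_def K_def pw by simp
  let ?P = "PiM {..<K} (\<lambda>_. borel) :: (nat => real) measure"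
  define B' where "B' = {v \<in> space ?P. \<forall>p\<in>J. (\<Sum>i<k p. v i) \<in> A p}"
  have B': "B' \<in> sets ?P"
   unfolding B'_def
  proof (rule sets.sets_Collect_finite_All[OF _ J])
   fix p assume p: "p \<in> J"
   have [measurable]: "A p \<in> sets borel" by (rule A[OF p])
   have "(\<lambda>v. \<Sum>i<k p. v i) \<in> borel_measurable ?P"
    by (intro borel_measurable_sum measurable_component_singleton) (use kK[of p] in auto)
   then show "{v \<in> space ?P. (\<Sum>i<k p. v i) \<in> A p} \<in> sets ?P" by measurable
  qed
  have eq: "indicator ?E z = (indicator B' (\<lambda>i\<in>{..<K}. u i) :: ennreal)"
   if z: "!!p. p \<in> J ==> z p = (\<Sum>i<k p. u i)" for z u
  proof -
   have "(\<Sum>i<k p. (\<lambda>i\<in>{..<K}. u i) i) = (\<Sum>i<k p. u i)" for p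
    by (rule sum.cong) (use kK[of p] in auto)
   then have "(\<lambda>i\<in>{..<K}. u i) \<in> B' \<longleftrightarrow> (\<forall>p\<in>J. z p \<in> A p)" using z by (simp add: B'_def space_PiM)
   moreover have "z \<in> ?E \<longleftrightarrow> (\<forall>p\<in>J. z p \<in> A p)" by (auto simp: prod_emb_iff)
   ultimately show ?thesis by (simp add: indicator_def)
  qed
  have "emeasure M1 ?E = (\<integral>\<^sup>+w. indicator B' (\<lambda>i\<in>{..<K}. binc K i w + (if i < m' then x / real K else 0)) \<partial>Q)"
   unfolding m1[OF E]
  proof (intro nn_integral_cong eq)
   fix w p assume w: "w \<in> space Q" and p: "p \<in> J"
   have "(\<Sum>i<k p. if i < m' then x / real K else 0) = (\<Sum>i<min (k p) m'. x / real K)"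
    by (rule sum.mono_neutral_cong_right) auto
   also have "\<dots> = x * (real (min (k p) m') / real K)" by simp
   also have "\<dots> = x * min (real (k p) / real K) (real m' / real K)"
    by (simp add: min_divide_distrib_right of_nat_min)
   finally show "?Z w p + x * ?g p = (\<Sum>i<k p. binc K i w + (if i < m' then x / real K else 0))"
    unfolding Zc_def k[OF p] W_eq_sum[OF w] shift_dir_def sK by (simp add: sum.distrib)
  qed
  also have "\<dots> = (\<integral>\<^sup>+w. indicator B' (\<lambda>i\<in>{..<K}. binc K i w) * ?r w \<partial>Q)"
   unfolding sK by (rule shift_finite[OF K m' B'])
  also have "\<dots> = emeasure M2 ?E"
   unfolding m2[OF E]
  proof (intro nn_integral_cong arg_cong2[where f = "(*)"] refl eq[symmetric])
   fix w p assume w: "w \<in> space Q" and p: "p \<in> J"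
   show "?Z w p = (\<Sum>i<k p. binc K i w)" unfolding Zc_def k[OF p] W_eq_sum[OF w] ..
  qed
  finally show "emeasure M1 ?E = emeasure M2 ?E" .
 next
  have "prob_space M1" unfolding M1_def by (rule prob_space_distr) measurable
  then show "finite_measure M1" by (rule prob_space.finite_measure)
 qed (auto simp: M1_def M2_def)
 then show ?thesis using m1[OF B] m2[OF B] by simp
qed

end

section \<open>Absence of an atom at zero\<close>

lemma separated_countable:
 fixes X :: "real set"
 assumes d: "0 < d" and sep: "!!x y. x \<in> X ==> y \<in> X ==> x < y ==> d <= y - x"
 shows "countable X"
proof -
 have "inj_on (\<lambda>x. \<lfloor>x / d\<rfloor>) X"
 proof (rule inj_onI, rule ccontr)
  fix x y assume xy: "x \<in> X" "y \<in> X" "\<lfloor>x / d\<rfloor> = \<lfloor>y / d\<rfloor>" "x \<noteq> y"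
  have aux: False if "u \<in> X" "v \<in> X" "\<lfloor>u / d\<rfloor> = \<lfloor>v / d\<rfloor>" "u < v" for u v
  proof -
   have "1 <= (v - u) / d" using sep[OF that(1,2,4)] d by simp
   then have "u / d + 1 <= v / d" by (simp add: diff_divide_distrib)
   then show False using that(3) by linarith
  qed
  show False using aux[OF xy(1,2,3)] aux[OF xy(2,1) xy(3)[symmetric]] xy(4) by linarith
 qed
 then show ?thesis by (rule countable_image_inj_on[rotated]) auto
qed

text \<open>\<open>cPsi\<close> as a measurable function on a countable product. For continuous
  paths started at 0 the limit along dyadic grids exists, and only these paths are inserted.\<close>

definition cPsiZ :: "real => (nat \<times> nat => real) => real" where
 "cPsiZ q z = lim (\<lambda>N. dPsi q (2 ^ N) (\<lambda>k. z (N, k)))"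

lemma measurable_cPsiZ [measurable]: "cPsiZ q \<in> borel_measurable (PiM UNIV (\<lambda>_. borel))"
 unfolding cPsiZ_def[abs_def] by (intro borel_measurable_lim_metric measurable_dPsi) simp

lemma cPsiZ_path:
 assumes w: "continuous_on {0..1} w" "w 0 = 0"
 shows "cPsiZ q (\<lambda>p. w (dy p)) = cPsi q w"
 unfolding cPsiZ_def
proof (rule limI)
 have "filterlim (\<lambda>N. 2 ^ N :: nat) at_top sequentially"
  by (rule filterlim_at_top_mono[OF filterlim_ident]) (auto intro!: always_eventually less_imp_le[OF less_exp])
 from filterlim_compose[OF dPsi_tendsto[OF w] this]
 have "(\<lambda>N. dPsi q (2 ^ N) (\<lambda>i. w (real i / real (2 ^ N)))) \<longlonglongrightarrow> cPsi q w" .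
 moreover have "dPsi q (2 ^ N) (\<lambda>i. w (real i / real (2 ^ N))) = dPsi q (2 ^ N) (\<lambda>k. w (dy (N, k)))" for N
 proof (rule dPsi_cong)
  fix i assume "i <= (2::nat) ^ N"
  then have "real i <= 2 ^ N" by (metis of_nat_le_iff of_nat_numeral of_nat_power)
  then have "dy (N, i) = real i / real (2 ^ N)" by (simp add: dy_def min_absorb2)
  then show "w (real i / real (2 ^ N)) = w (dy (N, i))" by simp
 qed
 ultimately show "(\<lambda>N. dPsi q (2 ^ N) (\<lambda>k. w (dy (N, k)))) \<longlonglongrightarrow> cPsi q w" by simp
qed

lemma shift_dir_path: "0 <= s ==> continuous_on {0..1} (shift_dir s) \<and> shift_dir s 0 = 0"
 unfolding shift_dir_def[abs_def] by (auto intro!: continuous_intros)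

lemma shifted_path:
 assumes w: "continuous_on {0..1} w" "w 0 = 0" and s: "0 <= s"
 shows "continuous_on {0..1} (\<lambda>t. w t + x * shift_dir s t)" "w 0 + x * shift_dir s 0 = 0"
 using shift_dir_path[OF s] w by (auto intro!: continuous_intros)

lemma cPsi_line_continuous:
 assumes w: "continuous_on {0..1} w" "w 0 = 0" and s: "s \<in> {0..1}"
 shows "isCont (\<lambda>x. cPsi q (\<lambda>t. w t + x * shift_dir s t)) x0"
proof -
 have s0: "0 <= s" using s by simp
 obtain A where A: "unit_path A w" using unit_path_bound[OF w] by blast
 have g: "\<bar>shift_dir s t\<bar> <= 1" if "t \<in> {0..1}" for t using that s by (auto simp: shift_dir_def min_def)
 have up: "unit_path (A + (\<bar>x0\<bar> + 1)) (\<lambda>t. w t + x * shift_dir s t)" if x: "\<bar>x - x0\<bar> <= 1" for x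
  unfolding unit_path_def
 proof (intro conjI ballI)
  fix t :: real assume t: "t \<in> {0..1}"
  have "\<bar>x * shift_dir s t\<bar> <= (\<bar>x0\<bar> + 1) * 1" unfolding abs_mult using g[OF t] x by (intro mult_mono) auto
  then show "\<bar>w t + x * shift_dir s t\<bar> <= A + (\<bar>x0\<bar> + 1)"
   by (intro order_trans[OF abs_triangle_ineq] add_mono unit_pathD(3)[OF A t]) simp
 qed (use shifted_path[OF w s0] in auto)
 let ?C = "psi_mod q (A + (\<bar>x0\<bar> + 1))"
 have "((\<lambda>x. cPsi q (\<lambda>t. w t + x * shift_dir s t) - cPsi q (\<lambda>t. w t + x0 * shift_dir s t)) \<longlongrightarrow> 0) (at x0)"
 proof (rule Lim_null_comparison)
  show "\<forall>\<^sub>F x in at x0. norm (cPsi q (\<lambda>t. w t + x * shift_dir s t) - cPsi q (\<lambda>t. w t + x0 * shift_dir s t)) <= ?C * \<bar>x - x0\<bar>"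
   unfolding eventually_at
  proof (intro exI[of _ 1] conjI ballI impI)
   fix x assume "x \<noteq> x0 \<and> dist x x0 < 1"
   then have x: "\<bar>x - x0\<bar> <= 1" by (simp add: dist_real_def)
   show "norm (cPsi q (\<lambda>t. w t + x * shift_dir s t) - cPsi q (\<lambda>t. w t + x0 * shift_dir s t)) <= ?C * \<bar>x - x0\<bar>"
    unfolding real_norm_def
   proof (rule cPsi_diff[OF up[OF x] up])
    fix t :: real assume t: "t \<in> {0..1}"
    have "(w t + x * shift_dir s t) - (w t + x0 * shift_dir s t) = (x - x0) * shift_dir s t" by (simp add: algebra_simps)
    then have "\<bar>(w t + x * shift_dir s t) - (w t + x0 * shift_dir s t)\<bar> = \<bar>x - x0\<bar> * \<bar>shift_dir s t\<bar>" by (simp add: abs_mult)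
    also have "\<dots> <= \<bar>x - x0\<bar> * 1" using g[OF t] by (intro mult_left_mono) auto
    finally show "\<bar>(w t + x * shift_dir s t) - (w t + x0 * shift_dir s t)\<bar> <= \<bar>x - x0\<bar>" by simp
   qed simp
  qed simp
  have "((\<lambda>x. ?C * \<bar>x - x0\<bar>) \<longlongrightarrow> ?C * \<bar>x0 - x0\<bar>) (at x0)" by (intro tendsto_intros)
  then show "((\<lambda>x. ?C * \<bar>x - x0\<bar>) \<longlongrightarrow> 0) (at x0)" by simp
 qed
 then show ?thesis unfolding isCont_def by (rule LIM_zero_cancel)
qed

text \<open>If f(x) = 0 and f(x + y) is at least y / n for y below 1 / n, then no zero follows
  within distance 1 / n. The condition is imposed at rational y so that it is a countable one and
  yields measurable sets; continuity of f supplies the other y.\<close>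

lemma separated_zeros:
 fixes f :: "real => real"
 assumes f: "!!x. isCont f x" and n: "0 < n"
 shows "countable {x. f x = 0 \<and> (\<forall>y\<in>\<rat>. 0 < y \<and> y < 1 / real n \<longrightarrow> y / real n <= f (x + y))}"
  (is "countable ?X")
proof (rule separated_countable)
 show "0 < 1 / real n" using n by simp
 fix x x' assume x: "x \<in> ?X" and x': "x' \<in> ?X" and lt: "x < x'"
 show "1 / real n <= x' - x"
 proof (rule ccontr)
  assume "\<not> 1 / real n <= x' - x"
  then have d: "x' - x < 1 / real n" by simp
  have "\<exists>y. y \<in> \<rat> \<and> 0 < y \<and> y < 1 / real n \<and> \<bar>y - (x' - x)\<bar> < e \<and> y \<ge> x' - x" if e: "0 < e" for e
  proof -
   have "x' - x < min (x' - x + e) (1 / real n)" using d e by simp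
   from Rats_dense_in_real[OF this] obtain y where "y \<in> \<rat>" "x' - x < y" "y < min (x' - x + e) (1 / real n)" by blast
   then show ?thesis using lt by (intro exI[of _ y]) auto
  qed
  then have "\<exists>y. \<forall>k::nat. y k \<in> \<rat> \<and> 0 < y k \<and> y k < 1 / real n \<and> \<bar>y k - (x' - x)\<bar> < 1 / real (Suc k) \<and> y k \<ge> x' - x"
   by (intro choice allI) simp
  then obtain y where y: "!!k::nat. y k \<in> \<rat>" "!!k. 0 < y k" "!!k. y k < 1 / real n"
   "!!k. \<bar>y k - (x' - x)\<bar> < 1 / real (Suc k)" "!!k. x' - x <= y k" by blast
  have "(\<lambda>k. y k - (x' - x)) \<longlonglongrightarrow> 0"
   by (rule Lim_null_comparison[OF _ LIMSEQ_Suc[OF lim_1_over_n]]) (use y(4) in \<open>auto intro!: always_eventually less_imp_le\<close>)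
  then have "(\<lambda>k. y k - (x' - x) + x') \<longlonglongrightarrow> 0 + x'" by (intro tendsto_intros)
  then have "(\<lambda>k. x + y k) \<longlonglongrightarrow> x'" by (simp add: algebra_simps)
  then have "(\<lambda>k. f (x + y k)) \<longlonglongrightarrow> f x'" by (rule isCont_tendsto_compose[OF f])
  then have "(x' - x) / real n <= f x'"
  proof (rule LIMSEQ_le_const, intro exI allI impI)
   fix k
   have "(x' - x) / real n <= y k / real n" using y(5) by (rule divide_right_mono) simp
   also have "\<dots> <= f (x + y k)" using x y(1,2,3) by blast
   finally show "(x' - x) / real n <= f (x + y k)" .
  qed
  moreover have "0 < (x' - x) / real n" using lt n by simp
  ultimately show False using x' by simp
 qed
qed

text \<open>At a maximiser t the bridge D satisfies D^2 = q^2 V2 > 0, so t is neither 0 nor 1. A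
  shift by y c min(u, t), with c the sign of D, raises \<open>psi\<close> at t by 2 y r plus a
  square, where r = |D| t (1 - t). To have countably many directions, t is replaced by a dyadic s
  close to it, which costs at most y r.\<close>

lemma zero_max_growth:
 assumes w: "continuous_on {0..1} w" "w 0 = 0" and V: "!!t. t \<in> {0..1} ==> 0 < V2 w t" and q: "0 < q" and z: "cPsi q w = 0"
 shows "\<exists>c\<in>{-1, 1}. \<exists>m s0 n. s0 <= (2::nat) ^ m \<and> 0 < (n::nat) \<and>
  (\<forall>y. 0 < y \<and> y < 1 / real n \<longrightarrow> y / real n <= cPsi q (\<lambda>t. w t + y * c * shift_dir (real s0 / 2 ^ m) t))"
proof -
 obtain t where t: "t \<in> {0..1}" "psi q w t = 0" using cPsi_attained(1)[OF w, of q] z by auto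
 define D where "D = bridge w t"
 have "0 < D^2" using t V[OF t(1)] q by (simp add: psi_def D_def)
 then have D: "D \<noteq> 0" by auto
 have t01: "0 < t" "t < 1"
  using D t(1) w(2) by (auto simp: D_def bridge_def less_le)
 define c where "c = (if 0 < D then 1 else -1 :: real)"
 have c: "c \<in> {-1, 1}" "c * D = \<bar>D\<bar>" "\<bar>c\<bar> = 1" using D by (auto simp: c_def)
 obtain A where A: "unit_path A w" using unit_path_bound[OF w] by blast
 define C where "C = psi_mod q (A + 1) + 1"
 have A0: "0 <= A" by (rule unit_pathD(4)[OF A])
 have C: "0 < C" "psi_mod q (A + 1) <= C" using psi_mod_nonneg[of "A + 1" q] A0 by (auto simp: C_def)
 define r where "r = \<bar>D\<bar> * (t * (1 - t))"
 have r: "0 < r" using D t01 by (simp add: r_def)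
 have "(\<lambda>m. (1 / 2) ^ m :: real) \<longlonglongrightarrow> 0" by (rule LIMSEQ_power_zero) simp
 then have "\<forall>\<^sub>F m in sequentially. (1 / 2) ^ m < r / C" using r C by (intro order_tendstoD(2)) auto
 \<comment> \<open>The grid is so fine that the Lipschitz constant C of \<open>psi\<close> turns |s
   - t| into an error below r.\<close>
 then obtain m where m: "(1 / 2 :: real) ^ m < r / C" by (auto simp: eventually_sequentially)
 define s0 where "s0 = nat \<lfloor>2 ^ m * t\<rfloor>"
 define s where "s = real s0 / 2 ^ m"
 have s0: "real s0 <= 2 ^ m * t" "2 ^ m * t < real s0 + 1" using t01 by (auto simp: s0_def)
 have "2 ^ m * t <= 2 ^ m * (1::real)" using t01 by (intro mult_left_mono) auto
 then have "real s0 <= 2 ^ m * 1" using s0 by linarith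
 then have "real s0 <= real (2 ^ m)" by (simp only: of_nat_power of_nat_numeral mult_1_right)
 then have s0m: "s0 <= 2 ^ m" by (simp only: of_nat_le_iff)
 have st: "\<bar>s - t\<bar> <= (1 / 2) ^ m"
 proof -
  have "s - t = (real s0 - 2 ^ m * t) / 2 ^ m" by (simp add: s_def diff_divide_distrib)
  then have "\<bar>s - t\<bar> = \<bar>real s0 - 2 ^ m * t\<bar> / 2 ^ m" by (simp add: abs_divide)
  also have "\<dots> <= 1 / 2 ^ m" using s0 by (intro divide_right_mono) auto
  finally show ?thesis by (simp add: power_divide)
 qed
 have s: "s \<in> {0..1}" using s0m by (simp add: s_def)
 obtain n0 :: nat where n0: "1 / r < n0" using reals_Archimedean2 by blast
 define n where "n = max 1 n0"
 have n: "0 < n" "1 / real n <= r"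
 proof -
  have "1 / r < real n" using n0 by (simp add: n_def)
  then show "1 / real n <= r" using r by (simp add: n_def field_simps)
 qed (simp add: n_def)
 have grow: "y / real n <= cPsi q (\<lambda>u. w u + y * c * shift_dir s u)" if y: "0 < y" "y < 1 / real n" for y
 proof -
  have "1 / real n <= 1" using n(1) by simp
  then have y1: "y <= 1" using y by simp
  have up: "unit_path (A + 1) (\<lambda>u. w u + y * c * shift_dir s' u)" if s': "s' \<in> {0..1}" for s'
   unfolding unit_path_def
  proof (intro conjI ballI)
   fix u :: real assume u: "u \<in> {0..1}"
   have "\<bar>shift_dir s' u\<bar> <= 1" using u s' by (auto simp: shift_dir_def min_def)
   then have "\<bar>y * c * shift_dir s' u\<bar> <= 1 * 1 * 1" unfolding abs_mult using y y1 c(3) by (intro mult_mono) auto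
   then show "\<bar>w u + y * c * shift_dir s' u\<bar> <= A + 1" using unit_pathD(3)[OF A u] by linarith
  qed (use shifted_path[OF w, of s' "y * c"] s' in auto)
  have close: "\<bar>psi q (\<lambda>u. w u + y * c * shift_dir s u) t - psi q (\<lambda>u. w u + y * c * shift_dir t u) t\<bar>
    <= psi_mod q (A + 1) * (y * \<bar>s - t\<bar> + \<bar>t - t\<bar>)"
  proof (rule psi_diff[OF up[OF s] up[OF t(1)] t(1) t(1)])
   fix u u' :: real assume "u \<in> {0..1}" "\<bar>u - u'\<bar> <= \<bar>t - t\<bar>"
   then have "u' = u" by simp
   have "\<bar>shift_dir s u - shift_dir t u\<bar> <= \<bar>s - t\<bar>" by (auto simp: shift_dir_def min_def)
   then have "y * \<bar>c\<bar> * \<bar>shift_dir s u - shift_dir t u\<bar> <= y * 1 * \<bar>s - t\<bar>" using y c(3) by (intro mult_mono) auto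
   moreover have "w u + y * c * shift_dir s u - (w u' + y * c * shift_dir t u') = y * c * (shift_dir s u - shift_dir t u)"
    unfolding \<open>u' = u\<close> by (simp add: algebra_simps)
   ultimately show "\<bar>w u + y * c * shift_dir s u - (w u' + y * c * shift_dir t u')\<bar> <= y * \<bar>s - t\<bar>"
    using y by (simp add: abs_mult)
  qed
  have exact: "psi q (\<lambda>u. w u + y * c * shift_dir t u) t = 2 * (y * r) + (y * (t * (1 - t)))^2"
  proof -
   have "resid (\<lambda>u. w u + y * c * shift_dir t u) 0 t v = resid w 0 t v" if "v \<in> {0..1}" for v
   proof -
    have "t * v <= t * 1" using that t01 by (intro mult_left_mono) auto
    then have "shift_dir t (0 + (t - 0) * v) = t * v" "shift_dir t 0 = 0" "shift_dir t t = t"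
     using t01 by (auto simp: shift_dir_def min_def)
    then show ?thesis unfolding resid_def by (simp add: algebra_simps)
   qed
   then have R1: "resid_sq (\<lambda>u. w u + y * c * shift_dir t u) 0 t = resid_sq w 0 t"
    unfolding resid_sq_def by (intro arg_cong2[where f = "(*)"] refl integral_cong) simp
   have "resid (\<lambda>u. w u + y * c * shift_dir t u) t 1 v = resid w t 1 v" if "v \<in> {0..1}" for v
   proof -
    have v: "0 <= (1 - t) * v" using that t01 by simp
    have "shift_dir t (t + (1 - t) * v) = t" "shift_dir t t = t" "shift_dir t 1 = t"
     using v t01 by (auto simp: shift_dir_def min_def)
    then show ?thesis unfolding resid_def by (simp add: algebra_simps)
   qed
   then have R2: "resid_sq (\<lambda>u. w u + y * c * shift_dir t u) t 1 = resid_sq w t 1"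
    unfolding resid_sq_def by (intro arg_cong2[where f = "(*)"] refl integral_cong) simp
   have b: "bridge (\<lambda>u. w u + y * c * shift_dir t u) t = D + y * c * (t * (1 - t))"
    using t01 by (simp add: bridge_def D_def shift_dir_def min_def algebra_simps)
   have "(D + y * c * (t * (1 - t)))^2 = D^2 + 2 * y * ((c * D) * (t * (1 - t))) + (c * c) * (y * (t * (1 - t)))^2"
    by (simp add: power2_eq_square algebra_simps)
   moreover have "c * c = 1" using c(1) by auto
   ultimately have "psi q (\<lambda>u. w u + y * c * shift_dir t u) t = (D^2 - q^2 * V2 w t) + 2 * y * r + (y * (t * (1 - t)))^2"
    unfolding psi_def b V2_def R1 R2 c(2) r_def by simp
   then show ?thesis using t(2) by (simp add: psi_def D_def)
  qed
  have "psi_mod q (A + 1) * (y * \<bar>s - t\<bar>) <= C * (y * (r / C))"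
   using C y st m psi_mod_nonneg[of "A + 1" q] A0 by (intro mult_mono) auto
  also have "\<dots> = y * r" using C by simp
  finally have "y * r <= psi q (\<lambda>u. w u + y * c * shift_dir s u) t"
   using close zero_le_power2[of "y * (t * (1 - t))"] unfolding exact diff_self abs_zero add_0_right by linarith
  also have "\<dots> <= cPsi q (\<lambda>u. w u + y * c * shift_dir s u)"
   using unit_path_continuous[OF up[OF s]] t(1) by (intro cPsi_attained(2)) auto
  finally have "y * r <= cPsi q (\<lambda>u. w u + y * c * shift_dir s u)" .
  moreover have "y * (1 / real n) <= y * r" using n(2) y by (intro mult_left_mono) auto
  ultimately show ?thesis by simp
 qed
 show ?thesis
 proof (intro bexI[of _ c] exI conjI allI impI)
  show "s0 <= 2 ^ m" by (rule s0m)
  show "0 < n" by (rule n(1))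
  fix y assume "0 < y \<and> y < 1 / real n"
  then show "y / real n <= cPsi q (\<lambda>t. w t + y * c * shift_dir (real s0 / 2 ^ m) t)"
   using grow unfolding s_def by blast
 qed (rule c(1))
qed

context brownian
begin

text \<open>Fubini on \<open>Q \<Otimes>\<^sub>M lborel\<close> makes almost every shift of \<open>B\<close> null, and by the Cameron--Martin formula all
 shifts have the same null sets.\<close>

lemma null_of_countable_sections:
 assumes s: "s = real s0 / 2 ^ m" "s0 <= 2 ^ m" and B: "B \<in> sets PZ"
  and cnt: "!!w. w \<in> space Q ==> countable {x. (\<lambda>p. Zc (\<lambda>t. W t w) p + x * Zc (shift_dir s) p) \<in> B}"
 shows "AE w in Q. Zc (\<lambda>t. W t w) \<notin> B"
proof -
 interpret P: pair_sigma_finite Q lborel ..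
 let ?g = "Zc (shift_dir s)"
 let ?F = "\<lambda>(w, x). \<lambda>p. Zc (\<lambda>t. W t w) p + x * ?g p"
 have [measurable]: "?F \<in> measurable (Q \<Otimes>\<^sub>M lborel) PZ"
  unfolding split_beta
 proof (rule measurable_PiM_single')
  fix p
  have [measurable]: "(\<lambda>w. Zc (\<lambda>t. W t w) p) \<in> borel_measurable Q"
   unfolding Zc_def using dy_unit[of p] by (intro measurable_W) simp
  show "(\<lambda>z. Zc (\<lambda>t. W t (fst z)) p + snd z * ?g p) \<in> borel_measurable (Q \<Otimes>\<^sub>M lborel)" by measurable
 qed simp
 note [measurable] = B
 have "(\<lambda>z. indicator B (?F z) :: ennreal) \<in> borel_measurable (Q \<Otimes>\<^sub>M lborel)" by measurable
 then have m: "(\<lambda>(w, x). indicator B (?F (w, x)) :: ennreal) \<in> borel_measurable (Q \<Otimes>\<^sub>M lborel)" by (simp add: split_beta')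
 have "(\<integral>\<^sup>+w. \<integral>\<^sup>+x. indicator B (?F (w, x)) \<partial>lborel \<partial>Q) = 0"
 proof -
  have "(\<integral>\<^sup>+x. indicator B (?F (w, x)) \<partial>lborel) = 0" if w: "w \<in> space Q" for w
  proof -
   have "{x. ?F (w, x) \<in> B} \<in> null_sets lborel"
    using countable_imp_null_set_lborel[OF cnt[OF w]] by simp
   then have "AE x in lborel. x \<notin> {x. ?F (w, x) \<in> B}" by (rule AE_not_in)
   then have "AE x in lborel. indicator B (?F (w, x)) = (0::ennreal)" by eventually_elim (simp add: indicator_def)
   then have "(\<integral>\<^sup>+x. indicator B (?F (w, x)) \<partial>lborel) = (\<integral>\<^sup>+x. 0 \<partial>(lborel :: real measure))" by (rule nn_integral_cong_AE)
   then show ?thesis by simp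
  qed
  then have "(\<integral>\<^sup>+w. \<integral>\<^sup>+x. indicator B (?F (w, x)) \<partial>lborel \<partial>Q) = (\<integral>\<^sup>+w. 0 \<partial>Q)" by (intro nn_integral_cong)
  then show ?thesis by simp
 qed
 then have "(\<integral>\<^sup>+x. \<integral>\<^sup>+w. indicator B (?F (w, x)) \<partial>Q \<partial>lborel) = 0"
  using P.Fubini'[OF m] by simp
 then have "AE x in lborel. (\<integral>\<^sup>+w. indicator B (?F (w, x)) \<partial>Q) = 0"
  by (subst (asm) nn_integral_0_iff_AE) measurable
 \<comment> \<open>Almost every x gives a null shift, and a single such x is enough.\<close>
 moreover have "ae_filter (lborel :: real measure) \<noteq> bot" by (simp add: ae_filter_eq_bot_iff)
 ultimately obtain x where x: "(\<integral>\<^sup>+w. indicator B (?F (w, x)) \<partial>Q) = 0"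
  using eventually_happens' by blast
 have [measurable]: "W s \<in> borel_measurable Q" using s by (intro measurable_W) simp
 have "(\<integral>\<^sup>+w. indicator B (Zc (\<lambda>t. W t w)) * ennreal (exp (x * W s w - x^2 * s / 2)) \<partial>Q) = 0"
  using x Cameron_Martin[OF s B, of x] by simp
 then have "AE w in Q. indicator B (Zc (\<lambda>t. W t w)) * ennreal (exp (x * W s w - x^2 * s / 2)) = 0"
  by (subst (asm) nn_integral_0_iff_AE) measurable
 then show ?thesis
  by eventually_elim (auto simp: indicator_def split: if_splits)
qed

text \<open>By \<open>zero_max_growth\<close> a good path with maximum 0 lies in one of the
  countably many sets \<open>B c m s0 n\<close>. A line in direction \<open>shift_dir\<close> meets
  such a set in zeros at mutual distance at least 1 / n, so
  \<open>null_of_countable_sections\<close> applies.\<close>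

theorem cPsi_no_atom:
 assumes q: "0 < q"
 shows "AE v in Q. cPsi q (\<lambda>t. W t v) \<noteq> 0"
proof -
 define B where "B c m s0 n = {z \<in> space PZ. cPsiZ q z = 0 \<and>
   (\<forall>y\<in>\<rat>. 0 < y \<and> y < 1 / real n \<longrightarrow> y / real n <= cPsiZ q (\<lambda>p. z p + y * c * Zc (shift_dir (real s0 / 2 ^ m)) p))}"
  for c :: real and m s0 n :: nat
 have null: "AE v in Q. Zc (\<lambda>t. W t v) \<notin> B c m s0 n" if c: "c \<in> {-1, 1}" and s0: "s0 <= 2 ^ m" and n: "0 < n" for c m s0 n
 proof (rule null_of_countable_sections[OF refl s0])
  let ?s = "real s0 / 2 ^ m"
  have "real s0 <= 2 ^ m" using s0 by (metis of_nat_le_iff of_nat_numeral of_nat_power)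
  then have s: "?s \<in> {0..1}" by simp
  have "{z \<in> space PZ. y / real n <= cPsiZ q (\<lambda>p. z p + y * c * Zc (shift_dir ?s) p)} \<in> sets PZ" for y
  proof -
   have [measurable]: "(\<lambda>z. cPsiZ q (\<lambda>p. z p + (y * c) * Zc (shift_dir ?s) p)) \<in> borel_measurable PZ"
    by (rule measurable_compose[OF measurable_shift measurable_cPsiZ])
   show ?thesis by measurable
  qed
  then have "{z \<in> space PZ. \<forall>y\<in>\<rat>. 0 < y \<and> y < 1 / real n \<longrightarrow> y / real n <= cPsiZ q (\<lambda>p. z p + y * c * Zc (shift_dir ?s) p)} \<in> sets PZ"
   by (intro sets.sets_Collect_countable_All'[OF _ countable_rat] sets.sets_Collect_imp sets.sets_Collect_const) auto
  then show "B c m s0 n \<in> sets PZ"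
   unfolding B_def by (intro sets.sets_Collect_conj) (auto intro: measurable_sets_Collect)
  fix v assume v: "v \<in> space Q"
  let ?w = "\<lambda>t. W t v"
  define f where "f x = cPsi q (\<lambda>t. ?w t + x * shift_dir ?s t)" for x
  have fZ: "cPsiZ q (\<lambda>p. Zc ?w p + x * Zc (shift_dir ?s) p) = f x" for x
   unfolding f_def Zc_def
   using cPsiZ_path[OF shifted_path[OF path_W[OF v], of ?s x], of q] s by simp
  have fc: "isCont f x" for x unfolding f_def by (rule cPsi_line_continuous[OF path_W[OF v] s])
  have c': "isCont (\<lambda>x. f (c * x)) x" for x
   by (intro isCont_o2[OF _ fc] continuous_intros)
  have cc: "c * c = 1" using c by auto
  \<comment> \<open>For c = -1 the growth is to the left; as c c = 1, the substitution of c x for x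
    reduces this to \<open>separated_zeros\<close> for the function f (c x) of x.\<close>
  have "{x. (\<lambda>p. Zc ?w p + x * Zc (shift_dir ?s) p) \<in> B c m s0 n} \<subseteq>
    (\<lambda>x. c * x) ` {x. f (c * x) = 0 \<and> (\<forall>y\<in>\<rat>. 0 < y \<and> y < 1 / real n \<longrightarrow> y / real n <= f (c * (x + y)))}"
  proof
   fix x assume "x \<in> {x. (\<lambda>p. Zc ?w p + x * Zc (shift_dir ?s) p) \<in> B c m s0 n}"
   then have xB: "f x = 0" "!!y. y \<in> \<rat> ==> 0 < y ==> y < 1 / real n ==>
     y / real n <= cPsiZ q (\<lambda>p. Zc ?w p + x * Zc (shift_dir ?s) p + y * c * Zc (shift_dir ?s) p)"
    by (auto simp: B_def fZ)
   have "y / real n <= f (c * (c * x + y))" if "y \<in> \<rat>" "0 < y" "y < 1 / real n" for y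
   proof -
    have "c * (c * x + y) = x + y * c" using cc by (simp add: distrib_left mult.commute flip: mult.assoc)
    moreover have "(\<lambda>p. Zc ?w p + x * Zc (shift_dir ?s) p + y * c * Zc (shift_dir ?s) p) = (\<lambda>p. Zc ?w p + (x + y * c) * Zc (shift_dir ?s) p)"
     by (simp add: algebra_simps)
    ultimately show ?thesis using xB(2)[OF that] by (simp only: fZ)
   qed
   moreover have cx: "c * (c * x) = x" using cc by (simp flip: mult.assoc)
   ultimately show "x \<in> (\<lambda>x. c * x) ` {x. f (c * x) = 0 \<and> (\<forall>y\<in>\<rat>. 0 < y \<and> y < 1 / real n \<longrightarrow> y / real n <= f (c * (x + y)))}"
    using xB(1) cx by (intro image_eqI[where x = "c * x"] CollectI conjI ballI impI) (simp_all only: cx)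
  qed
  then show "countable {x. (\<lambda>p. Zc ?w p + x * Zc (shift_dir ?s) p) \<in> B c m s0 n}"
   by (rule countable_subset) (intro countable_image separated_zeros c' n)
 qed
 have "AE v in Q. \<forall>c\<in>{-1, 1}. \<forall>m s0 n. s0 <= 2 ^ m \<longrightarrow> 0 < n \<longrightarrow> Zc (\<lambda>t. W t v) \<notin> B c m s0 n"
  using null by (intro AE_finite_allI AE_all_countable[THEN iffD2] allI AE_impI) auto
 then show ?thesis using AE_good
 proof eventually_elim
  case (elim v)
  have v: "v \<in> space Q" using elim(2) by (simp add: good_def)
  show ?case
  proof
   assume z: "cPsi q (\<lambda>t. W t v) = 0"
   have "\<exists>c\<in>{-1, 1}. \<exists>m s0 n. s0 <= (2::nat) ^ m \<and> 0 < (n::nat) \<and>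
    (\<forall>y. 0 < y \<and> y < 1 / real n \<longrightarrow> y / real n <= cPsi q (\<lambda>t. W t v + y * c * shift_dir (real s0 / 2 ^ m) t))"
    using z by (intro zero_max_growth path_W[OF v] good_V2[OF elim(2)] q) simp
   then obtain c m s0 n where c: "c \<in> {-1, 1}" "s0 <= (2::nat) ^ m" "0 < n" and
    g: "\<forall>y. 0 < y \<and> y < 1 / real n \<longrightarrow> y / real n <= cPsi q (\<lambda>t. W t v + y * c * shift_dir (real s0 / 2 ^ m) t)" by blast
   let ?s = "real s0 / 2 ^ m"
   have e: "cPsiZ q (\<lambda>p. Zc (\<lambda>t. W t v) p + x * Zc (shift_dir ?s) p) = cPsi q (\<lambda>t. W t v + x * shift_dir ?s t)" for x
    unfolding Zc_def using cPsiZ_path[OF shifted_path[OF path_W[OF v], of ?s x], of q] by simp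
   have "Zc (\<lambda>t. W t v) \<in> B c m s0 n"
    unfolding B_def using e[of 0] z g by (auto simp: e space_PiM)
   then show False using elim(1) c by blast
  qed
 qed
qed

end

section \<open>Weak convergence and the level\<close>

text \<open>The part of the event c <= f n on which g < c has probability tending to 0 by dominated
  convergence. One-sided, as the portmanteau theorem is for closed sets.\<close>

lemma (in prob_space) prob_ge_limit:
 fixes f :: "nat => 'a => real"
 assumes [measurable]: "!!n. f n \<in> borel_measurable M" "g \<in> borel_measurable M"
  and lim: "!!v. v \<in> space M ==> (\<lambda>n. f n v) \<longlonglongrightarrow> g v" and e: "0 < e"
 shows "\<forall>\<^sub>F n in sequentially. prob {v \<in> space M. c <= f n v} <= prob {v \<in> space M. c <= g v} + e"
proof -
 let ?D = "\<lambda>n. {v \<in> space M. c <= f n v \<and> g v < c}"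
 have "(\<lambda>n. \<integral>v. (indicator (?D n) v :: real) \<partial>M) \<longlonglongrightarrow> (\<integral>v. 0 \<partial>M)"
 proof (rule integral_dominated_convergence[where w = "\<lambda>_. 1"])
  show "AE v in M. (\<lambda>n. indicator (?D n) v :: real) \<longlonglongrightarrow> 0"
  proof (rule AE_I2, rule tendsto_eventually)
   fix v assume v: "v \<in> space M"
   show "\<forall>\<^sub>F n in sequentially. indicator (?D n) v = (0::real)"
   proof (cases "g v < c")
    case True
    then have "\<forall>\<^sub>F n in sequentially. f n v < c" using lim[OF v] by (intro order_tendstoD(2))
    then show ?thesis by eventually_elim (simp add: indicator_def)
   qed (simp add: indicator_def)
  qed
 qed (auto simp: indicator_def)
 then have "(\<lambda>n. prob (?D n)) \<longlonglongrightarrow> 0" by simp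
 then have "\<forall>\<^sub>F n in sequentially. prob (?D n) < e" using e by (rule order_tendstoD(2))
 then show ?thesis
 proof eventually_elim
  case (elim n)
  have "prob {v \<in> space M. c <= f n v} <= prob ({v \<in> space M. c <= g v} \<union> ?D n)"
   by (intro finite_measure_mono) auto
  also have "\<dots> <= prob {v \<in> space M. c <= g v} + prob (?D n)"
   by (intro measure_Un_le) auto
  finally show ?case using elim by simp
 qed
qed

lemma distr_PiM_map:
 assumes I: "I \<noteq> {}" and N: "!!i. i \<in> I ==> prob_space (N i)" and Y: "!!i. i \<in> I ==> Y i \<in> borel_measurable (N i)"
 shows "distr (PiM I N) (PiM I (\<lambda>_. borel)) (\<lambda>w. \<lambda>i\<in>I. Y i (w i)) = PiM I (\<lambda>i. distr (N i) borel (Y i))"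
proof -
 interpret R: prob_space "PiM I N" by (rule prob_space_PiM[OF N])
 have m: "(\<lambda>w. w i) \<in> measurable (PiM I N) (N i)" if "i \<in> I" for i using that by measurable
 have "R.indep_vars N (\<lambda>i w. w i) I"
 proof (subst R.indep_vars_iff_distr_eq_PiM'[OF I m])
  have "distr (PiM I N) (PiM I N) (\<lambda>w. \<lambda>i\<in>I. w i) = distr (PiM I N) (PiM I N) (\<lambda>w. w)"
   by (rule distr_cong) (auto simp: space_PiM PiE_restrict)
  also have "\<dots> = PiM I (\<lambda>i. distr (PiM I N) (N i) (\<lambda>w. w i))"
   by (simp add: distr_id) (rule PiM_cong, simp, rule distr_PiM_component[symmetric], auto intro: N)
  finally show "distr (PiM I N) (PiM I N) (\<lambda>w. \<lambda>i\<in>I. w i) = PiM I (\<lambda>i. distr (PiM I N) (N i) (\<lambda>w. w i))" .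
 qed
 then have "R.indep_vars (\<lambda>_. borel) (\<lambda>i w. Y i (w i)) I"
  by (rule R.indep_vars_compose2) (rule Y)
 moreover have mY: "(\<lambda>w. Y i (w i)) \<in> borel_measurable (PiM I N)" if "i \<in> I" for i
  by (rule measurable_compose[OF m[OF that] Y[OF that]])
 ultimately have "distr (PiM I N) (PiM I (\<lambda>_. borel)) (\<lambda>w. \<lambda>i\<in>I. Y i (w i)) = PiM I (\<lambda>i. distr (PiM I N) borel (\<lambda>w. Y i (w i)))"
  by (subst (asm) R.indep_vars_iff_distr_eq_PiM'[OF I]) auto
 also have "\<dots> = PiM I (\<lambda>i. distr (N i) borel (Y i))"
 proof (rule PiM_cong[OF refl])
  fix i assume i: "i \<in> I"
  have "distr (PiM I N) borel (\<lambda>w. Y i (w i)) = distr (distr (PiM I N) (N i) (\<lambda>w. w i)) borel (Y i)"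
   by (subst distr_distr[OF Y[OF i] m[OF i]]) (simp add: comp_def)
  then show "distr (PiM I N) borel (\<lambda>w. Y i (w i)) = distr (N i) borel (Y i)"
   using distr_PiM_component[where M = N, OF N i] by simp
 qed
 finally show ?thesis .
qed

lemma measure_ge_distr:
 fixes F :: "'b => real"
 assumes V: "V \<in> measurable A B" and F [measurable]: "F \<in> borel_measurable B"
 shows "measure A {w \<in> space A. c <= F (V w)} = measure (distr A B V) {v \<in> space B. c <= F v}"
proof -
 have "{v \<in> space B. c <= F v} \<in> sets B" by measurable
 then show ?thesis
  by (subst measure_distr[OF V]) (auto intro!: arg_cong[where f = "measure A"] dest: measurable_space[OF V])
qed

text \<open>Skorohod's theorem is applied to each coordinate on a space of its own. The product of
  these spaces carries the joint laws, because the coordinates are independent for every n and in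
  the limit; so one-dimensional weak convergence suffices.\<close>

lemma weak_conv_joint:
 fixes X :: "nat => nat => 'a => real" and G :: "nat => 'v => real" and F :: "(nat => real) => real"
 assumes P: "prob_space P" and Q: "prob_space Q" and M: "1 <= M"
  and X: "!!n. prob_space.indep_vars P (\<lambda>_. borel) (X n) {..<M}" and G: "prob_space.indep_vars Q (\<lambda>_. borel) G {..<M}"
  and wc: "!!j. j < M ==> weak_conv_m (\<lambda>n. distr P borel (X n j)) (distr Q borel (G j))"
  and F [measurable]: "F \<in> borel_measurable (PiM {..<M} (\<lambda>_. borel))"
  and cont: "!!u v. (!!j. j < M ==> (\<lambda>n. u n j) \<longlonglongrightarrow> v j) ==> (\<lambda>n. F (u n)) \<longlonglongrightarrow> F v"
  and e: "0 < e"
 shows "\<forall>\<^sub>F n in sequentially. measure P {w \<in> space P. c <= F (\<lambda>j\<in>{..<M}. X n j w)}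
  <= measure Q {w \<in> space Q. c <= F (\<lambda>j\<in>{..<M}. G j w)} + e"
proof -
 interpret P: prob_space P by (rule P)
 interpret Q: prob_space Q by (rule Q)
 let ?B = "PiM {..<M} (\<lambda>_. borel) :: (nat => real) measure"
 have I: "{..<M} \<noteq> {}" using M by (simp add: lessThan_empty_iff)
 have mX [measurable]: "X n j \<in> borel_measurable P" if "j \<in> {..<M}" for n j using X that by (auto simp: P.indep_vars_def)
 have mG [measurable]: "G j \<in> borel_measurable Q" if "j \<in> {..<M}" for j using G that by (auto simp: Q.indep_vars_def)
 \<comment> \<open>T bundles probability space, sequence and limit, so that \<open>bchoice\<close>
   selects all three for every coordinate at once.\<close>
 define sk where "sk j T \<longleftrightarrow> prob_space (fst T) \<and>
  (\<forall>n. fst (snd T) n \<in> measurable (fst T) borel) \<and> (\<forall>n. distr (fst T) borel (fst (snd T) n) = distr P borel (X n j)) \<and>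
  snd (snd T) \<in> measurable (fst T) lborel \<and> distr (fst T) borel (snd (snd T)) = distr Q borel (G j) \<and>
  (\<forall>x \<in> space (fst T). (\<lambda>n. fst (snd T) n x) \<longlonglongrightarrow> snd (snd T) x)"
  for j and T :: "real measure \<times> (nat => real => real) \<times> (real => real)"
 have "\<exists>T. sk j T" if j: "j \<in> {..<M}" for j
 proof -
  have "\<exists>(N :: real measure) (Y :: nat => real => real) (Z :: real => real). prob_space N \<and>
   (\<forall>n. Y n \<in> measurable N borel) \<and> (\<forall>n. distr N borel (Y n) = distr P borel (X n j)) \<and>
   Z \<in> measurable N lborel \<and> distr N borel Z = distr Q borel (G j) \<and> (\<forall>x \<in> space N. (\<lambda>n. Y n x) \<longlonglongrightarrow> Z x)"
   by (rule Skorohod) (use j mX mG wc in \<open>auto intro!: P.real_distribution_distr Q.real_distribution_distr\<close>)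
  then obtain N Y Z where "sk j (N, Y, Z)" unfolding sk_def fst_conv snd_conv by blast
  then show ?thesis by blast
 qed
 then have "\<forall>j\<in>{..<M}. \<exists>T. sk j T" by blast
 then have "\<exists>T. \<forall>j\<in>{..<M}. sk j (T j)" by (rule bchoice)
 then obtain T where T: "!!j. j \<in> {..<M} ==> sk j (T j)" by blast
 define N Y Z where "N j = fst (T j)" and "Y j = fst (snd (T j))" and "Z j = snd (snd (T j))" for j
 have S: "prob_space (N j)" "Y j n \<in> measurable (N j) borel" "distr (N j) borel (Y j n) = distr P borel (X n j)"
  "Z j \<in> measurable (N j) lborel" "distr (N j) borel (Z j) = distr Q borel (G j)"
  "x \<in> space (N j) ==> (\<lambda>n. Y j n x) \<longlonglongrightarrow> Z j x" if "j \<in> {..<M}" for j n x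
  using T[OF that] unfolding sk_def N_def Y_def Z_def by blast+
 have S4: "Z j \<in> borel_measurable (N j)" if "j \<in> {..<M}" for j using S(4)[OF that] by simp
 let ?R = "PiM {..<M} N"
 interpret R: prob_space ?R by (rule prob_space_PiM[OF S(1)])
 let ?Y = "\<lambda>n w. \<lambda>j\<in>{..<M}. Y j n (w j)" and ?Z = "\<lambda>w. \<lambda>j\<in>{..<M}. Z j (w j)"
 have mc: "(\<lambda>w. w j) \<in> measurable ?R (N j)" if "j \<in> {..<M}" for j using that by measurable
 have mY [measurable]: "?Y n \<in> measurable ?R ?B" for n
  by (rule measurable_restrict) (rule measurable_compose[OF mc S(2)])
 have mZ [measurable]: "?Z \<in> measurable ?R ?B"
  by (rule measurable_restrict) (rule measurable_compose[OF mc S4])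
 have mXv [measurable]: "(\<lambda>w. \<lambda>j\<in>{..<M}. X n j w) \<in> measurable P ?B" for n by (rule measurable_restrict) (rule mX)
 have mGv [measurable]: "(\<lambda>w. \<lambda>j\<in>{..<M}. G j w) \<in> measurable Q ?B" by (rule measurable_restrict) (rule mG)
 have lawX: "distr P ?B (\<lambda>w. \<lambda>j\<in>{..<M}. X n j w) = distr ?R ?B (?Y n)" for n
 proof -
  have "distr P ?B (\<lambda>w. \<lambda>j\<in>{..<M}. X n j w) = PiM {..<M} (\<lambda>j. distr P borel (X n j))"
   using X[of n] by (subst (asm) P.indep_vars_iff_distr_eq_PiM'[OF I mX]) auto
  also have "\<dots> = PiM {..<M} (\<lambda>j. distr (N j) borel (Y j n))" by (rule PiM_cong) (simp_all add: S(3))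
  also have "\<dots> = distr ?R ?B (?Y n)" by (rule distr_PiM_map[OF I S(1) S(2), symmetric])
  finally show ?thesis .
 qed
 have lawG: "distr Q ?B (\<lambda>w. \<lambda>j\<in>{..<M}. G j w) = distr ?R ?B ?Z"
 proof -
  have "distr Q ?B (\<lambda>w. \<lambda>j\<in>{..<M}. G j w) = PiM {..<M} (\<lambda>j. distr Q borel (G j))"
   using G by (subst (asm) Q.indep_vars_iff_distr_eq_PiM'[OF I mG]) auto
  also have "\<dots> = PiM {..<M} (\<lambda>j. distr (N j) borel (Z j))" by (rule PiM_cong) (simp_all add: S(5))
  also have "\<dots> = distr ?R ?B ?Z" by (rule distr_PiM_map[OF I S(1) S4, symmetric])
  finally show ?thesis .
 qed
 have "\<forall>\<^sub>F n in sequentially. R.prob {w \<in> space ?R. c <= F (?Y n w)} <= R.prob {w \<in> space ?R. c <= F (?Z w)} + e"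
 proof (rule R.prob_ge_limit[where f = "\<lambda>n w. F (?Y n w)" and g = "\<lambda>w. F (?Z w)", OF _ _ _ e])
  fix w assume w: "w \<in> space ?R"
  show "(\<lambda>n. F (?Y n w)) \<longlonglongrightarrow> F (?Z w)"
  proof (rule cont)
   fix j assume "j < M"
   then show "(\<lambda>n. ?Y n w j) \<longlonglongrightarrow> ?Z w j" using S(6)[of j "w j"] w by (simp add: space_PiM PiE_iff)
  qed
 qed measurable
 then show ?thesis unfolding measure_ge_distr[OF mXv F] measure_ge_distr[OF mGv F] measure_ge_distr[OF mY F] measure_ge_distr[OF mZ F] lawX lawG .
qed

lemma (in prob_space) moment_tail:
 fixes X :: "'a => real"
 assumes [measurable]: "X \<in> borel_measurable M" and i: "integrable M (\<lambda>w. X w ^ p)" and X: "!!w. 0 <= X w" and a: "0 < a"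
  and b: "(\<integral>w. X w ^ p \<partial>M) <= b"
 shows "prob {w \<in> space M. a < X w} <= b / a ^ p"
proof -
 have "a ^ p * prob {w \<in> space M. a < X w} = (\<integral>w. a ^ p * indicator {w \<in> space M. a < X w} w \<partial>M)"
  by simp
 also have "\<dots> <= (\<integral>w. X w ^ p \<partial>M)"
 proof (rule integral_mono[OF _ i])
  show "integrable M (\<lambda>w. a ^ p * indicator {w \<in> space M. a < X w} w)"
   by (intro integrable_mult_right integrable_real_indicator) (auto simp: emeasure_eq_measure)
  show "a ^ p * indicator {w \<in> space M. a < X w} w <= X w ^ p" for w
   using a X[of w] by (auto simp: indicator_def intro!: power_mono)
 qed
 finally show ?thesis using a b by (simp add: le_divide_eq mult.commute)
qed

section \<open>Tightness of the partial sums\<close>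

context loc_stat
begin

lemma ysum_max_tail:
 assumes n: "1 <= n" and a: "0 < a"
 shows "\<P>(z in \<pi>. a * sqrt (real n) < rmax (\<lambda>k. \<bar>ysum n k z\<bar>) n) <= 16 * (\<Theta> 0)^2 / a^2"
proof -
 have eq: "rmax (\<lambda>k. \<bar>ysum n k z\<bar>) n = maxsum (on {1..n} n h) n z" for z
  unfolding ysum_def maxsum_def ..
 have "\<P>(z in \<pi>. a * sqrt (real n) < rmax (\<lambda>k. \<bar>ysum n k z\<bar>) n) <= (16 * n * (\<Theta> 0)^2) / (a * sqrt (real n))^2"
 proof (rule pi.moment_tail)
  show "(\<lambda>z. rmax (\<lambda>k. \<bar>ysum n k z\<bar>) n) \<in> borel_measurable \<pi>" by measurable
  show "integrable \<pi> (\<lambda>z. (rmax (\<lambda>k. \<bar>ysum n k z\<bar>) n)^2)"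
   unfolding eq by (rule maxsum_h(1)) simp
  show "(\<integral>z. (rmax (\<lambda>k. \<bar>ysum n k z\<bar>) n)^2 \<partial>\<pi>) <= 16 * n * (\<Theta> 0)^2"
   unfolding eq using maxsum_h(2)[of "{1..n}" n, OF order_refl] by (simp only: card_atLeastAtMost diff_Suc_1)
  show "0 < a * sqrt (real n)" using n a by simp
 qed (rule rmax_nonneg, simp)
 also have "\<dots> = 16 * (\<Theta> 0)^2 / a^2" using n a by (simp add: power_mult_distrib)
 finally show ?thesis .
qed

text \<open>Increments over the last blocks may run past n, where the summands are 0.\<close>

lemma lagsum_on_min: "lagsum (on {1..n} n f) k z = lagsum (on {1..n} n f) (min k n) z"
 unfolding lagsum_def by (rule sum.mono_neutral_right) auto

text \<open>L is fixed first, which makes the error of \<open>tr L\<close> small uniformly in M. For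
  \<open>tr L\<close> the fourth moments bound the probability of a large oscillation by a multiple
  of M (n / M)^2 / n^2 = 1 / M. The block length n div M + 3 is at least n / M + 2, as
  \<open>osc_poly\<close> requires, and at most 2 n / M once n >= 3 M.\<close>

theorem tightness:
 assumes d: "0 < d" and e: "0 < e"
 shows "\<exists>M0. \<forall>M\<ge>M0. \<forall>n\<ge>3 * M. \<P>(w in \<pi>. \<exists>r<M. d * sqrt (real n) <
  rmax (\<lambda>j. \<bar>ysum n (r * (n div M + 3) + j) w - ysum n (r * (n div M + 3)) w\<bar>) (n div M + 3)) <= e"
proof -
 have "(\<lambda>L. 256 * (S L)^2 / d^2) \<longlonglongrightarrow> 256 * 0^2 / d^2" using d by (intro tendsto_intros S_tendsto) auto
 then have "\<forall>\<^sub>F L in sequentially. 256 * (S L)^2 / d^2 < e / 2" using e by (intro order_tendstoD(2)) auto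
 with eventually_ge_at_top[of 1] have "\<forall>\<^sub>F L in sequentially. 1 <= L \<and> 256 * (S L)^2 / d^2 < e / 2" by eventually_elim simp
 then obtain L where L: "1 <= L" "256 * (S L)^2 / d^2 < e / 2" by (auto simp: eventually_sequentially)
 define C where "C = 11264 * real L ^ 4 * real L ^ 4"
 have C: "0 <= C" by (simp add: C_def)
 obtain M0 :: nat where M0: "64 * C / d ^ 4 / (e / 2) < M0" using reals_Archimedean2 by blast
 show ?thesis
 proof (intro exI[of _ "max 1 M0"] allI impI)
  fix M n assume M: "max 1 M0 <= M" and n: "3 * M <= n"
  let ?K = "n div M + 3"
  let ?x = "\<lambda>f a w. rmax (\<lambda>j. \<bar>lagsum (on {1..n} n f) (a + j) w - lagsum (on {1..n} n f) a w\<bar>) ?K"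
  let ?e = "\<lambda>t x. h t x - tr L t x"
  have M1: "1 <= M" "1 <= n" using M n by auto
  have mtr: "on {1..n} n (tr L) i \<in> borel_measurable \<nu>" "on {1..n} n ?e i \<in> borel_measurable \<nu>" for i
   using measurable_on[of "{1..n}" n "tr L" i] measurable_on[of "{1..n}" n ?e i] h_meas measurable_tr by auto
  have [measurable]: "lagsum (on {1..n} n (tr L)) k \<in> borel_measurable \<pi>" "lagsum (on {1..n} n ?e) k \<in> borel_measurable \<pi>" for k
   unfolding lagsum_def[abs_def] by (intro borel_measurable_sum measurable_compose[OF measurable_lag] mtr)+
  have p4: "\<P>(w in \<pi>. d / 2 * sqrt (real n) < ?x (tr L) a w) <= (C * (real ?K)^2) / (d / 2 * sqrt (real n)) ^ 4" for a
  proof -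
   have eq: "on {1..n} n (tr L) = (\<lambda>i x. proj (on {1..n} n (cl L) i) L x - proj (on {1..n} n (cl L) i) 0 x)"
    using on_cl(5)[OF order_refl] by blast
   note pw = integral_max_increment_pow4[of "on {1..n} n (cl L)" "real L" L a ?K, OF on_cl(1,2)[OF order_refl]]
   show ?thesis
   proof (rule pi.moment_tail)
    show "?x (tr L) a \<in> borel_measurable \<pi>" by measurable
    show "integrable \<pi> (\<lambda>w. ?x (tr L) a w ^ 4)" unfolding eq by (rule pw(1))
    show "(\<integral>w. ?x (tr L) a w ^ 4 \<partial>\<pi>) <= C * (real ?K)^2" unfolding eq C_def by (rule pw(2))
    show "0 < d / 2 * sqrt (real n)" using M1 d by simp
   qed (rule rmax_nonneg, simp)
  qed
  have er: "\<P>(w in \<pi>. d / 4 * sqrt (real n) < maxsum (on {1..n} n ?e) n w) <= (16 * n * (S L)^2) / (d / 4 * sqrt (real n))^2"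
  proof (rule pi.moment_tail)
   show "maxsum (on {1..n} n ?e) n \<in> borel_measurable \<pi>" unfolding maxsum_def[abs_def] by measurable
   show "0 <= maxsum (on {1..n} n ?e) n w" for w unfolding maxsum_def by (rule rmax_nonneg) simp
   show "integrable \<pi> (\<lambda>w. (maxsum (on {1..n} n ?e) n w)^2)" by (rule maxsum_err(1)[OF order_refl L(1)])
   show "(\<integral>w. (maxsum (on {1..n} n ?e) n w)^2 \<partial>\<pi>) <= 16 * n * (S L)^2"
    using maxsum_err(2)[of "{1..n}" n L, OF order_refl L(1)] by (simp only: card_atLeastAtMost diff_Suc_1)
   show "0 < d / 4 * sqrt (real n)" using M1 d by simp
  qed
  have split: "?x h a w <= ?x (tr L) a w + 2 * maxsum (on {1..n} n ?e) n w" for a w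
  proof (rule rmax_leI)
   fix j assume j: "j <= ?K"
   have add: "lagsum (on {1..n} n h) k w = lagsum (on {1..n} n (tr L)) k w + lagsum (on {1..n} n ?e) k w" for k
    unfolding lagsum_def sum.distrib[symmetric] by (rule sum.cong) auto
   have e: "\<bar>lagsum (on {1..n} n ?e) k w\<bar> <= maxsum (on {1..n} n ?e) n w" for k
    unfolding lagsum_on_min[of n ?e k] by (rule lagsum_le_maxsum) simp
   show "\<bar>lagsum (on {1..n} n h) (a + j) w - lagsum (on {1..n} n h) a w\<bar> <= ?x (tr L) a w + 2 * maxsum (on {1..n} n ?e) n w"
    using le_rmax[OF j, of "\<lambda>j. \<bar>lagsum (on {1..n} n (tr L)) (a + j) w - lagsum (on {1..n} n (tr L)) a w\<bar>"] e[of a] e[of "a + j"]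
    unfolding add by linarith
  qed
  let ?A = "\<lambda>r. {w \<in> space \<pi>. d / 2 * sqrt (real n) < ?x (tr L) (r * ?K) w}"
  let ?B = "{w \<in> space \<pi>. d / 4 * sqrt (real n) < maxsum (on {1..n} n ?e) n w}"
  have [measurable]: "maxsum (on {1..n} n ?e) n \<in> borel_measurable \<pi>" unfolding maxsum_def[abs_def] by measurable
  have A: "?A r \<in> sets \<pi>" for r by measurable
  have B: "?B \<in> sets \<pi>" by measurable
  have "\<P>(w in \<pi>. \<exists>r<M. d * sqrt (real n) < rmax (\<lambda>j. \<bar>ysum n (r * ?K + j) w - ysum n (r * ?K) w\<bar>) ?K)
   <= pi.prob ((\<Union>r\<in>{..<M}. ?A r) \<union> ?B)"
  proof (rule pi.finite_measure_mono)
   show "(\<Union>r\<in>{..<M}. ?A r) \<union> ?B \<in> sets \<pi>" by (intro sets.Un sets.finite_UN finite_lessThan A B)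
   show "{w \<in> space \<pi>. \<exists>r<M. d * sqrt (real n) < rmax (\<lambda>j. \<bar>ysum n (r * ?K + j) w - ysum n (r * ?K) w\<bar>) ?K} \<subseteq> (\<Union>r\<in>{..<M}. ?A r) \<union> ?B"
   proof
    fix w assume "w \<in> {w \<in> space \<pi>. \<exists>r<M. d * sqrt (real n) < rmax (\<lambda>j. \<bar>ysum n (r * ?K + j) w - ysum n (r * ?K) w\<bar>) ?K}"
    then obtain r where r: "w \<in> space \<pi>" "r < M" "d * sqrt (real n) < ?x h (r * ?K) w" by (auto simp: ysum_def)
    have "d / 2 * sqrt (real n) < ?x (tr L) (r * ?K) w \<or> d / 4 * sqrt (real n) < maxsum (on {1..n} n ?e) n w"
     using r(3) split[of "r * ?K" w] by linarith
    then show "w \<in> (\<Union>r\<in>{..<M}. ?A r) \<union> ?B" using r(1,2) by blast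
   qed
  qed
  also have "\<dots> <= pi.prob (\<Union>r\<in>{..<M}. ?A r) + pi.prob ?B"
   by (intro measure_Un_le sets.finite_UN finite_lessThan A B)
  also have "pi.prob (\<Union>r\<in>{..<M}. ?A r) <= (\<Sum>r<M. pi.prob (?A r))"
   by (intro measure_UNION_le finite_lessThan A)
  also have "\<dots> <= (\<Sum>r<M. (C * (real ?K)^2) / (d / 2 * sqrt (real n)) ^ 4)" by (intro sum_mono p4)
  also have "\<dots> = M * ((C * (real ?K)^2) / (d / 2 * sqrt (real n)) ^ 4)" by simp
  also have "\<dots> <= M * ((C * (2 * real n / M)^2) / (d / 2 * sqrt (real n)) ^ 4)"
  proof -
   have "real (n div M) <= real n / M" by (rule of_nat_div_le_of_nat)
   moreover have "3 <= real n / M" using n M1 by (simp add: le_divide_eq)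
   ultimately have "real ?K <= 2 * real n / M" by simp
   then show ?thesis using C d by (intro mult_left_mono divide_right_mono power_mono) auto
  qed
  also have "\<dots> = 64 * C / d ^ 4 / M"
  proof -
   have "sqrt (real n) ^ 4 = (real n)^2"
    using power_mult[of "sqrt (real n)" 2 2] by simp
   then have "(d / 2 * sqrt (real n)) ^ 4 = d ^ 4 * (real n)^2 / 16" by (simp add: power_mult_distrib power_divide)
   then show ?thesis using M1 d by (simp add: power2_eq_square field_simps)
  qed
  also have "\<dots> <= e / 2"
  proof -
   have aux: "z / y <= x" if "z / x < y" "0 < x" "0 < y" for x y z :: real
    using that by (simp add: divide_less_eq divide_le_eq mult.commute)
   have "64 * C / d ^ 4 / (e / 2) < real M" using M0 M by linarith
   then show ?thesis using M1 e by (intro aux) auto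
  qed
  also have "pi.prob ?B <= e / 2"
  proof -
   have "(16 * n * (S L)^2) / (d / 4 * sqrt (real n))^2 = 256 * (S L)^2 / d^2"
    using M1 by (simp add: power_mult_distrib power_divide)
   then show ?thesis using er L(2) by linarith
  qed
  finally show "\<P>(w in \<pi>. \<exists>r<M. d * sqrt (real n) < rmax (\<lambda>j. \<bar>ysum n (r * ?K + j) w - ysum n (r * ?K) w\<bar>) ?K) <= e" by simp
 qed
qed

text \<open>No block crosses the point n j / M, which need not be an integer; so at j / M the
  polygonal path has completed all blocks before that point and begun none after it.\<close>

lemma poly_yt_grid:
 assumes n: "1 <= n" and M: "1 <= M" and j: "j <= M"
 shows "poly_path n (yt M n z) (real j / real M) = (\<Sum>k<j. incs M n k z) / sqrt (real M)"
proof -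
 let ?c = "\<lambda>i. max 0 (min 1 (real n * (real j / real M) - (real i - 1)))"
 let ?t = "\<lambda>i. tr (block_len n) (real i / real n) (lag (int i) z)"
 have disj: "big_in n M k \<inter> big_in n M l = {}" if "k \<noteq> l" for k l
 proof (rule ccontr)
  assume "big_in n M k \<inter> big_in n M l \<noteq> {}"
  then obtain i where i: "i \<in> big_in n M k" "i \<in> big_in n M l" by blast
  note bk = big_in_bounds[OF n M i(1)] and bl = big_in_bounds[OF n M i(2)]
  have "M * (i - 1) < M * i" using M bk(3) by simp
  then have "n * k < n * (l + 1)" "n * l < n * (k + 1)" using bk(1,2) bl(1,2) by linarith+
  then have "k < l + 1" "l < k + 1" by (simp_all only: mult_less_cancel1)
  then show False using that by simp
 qed
 have clamp: "?c i = (if k < j then 1 else 0)" if "i \<in> big_in n M k" for i k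
 proof -
  note b = big_in_bounds[OF n M that]
  have eq: "real n * (real j / real M) - (real i - 1) = (real (n * j) - real M * (real i - 1)) / real M"
   using M by (simp add: field_simps)
  show ?thesis
  proof (cases "k < j")
   case True
   then have "n * (k + 1) <= n * j" by (intro mult_left_mono) auto
   then have "M * i <= n * j" using b(2) by linarith
   then have "real M * real i <= real (n * j)" by (simp only: of_nat_mult[symmetric] of_nat_le_iff)
   then have "1 <= (real (n * j) - real M * (real i - 1)) / real M" using M by (simp add: le_divide_eq algebra_simps)
   then show ?thesis unfolding eq using True by simp
  next
   case False
   then have "n * j <= n * k" by (intro mult_left_mono) auto
   then have "n * j <= M * (i - 1)" using b(1) by linarith
   then have "real (n * j) <= real M * real (i - 1)" by (simp only: of_nat_mult[symmetric] of_nat_le_iff)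
   then have "(real (n * j) - real M * (real i - 1)) / real M <= 0" using M b(3) by (simp add: divide_le_0_iff of_nat_diff)
   then show ?thesis unfolding eq using False by simp
  qed
 qed
 have fin: "finite (big_in n M k)" for k unfolding big_in_def blk_def using finite_blocks_in[OF n M] by blast
 have "(\<Sum>i=1..n. yt M n z i * ?c i) = (\<Sum>i\<in>big n M. ?t i * ?c i)"
  by (rule sum.mono_neutral_cong_right) (use big_subset[OF n M] in \<open>auto simp: yt_def\<close>)
 also have "\<dots> = (\<Sum>k<M. \<Sum>i\<in>big_in n M k. ?t i * ?c i)"
  unfolding big_def by (rule sum.UNION_disjoint) (use disj fin in auto)
 also have "\<dots> = (\<Sum>k<M. if k < j then \<Sum>i\<in>big_in n M k. ?t i else 0)"
 proof (rule sum.cong[OF refl])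
  fix k
  have "(\<Sum>i\<in>big_in n M k. ?t i * ?c i) = (\<Sum>i\<in>big_in n M k. ?t i * (if k < j then 1 else 0))"
   by (rule sum.cong[OF refl]) (simp only: clamp)
  then show "(\<Sum>i\<in>big_in n M k. ?t i * ?c i) = (if k < j then \<Sum>i\<in>big_in n M k. ?t i else 0)" by simp
 qed
 also have "\<dots> = (\<Sum>k<j. \<Sum>i\<in>big_in n M k. ?t i)"
  by (rule sum.mono_neutral_cong_right) (use j in auto)
 finally have "poly_path n (yt M n z) (real j / real M) = (\<Sum>k<j. \<Sum>i\<in>big_in n M k. ?t i) / sqrt (real n)"
  unfolding poly_path_def by simp
 moreover have "incs M n k z = sqrt (real M) * ((\<Sum>i\<in>big_in n M k. ?t i) / sqrt (real n))" for k
  unfolding incs_def sum_big_in[OF n M] by (simp add: real_sqrt_divide)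
 ultimately show ?thesis using M by (simp add: sum_distrib_left[symmetric] sum_divide_distrib)
qed

end

section \<open>Passage to the Brownian limit\<close>

text \<open>Homogeneity of degree 2: the long-run variance becomes a positive factor of the maximum,
  which leaves its sign alone.\<close>

lemma dPsi_scale: "2 <= N ==> dPsi q N (\<lambda>i. c * p i) = c^2 * dPsi q N p"
proof -
 assume N: "2 <= N"
 have b: "dbridge N (\<lambda>i. c * p i) k = c * dbridge N p k" for k by (simp add: dbridge_def algebra_simps)
 have 1: "(c * p i - r * (c * p k))^2 = c^2 * (p i - r * p k)^2" for i k r
  by (simp add: power_mult_distrib[symmetric] algebra_simps)
 have 2: "(c * p N - c * p i - r * (c * p N - c * p k))^2 = c^2 * (p N - p i - r * (p N - p k))^2" for i k r
  by (simp add: power_mult_distrib[symmetric] algebra_simps)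
 have v: "dV2 N (\<lambda>i. c * p i) k = c^2 * dV2 N p k" for k
  unfolding dV2_def 1 2 by (simp add: sum_distrib_left[symmetric] distrib_left add_divide_distrib)
 have d: "dpsi q N (\<lambda>i. c * p i) k = c^2 * dpsi q N p k" for k
  unfolding dpsi_def b v by (simp add: power_mult_distrib algebra_simps)
 let ?A = "dpsi q N p ` {1..N-1}"
 have "c^2 * Max ?A = Max ((*) (c^2) ` ?A)"
  by (rule mono_Max_commute) (use N in \<open>auto intro!: monoI mult_left_mono\<close>)
 then show ?thesis unfolding dPsi_def d by (simp add: image_image)
qed

lemma dPsi_continuous:
 assumes M: "2 <= M" and p: "!!i. i <= M ==> (\<lambda>n. p n i) \<longlonglongrightarrow> p' i"
 shows "(\<lambda>n. dPsi q M (p n)) \<longlonglongrightarrow> dPsi q M p'"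
proof -
 have max: "(\<lambda>n. Max ((\<lambda>k. f n k) ` I)) \<longlonglongrightarrow> Max (g ` I)"
  if "finite I" "I \<noteq> {}" "!!k. k \<in> I ==> (\<lambda>n. f n k) \<longlonglongrightarrow> (g k :: real)" for f g and I :: "nat set"
  using that
 proof (induction I rule: finite_ne_induct)
  case (insert x I)
  have "(\<lambda>n. max (f n x) (Max (f n ` I))) \<longlonglongrightarrow> max (g x) (Max (g ` I))"
   by (intro tendsto_max insert.IH insert.prems) auto
  then show ?case using insert.hyps by simp
 qed simp
 show ?thesis
  unfolding dPsi_def
 proof (rule max)
  fix k assume k: "k \<in> {1..M-1}"
  have pk: "(\<lambda>n. p n i) \<longlonglongrightarrow> p' i" if "i \<in> {1..k} \<or> i \<in> {k+1..M} \<or> i = k \<or> i = M" for i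
   by (rule p) (use that k in auto)
  show "(\<lambda>n. dpsi q M (p n) k) \<longlonglongrightarrow> dpsi q M p' k"
   unfolding dpsi_def dbridge_def dV2_def by (intro tendsto_intros pk) (use M in auto)
 qed (use M in auto)
qed

locale limit_test = loc_stat \<mu> h \<delta> \<kappa> Cm \<Lambda> \<sigma>2 + BM: brownian Q W
 for \<mu> :: "'e measure" and h and \<delta> and \<kappa> Cm \<Lambda> \<sigma>2 :: real and Q :: "'v measure" and W
begin

definition gauss :: "nat => nat => 'v => real" where
 "gauss M j w = sqrt \<sigma>2 * (sqrt (real M) * BM.binc M j w)"

lemma measurable_gauss [measurable]: "gauss M j \<in> borel_measurable Q"
 unfolding gauss_def[abs_def] by measurable

lemma gauss_law: "1 <= M ==> distr Q borel (gauss M j) = limit_normal"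
proof -
 assume M: "1 <= M"
 have p: "0 < sqrt (1 / real M)" using M by simp
 have "distributed Q lborel (\<lambda>w. (BM.binc M j w - 0) / sqrt (1 / real M)) std_normal_density"
  using BM.binc_normal[OF M, of j] unfolding BM.normal_standard_normal_convert[OF p] .
 then have "distributed Q lborel (\<lambda>w. sqrt (real M) * BM.binc M j w) std_normal_density"
  using M by (simp add: real_sqrt_divide mult.commute)
 then have std: "distr Q borel (\<lambda>w. sqrt (real M) * BM.binc M j w) = std_normal_distribution"
  using distributed_distr_eq_density by (metis distr_cong sets_lborel)
 show ?thesis
  unfolding limit_normal_def std[symmetric] gauss_def[abs_def] by (subst distr_distr) (auto simp: comp_def)
qed

lemma gauss_indep: "1 <= M ==> BM.indep_vars (\<lambda>_. borel) (gauss M) {..<M}"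
 unfolding gauss_def[abs_def]
 by (rule BM.indep_vars_compose2[OF BM.binc_indep, where Y = "\<lambda>_ x. sqrt \<sigma>2 * (sqrt (real M) * x)"]) auto

lemma gauss_sum: "1 <= M ==> w \<in> space Q ==> (\<Sum>k<i. gauss M k w) / sqrt (real M) = sqrt \<sigma>2 * W (real i / real M) w"
 unfolding gauss_def by (simp add: sum_distrib_left[symmetric] BM.W_eq_sum)

lemma incs_limit:
 fixes F :: "(nat => real) => real"
 assumes M: "1 <= M" and F: "F \<in> borel_measurable (PiM {..<M} (\<lambda>_. borel))"
  and cont: "!!u v. (!!j. j < M ==> (\<lambda>n. u n j) \<longlonglongrightarrow> v j) ==> (\<lambda>n. F (u n)) \<longlonglongrightarrow> F v"
  and e: "0 < e"
 shows "\<forall>\<^sub>F n in sequentially. \<P>(z in \<pi>. c <= F (\<lambda>j\<in>{..<M}. incs M n j z)) <= \<P>(w in Q. c <= F (\<lambda>j\<in>{..<M}. gauss M j w)) + e"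
proof -
 have "\<forall>\<^sub>F n in sequentially. \<P>(z in \<pi>. c <= F (\<lambda>j\<in>{..<M}. incs M (Suc n) j z)) <= \<P>(w in Q. c <= F (\<lambda>j\<in>{..<M}. gauss M j w)) + e"
 proof (rule weak_conv_joint[OF pi.prob_space_axioms BM.prob_space_axioms M _ gauss_indep[OF M] _ F cont e])
  show "pi.indep_vars (\<lambda>_. borel) (incs M (Suc n)) {..<M}" for n by (rule indep_incs[OF _ M]) simp
  show "weak_conv_m (\<lambda>n. distr \<pi> borel (incs M (Suc n) j)) (distr Q borel (gauss M j))" if "j < M" for j
   unfolding gauss_law[OF M] by (rule weak_conv_incs[OF M that])
 qed
 then show ?thesis by (subst (asm) eventually_sequentially_Suc)
qed

lemma incs_limit_dPsi:
 assumes M: "2 <= M" and e: "0 < e"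
 shows "\<forall>\<^sub>F n in sequentially. \<P>(z in \<pi>. c <= dPsi q M (\<lambda>i. poly_path n (yt M n z) (real i / real M)))
  <= \<P>(w in Q. c / \<sigma>2 <= dPsi q M (\<lambda>i. W (real i / real M) w)) + e"
proof -
 have M1: "1 <= M" using M by simp
 \<comment> \<open>\<open>min i M\<close> makes F depend on the coordinates below M alone, as
   measurability on the finite product demands.\<close>
 define F where "F u = dPsi q M (\<lambda>i. (\<Sum>k<min i M. u k) / sqrt (real M))" for u
 have F: "F \<in> borel_measurable (PiM {..<M} (\<lambda>_. borel))"
  unfolding F_def[abs_def]
 proof (rule measurable_dPsi)
  fix i show "(\<lambda>u. (\<Sum>k<min i M. u k) / sqrt (real M)) \<in> borel_measurable (PiM {..<M} (\<lambda>_. borel))"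
   by (intro borel_measurable_divide borel_measurable_sum borel_measurable_const measurable_component_singleton) auto
 qed
 have cont: "(\<lambda>n. F (u n)) \<longlonglongrightarrow> F v" if "!!j. j < M ==> (\<lambda>n. u n j) \<longlonglongrightarrow> v j" for u v
  unfolding F_def by (intro dPsi_continuous M tendsto_intros that) (use M in auto)
 have Fr: "F (\<lambda>j\<in>{..<M}. u j) = dPsi q M (\<lambda>i. (\<Sum>k<i. u k) / sqrt (real M))" for u
  unfolding F_def
 proof (rule dPsi_cong)
  fix i assume i: "i <= M"
  have "(\<Sum>k<min i M. (\<lambda>j\<in>{..<M}. u j) k) = (\<Sum>k<i. u k)" by (rule sum.cong) (use i in auto)
  then show "(\<Sum>k<min i M. (\<lambda>j\<in>{..<M}. u j) k) / sqrt (real M) = (\<Sum>k<i. u k) / sqrt (real M)" by simp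
 qed
 have inc: "dPsi q M (\<lambda>i. poly_path n (yt M n z) (real i / real M)) = F (\<lambda>j\<in>{..<M}. incs M n j z)" if "1 <= n" for n z
  unfolding Fr by (rule dPsi_cong) (rule poly_yt_grid[OF that M1])
 have lim: "F (\<lambda>j\<in>{..<M}. gauss M j w) = \<sigma>2 * dPsi q M (\<lambda>i. W (real i / real M) w)" if "w \<in> space Q" for w
  unfolding Fr gauss_sum[OF M1 that] dPsi_scale[OF M] using \<sigma>2_pos by simp
 have eq: "\<P>(w in Q. c <= F (\<lambda>j\<in>{..<M}. gauss M j w)) = \<P>(w in Q. c / \<sigma>2 <= dPsi q M (\<lambda>i. W (real i / real M) w))"
  by (rule arg_cong[where f = "measure Q"]) (use \<sigma>2_pos in \<open>auto simp: lim divide_le_eq mult.commute\<close>)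
 have "\<forall>\<^sub>F n in sequentially. \<P>(z in \<pi>. c <= F (\<lambda>j\<in>{..<M}. incs M n j z)) <= \<P>(w in Q. c <= F (\<lambda>j\<in>{..<M}. gauss M j w)) + e"
  by (rule incs_limit[where F = F, OF M1 F _ e]) (rule cont)
 with eventually_ge_at_top[of 1] show ?thesis
 proof eventually_elim
  case (elim n)
  then show ?case unfolding inc[OF elim(1)] eq by simp
 qed
qed

lemma replacement_tail:
 assumes M: "1 <= M" and d: "0 < d" and e: "0 < e"
 shows "\<forall>\<^sub>F n in sequentially.
  (\<lambda>z. rmax (\<lambda>k. \<bar>ysum n k z - (\<Sum>i=1..k. yt M n z i)\<bar>) n) \<in> borel_measurable \<pi> \<and>
  \<P>(z in \<pi>. d * sqrt (real n) < rmax (\<lambda>k. \<bar>ysum n k z - (\<Sum>i=1..k. yt M n z i)\<bar>) n) <= e"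
proof -
 have "(\<lambda>n. replacement_bound M n / d^2) \<longlonglongrightarrow> 0 / d^2" using d by (intro tendsto_intros replacement_bound_tendsto M) auto
 then have "\<forall>\<^sub>F n in sequentially. replacement_bound M n / d^2 < e" using e by (intro order_tendstoD(2)) auto
 then show ?thesis using eventually_ge_at_top[of 1]
 proof eventually_elim
  case (elim n)
  let ?r = "\<lambda>z. rmax (\<lambda>k. \<bar>ysum n k z - (\<Sum>i=1..k. yt M n z i)\<bar>) n"
  have mr: "?r \<in> borel_measurable \<pi>"
   using measurable_yt[OF elim(2) M] by (intro measurable_rmax borel_measurable_abs borel_measurable_diff borel_measurable_sum measurable_ysum)
  have "\<P>(z in \<pi>. d * sqrt (real n) < ?r z) <= (real n * replacement_bound M n) / (d * sqrt (real n))^2"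
   by (rule pi.moment_tail[OF mr replacement_error(1)[OF elim(2) M] _ _ replacement_error(2)[OF elim(2) M]])
    (use d elim(2) in \<open>auto intro: rmax_nonneg\<close>)
  also have "\<dots> = replacement_bound M n / d^2" using elim(2) by (simp add: power_mult_distrib)
  finally show ?case using mr elim(1) by auto
 qed
qed

text \<open>The order of choices matters: a bounds the path and fixes the Lipschitz constant C;
  \<open>et\<close> is the slack in the limit event; \<open>ep\<close>, the tolerance for paths, is
  chosen small in terms of both; M makes tightness, the grid approximation and 1 / M <
  \<open>ep\<close> hold; n comes last.\<close>

theorem level:
 assumes e: "0 < e"
 shows "\<forall>\<^sub>F n in sequentially. \<P>(z in \<pi>. 0 < dPsi q n (\<lambda>k. ysum n k z / sqrt (real n)))
  <= \<P>(w in Q. 0 <= cPsi q (\<lambda>t. W t w)) + e"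
proof -
 \<comment> \<open>Six errors: the events \<open>?A1\<close>, \<open>?A2\<close> and
   \<open>?A3\<close>, the weak limit for M increments, the grid of size M in place of the path, and
   the slack \<open>et\<close>.\<close>
 define e' where "e' = e / 6"
 have e': "0 < e'" using e by (simp add: e'_def)
 define a where "a = sqrt (16 * (\<Theta> 0)^2 / e') + 1"
 have a: "0 < a" by (simp add: a_def add_nonneg_pos e' less_imp_le)
 have a2: "16 * (\<Theta> 0)^2 / a^2 <= e'"
 proof -
  have "16 * (\<Theta> 0)^2 / e' = (sqrt (16 * (\<Theta> 0)^2 / e'))^2" using e' by simp
  also have "\<dots> <= a^2" unfolding a_def using e' by (intro power_mono) auto
  finally show ?thesis using e' a by (simp add: divide_le_eq mult.commute)
 qed
 define C where "C = psi_mod q (a + 1)"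
 have C: "0 <= C" unfolding C_def using a by (intro psi_mod_nonneg) simp
 have "\<forall>\<^sub>F k in sequentially. \<P>(w in Q. 0 <= cPsi q (\<lambda>t. W t w) + 1 / real (Suc k)) <= \<P>(w in Q. 0 <= cPsi q (\<lambda>t. W t w)) + e'"
 proof (rule BM.prob_ge_limit[OF _ _ _ e'])
  show "(\<lambda>k. cPsi q (\<lambda>t. W t w) + 1 / real (Suc k)) \<longlonglongrightarrow> cPsi q (\<lambda>t. W t w)" for w
   using tendsto_add[OF tendsto_const LIMSEQ_Suc[OF lim_1_over_n]] by (metis add.right_neutral)
 qed measurable
 then obtain k where k: "\<P>(w in Q. 0 <= cPsi q (\<lambda>t. W t w) + 1 / real (Suc k)) <= \<P>(w in Q. 0 <= cPsi q (\<lambda>t. W t w)) + e'"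
  by (auto simp: eventually_sequentially)
 define et where "et = 1 / real (Suc k)"
 have et: "0 < et" by (simp add: et_def)
 have k': "\<P>(w in Q. - et <= cPsi q (\<lambda>t. W t w)) <= \<P>(w in Q. 0 <= cPsi q (\<lambda>t. W t w)) + e'"
 proof -
  have "(- et <= x) = (0 <= x + 1 / real (Suc k))" for x unfolding et_def by linarith
  then show ?thesis using k by simp
 qed
 \<comment> \<open>18 is twice the 9 of \<open>dPsi_transfer\<close>, as 1 / M < \<open>ep\<close>;
   \<open>\<sigma>2\<close> enters because the limit path is \<open>sqrt \<sigma>2\<close> times
   W.\<close>
 define ep where "ep = min 1 (et * \<sigma>2 / (18 * C + 1))"
 have ep: "0 < ep" "ep <= 1" using et \<sigma>2_pos C by (auto simp: ep_def)
 have epC: "18 * C * ep / \<sigma>2 <= et"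
 proof -
  have "(18 * C + 1) * ep <= (18 * C + 1) * (et * \<sigma>2 / (18 * C + 1))" using C by (intro mult_left_mono) (auto simp: ep_def)
  also have "\<dots> = et * \<sigma>2" using C by simp
  finally have "18 * C * ep <= et * \<sigma>2" using ep by (simp add: algebra_simps)
  then show ?thesis using \<sigma>2_pos by (simp add: divide_le_eq)
 qed
 obtain M0 where M0: "!!M n. M0 <= M ==> 3 * M <= n ==> \<P>(z in \<pi>. \<exists>r<M. ep / 3 * sqrt (real n) <
  rmax (\<lambda>j. \<bar>ysum n (r * (n div M + 3) + j) z - ysum n (r * (n div M + 3)) z\<bar>) (n div M + 3)) <= e'"
  using tightness[of "ep / 3" e'] ep e' by auto
 have "\<forall>\<^sub>F M in sequentially. \<P>(w in Q. - et <= dPsi q M (\<lambda>i. W (real i / real M) w)) <= \<P>(w in Q. - et <= cPsi q (\<lambda>t. W t w)) + e'"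
  by (rule BM.prob_ge_limit[OF _ _ BM.dPsi_W_tendsto e']) (auto intro!: measurable_dPsi BM.measurable_W)
 moreover have "\<forall>\<^sub>F M in sequentially. 1 / real M < ep" by (rule order_tendstoD(2)[OF lim_1_over_n ep(1)])
 ultimately have "\<forall>\<^sub>F M in sequentially. \<P>(w in Q. - et <= dPsi q M (\<lambda>i. W (real i / real M) w)) <= \<P>(w in Q. - et <= cPsi q (\<lambda>t. W t w)) + e'
   \<and> 1 / real M < ep \<and> max 2 M0 <= M"
  using eventually_ge_at_top[of "max 2 M0"] by eventually_elim blast
 then obtain M where M: "\<P>(w in Q. - et <= dPsi q M (\<lambda>i. W (real i / real M) w)) <= \<P>(w in Q. - et <= cPsi q (\<lambda>t. W t w)) + e'"
   "1 / real M < ep" "max 2 M0 <= M" by (auto simp: eventually_sequentially)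
 have M2: "2 <= M" "1 <= M" using M(3) by auto
 have thr: "\<P>(w in Q. - (18 * C * ep) / \<sigma>2 <= dPsi q M (\<lambda>i. W (real i / real M) w)) <= \<P>(w in Q. - et <= dPsi q M (\<lambda>i. W (real i / real M) w))"
 proof (rule BM.finite_measure_mono)
  have [measurable]: "(\<lambda>w. dPsi q M (\<lambda>i. W (real i / real M) w)) \<in> borel_measurable Q"
   by (intro measurable_dPsi BM.measurable_W) simp
  show "{w \<in> space Q. - et <= dPsi q M (\<lambda>i. W (real i / real M) w)} \<in> sets Q" by measurable
 qed (use epC in auto)
 show ?thesis
  using replacement_tail[OF M2(2) ep(1) e'] incs_limit_dPsi[OF M2(1) e', of "- (18 * C * ep)" q] eventually_ge_at_top[of "3 * M"]
 proof eventually_elim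
  case (elim n)
  let ?K = "n div M + 3"
  have n: "1 <= n" "M <= n" using elim(3) M2 by auto
  let ?r = "\<lambda>z. rmax (\<lambda>k. \<bar>ysum n k z - (\<Sum>i=1..k. yt M n z i)\<bar>) n"
  let ?A1 = "{z \<in> space \<pi>. a * sqrt (real n) < rmax (\<lambda>k. \<bar>ysum n k z\<bar>) n}"
  let ?A2 = "{z \<in> space \<pi>. ep * sqrt (real n) < ?r z}"
  let ?A3 = "{z \<in> space \<pi>. \<exists>r<M. ep / 3 * sqrt (real n) < rmax (\<lambda>j. \<bar>ysum n (r * ?K + j) z - ysum n (r * ?K) z\<bar>) ?K}"
  let ?A4 = "{z \<in> space \<pi>. - (18 * C * ep) <= dPsi q M (\<lambda>i. poly_path n (yt M n z) (real i / real M))}"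
  have P1: "pi.prob ?A1 <= e'" using ysum_max_tail[OF n(1) a] a2 by linarith
  have P3: "pi.prob ?A3 <= e'" by (rule M0) (use M(3) elim(3) in auto)
  have S1: "?A1 \<in> sets \<pi>" by measurable
  have S2: "?A2 \<in> sets \<pi>" by (rule borel_measurable_less[OF borel_measurable_const conjunct1[OF elim(1)]])
  have S3: "?A3 \<in> sets \<pi>" by measurable
  have S4: "?A4 \<in> sets \<pi>"
   using measurable_yt[OF n(1) M2(2)] unfolding poly_path_def
   by (intro borel_measurable_le borel_measurable_const measurable_dPsi borel_measurable_divide borel_measurable_sum borel_measurable_times)
  have incl: "{z \<in> space \<pi>. 0 < dPsi q n (\<lambda>k. ysum n k z / sqrt (real n))} \<subseteq> ((?A1 \<union> ?A2) \<union> ?A3) \<union> ?A4"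
  proof (rule subsetI, rule ccontr)
   fix z assume z: "z \<in> {z \<in> space \<pi>. 0 < dPsi q n (\<lambda>k. ysum n k z / sqrt (real n))}"
    and no: "z \<notin> ((?A1 \<union> ?A2) \<union> ?A3) \<union> ?A4"
   have sp: "z \<in> space \<pi>" and pos: "0 < dPsi q n (\<lambda>k. ysum n k z / sqrt (real n))" using z by blast+
   have n1: "rmax (\<lambda>k. \<bar>ysum n k z\<bar>) n <= a * sqrt (real n)" using no sp by force
   have n2: "?r z <= ep * sqrt (real n)" using no sp by force
   have n3: "rmax (\<lambda>j. \<bar>ysum n (r * ?K + j) z - ysum n (r * ?K) z\<bar>) ?K <= ep / 3 * sqrt (real n)" if "r < M" for r
    using no sp that by force
   have n4: "dPsi q M (\<lambda>i. poly_path n (yt M n z) (real i / real M)) < - (18 * C * ep)" using no sp by force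
   let ?y = "\<lambda>i. on {1..n} n h i (lag (int i) z)" and ?y' = "yt M n z"
   have sn: "0 < sqrt (real n)" using n by simp
   have sy: "(\<Sum>i=1..k. ?y i) = ysum n k z" for k unfolding ysum_def lagsum_def ..
   have d: "\<bar>(\<Sum>i=1..k. ?y i) / sqrt (real n) - (\<Sum>i=1..k. ?y' i) / sqrt (real n)\<bar> <= ep" if "k <= n" for k
   proof -
    have "\<bar>ysum n k z - (\<Sum>i=1..k. ?y' i)\<bar> <= ep * sqrt (real n)"
     using le_rmax[OF that, of "\<lambda>k. \<bar>ysum n k z - (\<Sum>i=1..k. yt M n z i)\<bar>"] n2 by linarith
    then show ?thesis using sn unfolding sy by (simp add: diff_divide_distrib[symmetric] abs_divide divide_le_eq)
   qed
   have b: "\<bar>(\<Sum>i=1..k. ?y i) / sqrt (real n)\<bar> <= a" if "k <= n" for k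
   proof -
    have "\<bar>ysum n k z\<bar> <= a * sqrt (real n)" using le_rmax[OF that, of "\<lambda>k. \<bar>ysum n k z\<bar>"] n1 by linarith
    then show ?thesis using sn unfolding sy by (simp add: abs_divide divide_le_eq)
   qed
   have osc: "osc (1 / real M) ep (poly_path n ?y)"
   proof (rule osc_poly[OF n(1)])
    have "n < M * (n div M) + M" using dividend_less_times_div[of M n] M2 by simp
    then have nK: "n < M * (n div M + 1)" by simp
    then have "real n < real M * (real (n div M) + 1)" by (metis of_nat_less_iff of_nat_mult of_nat_add of_nat_1)
    then have "real n / real M < real (n div M) + 1" using M2 by (simp add: divide_less_eq mult.commute)
    then show "real n * (1 / real M) + 2 <= real ?K" by simp
    fix k l assume kl: "k <= n" "l <= n" "k <= l" "l <= k + ?K"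
    have "\<bar>ysum n k z - ysum n l z\<bar> <= 3 * (ep / 3 * sqrt (real n))"
    proof (rule block_increment[of ?K n])
     fix r j assume r: "r * ?K <= n" and j: "j <= ?K"
     \<comment> \<open>M blocks of length \<open>?K\<close> exceed the sample, so a block that
       starts at or before n is among the first M.\<close>
     have "r < M"
     proof (rule ccontr)
      assume "\<not> r < M"
      then have "M * ?K <= r * ?K" by (intro mult_right_mono) auto
      moreover have "M * (n div M + 1) <= M * ?K" by (intro mult_left_mono) auto
      ultimately show False using r nK by linarith
     qed
     then show "\<bar>ysum n (r * ?K + j) z - ysum n (r * ?K) z\<bar> <= ep / 3 * sqrt (real n)"
      using le_rmax[OF j, of "\<lambda>j. \<bar>ysum n (r * ?K + j) z - ysum n (r * ?K) z\<bar>"] n3[of r] by linarith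
    qed (use kl in auto)
    then show "\<bar>(\<Sum>i=1..k. ?y i) / sqrt (real n) - (\<Sum>i=1..l. ?y i) / sqrt (real n)\<bar> <= ep"
     using sn unfolding sy by (simp add: diff_divide_distrib[symmetric] abs_divide divide_le_eq)
   qed
   have "dPsi q n (\<lambda>k. (\<Sum>i=1..k. ?y i) / sqrt (real n)) <=
    dPsi q M (\<lambda>i. poly_path n ?y' (real i / real M)) + 9 * psi_mod q (a + 1) * (ep + 1 / real M)"
   proof (rule dPsi_transfer[OF n(2) M2(1) _ _ d osc])
    show "\<bar>(\<Sum>i=1..k. ?y i) / sqrt (real n)\<bar> <= a + 1" if "k <= n" for k using b[OF that] by linarith
    show "\<bar>(\<Sum>i=1..k. ?y' i) / sqrt (real n)\<bar> <= a + 1" if "k <= n" for k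
     using b[OF that] d[OF that] ep(2) by linarith
   qed
   moreover have "9 * C * (ep + 1 / real M) <= 9 * C * (ep + ep)" using M(2) C by (intro mult_left_mono) auto
   moreover have "9 * C * (ep + ep) = 18 * C * ep" by simp
   ultimately show False using pos n4 unfolding sy C_def[symmetric] by linarith
  qed
  have "pi.prob {z \<in> space \<pi>. 0 < dPsi q n (\<lambda>k. ysum n k z / sqrt (real n))} <= pi.prob (((?A1 \<union> ?A2) \<union> ?A3) \<union> ?A4)"
   by (rule pi.finite_measure_mono[OF incl]) (intro sets.Un S1 S2 S3 S4)
  also have "\<dots> <= pi.prob ((?A1 \<union> ?A2) \<union> ?A3) + pi.prob ?A4" by (intro measure_Un_le sets.Un S1 S2 S3 S4)
  also have "pi.prob ((?A1 \<union> ?A2) \<union> ?A3) <= pi.prob (?A1 \<union> ?A2) + pi.prob ?A3" by (intro measure_Un_le sets.Un S1 S2 S3)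
  also have "pi.prob (?A1 \<union> ?A2) <= pi.prob ?A1 + pi.prob ?A2" by (intro measure_Un_le S1 S2)
  finally show ?case using P1 P3 elim(1,2) thr M(1) k' unfolding e'_def by linarith
 qed
qed

end

section \<open>Consistency\<close>

lemma dV2_eq_0D:
 assumes z: "dV2 n p k = 0" and n: "1 <= n"
 shows "i \<in> {1..k} ==> p i = real i / real k * p k"
  "i \<in> {k+1..n} ==> p n - p i = (real n - real i) / (real n - real k) * (p n - p k)"
proof -
 let ?a = "\<lambda>i. (p i - real i / real k * p k)^2"
 let ?b = "\<lambda>i. (p n - p i - (real n - real i) / (real n - real k) * (p n - p k))^2"
 have "sum ?a {1..k} + sum ?b {k+1..n} = 0" using z n by (simp add: dV2_def)
 moreover have "0 <= sum ?a {1..k}" "0 <= sum ?b {k+1..n}" by (intro sum_nonneg; simp)+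
 ultimately have s: "sum ?a {1..k} = 0" "sum ?b {k+1..n} = 0" by linarith+
 show "i \<in> {1..k} ==> p i = real i / real k * p k" using sum_nonneg_0[OF _ _ s(1), of i] by simp
 show "i \<in> {k+1..n} ==> p n - p i = (real n - real i) / (real n - real k) * (p n - p k)"
  using sum_nonneg_0[OF _ _ s(2), of i] by simp
qed

text \<open>Where \<open>dV2\<close> vanishes, the quotient in the statistic is the junk value \<open>0\<close>. Zeros at two
 adjacent points force a linear path, so one of two adjacent candidates always detects the drift.\<close>

lemma dbridge_eq_0:
 assumes z: "dV2 n p k = 0" "dV2 n p (k + 1) = 0" and k: "1 <= k" "k + 1 < n"
 shows "dbridge n p k = 0"
proof -
 have 1: "p k = real k / (real k + 1) * p (k + 1)" using dV2_eq_0D(1)[OF z(2), of k] k by simp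
 have 2: "p n - p (k + 1) = (real n - (real k + 1)) / (real n - real k) * (p n - p k)"
  using dV2_eq_0D(2)[OF z(1), of "k + 1"] k by simp
 have kn: "real n - real k \<noteq> 0" "real k + 1 \<noteq> 0" "real n \<noteq> 0" using k by auto
 have "(real k + 1) * p k = real k * p (k + 1)" using 1 kn(2) by (simp add: field_simps)
 moreover have "(real n - real k) * (p n - p (k + 1)) = (real n - (real k + 1)) * (p n - p k)" using 2 kn(1) by simp
 ultimately have "(real n * p k - real k * p n) * (real k + 1 - real k) = 0" by algebra
 then show ?thesis using kn(3) by (simp add: dbridge_def field_simps)
qed

lemma dV2_le:
 assumes k: "1 <= k" "k < n" and m: "!!i. i <= n ==> \<bar>p i\<bar> <= m"
 shows "dV2 n p k <= 4 * m^2" "\<bar>dbridge n p k\<bar> <= 2 * m"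
proof -
 have m0: "0 <= m" using m[of 0] by simp
 have ad: "\<bar>a - b\<bar> <= 2 * m" if "\<bar>a\<bar> <= m" "\<bar>b\<bar> <= m" for a b using that by linarith
 have sq: "x^2 <= 4 * m^2" if "\<bar>x\<bar> <= 2 * m" for x
  using power_mono[OF that abs_ge_zero, of 2] by (simp add: power_mult_distrib)
 have 1: "(p i - real i / real k * p k)^2 <= 4 * m^2" if "i \<in> {1..k}" for i
 proof (rule sq)
  have "\<bar>real i / real k * p k\<bar> <= 1 * m" unfolding abs_mult using that k m[of k] by (intro mult_mono) auto
  moreover have "\<bar>p i\<bar> <= m" using that k by (intro m) simp
  ultimately show "\<bar>p i - real i / real k * p k\<bar> <= 2 * m" by (intro ad) simp_all
 qed
 have 2: "(p n - p i - (real n - real i) / (real n - real k) * (p n - p k))^2 <= 4 * m^2" if "i \<in> {k+1..n}" for i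
 proof (rule sq)
  define r where "r = (real n - real i) / (real n - real k)"
  have r: "r \<in> {0..1}" using that k by (auto simp: r_def divide_le_eq)
  have "\<bar>((1 - r) * p n + r * p k) - ((1 - r) * p i + r * p i)\<bar> <= 2 * m"
  proof (rule convex_comb_diff[OF _ _ r])
   show "\<bar>p n - p i\<bar> <= 2 * m" "\<bar>p k - p i\<bar> <= 2 * m" using m[of n] m[of i] m[of k] that k by (auto simp: abs_le_iff)
  qed
  moreover have "((1 - r) * p n + r * p k) - ((1 - r) * p i + r * p i) = p n - p i - r * (p n - p k)" by (simp add: algebra_simps)
  ultimately show "\<bar>p n - p i - (real n - real i) / (real n - real k) * (p n - p k)\<bar> <= 2 * m" unfolding r_def by simp
 qed
 have "dV2 n p k <= ((\<Sum>i=1..k. 4 * m^2) + (\<Sum>i=k+1..n. 4 * m^2)) / real n"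
  unfolding dV2_def by (intro divide_right_mono add_mono sum_mono 1 2) auto
 also have "\<dots> = 4 * m^2" using k by (simp add: of_nat_diff field_simps)
 finally show "dV2 n p k <= 4 * m^2" .
 have "\<bar>real k / real n * p n\<bar> <= 1 * m" unfolding abs_mult using k m[of n] by (intro mult_mono) auto
 moreover have "\<bar>p k\<bar> <= m" using k by (intro m) simp
 ultimately show "\<bar>dbridge n p k\<bar> <= 2 * m" unfolding dbridge_def by (intro ad) simp_all
qed

lemma change_dV2:
 assumes k: "1 <= k" "k < n"
 shows "dV2 n (\<lambda>i. p i + d * (real i - real k) * of_bool (k < i)) k = dV2 n p k"
  "dbridge n (\<lambda>i. p i + d * (real i - real k) * of_bool (k < i)) k = dbridge n p k - d * real k * (1 - real k / real n)"
proof -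
 have "(\<Sum>i=k+1..n. ((p n + d * (real n - real k) * of_bool (k < n)) - (p i + d * (real i - real k) * of_bool (k < i))
   - (real n - real i) / (real n - real k) * ((p n + d * (real n - real k) * of_bool (k < n)) - (p k + d * (real k - real k) * of_bool (k < k))))^2) =
  (\<Sum>i=k+1..n. (p n - p i - (real n - real i) / (real n - real k) * (p n - p k))^2)"
 proof (intro sum.cong refl arg_cong[where f = "\<lambda>x. x^2"])
  fix i assume i: "i \<in> {k+1..n}"
  define r where "r = (real n - real i) / (real n - real k)"
  have r: "d * (r * (real n - real k)) = d * (real n - real i)" using k by (simp add: r_def)
  have b: "of_bool (k < n) = (1::real)" "of_bool (k < i) = (1::real)" using k i by auto
  show "(p n + d * (real n - real k) * of_bool (k < n)) - (p i + d * (real i - real k) * of_bool (k < i))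
   - (real n - real i) / (real n - real k) * ((p n + d * (real n - real k) * of_bool (k < n)) - (p k + d * (real k - real k) * of_bool (k < k)))
   = p n - p i - (real n - real i) / (real n - real k) * (p n - p k)"
   unfolding b r_def[symmetric] using r by (simp add: algebra_simps)
 qed
 moreover have "(\<Sum>i=1..k. ((p i + d * (real i - real k) * of_bool (k < i)) - real i / real k * (p k + d * (real k - real k) * of_bool (k < k)))^2) =
  (\<Sum>i=1..k. (p i - real i / real k * p k)^2)"
  by (rule sum.cong) auto
 ultimately show "dV2 n (\<lambda>i. p i + d * (real i - real k) * of_bool (k < i)) k = dV2 n p k" unfolding dV2_def by simp
 show "dbridge n (\<lambda>i. p i + d * (real i - real k) * of_bool (k < i)) k = dbridge n p k - d * real k * (1 - real k / real n)"
  using k unfolding dbridge_def by (simp add: field_simps)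
qed

text \<open>\<open>dV2\<close> is at most 4 m^2 and the unshifted bridge at most 2 m; a shift beyond
  2 (1 + q) m leaves a bridge larger than 2 q m.\<close>

lemma change_dpsi:
 assumes q: "0 <= q" and k: "1 <= k" "k < n" and m: "!!i. i <= n ==> \<bar>p i\<bar> <= m"
  and large: "2 * (1 + q) * m < \<bar>d * real k * (1 - real k / real n)\<bar>"
 shows "0 < dpsi q n (\<lambda>i. p i + d * (real i - real k) * of_bool (k < i)) k"
proof -
 let ?D = "dbridge n p k - d * real k * (1 - real k / real n)"
 have "\<bar>dbridge n p k\<bar> <= 2 * m" by (rule dV2_le(2)[OF k m])
 then have "\<bar>2 * q * m\<bar> < \<bar>?D\<bar>" using large m[of 0] q by (simp add: algebra_simps)
 then have "(2 * q * m)^2 < ?D^2" by (metis abs_le_square_iff not_le)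
 moreover have "q^2 * dV2 n p k <= q^2 * (4 * m^2)" by (intro mult_left_mono dV2_le(1) k m) simp_all
 ultimately show ?thesis unfolding dpsi_def change_dV2[OF k] by (simp add: power_mult_distrib)
qed

lemma sum_change:
 "(\<Sum>i=1..j. y i + (if k < i then d else 0)) / s = (\<Sum>i=1..j. y i) / s + d / s * (real j - real k) * of_bool (k < j)" for d s :: real
proof -
 have "(\<Sum>i=1..j. if k < i then d else 0) = (\<Sum>i\<in>{k+1..j}. d)"
  by (rule sum.mono_neutral_cong_right) auto
 also have "\<dots> = d * (real j - real k) * of_bool (k < j)" by (cases "k < j") (auto simp: of_nat_diff)
 finally show ?thesis by (simp add: sum.distrib add_divide_distrib)
qed

context limit_test
begin

lemma floor_ratio:
 assumes p: "0 < p" "p < 1"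
 shows "(\<lambda>n. real (nat \<lfloor>p * real n\<rfloor>) / real n) \<longlonglongrightarrow> p"
proof (rule LIM_zero_cancel, rule Lim_null_comparison[OF _ lim_const_over_n[of 1]])
 show "\<forall>\<^sub>F n in sequentially. norm (real (nat \<lfloor>p * real n\<rfloor>) / real n - p) <= 1 / real n"
  using eventually_gt_at_top[of 0]
 proof eventually_elim
  case (elim n)
  have "0 <= p * real n" using p by simp
  then have f: "real (nat \<lfloor>p * real n\<rfloor>) <= p * real n" "p * real n < real (nat \<lfloor>p * real n\<rfloor>) + 1" by auto
  have "real (nat \<lfloor>p * real n\<rfloor>) / real n - p = (real (nat \<lfloor>p * real n\<rfloor>) - p * real n) / real n"
   using elim by (simp add: diff_divide_distrib)
  also have "\<bar>\<dots>\<bar> <= 1 / real n"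
  proof -
   have "\<bar>real (nat \<lfloor>p * real n\<rfloor>) - p * real n\<bar> <= 1" using f by linarith
   then show ?thesis unfolding abs_divide abs_of_nat by (rule divide_right_mono) simp
  qed
  finally show ?case by simp
 qed
qed

text \<open>One inclusion is enough for the level: rejection forces the maximum of
  \<open>dpsi\<close> to be positive, wherever \<open>dV2\<close> may vanish.\<close>

theorem level_test:
 assumes q: "0 <= q" and e: "0 < e"
 shows "\<forall>\<^sub>F n in sequentially. \<P>(z in \<pi>. q < test_stat (\<lambda>i. h (real i / real n) (lag (int i) z)) n)
  <= \<P>(w in Q. 0 <= cPsi q (\<lambda>t. W t w)) + e"
 using level[OF e, of q] eventually_ge_at_top[of 2]
proof eventually_elim
 case (elim n)
 have mP: "{z \<in> space \<pi>. 0 < dPsi q n (\<lambda>k. ysum n k z / sqrt (real n))} \<in> sets \<pi>"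
  by (intro borel_measurable_less borel_measurable_const measurable_dPsi) measurable
 have "\<P>(z in \<pi>. q < test_stat (\<lambda>i. h (real i / real n) (lag (int i) z)) n) <= \<P>(z in \<pi>. 0 < dPsi q n (\<lambda>k. ysum n k z / sqrt (real n)))"
 proof (rule pi.finite_measure_mono[OF _ mP], rule subsetI)
  fix z assume "z \<in> {z \<in> space \<pi>. q < test_stat (\<lambda>i. h (real i / real n) (lag (int i) z)) n}"
  then have sp: "z \<in> space \<pi>" and t: "q < test_stat (\<lambda>i. h (real i / real n) (lag (int i) z)) n" by blast+
  obtain k where k: "k \<in> {1..n-1}" and k2: "0 < dpsi q n (\<lambda>k. (\<Sum>i=1..k. h (real i / real n) (lag (int i) z)) / sqrt (real n)) k"
   using t unfolding test_stat_gt[OF q elim(2)] by blast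
  note k2
  also have "dpsi q n (\<lambda>k. (\<Sum>i=1..k. h (real i / real n) (lag (int i) z)) / sqrt (real n)) k = dpsi q n (\<lambda>k. ysum n k z / sqrt (real n)) k"
   by (rule dpsi_cong) (use k in \<open>auto simp: ysum_eq\<close>)
  also have "\<dots> <= dPsi q n (\<lambda>k. ysum n k z / sqrt (real n))"
   unfolding dPsi_def by (intro Max_ge finite_imageI imageI k) simp
  finally show "z \<in> {z \<in> space \<pi>. 0 < dPsi q n (\<lambda>k. ysum n k z / sqrt (real n))}" using sp by simp
 qed
 then show ?case using elim(1) by linarith
qed

text \<open>Both k and k + 1 are candidates, since \<open>dV2\<close> may vanish at one of them.
  Unless some partial sum exceeds n r, an event of probability of order 1 / n, \<open>dpsi\<close>
  is positive at both: r is such that the noise takes up half of |d| c \<open>sqrt n\<close>, where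
  c is half the limit of (k / n) (1 - k / n). The remaining half absorbs the shift of the change
  point by one index.\<close>

theorem consistency:
 fixes d :: real
 assumes q: "0 <= q" and th: "0 < th" "th < 1" and d: "d \<noteq> 0" and e: "0 < e"
 shows "\<forall>\<^sub>F n in sequentially. \<P>(z in \<pi>. \<not> q < test_stat (\<lambda>i. h (real i / real n) (lag (int i) z) + (if nat \<lfloor>th * real n\<rfloor> < i then d else 0)) n) <= e"
proof -
 define c where "c = th * (1 - th) / 2"
 have c: "0 < c" using th by (simp add: c_def)
 define r where "r = \<bar>d\<bar> * c / (4 * (1 + q))"
 have r: "0 < r" using c d q by (simp add: r_def)
 have "(\<lambda>n. real (nat \<lfloor>th * real n\<rfloor> + j) / real n * (1 - real (nat \<lfloor>th * real n\<rfloor> + j) / real n)) \<longlonglongrightarrow> (th + 0) * (1 - (th + 0))" for j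
  unfolding of_nat_add add_divide_distrib by (intro tendsto_intros floor_ratio th lim_const_over_n)
 then have ev: "\<forall>\<^sub>F n in sequentially. c < real (nat \<lfloor>th * real n\<rfloor> + j) / real n * (1 - real (nat \<lfloor>th * real n\<rfloor> + j) / real n)" for j
  by (rule order_tendstoD(1)) (use c in \<open>simp add: c_def\<close>)
 have "(\<lambda>n. 16 * (\<Theta> 0)^2 / r^2 / real n) \<longlonglongrightarrow> 0" by (rule lim_const_over_n)
 then have ev2: "\<forall>\<^sub>F n in sequentially. 16 * (\<Theta> 0)^2 / r^2 / real n < e" using e by (intro order_tendstoD(2)) auto
 show ?thesis
  using ev[of 0] ev[of 1] ev2 eventually_ge_at_top[of "max 2 (nat \<lceil>4 * (1 + q) / c\<rceil>)"]
 proof eventually_elim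
  case (elim n)
  define k where "k = nat \<lfloor>th * real n\<rfloor>"
  have n: "2 <= n" "4 * (1 + q) / c <= real n" using elim(4) by auto
  have kc: "c < real j / real n * (1 - real j / real n)" if "j \<in> {k, k + 1}" for j
   using elim(1,2) that by (auto simp: k_def)
  have j: "1 <= j \<and> j < n" if "j \<in> {k, k + 1}" for j
  proof -
   have p: "0 < real j / real n * (1 - real j / real n)" using kc[OF that] c by linarith
   then have j: "j \<noteq> 0" by (metis div_0 mult_zero_left of_nat_0 less_irrefl)
   have "0 < 1 - real j / real n" by (rule zero_less_mult_pos[OF p]) (use j n in simp)
   then show ?thesis using n j by (simp add: divide_less_eq)
  qed
  let ?A = "{z \<in> space \<pi>. sqrt (real n) * r * sqrt (real n) < rmax (\<lambda>k. \<bar>ysum n k z\<bar>) n}"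
  have "{z \<in> space \<pi>. \<not> q < test_stat (\<lambda>i. h (real i / real n) (lag (int i) z) + (if k < i then d else 0)) n} \<subseteq> ?A"
  proof (rule subsetI, rule ccontr)
   fix z assume z: "z \<in> {z \<in> space \<pi>. \<not> q < test_stat (\<lambda>i. h (real i / real n) (lag (int i) z) + (if k < i then d else 0)) n}"
    and no: "z \<notin> ?A"
   have t: "\<not> q < test_stat (\<lambda>i. h (real i / real n) (lag (int i) z) + (if k < i then d else 0)) n"
    using z by blast
   define s d' m where "s = sqrt (real n)" and "d' = d / sqrt (real n)" and "m = sqrt (real n) * r"
   have s: "0 < s" "s * s = real n" using n by (simp_all add: s_def)
   let ?p = "\<lambda>j. (\<Sum>i=1..j. h (real i / real n) (lag (int i) z)) / sqrt (real n)"
   let ?p' = "\<lambda>i. ?p i + d' * (real i - real k) * of_bool (k < i)"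
   have m: "\<bar>?p i\<bar> <= m" if "i <= n" for i
   proof -
    have "\<bar>ysum n i z\<bar> <= rmax (\<lambda>k. \<bar>ysum n k z\<bar>) n" by (rule le_rmax[OF that])
    also have "\<dots> <= m * s" using no z unfolding m_def s_def by force
    finally show ?thesis using s(1) unfolding ysum_eq[OF that] s_def[symmetric] by (simp add: abs_divide divide_le_eq)
   qed
   have large: "2 * (1 + q) * (m + \<bar>d'\<bar>) < \<bar>d' * real j * (1 - real j / real n)\<bar>" if jk: "j \<in> {k, k + 1}" for j
   proof -
    have "2 * (1 + q) * m = \<bar>d\<bar> * s * (c / 2)" using q by (simp add: m_def r_def s_def field_simps)
    moreover have "2 * (1 + q) * \<bar>d'\<bar> <= \<bar>d\<bar> * s * (c / 2)"
    proof -
     have "2 * (1 + q) <= s * s * (c / 2)" using n(2) c unfolding s(2) by (simp add: divide_le_eq)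
     then have "2 * (1 + q) * (\<bar>d\<bar> / s) <= s * s * (c / 2) * (\<bar>d\<bar> / s)" using s(1) by (intro mult_right_mono) auto
     then show ?thesis using s(1) by (simp add: d'_def s_def[symmetric] abs_divide mult_ac)
    qed
    moreover have "\<bar>d\<bar> * s * c < \<bar>d\<bar> * s * (real j / real n * (1 - real j / real n))"
     using kc[OF jk] d s(1) by (intro mult_strict_left_mono) auto
    moreover have "\<bar>d' * real j * (1 - real j / real n)\<bar> = \<bar>d\<bar> * s * (real j / real n * (1 - real j / real n))"
    proof -
     have "d' * real j * (1 - real j / real n) = d * s * (real j / real n * (1 - real j / real n))"
     proof -
      have "d' = d * s / real n" using s(1) unfolding s(2)[symmetric] d'_def s_def[symmetric] by simp
      then show ?thesis by simp
     qed
     moreover have "\<bar>d * s * x\<bar> = \<bar>d\<bar> * s * x" if "c < x" for x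
      using s(1) c that by (simp add: abs_mult)
     ultimately show ?thesis using kc[OF jk] by (simp only:)
    qed
    ultimately show ?thesis by (simp add: distrib_left)
   qed
   have m': "\<bar>?p i + d' * of_bool (k < i)\<bar> <= m + \<bar>d'\<bar>" if "i <= n" for i
    using m[OF that] by (auto intro: order_trans[OF abs_triangle_ineq])
   have "0 < dpsi q n ?p' k"
    by (rule change_dpsi[OF q _ _ _ large]) (use j m in \<open>force+\<close>)
   moreover have "0 < dpsi q n ?p' (k + 1)"
   proof -
    \<comment> \<open>Seen from k + 1, the change at k is a change at k + 1 added to a path with an
      extra step d' after k, which \<open>large\<close> allows for.\<close>
    have "?p' = (\<lambda>i. (?p i + d' * of_bool (k < i)) + d' * (real i - real (k + 1)) * of_bool (k + 1 < i))"
    proof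
     show "?p' i = (?p i + d' * of_bool (k < i)) + d' * (real i - real (k + 1)) * of_bool (k + 1 < i)" for i
      by (cases "i = k + 1") (auto simp: algebra_simps)
    qed
    then show ?thesis using change_dpsi[OF q _ _ m' large, of "k + 1"] j by simp
   qed
   moreover have "\<not> (dV2 n ?p' j \<noteq> 0 \<and> 0 < dpsi q n ?p' j)" if "j \<in> {k, k + 1}" for j
    using t j[OF that] unfolding test_stat_gt[OF q n(1)] sum_change d'_def[symmetric] by auto
   ultimately have "dV2 n ?p' k = 0" "dV2 n ?p' (k + 1) = 0" "0 < dpsi q n ?p' k" by blast+
   then show False using dbridge_eq_0[of n ?p' k] j[of k] j[of "k + 1"] by (simp add: dpsi_def)
  qed
  then have "\<P>(z in \<pi>. \<not> q < test_stat (\<lambda>i. h (real i / real n) (lag (int i) z) + (if k < i then d else 0)) n) <= pi.prob ?A"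
   by (rule pi.finite_measure_mono) measurable
  also have "\<dots> <= 16 * (\<Theta> 0)^2 / (sqrt (real n) * r)^2" using n r by (intro ysum_max_tail) auto
  also have "\<dots> = 16 * (\<Theta> 0)^2 / r^2 / real n" by (simp add: power_mult_distrib mult.commute)
  finally show ?case using elim(3) unfolding k_def by linarith
 qed
qed

end

section \<open>Functionals of the error process\<close>

text \<open>Young's inequality for u^2 times 1, with exponents p / 2 and p / (p - 2).\<close>

lemma square_le_powr:
 fixes u p :: real
 assumes "0 <= u" "2 < p"
 shows "u^2 <= 2 / p * u powr p + (1 - 2 / p)"
proof -
 have "u^2 * 1 <= (u^2) powr (p / 2) / (p / 2) + 1 powr (p / (p - 2)) / (p / (p - 2))"
  by (rule Youngs_inequality) (use assms in \<open>auto simp: field_simps\<close>)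
 moreover have "(u^2) powr (p / 2) = u powr p"
  using assms by (cases "u = 0") (auto simp: powr_powr simp flip: powr_numeral)
 ultimately show ?thesis using assms by (simp add: diff_divide_distrib mult.commute)
qed

lemma norm_diff_powr_le:
 assumes "0 <= p"
 shows "norm (a - b) powr p <= 2 powr p * (norm a powr p + norm b powr p)"
proof -
 have "norm (a - b) <= 2 * max (norm a) (norm b)" using norm_triangle_ineq4[of a b] by linarith
 then have "norm (a - b) powr p <= (2 * max (norm a) (norm b)) powr p" using assms by (intro powr_mono2) auto
 also have "\<dots> = 2 powr p * (max (norm a) (norm b)) powr p" by (rule powr_mult)
 also have "(max (norm a) (norm b)) powr p <= norm a powr p + norm b powr p" by (auto simp: max_def)
 finally show ?thesis by simp
qed

text \<open>Monotonicity of Lp norms. After division by s the weights 2 / p and 1 - 2 / p of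
  \<open>square_le_powr\<close> add up to 1, so no constant is lost.\<close>

lemma (in prob_space) square_integral_le_powr:
 fixes f :: "'a => real"
 assumes [measurable]: "f \<in> borel_measurable M" and i: "integrable M (\<lambda>x. \<bar>f x\<bar> powr p)" and p: "2 < p" and s: "0 < s"
  and le: "(\<integral>x. \<bar>f x\<bar> powr p \<partial>M) <= s powr p"
 shows "integrable M (\<lambda>x. (f x)^2)" "(\<integral>x. (f x)^2 \<partial>M) <= s^2"
proof -
 have pt: "(f x)^2 <= s^2 * (2 / p * (\<bar>f x\<bar> powr p / s powr p) + (1 - 2 / p))" for x
 proof -
  have "(\<bar>f x\<bar> / s)^2 <= 2 / p * (\<bar>f x\<bar> / s) powr p + (1 - 2 / p)" using s p by (intro square_le_powr) auto
  then have "s^2 * (\<bar>f x\<bar> / s)^2 <= s^2 * (2 / p * (\<bar>f x\<bar> / s) powr p + (1 - 2 / p))" by (rule mult_left_mono) simp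
  then show ?thesis using s by (simp add: power_divide powr_divide)
 qed
 have int: "integrable M (\<lambda>x. s^2 * (2 / p * (\<bar>f x\<bar> powr p / s powr p) + (1 - 2 / p)))" using i by simp
 show i2: "integrable M (\<lambda>x. (f x)^2)"
  by (rule integrable_bd[OF int]) (use pt in \<open>auto intro: order_trans[OF _ abs_ge_self]\<close>)
 have "(\<integral>x. (f x)^2 \<partial>M) <= (\<integral>x. s^2 * (2 / p * (\<bar>f x\<bar> powr p / s powr p) + (1 - 2 / p)) \<partial>M)"
  by (rule integral_mono[OF i2 int pt])
 also have "\<dots> = s^2 * (2 / p * ((\<integral>x. \<bar>f x\<bar> powr p \<partial>M) / s powr p) + (1 - 2 / p))"
  using i by (simp add: prob_space)
 also have "\<dots> <= s^2 * (2 / p * 1 + (1 - 2 / p))"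
  using le s p by (intro mult_left_mono add_mono) (auto simp: divide_le_eq)
 finally show "(\<integral>x. (f x)^2 \<partial>M) <= s^2" by simp
qed

section \<open>From the given innovations to the canonical noise\<close>

locale functional_of_process = prob_space P for P :: "'w measure" +
 fixes E :: "'e measure" and \<eta> \<eta>' :: "int => 'w => 'e"
  and H :: "real => (nat => 'e) => 'b::{banach, second_countable_topology}"
  and b :: "'b \<Rightarrow>\<^sub>L real" and \<kappa> :: real
 assumes iid: "iid_with_copy P E \<eta> \<eta>'" and H_meas: "!!t. t \<in> {0..1} ==> H t \<in> borel_measurable (PiM UNIV (\<lambda>_. E))"
  and \<kappa>: "0 < \<kappa>" and md: "moment_dependence P \<eta> \<eta>' H \<kappa>" and nb: "norm b = 1"
begin

lemma measurable_\<eta> [measurable]: "\<eta> i \<in> measurable P E"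
 using iid by (auto simp: iid_with_copy_def indep_vars_def)

abbreviation \<mu>0 :: "'e measure" where "\<mu>0 \<equiv> distr P E (\<eta> 0)"

sublocale inn: innovations \<mu>0
 unfolding innovations_def by (rule prob_space_distr) measurable

notation inn.past_law ("\<nu>") and inn.noise_law ("\<pi>")

abbreviation \<pi>2 :: "('e \<times> (nat => 'e)) measure" where "\<pi>2 \<equiv> \<mu>0 \<Otimes>\<^sub>M \<nu>"

lemma sets_product: "sets (PiM UNIV (\<lambda>_. \<mu>0)) = sets (PiM UNIV (\<lambda>_. E))"
 by (rule sets_PiM_cong) auto

lemma measurable_H [measurable]: "t \<in> {0..1} ==> H t \<in> borel_measurable \<nu>"
 using H_meas[of t] by (subst measurable_cong_sets[OF sets_product refl])

definition noise :: "'w => int => 'e" where "noise v = (\<lambda>i. \<eta> i v)"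

lemma measurable_noise [measurable]: "noise \<in> measurable P \<pi>"
proof (rule measurable_PiM_single')
 show "(\<lambda>w. noise w i) \<in> measurable P \<mu>0" for i unfolding noise_def using measurable_\<eta>[of i] by simp
qed (auto simp: space_PiM noise_def intro: measurable_space[OF measurable_\<eta>])

lemma law_noise: "distr P \<pi> noise = \<pi>"
proof -
 have "distr P (PiM UNIV (\<lambda>_. E)) (\<lambda>w. \<lambda>i\<in>UNIV. \<eta> i w) = PiM UNIV (\<lambda>i. distr P E (\<eta> i))"
  using iid by (subst indep_vars_iff_distr_eq_PiM[symmetric]) (auto simp: iid_with_copy_def)
 also have "\<dots> = \<pi>" using iid unfolding iid_with_copy_def by (intro PiM_cong refl) blast
 finally have "distr P (PiM UNIV (\<lambda>_. E)) noise = \<pi>" by (simp add: noise_def[abs_def] restrict_UNIV)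
 moreover have "distr P \<pi> noise = distr P (PiM UNIV (\<lambda>_. E)) noise" by (rule distr_cong) (auto simp: sets_product)
 ultimately show ?thesis by simp
qed

lemma past_eq: "past \<eta> i w = lag i (noise w)"
 unfolding noise_def by (rule past_eq_lag)

lemma measurable_past [measurable]: "past \<eta> i \<in> measurable P \<nu>"
 unfolding past_eq[abs_def] by measurable

lemma law_past: "distr P \<nu> (past \<eta> i) = \<nu>"
proof -
 have "distr P \<nu> (past \<eta> i) = distr (distr P \<pi> noise) \<nu> (lag i)"
  by (subst distr_distr) (auto simp: comp_def past_eq[abs_def])
 then show ?thesis by (simp only: law_noise inn.distr_lag)
qed

lemma integral_past:
 fixes f :: "(nat => 'e) => real"
 assumes [measurable]: "f \<in> borel_measurable \<nu>"
 shows "(\<integral>w. f (past \<eta> i w) \<partial>P) = (\<integral>x. f x \<partial>\<nu>)" "integrable P (\<lambda>w. f (past \<eta> i w)) \<longleftrightarrow> integrable \<nu> f"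
proof -
 have "(\<integral>x. f x \<partial>\<nu>) = (\<integral>x. f x \<partial>distr P \<nu> (past \<eta> i))" by (simp only: law_past)
 then show "(\<integral>w. f (past \<eta> i w) \<partial>P) = (\<integral>x. f x \<partial>\<nu>)" by (simp only: integral_distr[OF measurable_past assms])
 have "integrable \<nu> f \<longleftrightarrow> integrable (distr P \<nu> (past \<eta> i)) f" by (simp only: law_past)
 then show "integrable P (\<lambda>w. f (past \<eta> i w)) \<longleftrightarrow> integrable \<nu> f" by (simp only: integrable_distr_eq[OF measurable_past assms])
qed

lemma coupled_past_eq: "coupled_past \<eta> \<eta>' (int l) w = (past \<eta> (int l) w)(l := \<eta>' 0 w)"
 by (auto simp: coupled_past_def past_def fun_eq_iff)

lemma measurable_\<eta>' [measurable]: "\<eta>' 0 \<in> measurable P \<mu>0"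
proof -
 have iv: "indep_var (PiM UNIV (\<lambda>_. E)) (\<lambda>w i. \<eta> i w) (PiM UNIV (\<lambda>_. E)) (\<lambda>w i. \<eta>' i w)"
  using iid by (simp add: iid_with_copy_def)
 have "(\<lambda>w i. \<eta>' i w) \<in> measurable P (PiM UNIV (\<lambda>_. E))" by (rule indep_var_rv2[OF iv])
 then have "(\<lambda>w. (\<lambda>i. \<eta>' i w) 0) \<in> measurable P E" by (rule measurable_compose) simp
 then show ?thesis by simp
qed

lemma measurable_coupled: "(\<lambda>w. (\<eta>' 0 w, past \<eta> i w)) \<in> measurable P \<pi>2"
 by (intro measurable_Pair measurable_\<eta>' measurable_past)

text \<open>\<open>coupled_past\<close> at time l is the past with coordinate l overwritten by an
  innovation of the copy. The copy is independent of the noise and has the same law, so the pair is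
  distributed like the product over which \<open>dep\<close> integrates.\<close>

lemma law_coupled: "distr P \<pi>2 (\<lambda>w. (\<eta>' 0 w, past \<eta> i w)) = \<pi>2"
proof -
 let ?E = "PiM UNIV (\<lambda>_. E)" and ?N = "\<lambda>w i. \<eta>' i w"
 have iv: "indep_var ?E noise ?E ?N" and same: "distr P ?E ?N = distr P ?E noise"
  using iid by (simp_all add: iid_with_copy_def noise_def[abs_def])
 have law: "distr P ?E noise = \<pi>"
  using law_noise distr_cong[of P P ?E \<pi> noise noise] by (simp add: sets_product)
 have mN: "?N \<in> measurable P \<pi>"
  using indep_var_rv2[OF iv] by (subst measurable_cong_sets[OF refl sets_product])
 have joint: "\<pi> \<Otimes>\<^sub>M \<pi> = distr P (?E \<Otimes>\<^sub>M ?E) (\<lambda>w. (noise w, ?N w))"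
  using iv unfolding indep_var_distribution_eq same law by simp
 have mz: "(\<lambda>z. z (0::int)) \<in> measurable \<pi> \<mu>0" by simp
 have l0: "distr \<pi> \<mu>0 (\<lambda>z. z 0) = \<mu>0" by (rule distr_PiM_component) (auto intro: inn.prob_space_axioms)
 interpret p\<pi>: pair_prob_space \<pi> \<pi> ..
 interpret sw: pair_prob_space \<mu>0 \<nu> ..
 let ?f = "\<lambda>(z, z'). (lag i z, z' (0::int))"
 have "sigma_finite_measure (distr \<pi> \<mu>0 (\<lambda>z. z 0))" unfolding l0 by (rule prob_space_imp_sigma_finite) (rule inn.prob_space_axioms)
 from pair_measure_distr[OF inn.measurable_lag mz this]
 have "\<nu> \<Otimes>\<^sub>M \<mu>0 = distr (\<pi> \<Otimes>\<^sub>M \<pi>) (\<nu> \<Otimes>\<^sub>M \<mu>0) ?f" unfolding l0 inn.distr_lag .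
 then have "distr (\<nu> \<Otimes>\<^sub>M \<mu>0) \<pi>2 (\<lambda>(x, y). (y, x)) =
   distr (distr (\<pi> \<Otimes>\<^sub>M \<pi>) (\<nu> \<Otimes>\<^sub>M \<mu>0) ?f) \<pi>2 (\<lambda>(x, y). (y, x))" by simp
 then have "\<pi>2 = distr (distr (\<pi> \<Otimes>\<^sub>M \<pi>) (\<nu> \<Otimes>\<^sub>M \<mu>0) ?f) \<pi>2 (\<lambda>(x, y). (y, x))"
  by (simp only: sw.distr_pair_swap[symmetric])
 also have "\<dots> = distr (\<pi> \<Otimes>\<^sub>M \<pi>) \<pi>2 (\<lambda>(z, z'). (z' 0, lag i z))"
  by (subst distr_distr) (auto simp: comp_def split_beta' intro!: measurable_Pair measurable_compose[OF _ inn.measurable_lag])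
 also have "\<dots> = distr (distr P (?E \<Otimes>\<^sub>M ?E) (\<lambda>w. (noise w, ?N w))) \<pi>2 (\<lambda>(z, z'). (z' 0, lag i z))"
  by (simp only: joint)
 also have "\<dots> = distr P \<pi>2 ((\<lambda>(z, z'). (z' 0, lag i z)) \<circ> (\<lambda>w. (noise w, ?N w)))"
 proof (rule distr_distr)
  have "sets (?E \<Otimes>\<^sub>M ?E) = sets (\<pi> \<Otimes>\<^sub>M \<pi>)" by (rule sets_pair_measure_cong) (simp_all add: sets_product)
  moreover have "(\<lambda>(z, z'). (z' 0, lag i z)) \<in> measurable (\<pi> \<Otimes>\<^sub>M \<pi>) \<pi>2"
   unfolding split_beta' by (intro measurable_Pair measurable_compose[OF measurable_fst inn.measurable_lag] measurable_compose[OF measurable_snd mz])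
  ultimately show "(\<lambda>(z, z'). (z' 0, lag i z)) \<in> measurable (?E \<Otimes>\<^sub>M ?E) \<pi>2"
   by (simp cong: measurable_cong_sets)
  show "(\<lambda>w. (noise w, ?N w)) \<in> measurable P (?E \<Otimes>\<^sub>M ?E)"
   by (intro measurable_Pair indep_var_rv1[OF iv] indep_var_rv2[OF iv])
 qed
 finally show ?thesis by (simp add: comp_def past_eq)
qed

lemma integral_coupled:
 fixes f :: "(nat => 'e) => (nat => 'e) => real"
 assumes [measurable]: "(\<lambda>(x, x'). f x x') \<in> borel_measurable (\<nu> \<Otimes>\<^sub>M \<nu>)"
 shows "(\<integral>w. f (past \<eta> (int l) w) (coupled_past \<eta> \<eta>' (int l) w) \<partial>P) = (\<integral>(y, x). f x (x(l := y)) \<partial>\<pi>2)"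
proof -
 have m: "(\<lambda>(y, x). f x (x(l := y))) \<in> borel_measurable \<pi>2"
 proof -
  have "(\<lambda>p. (snd p, (snd p)(l := fst p))) \<in> measurable \<pi>2 (\<nu> \<Otimes>\<^sub>M \<nu>)" by measurable
  from measurable_compose[OF this assms] show ?thesis by (simp add: split_beta')
 qed
 have "(\<integral>(y, x). f x (x(l := y)) \<partial>\<pi>2) =
   (\<integral>(y, x). f x (x(l := y)) \<partial>distr P \<pi>2 (\<lambda>w. (\<eta>' 0 w, past \<eta> (int l) w)))" by (simp only: law_coupled)
 also have "\<dots> = (\<integral>w. f (past \<eta> (int l) w) ((past \<eta> (int l) w)(l := \<eta>' 0 w)) \<partial>P)"
  by (simp only: integral_distr[OF measurable_coupled m] prod.case)
 finally show ?thesis by (simp only: coupled_past_eq)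
qed

section \<open>Moments, dependence and long-run variance of the scalar process\<close>

abbreviation \<rho> :: real where "\<rho> \<equiv> 2 + \<kappa>"

abbreviation dd :: "nat => real" where "dd \<equiv> phys_dep P \<eta> \<eta>' H \<rho>"

definition Cm :: real where
 "Cm = enn2real (SUP t\<in>{0..1}. \<integral>\<^sup>+w. ennreal (norm (H t (past \<eta> 0 w)) powr \<rho>) \<partial>P)"

lemma H_moment:
 assumes t: "t \<in> {0..1}"
 shows "integrable \<nu> (\<lambda>x. norm (H t x) powr \<rho>)" "(\<integral>x. norm (H t x) powr \<rho> \<partial>\<nu>) <= Cm"
proof -
 note [measurable] = measurable_H[OF t]
 let ?S = "SUP t\<in>{0..1}. \<integral>\<^sup>+w. ennreal (norm (H t (past \<eta> 0 w)) powr \<rho>) \<partial>P"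
 have fin: "?S < \<infinity>" using md by (simp add: moment_dependence_def)
 have "(\<integral>\<^sup>+x. ennreal (norm (H t x) powr \<rho>) \<partial>\<nu>) = (\<integral>\<^sup>+w. ennreal (norm (H t (past \<eta> 0 w)) powr \<rho>) \<partial>P)"
  by (subst law_past[of 0, symmetric], subst nn_integral_distr) auto
 also have "\<dots> <= ?S" by (rule SUP_upper[OF t])
 finally have le: "(\<integral>\<^sup>+x. ennreal (norm (H t x) powr \<rho>) \<partial>\<nu>) <= ?S" .
 show int: "integrable \<nu> (\<lambda>x. norm (H t x) powr \<rho>)"
  by (rule integrableI_nonneg) (use le fin in auto)
 have "(\<integral>x. norm (H t x) powr \<rho> \<partial>\<nu>) = enn2real (\<integral>\<^sup>+x. ennreal (norm (H t x) powr \<rho>) \<partial>\<nu>)"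
  by (rule integral_eq_nn_integral) auto
 also have "\<dots> <= Cm" unfolding Cm_def using le fin by (intro enn2real_mono) auto
 finally show "(\<integral>x. norm (H t x) powr \<rho> \<partial>\<nu>) <= Cm" .
qed

lemma H_sq:
 assumes u: "u \<in> {0..1}"
 shows "integrable \<nu> (\<lambda>x. (norm (H u x))^2)"
proof (rule inn.nu.P.square_integral_le_powr(1)[where s = "(Cm + 1) powr (1 / \<rho>)" and p = \<rho>])
 have C: "0 <= Cm" by (simp add: Cm_def)
 show "(\<lambda>x. norm (H u x)) \<in> borel_measurable \<nu>" using measurable_H[OF u] by measurable
 show "integrable \<nu> (\<lambda>x. \<bar>norm (H u x)\<bar> powr \<rho>)" using H_moment(1)[OF u] by simp
 show "(\<integral>x. \<bar>norm (H u x)\<bar> powr \<rho> \<partial>\<nu>) <= ((Cm + 1) powr (1 / \<rho>)) powr \<rho>"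
  using H_moment(2)[OF u] C \<kappa> by (simp add: powr_powr)
 show "0 < (Cm + 1) powr (1 / \<rho>)" using C by simp
qed (use \<kappa> in simp)

abbreviation dH :: "real => nat => 'e \<times> (nat => 'e) => real" where
 "dH t l \<equiv> \<lambda>(y, x). norm (H t x - H t (x(l := y))) powr \<rho>"

text \<open>The past and its coupled version both have law \<open>\<nu>\<close>, so the moment bound
  for H applies to either; \<open>norm_diff_powr_le\<close> combines the two.\<close>

lemma H_diff_moment:
 assumes t: "t \<in> {0..1}"
 shows "integrable \<pi>2 (dH t l)"
  "(\<integral>z. dH t l z \<partial>\<pi>2) <= 2 powr \<rho> * (2 * Cm)"
proof -
 note [measurable] = measurable_H[OF t]
 interpret pp: pair_prob_space \<mu>0 \<nu> ..
 let ?g = "\<lambda>x. norm (H t x) powr \<rho>" and ?u = "\<lambda>(y, x). x(l := y)"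
 have m1: "snd \<in> measurable \<pi>2 \<nu>" and m2: "?u \<in> measurable \<pi>2 \<nu>" by measurable
 have l1: "distr \<pi>2 \<nu> snd = \<nu>"
  by (subst law_coupled[of 0, symmetric], subst distr_distr[OF measurable_snd measurable_coupled]) (simp add: comp_def law_past)
 have l2: "distr \<pi>2 \<nu> ?u = \<nu>" by (rule distr_PiM_UNIV_upd[OF inn.prob_space_axioms])
 have i1: "integrable \<pi>2 (\<lambda>z. ?g (snd z))" "(\<integral>z. ?g (snd z) \<partial>\<pi>2) <= Cm"
  using H_moment[OF t] integrable_distr_eq[OF m1, of ?g] integral_distr[OF m1, of ?g] l1 by simp_all
 have i2: "integrable \<pi>2 (\<lambda>z. ?g (?u z))" "(\<integral>z. ?g (?u z) \<partial>\<pi>2) <= Cm"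
  using H_moment[OF t] integrable_distr_eq[OF m2, of ?g] integral_distr[OF m2, of ?g] l2 by simp_all
 have le: "norm (dH t l z) <= 2 powr \<rho> * (?g (snd z) + ?g (?u z))" for z
  using norm_diff_powr_le[of \<rho>] \<kappa> by (cases z) auto
 have int: "integrable \<pi>2 (\<lambda>z. 2 powr \<rho> * (?g (snd z) + ?g (?u z)))" using i1 i2 by simp
 show i: "integrable \<pi>2 (dH t l)"
 proof (rule integrable_bd[OF int])
  show "dH t l \<in> borel_measurable \<pi>2" by measurable
  show "AE z in \<pi>2. norm (dH t l z)
    <= norm (2 powr \<rho> * (?g (snd z) + ?g (?u z)))"
   by (rule AE_I2, subst (2) real_norm_def) (rule order_trans[OF le abs_ge_self])
 qed
 have "(\<integral>z. dH t l z \<partial>\<pi>2) <=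
   (\<integral>z. 2 powr \<rho> * (?g (snd z) + ?g (?u z)) \<partial>\<pi>2)"
  by (rule lint_mono[OF i int]) (rule order_trans[OF abs_ge_self le[unfolded real_norm_def]])
 also have "\<dots> = 2 powr \<rho> * ((\<integral>z. ?g (snd z) \<partial>\<pi>2) + (\<integral>z. ?g (?u z) \<partial>\<pi>2))"
  using i1(1) i2(1) by simp
 also have "\<dots> <= 2 powr \<rho> * (2 * Cm)" using i1(2) i2(2) by (intro mult_left_mono) auto
 finally show "(\<integral>z. dH t l z \<partial>\<pi>2) <= 2 powr \<rho> * (2 * Cm)" .
qed

text \<open>The supremum in \<open>phys_dep\<close> is taken in the reals and dominates its members
  once the set is bounded above; this follows from the uniform moment bound
  \<open>Cm\<close>.\<close>

lemma phys_dep_ge: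
 assumes t: "t \<in> {0..1}"
 shows "(\<integral>z. dH t l z \<partial>\<pi>2) powr (1 / \<rho>) <= dd l"
proof -
 have eq: "Lp_norm P \<rho> (\<lambda>w. H t (past \<eta> (int l) w) - H t (coupled_past \<eta> \<eta>' (int l) w)) =
   (\<integral>z. dH t l z \<partial>\<pi>2) powr (1 / \<rho>)" if t: "t \<in> {0..1}" for t
 proof -
  note [measurable] = measurable_H[OF t]
  have "(\<lambda>(x, x'). norm (H t x - H t x') powr \<rho>) \<in> borel_measurable (\<nu> \<Otimes>\<^sub>M \<nu>)" by measurable
  from integral_coupled[OF this, of l] show ?thesis unfolding Lp_norm_def by simp
 qed
 have "bdd_above ((\<lambda>t. Lp_norm P \<rho> (\<lambda>w. H t (past \<eta> (int l) w) - H t (coupled_past \<eta> \<eta>' (int l) w))) ` {0..1})"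
 proof (rule bdd_aboveI2)
  fix t :: real assume t: "t \<in> {0..1}"
  have "0 <= (\<integral>z. dH t l z \<partial>\<pi>2)"
   by (rule lint_nonneg) auto
  then show "Lp_norm P \<rho> (\<lambda>w. H t (past \<eta> (int l) w) - H t (coupled_past \<eta> \<eta>' (int l) w)) <= (2 powr \<rho> * (2 * Cm)) powr (1 / \<rho>)"
   unfolding eq[OF t] using H_diff_moment(2)[OF t] \<kappa> by (intro powr_mono2) auto
 qed
 then have "Lp_norm P \<rho> (\<lambda>w. H t (past \<eta> (int l) w) - H t (coupled_past \<eta> \<eta>' (int l) w)) <= dd l"
  unfolding phys_dep_def by (rule cSUP_upper[OF t])
 then show ?thesis by (simp only: eq[OF t])
qed

definition hb :: "real => (nat => 'e) => real" where "hb t x = b (H t x)"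

text \<open>The added 2^(-l) makes the coefficients strictly positive, as \<open>\<delta>\<close> in
  \<open>loc_stat\<close> must be, and keeps the tail sums summable.\<close>

definition db :: "nat => real" where "db l = dd l + (1 / 2) ^ l"

lemma dd_nonneg: "0 <= dd l"
 using order_trans[OF powr_ge_zero phys_dep_ge[of 0 l]] by simp

lemma db_pos: "0 < db l"
 using dd_nonneg[of l] by (simp add: db_def add_nonneg_pos)

lemma b_le: "\<bar>b v\<bar> <= norm v"
 using norm_blinfun[of b v] nb by simp

lemma measurable_hb [measurable]: "t \<in> {0..1} ==> hb t \<in> borel_measurable \<nu>"
proof -
 assume t: "t \<in> {0..1}"
 have "continuous_on UNIV (blinfun_apply b)" by (intro continuous_intros)
 then have "blinfun_apply b \<in> borel_measurable borel" by (rule borel_measurable_continuous_onI)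
 then show ?thesis unfolding hb_def[abs_def] by (rule measurable_compose[OF measurable_H[OF t]])
qed

lemma hb_moment:
 assumes t: "t \<in> {0..1}"
 shows "integrable \<nu> (\<lambda>x. \<bar>hb t x\<bar> powr \<rho>)" "(\<integral>x. \<bar>hb t x\<bar> powr \<rho> \<partial>\<nu>) <= Cm"
proof -
 note [measurable] = measurable_hb[OF t]
 have le: "\<bar>hb t x\<bar> powr \<rho> <= norm (H t x) powr \<rho>" for x
  unfolding hb_def using b_le \<kappa> by (intro powr_mono2) auto
 show i: "integrable \<nu> (\<lambda>x. \<bar>hb t x\<bar> powr \<rho>)"
  by (rule integrable_bd[OF H_moment(1)[OF t]]) (use le in auto)
 show "(\<integral>x. \<bar>hb t x\<bar> powr \<rho> \<partial>\<nu>) <= Cm"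
  using lint_mono[OF i H_moment(1)[OF t] le] H_moment(2)[OF t] by linarith
qed

text \<open>From order 2 + \<kappa> to order 2 by monotonicity of Lp norms, and from the Banach
  space to the reals because b has norm 1.\<close>

lemma dep_hb:
 assumes t: "t \<in> {0..1}"
 shows "inn.dep (hb t) l <= (db l)^2"
proof -
 note [measurable] = measurable_hb[OF t]
 interpret pp: pair_prob_space \<mu>0 \<nu> ..
 let ?f = "\<lambda>z. hb t (snd z) - hb t ((snd z)(l := fst z))"
 have le: "\<bar>?f z\<bar> powr \<rho> <= dH t l z" for z
  unfolding hb_def blinfun.diff_right[symmetric] using b_le \<kappa> by (cases z) (auto intro!: powr_mono2)
 have mf: "?f \<in> borel_measurable \<pi>2" by measurable
 have i: "integrable \<pi>2 (\<lambda>z. \<bar>?f z\<bar> powr \<rho>)"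
 proof (rule integrable_bd[OF H_diff_moment(1)[OF t, of l]])
  show "(\<lambda>z. \<bar>?f z\<bar> powr \<rho>) \<in> borel_measurable \<pi>2" using mf by measurable
  show "AE z in \<pi>2. norm (\<bar>?f z\<bar> powr \<rho>) <= norm (dH t l z)"
   by (rule AE_I2, simp only: real_norm_def abs_of_nonneg[OF powr_ge_zero]) (rule order_trans[OF le abs_ge_self])
 qed
 have I0: "0 <= (\<integral>z. dH t l z \<partial>\<pi>2)" by (rule lint_nonneg) auto
 have "(\<integral>z. dH t l z \<partial>\<pi>2) = ((\<integral>z. dH t l z \<partial>\<pi>2) powr (1 / \<rho>)) powr \<rho>"
  using I0 \<kappa> by (simp add: powr_powr)
 also have "\<dots> <= db l powr \<rho>"
  using phys_dep_ge[OF t, of l] \<kappa> by (intro powr_mono2) (auto simp: db_def intro: add_increasing2)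
 finally have "(\<integral>z. \<bar>?f z\<bar> powr \<rho> \<partial>\<pi>2) <= db l powr \<rho>"
  using lint_mono[OF i H_diff_moment(1)[OF t, of l] le] by linarith
 from pp.P.square_integral_le_powr(2)[OF mf i _ db_pos this]
 show ?thesis using \<kappa> unfolding inn.dep_def by (simp add: split_beta')
qed

lemma summable_db: "summable db" "summable (tail_sum db)"
proof -
 have d: "summable dd" and t: "(\<lambda>k::int. tail_sum dd (nat \<bar>k\<bar>)) summable_on UNIV"
  using md by (simp_all add: moment_dependence_def)
 have g: "summable (\<lambda>l. (1 / 2 :: real) ^ l)" by (rule summable_geometric) simp
 show "summable db" unfolding db_def[abs_def] by (rule summable_add[OF d g])
 have "(\<lambda>k::int. tail_sum dd (nat \<bar>k\<bar>)) summable_on range int" by (rule summable_on_subset_banach[OF t]) simp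
 then have "((\<lambda>k::int. tail_sum dd (nat \<bar>k\<bar>)) \<circ> int) summable_on UNIV"
  by (subst (asm) summable_on_reindex) (auto simp: inj_on_def)
 then have "summable (tail_sum dd)" by (auto dest!: summable_on_imp_summable simp: comp_def)
 moreover have "tail_sum db = (\<lambda>k. tail_sum dd k + 2 * (1 / 2) ^ k)"
 proof
  fix k
  have "(\<Sum>i. (1 / 2 :: real) ^ (i + k)) = (\<Sum>i. (1 / 2) ^ k * (1 / 2) ^ i)" by (simp add: power_add mult.commute)
  also have "\<dots> = (1 / 2) ^ k * 2" by (subst suminf_mult) (auto simp: suminf_geometric g)
  finally have "(\<Sum>i. (1 / 2 :: real) ^ (i + k)) = 2 * (1 / 2) ^ k" by simp
  moreover have "(\<Sum>i. dd (i + k) + (1 / 2) ^ (i + k)) = (\<Sum>i. dd (i + k)) + (\<Sum>i. (1 / 2) ^ (i + k))"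
   using d g by (intro suminf_add[symmetric]) (auto simp: summable_iff_shift)
  ultimately show "tail_sum db k = tail_sum dd k + 2 * (1 / 2) ^ k" by (simp add: tail_sum_def db_def)
 qed
 ultimately show "summable (tail_sum db)" using g by (auto intro!: summable_add summable_mult)
qed

lemma hb_Lipschitz: "\<exists>\<Lambda>\<ge>0. \<forall>s\<in>{0..1}. \<forall>t\<in>{0..1}. (\<integral>x. (hb t x - hb s x)^2 \<partial>\<nu>) <= (\<Lambda> * (t - s))^2"
proof -
 have "bdd_above {Lp_norm P 2 (\<lambda>u. H t (past \<eta> 0 u) - H s (past \<eta> 0 u)) / \<bar>t - s\<bar> | s t. 0 <= s \<and> s < t \<and> t <= 1}"
  using md by (simp add: moment_dependence_def L2_Lipschitz_def)
 then obtain B where B: "!!s t. 0 <= s ==> s < t ==> t <= 1 ==> Lp_norm P 2 (\<lambda>u. H t (past \<eta> 0 u) - H s (past \<eta> 0 u)) / \<bar>t - s\<bar> <= B"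
  unfolding bdd_above_def by blast
 have main: "(\<integral>x. (hb t x - hb s x)^2 \<partial>\<nu>) <= (\<bar>B\<bar> * (t - s))^2" if st: "0 <= s" "s < t" "t <= 1" for s t
 proof -
  have t: "s \<in> {0..1}" "t \<in> {0..1}" using st by auto
  note [measurable] = measurable_H[OF t(1)] measurable_H[OF t(2)] measurable_hb[OF t(1)] measurable_hb[OF t(2)]
  have nd: "(norm (v - w))^2 <= 2 * (norm v)^2 + 2 * (norm w)^2" for v w :: 'b
  proof -
   have "(norm (v - w))^2 <= (norm v + norm w)^2" by (rule power_mono[OF norm_triangle_ineq4 norm_ge_zero])
   also have "\<dots> <= 2 * (norm v)^2 + 2 * (norm w)^2" using square_diff_le[of "norm v" "- norm w"] by simp
   finally show ?thesis .
  qed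
  have iH: "integrable \<nu> (\<lambda>x. (norm (H t x - H s x))^2)"
  proof (rule integrable_bd)
   show "integrable \<nu> (\<lambda>x. 2 * (norm (H t x))^2 + 2 * (norm (H s x))^2)" using H_sq t by simp
  qed (use nd in auto)
  have le: "(hb t x - hb s x)^2 <= (norm (H t x - H s x))^2" for x
   using power_mono[OF b_le[of "H t x - H s x"] abs_ge_zero, of 2] by (simp add: hb_def blinfun.diff_right)
  have ih: "integrable \<nu> (\<lambda>x. (hb t x - hb s x)^2)"
   by (rule integrable_bd[OF iH]) (use le in auto)
  have I0: "0 <= (\<integral>x. (norm (H t x - H s x))^2 \<partial>\<nu>)" by (rule lint_nonneg) auto
  have "Lp_norm P 2 (\<lambda>u. H t (past \<eta> 0 u) - H s (past \<eta> 0 u)) = sqrt (\<integral>x. (norm (H t x - H s x))^2 \<partial>\<nu>)"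
   unfolding Lp_norm_def using I0 by (simp add: powr_half_sqrt integral_past(1)[of "\<lambda>x. (norm (H t x - H s x))^2" 0])
  then have "sqrt (\<integral>x. (norm (H t x - H s x))^2 \<partial>\<nu>) <= B * (t - s)"
   using B[OF st] st by (simp add: divide_le_eq)
  also have "\<dots> <= \<bar>B\<bar> * (t - s)" using st by (intro mult_right_mono) auto
  finally have "(sqrt (\<integral>x. (norm (H t x - H s x))^2 \<partial>\<nu>))^2 <= (\<bar>B\<bar> * (t - s))^2" using I0 by (intro power_mono) auto
  then have "(\<integral>x. (norm (H t x - H s x))^2 \<partial>\<nu>) <= (\<bar>B\<bar> * (t - s))^2" using I0 by simp
  then show ?thesis using lint_mono[OF ih iH le] by linarith
 qed
 show ?thesis
 proof (intro exI[of _ "\<bar>B\<bar>"] conjI ballI)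
  fix s t :: real assume s: "s \<in> {0..1}" and t: "t \<in> {0..1}"
  consider "s = t" | "s < t" | "t < s" by linarith
  then show "(\<integral>x. (hb t x - hb s x)^2 \<partial>\<nu>) <= (\<bar>B\<bar> * (t - s))^2"
  proof cases
   case 3
   have "(\<integral>x. (hb t x - hb s x)^2 \<partial>\<nu>) = (\<integral>x. (hb s x - hb t x)^2 \<partial>\<nu>)" by (simp add: power2_commute)
   then show ?thesis using main[of t s] 3 s t by (simp add: power_mult_distrib power2_commute[of t s])
  qed (use main s t in auto)
 qed simp
qed

text \<open>An unordered sum that does not exist is 0 by convention, so the nonzero value v
  certifies summability. The continuous functional then passes through the sum and through the
  Bochner integrals of the covariances.\<close>

lemma hb_lrv:
 assumes t: "t \<in> {0..1}" and v: "tensor_functional b b (local_lrv P \<eta> H t) = v" "v \<noteq> 0"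
 shows "((\<lambda>k::int. \<integral>z. hb t (lag k z) * hb t (lag 0 z) \<partial>\<pi>) has_sum v) UNIV"
proof -
 note [measurable] = measurable_H[OF t] measurable_hb[OF t]
 let ?T = "tensor_functional b b"
 let ?c = "\<lambda>k::int. Cov P (\<lambda>w. H t (past \<eta> k w)) (\<lambda>w. H t (past \<eta> 0 w))"
 have s: "?c summable_on UNIV"
 proof (rule ccontr)
  assume "\<not> ?c summable_on UNIV"
  then have "local_lrv P \<eta> H t = 0" unfolding local_lrv_def by (rule infsum_not_exists)
  then show False using v by (simp add: blinfun.zero_right)
 qed
 have "(?c has_sum local_lrv P \<eta> H t) UNIV" unfolding local_lrv_def by (rule has_sum_infsum[OF s])
 from has_sum_bounded_linear[OF blinfun.bounded_linear_right this, of ?T]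
 have hs: "((\<lambda>k. ?T (?c k)) has_sum v) UNIV" using v by simp
 have sq: "integrable P (\<lambda>w. (norm (H t (past \<eta> k w)))^2)" for k
 proof -
  have "integrable \<nu> (\<lambda>x. (norm (H t x))^2)" by (rule H_sq[OF t])
  then show ?thesis by (subst integral_past(2)) auto
 qed
 interpret pt: bounded_bilinear "(\<otimes>\<^sub>\<pi>) :: 'b => 'b => _" by (rule bounded_bilinear_ptens)
 have "?T (?c k) = (\<integral>z. hb t (lag k z) * hb t (lag 0 z) \<partial>\<pi>)" for k
 proof -
  let ?X = "\<lambda>w. H t (past \<eta> k w)" and ?Y = "\<lambda>w. H t (past \<eta> 0 w)"
  have mX: "?X \<in> borel_measurable P" "?Y \<in> borel_measurable P" by measurable
  have m: "(\<lambda>w. ?X w \<otimes>\<^sub>\<pi> ?Y w) \<in> borel_measurable P"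
   by (rule borel_measurable_continuous_Pair[OF mX]) (intro pt.continuous_on continuous_intros)
  have i: "integrable P (\<lambda>w. ?X w \<otimes>\<^sub>\<pi> ?Y w)"
  proof (rule integrable_bd[OF _ m])
   show "integrable P (\<lambda>w. (norm (?X w))^2 + (norm (?Y w))^2)" using sq by simp
   have "norm (x \<otimes>\<^sub>\<pi> y) <= norm ((norm x)^2 + (norm y)^2)" for x y :: 'b
   proof -
    have "norm (x \<otimes>\<^sub>\<pi> y) <= norm x * norm y" by (simp add: ptens_def pnorm_tensor_le)
    also have "\<dots> <= (norm x)^2 + (norm y)^2"
     using sum_squares_bound[of "norm x" "norm y"] mult_nonneg_nonneg[OF norm_ge_zero[of x] norm_ge_zero[of y]] by linarith
    finally show ?thesis by simp
   qed
   then show "AE w in P. norm (?X w \<otimes>\<^sub>\<pi> ?Y w) <= norm ((norm (?X w))^2 + (norm (?Y w))^2)" by (intro AE_I2)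
  qed
  have "?T (?c k) = (\<integral>w. ?T (?X w \<otimes>\<^sub>\<pi> ?Y w) \<partial>P)"
   unfolding Cov_def by (rule integral_bounded_linear[OF blinfun.bounded_linear_right i, symmetric])
  also have "\<dots> = (\<integral>w. hb t (lag k (noise w)) * hb t (lag 0 (noise w)) \<partial>P)" by (simp add: hb_def past_eq)
  also have "\<dots> = (\<integral>z. hb t (lag k z) * hb t (lag 0 z) \<partial>distr P \<pi> noise)"
   by (subst integral_distr) auto
  finally show ?thesis by (simp only: law_noise)
 qed
 then show ?thesis using hs by simp
qed

end

section \<open>Level and consistency of the test\<close>

lemma test_stat_cong:
 assumes n: "2 <= n" and y: "!!i. i \<in> {1..n} ==> y i = y' i"
 shows "test_stat y n = test_stat y' n"
proof -
 have n1: "1 <= n" using n by simp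
 have p: "(\<Sum>i=1..k. y i) / sqrt (real n) = (\<Sum>i=1..k. y' i) / sqrt (real n)" if "k <= n" for k
  by (intro arg_cong2[where f = "(/)"] sum.cong refl y) (use that in auto)
 show ?thesis
  unfolding test_stat_def D_stat_grid[OF n1] V_stat_sq_grid[OF n1]
 proof (intro arg_cong[where f = Max] image_cong refl)
  fix k assume "k \<in> {1..n-1}"
  then have k: "k <= n" by auto
  show "\<bar>dbridge n (\<lambda>k. (\<Sum>i=1..k. y i) / sqrt (real n)) k\<bar> / sqrt (dV2 n (\<lambda>k. (\<Sum>i=1..k. y i) / sqrt (real n)) k) =
    \<bar>dbridge n (\<lambda>k. (\<Sum>i=1..k. y' i) / sqrt (real n)) k\<bar> / sqrt (dV2 n (\<lambda>k. (\<Sum>i=1..k. y' i) / sqrt (real n)) k)"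
   using dpsi_cong(1,2)[OF k, of "\<lambda>k. (\<Sum>i=1..k. y i) / sqrt (real n)" "\<lambda>k. (\<Sum>i=1..k. y' i) / sqrt (real n)"] p by simp
 qed
qed

lemma measurable_test_stat:
 assumes q: "0 <= q" and n: "2 <= n" and y: "!!i. i \<in> {1..n} ==> y i \<in> borel_measurable M"
 shows "{w \<in> space M. q < test_stat (\<lambda>i. y i w) n} \<in> sets M"
proof -
 \<comment> \<open>\<open>min k n\<close> keeps the sum within the indices for which y is known to
   be measurable.\<close>
 let ?p = "\<lambda>w k. (\<Sum>i=1..min k n. y i w) / sqrt (real n)"
 have p: "(\<lambda>w. ?p w k) \<in> borel_measurable M" for k
  by (intro borel_measurable_divide borel_measurable_sum borel_measurable_const y) auto
 have v: "(\<lambda>w. dV2 n (?p w) k) \<in> borel_measurable M" for k unfolding dV2_def using p by measurable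
 have d: "(\<lambda>w. dpsi q n (?p w) k) \<in> borel_measurable M" for k unfolding dpsi_def dbridge_def using p v by measurable
 have eq: "{w \<in> space M. q < test_stat (\<lambda>i. y i w) n} = (\<Union>k\<in>{1..n-1}. {w \<in> space M. dV2 n (?p w) k \<noteq> 0} \<inter> {w \<in> space M. 0 < dpsi q n (?p w) k})"
 proof -
  have "dV2 n (\<lambda>k. (\<Sum>i=1..k. y i w) / sqrt (real n)) k = dV2 n (?p w) k"
   "dpsi q n (\<lambda>k. (\<Sum>i=1..k. y i w) / sqrt (real n)) k = dpsi q n (?p w) k" if "k \<in> {1..n-1}" for k w
   by (rule dpsi_cong(2), use that in auto) (rule dpsi_cong(3), use that in auto)
  then show ?thesis unfolding test_stat_gt[OF q n] by auto
 qed
 have S: "{w \<in> space M. dV2 n (?p w) k \<noteq> 0} \<in> sets M" "{w \<in> space M. 0 < dpsi q n (?p w) k} \<in> sets M" for k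
  using v[of k] d[of k] by measurable
 show ?thesis unfolding eq by (intro sets.finite_UN sets.Int S finite_atLeastAtMost)
qed

text \<open>The hypotheses are statements about means; one sample with observations on both sides of
  the change translates them into b \<delta> = 0 and b \<delta> \<noteq> 0.\<close>

lemma ex_change_point:
 assumes "0 < \<theta>" "\<theta> < 1"
 shows "\<exists>n k. 1 <= k \<and> k < n \<and> k = nat \<lfloor>\<theta> * real n\<rfloor>"
proof -
 obtain n :: nat where n: "1 / \<theta> < n" using reals_Archimedean2 by blast
 then have \<theta>n: "1 < \<theta> * real n" using assms by (simp add: divide_less_eq mult.commute)
 then have "0 < real n" using assms by (cases n) auto
 then have "\<theta> * real n < 1 * real n" using assms by (intro mult_strict_right_mono) auto
 then have "1 <= nat \<lfloor>\<theta> * real n\<rfloor>" "nat \<lfloor>\<theta> * real n\<rfloor> < n" using \<theta>n by linarith+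
 then show ?thesis by blast
qed

theorem corollary9:
  fixes P :: "'w measure" and E :: "'e measure" and Q :: "'v measure"
    and \<eta> \<eta>' :: "int \<Rightarrow> 'w \<Rightarrow> 'e"
    and H :: "real \<Rightarrow> (nat \<Rightarrow> 'e) \<Rightarrow> 'b::{banach, second_countable_topology}"
    and \<epsilon> X :: "nat \<Rightarrow> nat \<Rightarrow> 'w \<Rightarrow> 'b"
    and e :: "nat \<Rightarrow> 'b" and e' :: "nat \<Rightarrow> 'b \<Rightarrow>\<^sub>L real"
    and b :: "'b \<Rightarrow>\<^sub>L real" and W :: "real \<Rightarrow> 'v \<Rightarrow> real"
    and \<mu> \<delta> :: 'b and \<kappa> \<sigma>\<^sub>b \<theta> \<alpha> :: real
  assumes "prob_space P"
    and "iid_with_copy P E \<eta> \<eta>'"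
    and "schauder_basis e e'"
    and "centered P \<epsilon>"
    and "locally_stationary P E \<eta> H \<epsilon>"
    and "\<kappa> > 0"
    and "moment_dependence P \<eta> \<eta>' H \<kappa>"
    and "tail_entropy P \<epsilon> e e' (phys_dep P \<eta> \<eta>' H 2)"
    and "block_length (tail_sum (phys_dep P \<eta> \<eta>' H (2 + \<kappa>))) \<kappa>"
    and "norm b = 1"
    and "\<sigma>\<^sub>b > 0"
    and "\<And>u. u \<in> {0..1} \<Longrightarrow> tensor_functional b b (local_lrv P \<eta> H u) = \<sigma>\<^sub>b\<^sup>2"
    and "0 < \<theta>" and "\<theta> < 1"
    and "\<And>n i \<omega>. i \<in> {1..n} \<Longrightarrow> \<omega> \<in> space P \<Longrightarrow>
      X i n \<omega> = \<mu> + (if int i > \<lfloor>\<theta> * real n\<rfloor> then \<delta> else 0) + \<epsilon> i n \<omega>"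
    and "0 < \<alpha>" and "\<alpha> < 1"
    and "brownian_motion Q W"
  defines "rejection_prob \<equiv>
      (\<lambda>n. measure P {\<omega>\<in>space P. test_stat (\<lambda>i. b (X i n \<omega>)) n > critical_value Q W \<alpha>})"
    and "m \<equiv> (\<lambda>i n. \<integral>\<omega>. b (X i n \<omega>) \<partial>P)"
  shows "(H0 m \<longrightarrow> limsup (\<lambda>n. ereal (rejection_prob n)) \<le> ereal \<alpha>) \<and>
         (H1 \<theta> m \<longrightarrow> rejection_prob \<longlonglongrightarrow> 1)"
proof -
 interpret FP: functional_of_process P E \<eta> \<eta>' H b \<kappa>
  using assms(1,2,5,6,7,10)
  unfolding functional_of_process_def functional_of_process_axioms_def locally_stationary_def by blast
 obtain \<Lambda> where \<Lambda>: "0 <= \<Lambda>" "\<forall>s\<in>{0..1}. \<forall>t\<in>{0..1}. (\<integral>x. (FP.hb t x - FP.hb s x)\<^sup>2 \<partial>PiM UNIV (\<lambda>_. FP.\<mu>0)) <= (\<Lambda> * (t - s))\<^sup>2"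
  using FP.hb_Lipschitz by blast
 have \<epsilon>: "\<epsilon> i n \<omega> = H (real i / real n) (past \<eta> (int i) \<omega>)" if "i \<in> {1..n}" "\<omega> \<in> space P" for i n \<omega>
  using assms(5) that by (simp add: locally_stationary_def)
 have u: "real i / real n \<in> {0..1}" if "i \<in> {1..n}" for i n :: nat
  using that by (auto simp: divide_le_eq)
 have b\<epsilon>: "integrable P (\<lambda>\<omega>. b (\<epsilon> i n \<omega>))" "(\<integral>\<omega>. b (\<epsilon> i n \<omega>) \<partial>P) = 0" if "i \<in> {1..n}" for i n
 proof -
  have c: "integrable P (\<epsilon> i n)" "(\<integral>\<omega>. \<epsilon> i n \<omega> \<partial>P) = 0" using assms(4) that by (simp_all add: centered_def)
  show "integrable P (\<lambda>\<omega>. b (\<epsilon> i n \<omega>))" by (rule integrable_bounded_linear[OF blinfun.bounded_linear_right c(1)])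
  show "(\<integral>\<omega>. b (\<epsilon> i n \<omega>) \<partial>P) = 0"
   using integral_bounded_linear[OF blinfun.bounded_linear_right[of b] c(1)] c(2) by (simp add: blinfun.zero_right)
 qed
 have mean: "(\<integral>x. FP.hb (real i / real n) x \<partial>PiM UNIV (\<lambda>_. FP.\<mu>0)) = 0" if "1 <= i" "i <= n" for i n
 proof -
  have i: "i \<in> {1..n}" using that by simp
  have "(\<integral>x. FP.hb (real i / real n) x \<partial>PiM UNIV (\<lambda>_. FP.\<mu>0)) = (\<integral>\<omega>. FP.hb (real i / real n) (past \<eta> (int i) \<omega>) \<partial>P)"
   by (rule FP.integral_past(1)[OF FP.measurable_hb[OF u[OF i]], symmetric])
  also have "\<dots> = (\<integral>\<omega>. b (\<epsilon> i n \<omega>) \<partial>P)" by (rule lint_cong) (simp_all add: FP.hb_def \<epsilon>[OF i])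
  finally show ?thesis using b\<epsilon>(2)[OF i] by simp
 qed
 have BM: "brownian Q W"
  using assms(18) unfolding brownian_def brownian_axioms_def brownian_motion_def by blast
 have s2: "0 < \<sigma>\<^sub>b\<^sup>2" using assms(11) by simp
 have LS: "loc_stat FP.\<mu>0 FP.hb FP.db \<kappa> FP.Cm \<Lambda> (\<sigma>\<^sub>b\<^sup>2)"
 proof (unfold_locales)
  show "FP.hb t \<in> borel_measurable (PiM UNIV (\<lambda>_. FP.\<mu>0))" if "t \<in> {0..1}" for t by (rule FP.measurable_hb[OF that])
  show "0 < \<kappa>" by (rule assms(6))
  show "integrable (PiM UNIV (\<lambda>_. FP.\<mu>0)) (\<lambda>x. \<bar>FP.hb t x\<bar> powr (2 + \<kappa>))" if "t \<in> {0..1}" for t by (rule FP.hb_moment(1)[OF that])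
  show "(\<integral>x. \<bar>FP.hb t x\<bar> powr (2 + \<kappa>) \<partial>PiM UNIV (\<lambda>_. FP.\<mu>0)) <= FP.Cm" if "t \<in> {0..1}" for t by (rule FP.hb_moment(2)[OF that])
  show "0 < FP.db l" for l by (rule FP.db_pos)
  show "FP.inn.dep (FP.hb t) l <= (FP.db l)\<^sup>2" if "t \<in> {0..1}" for t l by (rule FP.dep_hb[OF that])
  show "summable FP.db" "summable (tail_sum FP.db)" by (rule FP.summable_db)+
  show "(\<integral>x. (FP.hb t x - FP.hb s x)\<^sup>2 \<partial>PiM UNIV (\<lambda>_. FP.\<mu>0)) <= (\<Lambda> * (t - s))\<^sup>2" if "s \<in> {0..1}" "t \<in> {0..1}" for s t
   using \<Lambda>(2) that by blast
  show "0 <= \<Lambda>" by (rule \<Lambda>(1))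
  show "(\<integral>x. FP.hb (real i / real n) x \<partial>PiM UNIV (\<lambda>_. FP.\<mu>0)) = 0" if "1 <= i" "i <= n" for i n by (rule mean[OF that])
  show "0 < \<sigma>\<^sub>b\<^sup>2" by (rule s2)
  show "((\<lambda>k::int. \<integral>\<zeta>. FP.hb t (lag k \<zeta>) * FP.hb t (lag 0 \<zeta>) \<partial>PiM UNIV (\<lambda>_. FP.\<mu>0)) has_sum \<sigma>\<^sub>b\<^sup>2) UNIV" if "t \<in> {0..1}" for t
   by (rule FP.hb_lrv[OF that assms(12)[OF that]]) (use s2 in simp)
 qed
 interpret L: limit_test FP.\<mu>0 FP.hb FP.db \<kappa> FP.Cm \<Lambda> "\<sigma>\<^sub>b\<^sup>2" Q W
  unfolding limit_test_def using LS BM by blast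
 define q where "q = critical_value Q W \<alpha>"
 have q: "0 < q" unfolding q_def by (rule L.BM.critical_value(1)[OF assms(16,17)])
 have q0: "0 <= q" using q by simp
 define R where "R n \<zeta> = test_stat (\<lambda>i. FP.hb (real i / real n) (lag (int i) \<zeta>) + (if nat \<lfloor>\<theta> * real n\<rfloor> < i then b \<delta> else 0)) n" for n \<zeta>
 let ?\<pi> = "PiM (UNIV :: int set) (\<lambda>_. FP.\<mu>0)"
 have after: "(int i > \<lfloor>\<theta> * real n\<rfloor>) = (nat \<lfloor>\<theta> * real n\<rfloor> < i)" for i n
 proof -
  have "0 <= \<lfloor>\<theta> * real n\<rfloor>" using assms(13) by simp
  then show ?thesis by linarith
 qed
 have bX: "b (X i n \<omega>) = (FP.hb (real i / real n) (lag (int i) (FP.noise \<omega>)) + (if nat \<lfloor>\<theta> * real n\<rfloor> < i then b \<delta> else 0)) + b \<mu>"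
  if "i \<in> {1..n}" "\<omega> \<in> space P" for i n \<omega>
  unfolding assms(15)[OF that] after \<epsilon>[OF that] by (simp add: blinfun.add_right FP.hb_def FP.past_eq blinfun.zero_right)
 have mR: "{\<zeta> \<in> space ?\<pi>. q < R n \<zeta>} \<in> sets ?\<pi>" if n: "2 <= n" for n
  unfolding R_def
 proof (rule measurable_test_stat[OF q0 n])
  fix i assume i: "i \<in> {1..n}"
  have "(\<lambda>\<zeta>. FP.hb (real i / real n) (lag (int i) \<zeta>)) \<in> borel_measurable ?\<pi>"
   by (rule measurable_compose[OF FP.inn.measurable_lag FP.measurable_hb[OF u[OF i]]])
  then show "(\<lambda>\<zeta>. FP.hb (real i / real n) (lag (int i) \<zeta>) + (if nat \<lfloor>\<theta> * real n\<rfloor> < i then b \<delta> else 0)) \<in> borel_measurable ?\<pi>"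
   by (intro borel_measurable_add borel_measurable_const)
 qed
 have rp: "rejection_prob n = \<P>(\<zeta> in ?\<pi>. q < R n \<zeta>)" if n: "2 <= n" for n
 proof -
  have "test_stat (\<lambda>i. b (X i n \<omega>)) n = R n (FP.noise \<omega>)" if "\<omega> \<in> space P" for \<omega>
  proof -
   have "test_stat (\<lambda>i. b (X i n \<omega>)) n = test_stat (\<lambda>i. (FP.hb (real i / real n) (lag (int i) (FP.noise \<omega>)) +
     (if nat \<lfloor>\<theta> * real n\<rfloor> < i then b \<delta> else 0)) + b \<mu>) n"
    by (rule test_stat_cong[OF n]) (rule bX[OF _ that])
   \<comment> \<open>b \<mu> is a common shift of all observations and drops out.\<close>
   also have "\<dots> = R n (FP.noise \<omega>)" unfolding R_def by (rule test_stat_add_const[OF n])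
   finally show ?thesis .
  qed
  then have "{\<omega> \<in> space P. q < test_stat (\<lambda>i. b (X i n \<omega>)) n} = FP.noise -` {\<zeta> \<in> space ?\<pi>. q < R n \<zeta>} \<inter> space P"
   using measurable_space[OF FP.measurable_noise] by auto
  then have "rejection_prob n = measure P (FP.noise -` {\<zeta> \<in> space ?\<pi>. q < R n \<zeta>} \<inter> space P)"
   unfolding rejection_prob_def q_def by simp
  also have "\<dots> = measure (distr P ?\<pi> FP.noise) {\<zeta> \<in> space ?\<pi>. q < R n \<zeta>}"
   by (rule measure_distr[OF FP.measurable_noise mR[OF n], symmetric])
  finally show ?thesis by (simp only: FP.law_noise)
 qed
 have m: "m i n = b \<mu> + (if nat \<lfloor>\<theta> * real n\<rfloor> < i then b \<delta> else 0)" if i: "i \<in> {1..n}" for i n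
 proof -
  have "b (X i n \<omega>) = (b \<mu> + (if nat \<lfloor>\<theta> * real n\<rfloor> < i then b \<delta> else 0)) + b (\<epsilon> i n \<omega>)" if "\<omega> \<in> space P" for \<omega>
   unfolding assms(15)[OF i that] after by (simp add: blinfun.add_right blinfun.zero_right)
  then have "m i n = (\<integral>\<omega>. (b \<mu> + (if nat \<lfloor>\<theta> * real n\<rfloor> < i then b \<delta> else 0)) + b (\<epsilon> i n \<omega>) \<partial>P)"
   unfolding m_def by (intro lint_cong refl)
  also have "\<dots> = (\<integral>\<omega>. b \<mu> + (if nat \<lfloor>\<theta> * real n\<rfloor> < i then b \<delta> else 0) \<partial>P) + (\<integral>\<omega>. b (\<epsilon> i n \<omega>) \<partial>P)"
   by (rule Bochner_Integration.integral_add) (use b\<epsilon>(1)[OF i] in auto)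
  finally show ?thesis using b\<epsilon>(2)[OF i] by (simp add: FP.prob_space)
 qed
 obtain n0 k0 where nk: "1 <= k0" "k0 < n0" "k0 = nat \<lfloor>\<theta> * real n0\<rfloor>"
  using ex_change_point[OF assms(13,14)] by blast
 have mk: "m k0 n0 = b \<mu>" "m (k0 + 1) n0 = b \<mu> + b \<delta>" "m 1 n0 = b \<mu>"
  using nk by (auto simp: m)
 show ?thesis
 proof (intro conjI impI)
  assume "H0 m"
  then have all: "\<forall>i\<in>{1..n0}. \<forall>j\<in>{1..n0}. m i n0 = m j n0" unfolding H0_def by (rule spec)
  have "k0 + 1 \<in> {1..n0}" "1 \<in> {1..n0}" using nk by auto
  then have "m (k0 + 1) n0 = m 1 n0" by (rule bspec[OF bspec[OF all]])
  then have d0: "b \<delta> = 0" using mk(2,3) by simp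
  show "limsup (\<lambda>n. ereal (rejection_prob n)) <= ereal \<alpha>"
  proof (rule ereal_le_epsilon2)
   fix e :: real assume e: "0 < e"
   \<comment> \<open>\<open>level_test\<close> bounds the rejection probability through the closed
     event, whereas \<open>prob_cPsi_pos\<close> controls the open one.\<close>
   have "\<P>(\<omega> in Q. 0 <= cPsi q (\<lambda>t. W t \<omega>)) = \<P>(\<omega> in Q. 0 < cPsi q (\<lambda>t. W t \<omega>))"
   proof (rule L.BM.finite_measure_eq_AE)
    show "AE \<omega> in Q. (\<omega> \<in> {\<omega> \<in> space Q. 0 <= cPsi q (\<lambda>t. W t \<omega>)}) = (\<omega> \<in> {\<omega> \<in> space Q. 0 < cPsi q (\<lambda>t. W t \<omega>)})"
     using L.BM.cPsi_no_atom[OF q] by eventually_elim auto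
   qed measurable
   also have "\<dots> <= \<alpha>" by (rule L.BM.prob_cPsi_pos[OF assms(16,17) q_def])
   finally have a: "\<P>(\<omega> in Q. 0 <= cPsi q (\<lambda>t. W t \<omega>)) <= \<alpha>" .
   have "\<forall>\<^sub>F n in sequentially. ereal (rejection_prob n) <= ereal \<alpha> + ereal e"
    using L.level_test[OF q0 e] eventually_ge_at_top[of 2]
   proof eventually_elim
    case (elim n)
    have "rejection_prob n <= \<alpha> + e" using elim(1) a unfolding rp[OF elim(2)] R_def d0 by simp
    then show ?case by simp
   qed
   then show "limsup (\<lambda>n. ereal (rejection_prob n)) <= ereal \<alpha> + ereal e" by (rule Limsup_bounded)
  qed
 next
  assume H1: "H1 \<theta> m"
  have "m k0 n0 \<noteq> m (k0 + 1) n0"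
   using spec[OF H1[unfolded H1_def Let_def], of n0] nk(1) unfolding nk(3)[symmetric] by blast
  then have d: "b \<delta> \<noteq> 0" using mk by simp
  show "rejection_prob \<longlonglongrightarrow> 1"
  proof (rule tendstoI)
   fix e :: real assume e: "0 < e"
   then have e2: "0 < e / 2" by simp
   show "\<forall>\<^sub>F n in sequentially. dist (rejection_prob n) 1 < e"
    using L.consistency[OF q0 assms(13,14) d e2] eventually_ge_at_top[of 2]
   proof eventually_elim
    case (elim n)
    have "{\<zeta> \<in> space ?\<pi>. \<not> q < R n \<zeta>} = space ?\<pi> - {\<zeta> \<in> space ?\<pi>. q < R n \<zeta>}" by auto
    then have "\<P>(\<zeta> in ?\<pi>. \<not> q < R n \<zeta>) = 1 - rejection_prob n"
     unfolding rp[OF elim(2)] using FP.inn.pi.prob_compl[OF mR[OF elim(2)]] by simp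
    moreover have "\<P>(\<zeta> in ?\<pi>. \<not> q < R n \<zeta>) <= e / 2" using elim(1) unfolding R_def .
    moreover have "rejection_prob n <= 1" unfolding rp[OF elim(2)] by (rule FP.inn.pi.prob_le_1)
    ultimately show ?case using e by (simp add: dist_real_def)
   qed
  qed
 qed
qed

end
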